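(* Let $K$ satisfy the kernel assumption. Assume that $\ell\in\tilde{\mathcal{L}}_{p+1}(M,C)$ for some $M\ge0$ and $C=(C_z,C_\theta)$. Suppose that (L1), (L4) hold with some $0<\alpha\le1$ and $q=M+1$. Furthermore suppose that $\Theta\subset\mathbb{R}^d$ is compact and that for all $u\in[0,1]$, $\theta_0(u)\in\mathrm{int}(\Theta)$ is the unique minimizer of $\theta\mapsto L(u,\theta)$ over $\Theta$. Then: (i) For all $u\in(0,1)$, if $n\to\infty$, $b=b_n\to0$ and $bn\to\infty$, then $\hat\theta_b(u)\to\theta_0(u)$ in probability. (ii) If additionally (L1), (L4) hold with some $q>M+1$, $b\to0$, $n^{\frac{M+1}{q}-1}=o(b)$, and $\theta_0(\cdot)$ is continuous, then $\sup_{u\in[\frac b2,1-\frac b2]}|\hat\theta_b(u)-\theta_0(u)|\to0$ in probability.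
   Context: Model: $(\varepsilon_t)_{t\in\mathbb{Z}}$ are i.i.d. real random variables, $\mathcal{F}_t:=(\varepsilon_t,\varepsilon_{t-1},\dots)$, $p,d\in\mathbb{N}$, $\Theta\subset\mathbb{R}^d$, $\theta_0:[0,1]\to\Theta$, $\tilde G:\mathbb{R}\times\mathbb{R}^p\times\Theta\to\mathbb{R}$ measurable, and $G_\varepsilon(y,u):=\tilde G_\varepsilon(y,\theta_0(u))$. For $u\in[0,1]$, $(\tilde X_t(u))_{t\in\mathbb{Z}}$ is the a.s. unique $\mathcal{F}_t$-measurable stationary ergodic solution of $\tilde X_t(u)=G_{\varepsilon_t}(\tilde X_{t-1}(u),\dots,\tilde X_{t-p}(u),u)$, $t\in\mathbb{Z}$; $(X_{t,n})_{t\le n}$ is the $\mathcal{F}_t$-measurable solution of $X_{t,n}=G_{\varepsilon_t}(X_{t-1,n},\dots,X_{t-p,n},\max\{\frac tn,0\})$, $t\le n$, with $X_{t,n}=\tilde X_t(0)$ for $t\le0$ (these exist under (L1)). $Y_{t-1,n}:=(X_{t-1,n},\dots,X_{t-p,n})'$, $\tilde Y_{t-1}(u):=(\tilde X_{t-1}(u),\dots,\tilde X_{t-p}(u))'$. Estimator: $\ell:\mathbb{R}\times\mathbb{R}^p\times\Theta\to\mathbb{R}$, $(x,y,\theta)\mapsto\ell(x,y,\theta)$, is a given objective function (e.g. a negative conditional log likelihood, possibly misspecified; no specific structure is used). With $K_b(x):=\frac1bK(\frac xb)$, $L_{n,b}(u,\theta):=\frac1n\sum_{t=p+1}^nK_b(\frac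 tn-u)\,\ell(X_{t,n},Y_{t-1,n},\theta)$ and $\hat\theta_b(u):=\arg\min_{\theta\in\Theta}L_{n,b}(u,\theta)$ (any minimizer). $L(u,\theta):=\mathbb{E}[\ell(\tilde X_t(u),\tilde Y_{t-1}(u),\theta)]$. Class $\tilde{\mathcal{L}}_{p+1}(M,C)$ with $C=(C_z,C_\theta)$, $C_z,C_\theta,M\ge0$: all $g:\mathbb{R}^{p+1}\times\Theta\to\mathbb{R}$ such that for all $z,z'\in\mathbb{R}^{p+1}$, $\theta,\theta'\in\Theta$: $|g(z,\theta)-g(z',\theta)|\le C_z|z-z'|_1(1+|z|_1^M+|z'|_1^M)$ and $|g(z,\theta)-g(z,\theta')|\le3C_\theta(1+|z|_1^{M+1})|\theta-\theta'|_1$, where $|\cdot|_1$ is the $\ell^1$-norm. $\|W\|_q:=(\mathbb{E}|W|^q)^{1/q}$. (L1) and (L4) with given $q$ $(\ge1)$: there are $\chi\in\mathbb{R}^p_{\ge0}$ with $\sum_i\chi_i<1$ and $y_0\in\mathbb{R}^p$ such that (L1) $\sup_{u\in[0,1]}\|G_{\varepsilon_0}(y_0,u)\|_q<\infty$ and $\|G_{\varepsilon_0}(y,u)-G_{\varepsilon_0}(y',u)\|_q\le\sum_{i=1}^p\chi_i|y_i-y_i'|$ for all $u\in[0,1]$, $y,y'\in\mathbb{R}^p$; (L4) for some $0<\alpha\le1$, $\sup_{u\in[0,1]}\|C(\tilde Y_t(u))\|_q<\infty$, where $C(y):=\sup_{u\ne u'}\frac{\|G_{\varepsilon_0}(y,u)-G_{\varepsilon_0}(y,u')\|_q}{|u-u'|^\alpha}$.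 Kernel assumption: $K:\mathbb{R}\to\mathbb{R}$ is bounded, of bounded variation, with compact support $[-\frac12,\frac12]$ and $\int K\,dx=1$. *)

theory Defs
  imports "HOL-Probability.Probability" "HOL-Library.Landau_Symbols"
begin

section \<open>Vectors, lags and norms\<close>

text \<open>The dimensions p and d are the cardinalities of the index types \<open>'p\<close> and \<open>'d\<close>. The linear
  order on \<open>'p\<close> serves only to number the coordinates: \<open>coord_no\<close> maps \<open>'p\<close> bijectively onto
  \<open>{1..p}\<close>.\<close>

definition coord_no :: "'p::{finite,linorder} \<Rightarrow> int" where
  "coord_no i = int (card {j. j \<le> i})"

text \<open>\<open>lags X s \<omega>\<close> is the vector \<open>(X s \<omega>, X (s - 1) \<omega>, \<dots>, X (s - p + 1) \<omega>)\<close>, that is, Y at time s.\<close>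

definition lags :: "(int \<Rightarrow> 'w \<Rightarrow> real) \<Rightarrow> int \<Rightarrow> 'w \<Rightarrow> real ^ 'p::{finite,linorder}" where
  "lags X s \<omega> = (\<chi> i. X (s + 1 - coord_no i) \<omega>)"

definition l1_norm :: "real ^ 'k \<Rightarrow> real" where
  "l1_norm v = (\<Sum>i\<in>UNIV. \<bar>v $ i\<bar>)"

text \<open>\<open>\<real>\<^sup>p\<^sup>+\<^sup>1\<close> is represented as \<open>\<real> \<times> \<real>\<^sup>p\<close>.\<close>

definition l1_norm_pair :: "real \<times> (real ^ 'p) \<Rightarrow> real" where
  "l1_norm_pair z = \<bar>fst z\<bar> + l1_norm (snd z)"

text \<open>Real powers of nonnegative numbers with \<open>0\<^sup>0 = 1\<close> (whereas \<open>0 powr 0 = 0\<close>).\<close>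

definition rpow :: "real \<Rightarrow> real \<Rightarrow> real" where
  "rpow x a = (if a = 0 then 1 else x powr a)"

text \<open>\<open>Lnorm P q W\<close> is \<open>(E W\<^sup>q)\<^sup>1\<^sup>/\<^sup>q\<close>, possibly infinite, for \<open>[0,\<infinity>]\<close>-valued W and \<open>q > 0\<close>.\<close>

definition epow :: "ennreal \<Rightarrow> real \<Rightarrow> ennreal" where
  "epow x a = (if x = \<top> then \<top> else ennreal (enn2real x powr a))"

definition Lnorm :: "'w measure \<Rightarrow> real \<Rightarrow> ('w \<Rightarrow> ennreal) \<Rightarrow> ennreal" where
  "Lnorm P q W = epow (\<integral>\<^sup>+ \<omega>. epow (W \<omega>) q \<partial>P) (1 / q)"

abbreviation Lnorm_real :: "'w measure \<Rightarrow> real \<Rightarrow> ('w \<Rightarrow> real) \<Rightarrow> ennreal" where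
  "Lnorm_real P q W \<equiv> Lnorm P q (\<lambda>\<omega>. ennreal \<bar>W \<omega>\<bar>)"


section \<open>Processes\<close>

definition iid :: "'w measure \<Rightarrow> (int \<Rightarrow> 'w \<Rightarrow> real) \<Rightarrow> bool" where
  "iid P \<epsilon> \<longleftrightarrow> prob_space.indep_vars P (\<lambda>_. borel) \<epsilon> UNIV \<and>
     (\<forall>t. distr P borel (\<epsilon> t) = distr P borel (\<epsilon> 0))"

definition past :: "'w measure \<Rightarrow> (int \<Rightarrow> 'w \<Rightarrow> real) \<Rightarrow> int \<Rightarrow> 'w measure" where
  "past P \<epsilon> t = sigma (space P) (\<Union>s\<in>{..t}. {\<epsilon> s -` A \<inter> space P | A. A \<in> sets borel})"

definition stationary :: "'w measure \<Rightarrow> (int \<Rightarrow> 'w \<Rightarrow> real) \<Rightarrow> bool" where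
  "stationary P X \<longleftrightarrow>
     (\<forall>h. distr P (\<Pi>\<^sub>M t\<in>UNIV. borel) (\<lambda>\<omega> t. X (t + h) \<omega>) =
          distr P (\<Pi>\<^sub>M t\<in>UNIV. borel) (\<lambda>\<omega> t. X t \<omega>))"

definition ergodic :: "'w measure \<Rightarrow> (int \<Rightarrow> 'w \<Rightarrow> real) \<Rightarrow> bool" where
  "ergodic P X \<longleftrightarrow>
     (\<forall>A \<in> sets (\<Pi>\<^sub>M t\<in>(UNIV :: int set). (borel :: real measure)).
        (\<lambda>x t. x (t + 1)) -` A = A \<longrightarrow>
          measure P {\<omega> \<in> space P. (\<lambda>t. X t \<omega>) \<in> A} \<in> {0, 1})"

definition G_fun :: "(real \<Rightarrow> real ^ 'p \<Rightarrow> real ^ 'd \<Rightarrow> real) \<Rightarrow> (real \<Rightarrow> real ^ 'd) \<Rightarrow>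
    real \<Rightarrow> real ^ 'p \<Rightarrow> real \<Rightarrow> real" where
  "G_fun Gt \<theta>0 e y u = Gt e y (\<theta>0 u)"

definition stationary_solution :: "'w measure \<Rightarrow> (int \<Rightarrow> 'w \<Rightarrow> real) \<Rightarrow>
    (real \<Rightarrow> real ^ 'p::{finite,linorder} \<Rightarrow> real \<Rightarrow> real) \<Rightarrow> real \<Rightarrow> (int \<Rightarrow> 'w \<Rightarrow> real) \<Rightarrow> bool" where
  "stationary_solution P \<epsilon> G u X \<longleftrightarrow>
     (\<forall>t. X t \<in> borel_measurable (past P \<epsilon> t)) \<and> stationary P X \<and> ergodic P X \<and>
     (\<forall>t. AE \<omega> in P. X t \<omega> = G (\<epsilon> t \<omega>) (lags X (t - 1) \<omega>) u)"

text \<open>Row n of the triangular array; \<open>X0\<close> is the stationary solution at \<open>u = 0\<close>. Only the values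
  \<open>X t\<close> with \<open>t \<le> n\<close> are constrained.\<close>

definition tv_solution :: "'w measure \<Rightarrow> (int \<Rightarrow> 'w \<Rightarrow> real) \<Rightarrow>
    (real \<Rightarrow> real ^ 'p::{finite,linorder} \<Rightarrow> real \<Rightarrow> real) \<Rightarrow> (int \<Rightarrow> 'w \<Rightarrow> real) \<Rightarrow>
    nat \<Rightarrow> (int \<Rightarrow> 'w \<Rightarrow> real) \<Rightarrow> bool" where
  "tv_solution P \<epsilon> G X0 n X \<longleftrightarrow>
     (\<forall>t \<le> int n. X t \<in> borel_measurable (past P \<epsilon> t)) \<and>
     (\<forall>t \<le> int n. AE \<omega> in P.
        X t \<omega> = G (\<epsilon> t \<omega>) (lags X (t - 1) \<omega>) (max (real_of_int t / real n) 0)) \<and>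
     (\<forall>t \<le> 0. AE \<omega> in P. X t \<omega> = X0 t \<omega>)"


section \<open>Assumptions\<close>

definition L1_cond :: "'w measure \<Rightarrow> (int \<Rightarrow> 'w \<Rightarrow> real) \<Rightarrow>
    (real \<Rightarrow> real ^ 'p \<Rightarrow> real \<Rightarrow> real) \<Rightarrow> real \<Rightarrow> bool" where
  "L1_cond P \<epsilon> G q \<longleftrightarrow>
     (\<exists>(\<chi>v :: real ^ 'p) (y0 :: real ^ 'p).
        (\<forall>i. 0 \<le> \<chi>v $ i) \<and> (\<Sum>i\<in>UNIV. \<chi>v $ i) < 1 \<and>
        (SUP u\<in>{0..1}. Lnorm_real P q (\<lambda>\<omega>. G (\<epsilon> 0 \<omega>) y0 u)) < \<top> \<and>
        (\<forall>u\<in>{0..1}. \<forall>y y'.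
           Lnorm_real P q (\<lambda>\<omega>. G (\<epsilon> 0 \<omega>) y u - G (\<epsilon> 0 \<omega>) y' u)
             \<le> ennreal (\<Sum>i\<in>UNIV. \<chi>v $ i * \<bar>y $ i - y' $ i\<bar>)))"

definition holder_const :: "'w measure \<Rightarrow> (int \<Rightarrow> 'w \<Rightarrow> real) \<Rightarrow>
    (real \<Rightarrow> real ^ 'p \<Rightarrow> real \<Rightarrow> real) \<Rightarrow> real \<Rightarrow> real \<Rightarrow> real ^ 'p \<Rightarrow> ennreal" where
  "holder_const P \<epsilon> G q \<alpha> y =
     (SUP (u, u') \<in> {(u, u'). u \<in> {0..1} \<and> u' \<in> {0..1} \<and> u \<noteq> u'}.
        Lnorm_real P q (\<lambda>\<omega>. G (\<epsilon> 0 \<omega>) y u - G (\<epsilon> 0 \<omega>) y u') / ennreal (\<bar>u - u'\<bar> powr \<alpha>))"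

text \<open>\<open>Xt u\<close> is the stationary solution at u; by stationarity the time index 0 below is immaterial.\<close>

definition L4_cond :: "'w measure \<Rightarrow> (int \<Rightarrow> 'w \<Rightarrow> real) \<Rightarrow>
    (real \<Rightarrow> real ^ 'p::{finite,linorder} \<Rightarrow> real \<Rightarrow> real) \<Rightarrow> (real \<Rightarrow> int \<Rightarrow> 'w \<Rightarrow> real) \<Rightarrow> real \<Rightarrow> bool" where
  "L4_cond P \<epsilon> G Xt q \<longleftrightarrow>
     (\<exists>\<alpha>. 0 < \<alpha> \<and> \<alpha> \<le> 1 \<and>
        (SUP u\<in>{0..1}. Lnorm P q (\<lambda>\<omega>. holder_const P \<epsilon> G q \<alpha> (lags (Xt u) 0 \<omega>))) < \<top>)"

definition lip_class :: "(real ^ 'd) set \<Rightarrow> real \<Rightarrow> real \<Rightarrow> real \<Rightarrow>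
    (real \<times> (real ^ 'p) \<Rightarrow> real ^ 'd \<Rightarrow> real) set" where
  "lip_class \<Theta> M Cz C\<theta> =
     {g. (\<forall>z z'. \<forall>\<theta>\<in>\<Theta>.
            \<bar>g z \<theta> - g z' \<theta>\<bar> \<le> Cz * l1_norm_pair (z - z') *
               (1 + rpow (l1_norm_pair z) M + rpow (l1_norm_pair z') M)) \<and>
         (\<forall>z. \<forall>\<theta>\<in>\<Theta>. \<forall>\<theta>'\<in>\<Theta>.
            \<bar>g z \<theta> - g z \<theta>'\<bar> \<le> 3 * C\<theta> * (1 + rpow (l1_norm_pair z) (M + 1)) * l1_norm (\<theta> - \<theta>'))}"

definition bounded_variation :: "(real \<Rightarrow> real) \<Rightarrow> bool" where
  "bounded_variation K \<longleftrightarrow>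
     (\<exists>B. \<forall>(x :: nat \<Rightarrow> real) N. mono x \<longrightarrow> (\<Sum>i<N. \<bar>K (x (Suc i)) - K (x i)\<bar>) \<le> B)"

definition kernel :: "(real \<Rightarrow> real) \<Rightarrow> bool" where
  "kernel K \<longleftrightarrow> bounded (range K) \<and> bounded_variation K \<and>
     (\<forall>x. x \<notin> {-1/2..1/2} \<longrightarrow> K x = 0) \<and> (LINT x|lborel. K x) = 1"


section \<open>Estimation\<close>

definition K_scaled :: "(real \<Rightarrow> real) \<Rightarrow> real \<Rightarrow> real \<Rightarrow> real" where
  "K_scaled K b x = 1 / b * K (x / b)"

definition L_emp :: "(real \<Rightarrow> real) \<Rightarrow> (real \<Rightarrow> real ^ 'p::{finite,linorder} \<Rightarrow> real ^ 'd \<Rightarrow> real) \<Rightarrow>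
    (nat \<Rightarrow> int \<Rightarrow> 'w \<Rightarrow> real) \<Rightarrow> nat \<Rightarrow> real \<Rightarrow> real \<Rightarrow> 'w \<Rightarrow> real ^ 'd \<Rightarrow> real" where
  "L_emp K ell X n b u \<omega> \<theta> =
     1 / real n * (\<Sum>t\<in>{int CARD('p) + 1..int n}.
        K_scaled K b (real_of_int t / real n - u) * ell (X n t \<omega>) (lags (X n) (t - 1) \<omega>) \<theta>)"

text \<open>Again the time index 0 is immaterial by stationarity.\<close>

definition L_lim :: "'w measure \<Rightarrow> (real \<Rightarrow> real ^ 'p::{finite,linorder} \<Rightarrow> real ^ 'd \<Rightarrow> real) \<Rightarrow>
    (real \<Rightarrow> int \<Rightarrow> 'w \<Rightarrow> real) \<Rightarrow> real \<Rightarrow> real ^ 'd \<Rightarrow> real" where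
  "L_lim P ell Xt u \<theta> = (LINT \<omega>|P. ell (Xt u 0 \<omega>) (lags (Xt u) (-1) \<omega>) \<theta>)"

text \<open>Convergence in probability. An arbitrary choice of minimizers, and a supremum over
  uncountably many of them, need not be measurable, so the deviation events are measured by the
  outer measure, which agrees with the probability on measurable events.\<close>

definition tendsto_in_prob :: "'w measure \<Rightarrow> (nat \<Rightarrow> 'w \<Rightarrow> 'b::metric_space) \<Rightarrow> 'b \<Rightarrow> bool" where
  "tendsto_in_prob P W c \<longleftrightarrow>
     (\<forall>r>0. (\<lambda>n. outer_measure_of P {\<omega> \<in> space P. dist (W n \<omega>) c > r}) \<longlonglongrightarrow> 0)"

end

theory Submission
  imports Defs "HOL-Real_Asymp.Real_Asymp"
begin

text \<open>A weighted norm V of the lag vector turns the contraction over p lags into a one-step contraction given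
  the past. It yields moment bounds, the closeness of \<open>X n t\<close> to the stationary solution at u for \<open>t / n\<close> near u,
  and a geometrically good coupling with copies restarted m steps earlier. The truncated objective is therefore
  almost m-dependent: with m of order \<open>(n b)\<^sup>1\<^sup>/\<^sup>4\<close>, Hoeffding's inequality along the residue classes modulo \<open>m + 1\<close>
  controls each window sum up to a superpolynomially small probability, and summation by parts against the
  kernel of bounded variation passes to kernel averages.

  The part cut off by the truncation is small in mean by stationarity, which suffices for a single u. Uniformly
  in u, it is dominated by \<open>min (V\<^sup>M\<^sup>+\<^sup>1) (c V\<^sup>q)\<close>, whose conditional drift is of order c. After compensation of
  this drift, window sums have a moment of order \<open>r = q / (M + 1)\<close> proportional to the window length only, so that
  the union over about \<open>1 / b\<close> blocks of length \<open>n b\<close> costs a multiple of \<open>n (n b)\<^sup>-\<^sup>r\<close>, which tends to 0 exactly under the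
  assumed rate. Consistency then follows because the minimizers of the continuous limit L are well separated on
  compact sets.\<close>


text \<open>The objective grows like the power \<open>M + 1\<close> of the lags, while moments exist
  just up to that order in the first claim and slightly beyond it in the second. Hoeffding's
  inequality replaces them below the truncation level, and a one-sided moment recursion above it:
  there \<open>(a + y) powr r\<close> is expanded with a sharp linear term, because the contraction
  can absorb only a factor close to 1. The exponent 1/4 balances two needs, with
  \<open>N = n b\<close>: both \<open>lam1 ^ m\<close> and the Hoeffding bound, whose exponent is of
  order \<open>N / m^2\<close>, must beat every power of \<open>N\<close>; exponents strictly
  between 0 and 1/2 do this. The parameter condition measures a change of the recursion along
  stationary solutions only, so when solutions with different parameters are compared, this change
  is evaluated at the lags of the stationary one. Minimizers and suprema need not be measurable;
  exceptional sets are therefore covered by events of small probability.\<close>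

section \<open>Moment bounds\<close>

text \<open>A bound on the q-norm with the q-th root avoided. Measurability, finiteness and the
  bound travel together, so that the Minkowski and Hoelder inequalities become rules about the
  constant, and no norm has to be known finite beforehand.\<close>

definition Lq_le :: "'a measure \<Rightarrow> real \<Rightarrow> ('a \<Rightarrow> real) \<Rightarrow> real \<Rightarrow> bool" where
  "Lq_le M q f A \<longleftrightarrow> 0 \<le> A \<and> f \<in> borel_measurable M \<and>
     (\<integral>\<^sup>+x. ennreal (\<bar>f x\<bar> powr q) \<partial>M) \<le> ennreal (A powr q)"

lemma Lq_leI:
  assumes "0 \<le> A" "f \<in> borel_measurable M" "(\<integral>\<^sup>+x. ennreal (\<bar>f x\<bar> powr q) \<partial>M) \<le> ennreal (A powr q)"
  shows "Lq_le M q f A"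
  using assms by (simp add: Lq_le_def)

lemma Lq_leD:
  assumes "Lq_le M q f A"
  shows Lq_le_nonneg: "0 \<le> A" and Lq_le_measurable: "f \<in> borel_measurable M"
    and Lq_le_nn_integral: "(\<integral>\<^sup>+x. ennreal (\<bar>f x\<bar> powr q) \<partial>M) \<le> ennreal (A powr q)"
  using assms by (auto simp: Lq_le_def)

lemma Lq_le_weaken:
  assumes "Lq_le M q f A" "A \<le> B" "0 \<le> q"
  shows "Lq_le M q f B"
  using assms Lq_leD[OF assms(1)]
  by (auto intro!: Lq_leI order_trans[OF Lq_le_nn_integral[OF assms(1)]] ennreal_leI powr_mono2)

lemma Lq_le_mono_AE:
  assumes "Lq_le M q f A" "g \<in> borel_measurable M" "AE x in M. \<bar>g x\<bar> \<le> \<bar>f x\<bar>" "0 \<le> q"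
  shows "Lq_le M q g A"
proof (rule Lq_leI)
  have "(\<integral>\<^sup>+x. ennreal (\<bar>g x\<bar> powr q) \<partial>M) \<le> (\<integral>\<^sup>+x. ennreal (\<bar>f x\<bar> powr q) \<partial>M)"
    using assms(3) by (intro nn_integral_mono_AE) (auto intro!: ennreal_leI powr_mono2 assms(4) elim!: eventually_mono)
  also note Lq_le_nn_integral[OF assms(1)]
  finally show "(\<integral>\<^sup>+x. ennreal (\<bar>g x\<bar> powr q) \<partial>M) \<le> ennreal (A powr q)" .
qed (use assms Lq_leD[OF assms(1)] in auto)

lemma Lq_le_mono:
  assumes "Lq_le M q f A" "g \<in> borel_measurable M" "\<And>x. x \<in> space M \<Longrightarrow> \<bar>g x\<bar> \<le> \<bar>f x\<bar>" "0 \<le> q"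
  shows "Lq_le M q g A"
  using assms by (intro Lq_le_mono_AE[OF assms(1,2)]) auto

lemma Lq_le_const:
  assumes "prob_space M" "q > 0"
  shows "Lq_le M q (\<lambda>_. c) \<bar>c\<bar>"
  using assms by (intro Lq_leI) (auto simp: prob_space.emeasure_space_1)

lemma Lq_le_cmult:
  assumes "Lq_le M q f A" "q > 0"
  shows "Lq_le M q (\<lambda>x. c * f x) (\<bar>c\<bar> * A)"
proof (rule Lq_leI)
  note [measurable] = Lq_le_measurable[OF assms(1)]
  have "(\<integral>\<^sup>+x. ennreal (\<bar>c * f x\<bar> powr q) \<partial>M) = (\<integral>\<^sup>+x. ennreal (\<bar>c\<bar> powr q) * ennreal (\<bar>f x\<bar> powr q) \<partial>M)"
    by (simp add: abs_mult powr_mult ennreal_mult)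
  also have "\<dots> = ennreal (\<bar>c\<bar> powr q) * (\<integral>\<^sup>+x. ennreal (\<bar>f x\<bar> powr q) \<partial>M)"
    by (subst nn_integral_cmult) auto
  also have "\<dots> \<le> ennreal (\<bar>c\<bar> powr q) * ennreal (A powr q)"
    by (intro mult_left_mono Lq_leD[OF assms(1)]) auto
  also have "\<dots> = ennreal ((\<bar>c\<bar> * A) powr q)"
    using Lq_le_nonneg[OF assms(1)] by (simp add: powr_mult ennreal_mult)
  finally show "(\<integral>\<^sup>+x. ennreal (\<bar>c * f x\<bar> powr q) \<partial>M) \<le> ennreal ((\<bar>c\<bar> * A) powr q)" .
qed (use Lq_leD[OF assms(1)] in auto)

lemma Lq_le_indicator_space: "Lq_le M q (\<lambda>x. indicator (space M) x * f x) c \<longleftrightarrow> Lq_le M q f c"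
  unfolding Lq_le_def by (simp cong: measurable_cong nn_integral_cong)

text \<open>The point 0 has to be included because the functions involved may vanish. There one of
  the two terms is 0 and convexity reduces to \<open>s powr p \<le> s\<close> for \<open>s\<close>
  between 0 and 1.\<close>

lemma convex_on_powr_nonneg:
  assumes "p \<ge> 1" shows "convex_on {0..} (\<lambda>x::real. x powr p)"
proof (rule convex_onI)
  fix t x y :: real assume t: "0 < t" "t < 1" and xy: "x \<in> {0..}" "y \<in> {0..}"
  have le: "s powr p \<le> s" if "0 < s" "s < 1" for s
    using powr_mono'[of 1 p s] that assms by simp
  consider "x = 0" | "y = 0" | "x > 0" "y > 0" using xy by fastforce
  then show "((1 - t) *\<^sub>R x + t *\<^sub>R y) powr p \<le> (1 - t) * x powr p + t * y powr p"
  proof cases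
    case 3
    then show ?thesis
      using convex_onD[OF powr_convex[OF assms], of t x y] t by simp
  next
    case 1
    then show ?thesis using xy t le[of t] assms by (auto simp: powr_mult intro!: mult_right_mono)
  next
    case 2
    then show ?thesis using xy t le[of "1 - t"] assms by (auto simp: powr_mult intro!: mult_right_mono)
  qed
qed simp

text \<open>\<open>(a + b) / (A + B)\<close> is the convex combination of \<open>a / A\<close> and
  \<open>b / B\<close> with weights proportional to \<open>A\<close> and \<open>B\<close>. When
  \<open>A\<close> and \<open>B\<close> bound the q-norms, the bracket integrates to at most 1,
  which is Minkowski's inequality.\<close>

lemma powr_add_le_weighted:
  fixes a b A B q :: real
  assumes "q \<ge> 1" "A > 0" "B > 0" "a \<ge> 0" "b \<ge> 0"
  shows "(a + b) powr q
    \<le> (A + B) powr q * (A / (A + B) * (a powr q / A powr q) + B / (A + B) * (b powr q / B powr q))"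
proof -
  let ?t = "B / (A + B)"
  have t: "0 \<le> ?t" "?t \<le> 1" "1 - ?t = A / (A + B)"
    using assms by (auto simp: field_simps)
  have "(a + b) / (A + B) = (1 - ?t) *\<^sub>R (a / A) + ?t *\<^sub>R (b / B)"
    unfolding t(3) using assms by (simp add: add_divide_distrib)
  then have "((a + b) / (A + B)) powr q \<le> (1 - ?t) * (a / A) powr q + ?t * (b / B) powr q"
    using convex_onD[OF convex_on_powr_nonneg[OF assms(1)] t(1,2), of "a / A" "b / B"] assms by simp
  then have "(a + b) powr q / (A + B) powr q
      \<le> A / (A + B) * (a powr q / A powr q) + B / (A + B) * (b powr q / B powr q)"
    unfolding t(3) using assms by (simp add: powr_divide)
  then show ?thesis
    using assms by (simp add: pos_divide_le_eq mult.commute)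
qed

lemma Lq_le_0_AE:
  assumes "Lq_le M q f 0"
  shows "AE x in M. f x = 0"
proof -
  note [measurable] = Lq_le_measurable[OF assms]
  have "(\<integral>\<^sup>+x. ennreal (\<bar>f x\<bar> powr q) \<partial>M) = 0"
    using Lq_le_nn_integral[OF assms] by simp
  then have "AE x in M. ennreal (\<bar>f x\<bar> powr q) = 0"
    by (subst (asm) nn_integral_0_iff_AE) auto
  then show ?thesis by (auto elim!: eventually_mono simp: ennreal_eq_0_iff)
qed

text \<open>Minkowski's inequality. \<open>c1\<close> and \<open>c2\<close> are the coefficients of
  \<open>powr_add_le_weighted\<close>, for which \<open>c1 * A powr q + c2 * B powr q\<close> equals
  \<open>(A + B) powr q\<close>. A vanishing bound is treated apart, since the weights divide by
  \<open>A powr q\<close> and \<open>B powr q\<close>.\<close>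

lemma Lq_le_add:
  assumes f: "Lq_le M q f A" and g: "Lq_le M q g B" and q: "q \<ge> 1"
  shows "Lq_le M q (\<lambda>x. f x + g x) (A + B)"
proof -
  note [measurable] = Lq_le_measurable[OF f] Lq_le_measurable[OF g]
  consider "A = 0" | "B = 0" | "A > 0" "B > 0"
    using Lq_le_nonneg[OF f] Lq_le_nonneg[OF g] by linarith
  then show ?thesis
  proof cases
    case 1
    then show ?thesis using Lq_le_0_AE[of M q f] f q
      by (auto intro!: Lq_le_mono_AE[OF g] elim!: eventually_mono)
  next
    case 2
    then show ?thesis using Lq_le_0_AE[of M q g] g q
      by (auto intro!: Lq_le_mono_AE[OF f] elim!: eventually_mono)
  next
    case 3
    define c1 where "c1 = (A + B) powr q * (A / (A + B)) / A powr q"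
    define c2 where "c2 = (A + B) powr q * (B / (A + B)) / B powr q"
    have c: "c1 \<ge> 0" "c2 \<ge> 0" using 3 by (auto simp: c1_def c2_def)
    have "(\<integral>\<^sup>+x. ennreal (\<bar>f x + g x\<bar> powr q) \<partial>M)
        \<le> (\<integral>\<^sup>+x. ennreal c1 * ennreal (\<bar>f x\<bar> powr q) + ennreal c2 * ennreal (\<bar>g x\<bar> powr q) \<partial>M)"
    proof (rule nn_integral_mono)
      fix x
      have "\<bar>f x + g x\<bar> powr q \<le> (\<bar>f x\<bar> + \<bar>g x\<bar>) powr q"
        using q by (intro powr_mono2) auto
      also have "\<dots> \<le> c1 * \<bar>f x\<bar> powr q + c2 * \<bar>g x\<bar> powr q"
        using powr_add_le_weighted[OF q 3, of "\<bar>f x\<bar>" "\<bar>g x\<bar>"]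
        by (simp add: c1_def c2_def algebra_simps)
      finally show "ennreal (\<bar>f x + g x\<bar> powr q)
          \<le> ennreal c1 * ennreal (\<bar>f x\<bar> powr q) + ennreal c2 * ennreal (\<bar>g x\<bar> powr q)"
        using c by (simp add: ennreal_leI flip: ennreal_mult ennreal_plus)
    qed
    also have "\<dots> = ennreal c1 * (\<integral>\<^sup>+x. ennreal (\<bar>f x\<bar> powr q) \<partial>M) + ennreal c2 * (\<integral>\<^sup>+x. ennreal (\<bar>g x\<bar> powr q) \<partial>M)"
      by (simp add: nn_integral_add nn_integral_cmult)
    also have "\<dots> \<le> ennreal c1 * ennreal (A powr q) + ennreal c2 * ennreal (B powr q)"
      by (intro add_mono mult_left_mono Lq_le_nn_integral f g) auto
    also have "\<dots> = ennreal (c1 * A powr q + c2 * B powr q)"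
      using c by (simp add: ennreal_mult ennreal_plus)
    also have "c1 * A powr q + c2 * B powr q = (A + B) powr q * (A / (A + B) + B / (A + B))"
      unfolding c1_def c2_def distrib_left using 3 by simp
    also have "A / (A + B) + B / (A + B) = 1"
      using 3 by (simp add: add_divide_distrib[symmetric])
    finally show ?thesis using 3 by (intro Lq_leI) auto
  qed
qed

lemma Lq_le_sum:
  assumes "finite I" "\<And>i. i \<in> I \<Longrightarrow> Lq_le M q (f i) (A i)" "q \<ge> 1"
  shows "Lq_le M q (\<lambda>x. \<Sum>i\<in>I. f i x) (\<Sum>i\<in>I. A i)"
  using assms(1,2)
proof (induction I)
  case empty
  then show ?case using assms(3) by (auto simp: Lq_le_def)
next
  case (insert i I)
  then show ?case using Lq_le_add[of M q "f i" "A i" "\<lambda>x. \<Sum>i\<in>I. f i x" "\<Sum>i\<in>I. A i"] assms(3) by auto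
qed

text \<open>Young's inequality with the constant 1 as second factor.\<close>

lemma powr_le_weighted:
  fixes x s q :: real
  assumes "x \<ge> 0" "0 < s" "s \<le> q"
  shows "x powr s \<le> s / q * x powr q + (1 - s / q)"
proof (cases "x = 0 \<or> s = q")
  case True
  then show ?thesis using assms by auto
next
  case False
  then have "(x powr q) powr (s / q) * 1 powr (1 - s / q) \<le> s / q * x powr q + (1 - s / q) * 1"
    using assms by (intro Youngs_inequality_0) auto
  then show ?thesis using assms False by (simp add: powr_powr)
qed

text \<open>On a probability space norms increase with the exponent: Young's inequality compares the
  powers of \<open>f / A\<close> pointwise, and the total mass 1 makes the two terms add up to
  \<open>A powr s\<close>.\<close>

lemma Lq_le_exponent:
  assumes M: "prob_space M" and f: "Lq_le M q f A" and s: "0 < s" "s \<le> q"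
  shows "Lq_le M s f A"
proof (cases "A = 0")
  case True
  then have "AE x in M. f x = 0" using f Lq_le_0_AE by auto
  moreover note [measurable] = Lq_le_measurable[OF f]
  moreover have "Lq_le M s (\<lambda>_. 0) 0"
    using Lq_le_const[OF M, of s 0] s by simp
  ultimately have "Lq_le M s f 0" using s
    by (intro Lq_le_mono_AE[of M s "\<lambda>_. 0" 0 f]) simp_all
  then show ?thesis using True by simp
next
  case False
  then have A: "A > 0" using Lq_le_nonneg[OF f] by simp
  note [measurable] = Lq_le_measurable[OF f]
  interpret prob_space M by fact
  define c1 where "c1 = A powr s * (s / q) / A powr q"
  define c2 where "c2 = A powr s * (1 - s / q)"
  have c: "c1 \<ge> 0" "c2 \<ge> 0" using s by (auto simp: c1_def c2_def)
  have "(\<integral>\<^sup>+x. ennreal (\<bar>f x\<bar> powr s) \<partial>M) \<le> (\<integral>\<^sup>+x. ennreal c1 * ennreal (\<bar>f x\<bar> powr q) + ennreal c2 \<partial>M)"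
  proof (rule nn_integral_mono)
    fix x
    have "(\<bar>f x\<bar> / A) powr s \<le> s / q * (\<bar>f x\<bar> / A) powr q + (1 - s / q)"
      using A s by (intro powr_le_weighted) auto
    then have "\<bar>f x\<bar> powr s \<le> (s / q * (\<bar>f x\<bar> powr q / A powr q) + (1 - s / q)) * A powr s"
      using A by (simp add: powr_divide pos_divide_le_eq)
    also have "\<dots> = c1 * \<bar>f x\<bar> powr q + c2"
      by (simp add: c1_def c2_def algebra_simps)
    finally show "ennreal (\<bar>f x\<bar> powr s) \<le> ennreal c1 * ennreal (\<bar>f x\<bar> powr q) + ennreal c2"
      using c by (simp add: ennreal_leI flip: ennreal_mult ennreal_plus)
  qed
  also have "\<dots> = ennreal c1 * (\<integral>\<^sup>+x. ennreal (\<bar>f x\<bar> powr q) \<partial>M) + ennreal c2"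
    by (simp add: nn_integral_add nn_integral_cmult emeasure_space_1)
  also have "\<dots> \<le> ennreal c1 * ennreal (A powr q) + ennreal c2"
    by (intro add_mono mult_left_mono Lq_le_nn_integral f) auto
  also have "\<dots> = ennreal (c1 * A powr q + c2)"
    using c by (simp add: ennreal_mult ennreal_plus)
  also have "c1 * A powr q + c2 = A powr s"
    using A by (simp add: c1_def c2_def algebra_simps)
  finally show ?thesis using A by (intro Lq_leI) auto
qed

text \<open>Young's inequality with the conjugate exponents \<open>M + 1\<close> and
  \<open>(M + 1) / M\<close> for the normalised factors \<open>x / A\<close> and
  \<open>y / B\<close>.\<close>

lemma powr_mult_le_weighted:
  fixes x y A B M :: real
  assumes "M > 0" "A > 0" "B > 0" "x \<ge> 0" "y \<ge> 0"
  shows "x * y powr M \<le> A * B powr M *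
    (1 / (M + 1) * (x powr (M + 1) / A powr (M + 1)) + M / (M + 1) * (y powr (M + 1) / B powr (M + 1)))"
proof (cases "x = 0 \<or> y = 0")
  case True
  then show ?thesis using assms by auto
next
  case False
  then have xy: "x > 0" "y > 0" using assms by auto
  have "((x / A) powr (M + 1)) powr (1 / (M + 1)) * ((y / B) powr (M + 1)) powr (M / (M + 1))
     \<le> 1 / (M + 1) * (x / A) powr (M + 1) + M / (M + 1) * (y / B) powr (M + 1)"
    using assms xy by (intro Youngs_inequality_0) (auto simp: field_simps)
  then have "x / A * (y / B) powr M \<le> 1 / (M + 1) * (x / A) powr (M + 1) + M / (M + 1) * (y / B) powr (M + 1)"
    using assms xy by (simp add: powr_powr)
  then have "x * y powr M / (A * B powr M)
     \<le> 1 / (M + 1) * (x powr (M + 1) / A powr (M + 1)) + M / (M + 1) * (y powr (M + 1) / B powr (M + 1))"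
    using assms xy by (simp add: powr_divide)
  then show ?thesis using assms by (simp add: pos_divide_le_eq mult.commute)
qed

lemma rpow_nonneg [simp]: "0 \<le> rpow x a"
  by (simp add: rpow_def)

lemma rpow_mono: "0 \<le> x \<Longrightarrow> x \<le> y \<Longrightarrow> 0 \<le> a \<Longrightarrow> rpow x a \<le> rpow y a"
  by (auto simp: rpow_def intro: powr_mono2)

lemma rpow_measurable [measurable]: "(\<lambda>x. rpow x a) \<in> borel_measurable borel"
  by (simp add: rpow_def)

text \<open>Hoelder's inequality in the form that the objective calls for: an increment times the
  power \<open>M\<close> of a norm. Both factors use moments of order \<open>M + 1\<close>, which is
  the origin of this order in the theorem. For \<open>M = 0\<close> the conjugate exponent is
  infinite, but then \<open>rpow\<close> is the constant 1.\<close>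

lemma Lq_le_Holder:
  assumes f: "Lq_le P (M + 1) f A" and g: "Lq_le P (M + 1) g B" and M: "M \<ge> 0" and AB: "A > 0" "B > 0"
  shows "(\<integral>\<^sup>+x. ennreal (\<bar>f x\<bar> * rpow \<bar>g x\<bar> M) \<partial>P) \<le> ennreal (A * rpow B M)"
proof (cases "M = 0")
  case True
  then show ?thesis using Lq_le_nn_integral[OF f] AB by (simp add: rpow_def)
next
  case False
  with M have M: "M > 0" by simp
  note [measurable] = Lq_le_measurable[OF f] Lq_le_measurable[OF g]
  define c1 where "c1 = A * B powr M * (1 / (M + 1)) / A powr (M + 1)"
  define c2 where "c2 = A * B powr M * (M / (M + 1)) / B powr (M + 1)"
  have c: "c1 \<ge> 0" "c2 \<ge> 0" using M AB by (auto simp: c1_def c2_def)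
  have "(\<integral>\<^sup>+x. ennreal (\<bar>f x\<bar> * rpow \<bar>g x\<bar> M) \<partial>P)
      \<le> (\<integral>\<^sup>+x. ennreal c1 * ennreal (\<bar>f x\<bar> powr (M + 1)) + ennreal c2 * ennreal (\<bar>g x\<bar> powr (M + 1)) \<partial>P)"
  proof (rule nn_integral_mono)
    fix x
    have "\<bar>f x\<bar> * \<bar>g x\<bar> powr M \<le> c1 * \<bar>f x\<bar> powr (M + 1) + c2 * \<bar>g x\<bar> powr (M + 1)"
      using powr_mult_le_weighted[OF M AB, of "\<bar>f x\<bar>" "\<bar>g x\<bar>"]
      by (simp add: c1_def c2_def algebra_simps)
    then show "ennreal (\<bar>f x\<bar> * rpow \<bar>g x\<bar> M)
        \<le> ennreal c1 * ennreal (\<bar>f x\<bar> powr (M + 1)) + ennreal c2 * ennreal (\<bar>g x\<bar> powr (M + 1))"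
      using c M by (simp add: rpow_def ennreal_leI flip: ennreal_mult ennreal_plus)
  qed
  also have "\<dots> = ennreal c1 * (\<integral>\<^sup>+x. ennreal (\<bar>f x\<bar> powr (M + 1)) \<partial>P) + ennreal c2 * (\<integral>\<^sup>+x. ennreal (\<bar>g x\<bar> powr (M + 1)) \<partial>P)"
    by (simp add: nn_integral_add nn_integral_cmult)
  also have "\<dots> \<le> ennreal c1 * ennreal (A powr (M + 1)) + ennreal c2 * ennreal (B powr (M + 1))"
    by (intro add_mono mult_left_mono Lq_le_nn_integral f g) auto
  also have "\<dots> = ennreal (c1 * A powr (M + 1) + c2 * B powr (M + 1))"
    using c by (simp add: ennreal_mult ennreal_plus)
  also have "c1 * A powr (M + 1) + c2 * B powr (M + 1) = A * B powr M * (1 / (M + 1) + M / (M + 1))"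
    unfolding c1_def c2_def distrib_left using AB by simp
  also have "1 / (M + 1) + M / (M + 1) = 1"
    using M by (simp add: add_divide_distrib[symmetric])
  finally show ?thesis using M by (simp add: rpow_def)
qed

section \<open>Translation of extended norms into \<open>Lq_le\<close>\<close>

lemma epow_mono: "x \<le> y \<Longrightarrow> 0 \<le> a \<Longrightarrow> epow x a \<le> epow y a"
  unfolding epow_def
  by (auto simp: top_unique intro!: ennreal_leI powr_mono2 enn2real_mono simp: less_top[symmetric])

lemma epow_ennreal: "0 \<le> x \<Longrightarrow> epow (ennreal x) a = ennreal (x powr a)"
  by (simp add: epow_def)

text \<open>A finite norm forces a finite integral because \<open>epow\<close> sends infinity to
  infinity; after that the root can be undone over the reals.\<close>

lemma Lnorm_le_imp_nn_integral_le:
  assumes "Lnorm P q W \<le> ennreal A" "0 \<le> A" "q > 0"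
  shows "(\<integral>\<^sup>+ \<omega>. epow (W \<omega>) q \<partial>P) \<le> ennreal (A powr q)"
proof -
  let ?I = "\<integral>\<^sup>+ \<omega>. epow (W \<omega>) q \<partial>P"
  have fin: "?I \<noteq> \<top>" using assms by (auto simp: Lnorm_def epow_def top_unique split: if_splits)
  then have "ennreal (enn2real ?I powr (1 / q)) \<le> ennreal A"
    using assms by (auto simp: Lnorm_def epow_def)
  then have "enn2real ?I powr (1 / q) \<le> A" using assms by (simp add: ennreal_le_iff)
  then have "(enn2real ?I powr (1 / q)) powr q \<le> A powr q"
    using assms by (intro powr_mono2) auto
  then have "enn2real ?I \<le> A powr q" using assms by (simp add: powr_powr)
  then have "ennreal (enn2real ?I) \<le> ennreal (A powr q)" by (rule ennreal_leI)
  also have "ennreal (enn2real ?I) = ?I" using fin by (simp add: less_top)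
  finally show ?thesis .
qed

lemma Lnorm_real_le_iff:
  assumes "f \<in> borel_measurable P" "Lnorm_real P q f \<le> ennreal A" "0 \<le> A" "q > 0"
  shows "Lq_le P q f A"
  using Lnorm_le_imp_nn_integral_le[OF assms(2-4)] assms by (intro Lq_leI) (auto simp: epow_ennreal)

section \<open>Lag vectors and the past\<close>

lemma borel_measurable_vec:
  fixes f :: "'a \<Rightarrow> real ^ 'n"
  assumes "\<And>i. (\<lambda>x. f x $ i) \<in> borel_measurable M"
  shows "f \<in> borel_measurable M"
  by (subst borel_measurable_euclidean_space) (auto simp: Basis_vec_def inner_axis intro: assms)

lemma vec_nth_measurable [measurable]: "(\<lambda>x::real ^ 'n. x $ i) \<in> borel_measurable borel"
  by (intro borel_measurable_continuous_onI continuous_intros)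

lemma lags_nth: "lags X s \<omega> $ i = X (s + 1 - coord_no i) \<omega>"
  by (simp add: lags_def)

lemma coord_no_less: "i < j \<Longrightarrow> coord_no i < coord_no j"
proof -
  assume ij: "i < j"
  then have "j \<notin> {k. k \<le> i}" "j \<in> {k. k \<le> j}" by auto
  moreover have "{k. k \<le> i} \<subseteq> {k. k \<le> j}" using ij by auto
  ultimately have "{k. k \<le> i} \<subset> {k. k \<le> j}" by blast
  then show ?thesis unfolding coord_no_def by (simp add: psubset_card_mono)
qed

lemma inj_coord_no: "inj coord_no"
  by (rule linorder_injI) (use coord_no_less in force)

lemma coord_no_ge_1: "1 \<le> coord_no i"
proof -
  have "card {i} \<le> card {j. j \<le> i}" by (intro card_mono) auto
  then show ?thesis by (simp add: coord_no_def)
qed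

lemma coord_no_le: "coord_no (i :: 'p::{finite,linorder}) \<le> int CARD('p)"
  unfolding coord_no_def by (simp add: card_mono)

text \<open>Surjectivity follows from injectivity by counting. It allows sums over coordinates to be
  rewritten as sums over lag numbers, which can be shifted.\<close>

lemma bij_coord_no: "bij_betw (coord_no :: 'p::{finite,linorder} \<Rightarrow> int) UNIV {1..int CARD('p)}"
proof (rule bij_betwI')
  show "\<exists>x\<in>(UNIV :: 'p set). y = coord_no x" if "y \<in> {1..int CARD('p)}" for y
  proof -
    have "range (coord_no :: 'p \<Rightarrow> int) = {1..int CARD('p)}"
    proof (rule card_subset_eq)
      show "range (coord_no :: 'p \<Rightarrow> int) \<subseteq> {1..int CARD('p)}"
        using coord_no_ge_1 coord_no_le by (auto simp: image_subset_iff)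
    qed (simp_all add: card_image[OF inj_coord_no])
    then have "y \<in> range (coord_no :: 'p \<Rightarrow> int)" using that by simp
    then show ?thesis by (auto simp: image_def)
  qed
  show "coord_no x \<in> {1..int CARD('p)}" for x :: 'p
    using coord_no_ge_1[of x] coord_no_le[of x] by simp
  show "(coord_no x = coord_no y) = (x = y)" for x y :: 'p
    using inj_coord_no by (rule inj_eq)
qed

lemma sum_coord_no:
  "(\<Sum>i\<in>(UNIV :: 'p::{finite,linorder} set). f (coord_no i)) = (\<Sum>k\<in>{1..int CARD('p)}. f k)"
  by (rule sum.reindex_bij_betw[OF bij_coord_no])

lemma lags_measurable:
  assumes "\<And>s. s \<le> t \<Longrightarrow> X s \<in> borel_measurable M"
  shows "lags X t \<in> borel_measurable M"
proof (rule borel_measurable_vec)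
  fix i
  show "(\<lambda>x. lags X t x $ i) \<in> borel_measurable M"
    unfolding lags_nth using coord_no_ge_1[of i] by (intro assms) simp
qed

section \<open>The filtration generated by the innovations\<close>

lemma space_past [simp]: "space (past P \<epsilon> t) = space P"
  by (simp add: past_def space_measure_of_conv)

lemma past_generator_subset:
  "(\<Union>s\<in>{..t}. {\<epsilon> s -` A \<inter> space P | A. A \<in> sets borel}) \<subseteq> Pow (space P)"
  by auto

lemma sets_past:
  "sets (past P \<epsilon> t) = sigma_sets (space P) (\<Union>s\<in>{..t}. {\<epsilon> s -` A \<inter> space P | A. A \<in> sets borel})"
  unfolding past_def by (rule sets_measure_of[OF past_generator_subset])

lemma subalgebra_past:
  assumes "\<And>s. \<epsilon> s \<in> borel_measurable P"
  shows "subalgebra P (past P \<epsilon> t)"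
  unfolding subalgebra_def sets_past
  using assms by (auto intro!: sets.sigma_sets_subset intro: measurable_sets)

lemma subalgebra_past_mono: "s \<le> t \<Longrightarrow> subalgebra (past P \<epsilon> t) (past P \<epsilon> s)"
  unfolding subalgebra_def sets_past using order_trans[of _ s t]
  by (simp, intro sigma_sets_subseteq UN_mono) auto

lemma past_measurable_mono:
  "f \<in> measurable (past P \<epsilon> s) N \<Longrightarrow> s \<le> t \<Longrightarrow> f \<in> measurable (past P \<epsilon> t) N"
  using measurable_from_subalg[OF subalgebra_past_mono] by blast

lemma lags_measurable_past:
  assumes "\<And>s. s \<le> t \<Longrightarrow> X s \<in> borel_measurable (past P \<epsilon> s)"
  shows "lags X t \<in> borel_measurable (past P \<epsilon> t)"
  by (rule lags_measurable) (use assms past_measurable_mono in blast)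

lemma innov_measurable_past: "s \<le> t \<Longrightarrow> \<epsilon> s \<in> borel_measurable (past P \<epsilon> t)"
  by (rule measurableI) (auto simp: sets_past intro!: sigma_sets.Basic)

abbreviation innov_law :: "'w measure \<Rightarrow> (int \<Rightarrow> 'w \<Rightarrow> real) \<Rightarrow> real measure" where
  "innov_law P \<epsilon> \<equiv> distr P borel (\<epsilon> 0)"

lemma (in prob_space) iid_measurable: "iid M \<epsilon> \<Longrightarrow> \<epsilon> s \<in> borel_measurable M"
  by (auto simp: iid_def indep_vars_def)

text \<open>The generators belonging to single innovations are independent and stable under
  intersection; grouping them into the index sets \<open>{t}\<close> and \<open>{..t - 1}\<close>
  preserves independence of the generated sigma-algebras.\<close>

lemma (in prob_space) iid_indep_past:
  assumes "iid M \<epsilon>" and A: "A \<in> sets borel" and B: "B \<in> sets (past M \<epsilon> (t - 1))"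
  shows "prob ((\<epsilon> t -` A \<inter> space M) \<inter> B) = prob (\<epsilon> t -` A \<inter> space M) * prob B"
proof -
  let ?E = "\<lambda>s. {\<epsilon> s -` A \<inter> space M | A. A \<in> sets borel}"
  let ?I = "case_bool {t} {..t - 1}"
  have "indep_sets (\<lambda>j. sigma_sets (space M) (\<Union>i\<in>?I j. ?E i)) UNIV"
  proof (rule indep_sets_collect_sigma)
    show "indep_sets ?E (\<Union>j\<in>UNIV. ?I j)"
      by (rule indep_sets_mono_index[of _ UNIV]) (use assms in \<open>auto simp: iid_def indep_vars_def2\<close>)
    show "Int_stable (?E i)" for i
      by (auto simp: Int_stable_def) (metis (no_types, lifting) sets.Int vimage_Int Int_assoc Int_left_commute inf.idem)
    show "disjoint_family_on ?I UNIV"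
      by (auto simp: disjoint_family_on_def split: bool.splits)
  qed
  then have "indep_set (sigma_sets (space M) (?E t)) (sigma_sets (space M) (\<Union>i\<in>{..t - 1}. ?E i))"
    unfolding indep_set_def by (rule indep_sets_mono_sets) (auto split: bool.splits)
  moreover have "\<epsilon> t -` A \<inter> space M \<in> sigma_sets (space M) (?E t)"
    using A by (auto intro: sigma_sets.Basic)
  ultimately show ?thesis
    using B unfolding indep_sets2_eq sets_past by blast
qed

text \<open>This takes the place of conditional expectation. The identity, seen as a map into the
  past sigma-algebra, is a random element carrying the whole past. Independence makes its joint law
  with \<open>\<epsilon> t\<close> a product, and Fubini integrates out the new innovation while the
  past is held fixed.\<close>

lemma (in prob_space) nn_integral_innov_past:
  assumes iid: "iid M \<epsilon>" and h: "h \<in> borel_measurable (borel \<Otimes>\<^sub>M past M \<epsilon> (t - 1))"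
  shows "(\<integral>\<^sup>+\<omega>. h (\<epsilon> t \<omega>, \<omega>) \<partial>M) = (\<integral>\<^sup>+\<omega>. \<integral>\<^sup>+e. h (e, \<omega>) \<partial>innov_law M \<epsilon> \<partial>M)"
proof -
  let ?F = "past M \<epsilon> (t - 1)" and ?\<mu> = "innov_law M \<epsilon>"
  have [measurable]: "\<epsilon> s \<in> borel_measurable M" for s by (rule iid_measurable[OF iid])
  have id: "(\<lambda>\<omega>. \<omega>) \<in> measurable M ?F"
    using measurable_from_subalg[OF subalgebra_past[of \<epsilon> M "t - 1"] measurable_ident] by (simp add: id_def)
  have law: "distr M borel (\<epsilon> t) = ?\<mu>" using iid by (auto simp: iid_def)
  interpret mu: prob_space ?\<mu> by (rule prob_space_distr) simp
  interpret N: prob_space "distr M ?F (\<lambda>\<omega>. \<omega>)" by (rule prob_space_distr) (rule id)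
  interpret pair_sigma_finite ?\<mu> "distr M ?F (\<lambda>\<omega>. \<omega>)" ..
  have eq: "?\<mu> \<Otimes>\<^sub>M distr M ?F (\<lambda>\<omega>. \<omega>) = distr M (borel \<Otimes>\<^sub>M ?F) (\<lambda>\<omega>. (\<epsilon> t \<omega>, \<omega>))"
  proof (rule pair_measure_eqI)
    fix A B assume "A \<in> sets ?\<mu>" "B \<in> sets (distr M ?F (\<lambda>\<omega>. \<omega>))"
    then have A: "A \<in> sets borel" and B: "B \<in> sets ?F" by auto
    have BM: "B \<inter> space M = B" using sets.sets_into_space[OF B] by auto
    have "emeasure (distr M (borel \<Otimes>\<^sub>M ?F) (\<lambda>\<omega>. (\<epsilon> t \<omega>, \<omega>))) (A \<times> B)
        = emeasure M ((\<lambda>\<omega>. (\<epsilon> t \<omega>, \<omega>)) -` (A \<times> B) \<inter> space M)"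
      using A B id by (intro emeasure_distr) auto
    also have "(\<lambda>\<omega>. (\<epsilon> t \<omega>, \<omega>)) -` (A \<times> B) \<inter> space M = (\<epsilon> t -` A \<inter> space M) \<inter> B"
      using BM by auto
    also have "emeasure M \<dots> = emeasure M (\<epsilon> t -` A \<inter> space M) * emeasure M B"
      using iid_indep_past[OF iid A B] by (simp add: emeasure_eq_measure ennreal_mult)
    also have "emeasure M (\<epsilon> t -` A \<inter> space M) = emeasure ?\<mu> A"
      unfolding law[symmetric] using A by (simp add: emeasure_distr)
    also have "emeasure M B = emeasure (distr M ?F (\<lambda>\<omega>. \<omega>)) B"
      using B BM id by (simp add: emeasure_distr)
    finally show "emeasure ?\<mu> A * emeasure (distr M ?F (\<lambda>\<omega>. \<omega>)) B
        = emeasure (distr M (borel \<Otimes>\<^sub>M ?F) (\<lambda>\<omega>. (\<epsilon> t \<omega>, \<omega>))) (A \<times> B)" ..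
  qed (simp_all add: mu.sigma_finite_measure_axioms N.sigma_finite_measure_axioms cong: sets_pair_measure_cong)
  have h': "h \<in> borel_measurable (?\<mu> \<Otimes>\<^sub>M ?F)"
    using h by (simp cong: measurable_cong_sets)
  have "(\<integral>\<^sup>+\<omega>. h (\<epsilon> t \<omega>, \<omega>) \<partial>M) = integral\<^sup>N (distr M (borel \<Otimes>\<^sub>M ?F) (\<lambda>\<omega>. (\<epsilon> t \<omega>, \<omega>))) h"
    by (subst nn_integral_distr) (use id h in auto)
  also have "\<dots> = (\<integral>\<^sup>+\<omega>. \<integral>\<^sup>+e. h (e, \<omega>) \<partial>?\<mu> \<partial>distr M ?F (\<lambda>\<omega>. \<omega>))"
    unfolding eq[symmetric] by (rule nn_integral_snd[symmetric]) (use h in \<open>simp cong: measurable_cong_sets\<close>)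
  also have "\<dots> = (\<integral>\<^sup>+\<omega>. \<integral>\<^sup>+e. h (e, \<omega>) \<partial>?\<mu> \<partial>M)"
  proof -
    have "(\<lambda>(\<omega>, e). h (e, \<omega>)) \<in> borel_measurable (?F \<Otimes>\<^sub>M ?\<mu>)"
      using measurable_compose[OF measurable_pair_swap' h'] by (simp add: case_prod_unfold)
    then have "(\<lambda>\<omega>. \<integral>\<^sup>+e. h (e, \<omega>) \<partial>?\<mu>) \<in> borel_measurable ?F"
      by (rule mu.borel_measurable_nn_integral)
    then show ?thesis using id by (subst nn_integral_distr) auto
  qed
  finally show ?thesis .
qed


section \<open>Contractive autoregressions\<close>

text \<open>\<open>G_growth\<close> combines the Lipschitz condition with the moment at a reference
  point; \<open>C0\<close> absorbs that moment and the position of the point. The conditions concern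
  the law of one innovation because they are applied with the past frozen. The exponent
  \<open>q\<close> is a parameter, since the locale is used with \<open>M + 1\<close> and also with
  a larger exponent that comes with constants of its own.\<close>

locale autoregression = prob_space P for P :: "'w measure" +
  fixes \<epsilon> :: "int \<Rightarrow> 'w \<Rightarrow> real"
    and G :: "real \<Rightarrow> real ^ 'p::{finite,linorder} \<Rightarrow> real \<Rightarrow> real"
    and q :: real and \<chi>v :: "real ^ 'p::{finite,linorder}" and C0 :: real
  assumes innov: "iid P \<epsilon>"
    and q_ge_1: "1 \<le> q"
    and chi_nonneg: "0 \<le> \<chi>v $ i"
    and chi_sum: "(\<Sum>i\<in>UNIV. \<chi>v $ i) < 1"
    and C0_nonneg: "0 \<le> C0"
    and G_measurable: "u \<in> {0..1} \<Longrightarrow> (\<lambda>(e, y). G e y u) \<in> borel_measurable (borel \<Otimes>\<^sub>M borel)"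
    and G_growth: "u \<in> {0..1} \<Longrightarrow>
      Lq_le (innov_law P \<epsilon>) q (\<lambda>e. G e y u) ((\<Sum>i\<in>UNIV. \<chi>v $ i * \<bar>y $ i\<bar>) + C0)"
    and G_lipschitz: "u \<in> {0..1} \<Longrightarrow>
      Lq_le (innov_law P \<epsilon>) q (\<lambda>e. G e y u - G e y' u) (\<Sum>i\<in>UNIV. \<chi>v $ i * \<bar>y $ i - y' $ i\<bar>)"
begin

abbreviation \<mu> :: "real measure" where "\<mu> \<equiv> innov_law P \<epsilon>"
abbreviation lagv :: "(int \<Rightarrow> 'w \<Rightarrow> real) \<Rightarrow> int \<Rightarrow> 'w \<Rightarrow> real ^ 'p::{finite,linorder}" where
  "lagv \<equiv> lags"
abbreviation F :: "int \<Rightarrow> 'w measure" where "F \<equiv> past P \<epsilon>"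

lemma innov_measurable [measurable]: "\<epsilon> s \<in> borel_measurable P"
  by (rule iid_measurable[OF innov])

lemma prob_space_law: "prob_space \<mu>"
  by (rule prob_space_distr) simp

lemma past_measurable: "f \<in> measurable (F t) N \<Longrightarrow> f \<in> measurable P N"
  by (rule measurable_from_subalg[OF subalgebra_past]) simp_all

text \<open>Linearly decreasing weights turn the contraction over p lags into a one-step contraction: the
  weight of a lag drops by \<open>\<chi>v $ i + gap\<close> whenever the lag ages by one.\<close>

definition gap :: real where "gap = (1 - (\<Sum>i\<in>UNIV. \<chi>v $ i)) / CARD('p)"

definition lam :: real where "lam = 1 - gap"

text \<open>\<open>gap\<close> is an equal share, over the p lags, of the slack left by the
  contraction. With it the tail sums run from 1 at lag 1 to 0 at lag p + 1: the newest value counts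
  fully, and a value that leaves the vector costs nothing.\<close>

definition weight :: "int \<Rightarrow> real" where
  "weight k = (\<Sum>i | k \<le> coord_no i. \<chi>v $ i + gap)"

definition V :: "real ^ 'p::{finite,linorder} \<Rightarrow> real" where
  "V y = (\<Sum>i\<in>UNIV. weight (coord_no i) * \<bar>y $ i\<bar>)"

lemma gap_pos: "0 < gap"
  using chi_sum by (simp add: gap_def)

lemma lam_less_1: "lam < 1"
  using gap_pos by (simp add: lam_def)

lemma gap_le_1: "gap \<le> 1"
proof -
  have "1 - (\<Sum>i\<in>UNIV. \<chi>v $ i) \<le> 1" using chi_nonneg by (simp add: sum_nonneg)
  also have "1 \<le> real CARD('p)" by (simp add: Suc_leI)
  finally show ?thesis by (simp add: gap_def)
qed

lemma lam_nonneg: "0 \<le> lam"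
  using gap_le_1 by (simp add: lam_def)

lemma weight_nonneg: "0 \<le> weight k"
  unfolding weight_def using chi_nonneg gap_pos by (intro sum_nonneg) (simp add: less_imp_le)

lemma weight_one: "weight 1 = 1"
proof -
  have "{i :: 'p. 1 \<le> coord_no i} = UNIV" using coord_no_ge_1 by auto
  then show ?thesis by (simp add: weight_def sum.distrib gap_def)
qed

lemma weight_Suc: "weight (coord_no i + 1) = weight (coord_no i) - \<chi>v $ i - gap"
proof -
  have "{j. coord_no i \<le> coord_no j} = insert i {j. coord_no i + 1 \<le> coord_no j}"
    using inj_coord_no by (auto simp: inj_def order_le_less)
  then show ?thesis by (simp add: weight_def)
qed

lemma weight_ge: "gap \<le> weight (coord_no (i :: 'p))"
  using weight_Suc[of i] weight_nonneg[of "coord_no i + 1"] chi_nonneg[of i] by linarith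

lemma weight_le_1: "1 \<le> k \<Longrightarrow> weight k \<le> 1"
  unfolding weight_one[symmetric] unfolding weight_def
  using chi_nonneg gap_pos by (intro sum_mono2) (auto simp: less_imp_le)

lemma weight_top: "weight (int CARD('p) + 1) = 0"
proof -
  have "\<not> int CARD('p) + 1 \<le> coord_no i" for i :: 'p using coord_no_le[of i] by simp
  then show ?thesis by (simp add: weight_def)
qed

lemma V_nonneg: "0 \<le> V y"
  unfolding V_def using weight_nonneg by (intro sum_nonneg) simp

lemma V_diff_le: "V (x - y) \<le> V x + V y"
  unfolding V_def sum.distrib[symmetric] distrib_left[symmetric]
  by (intro sum_mono mult_left_mono weight_nonneg) simp

lemma V_measurable [measurable]: "V \<in> borel_measurable borel"
  unfolding V_def[abs_def] by measurable

lemma l1_norm_le_V: "l1_norm y \<le> V y / gap"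
proof -
  have "gap * l1_norm y \<le> V y"
    unfolding l1_norm_def V_def sum_distrib_left using weight_ge by (intro sum_mono mult_right_mono) auto
  then show ?thesis using gap_pos by (simp add: pos_le_divide_eq mult.commute)
qed

lemma V_le_l1_norm: "V y \<le> l1_norm y"
  unfolding l1_norm_def V_def
  using weight_le_1[OF coord_no_ge_1] by (intro sum_mono mult_left_le_one_le weight_nonneg) auto

text \<open>Advancing by one step puts the new value in front, with \<open>weight 1 = 1\<close>, and
  moves each older value to the next lag. The term formally added at lag p + 1 vanishes by
  \<open>weight_top\<close>.\<close>

lemma V_shift:
  "V (lagv D t \<omega>) = \<bar>D t \<omega>\<bar> + (\<Sum>i\<in>UNIV. weight (coord_no i + 1) * \<bar>lagv D (t - 1) \<omega> $ i\<bar>)"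
proof -
  let ?p = "int CARD('p)"
  let ?f = "\<lambda>k. weight k * \<bar>D (t + 1 - k) \<omega>\<bar>"
  have "V (lagv D t \<omega>) = (\<Sum>k\<in>{1..?p}. ?f k)"
    unfolding V_def lags_nth by (rule sum_coord_no)
  also have "{1..?p} = insert 1 {2..?p}" by (auto simp: Suc_le_eq)
  also have "(\<Sum>k\<in>insert 1 {2..?p}. ?f k) = \<bar>D t \<omega>\<bar> + (\<Sum>k\<in>{2..?p}. ?f k)"
    by (subst sum.insert) (auto simp: weight_one)
  also have "(\<Sum>k\<in>{2..?p}. ?f k) = (\<Sum>k\<in>{2..?p + 1}. ?f k)"
  proof -
    have "{2..?p + 1} = insert (?p + 1) {2..?p}" by (auto simp: Suc_le_eq)
    then show ?thesis by (simp add: weight_top)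
  qed
  also have "\<dots> = (\<Sum>k\<in>{1..?p}. ?f (k + 1))"
    by (rule sum.reindex_bij_witness[of _ "\<lambda>k. k + 1" "\<lambda>k. k - 1"]) auto
  also have "\<dots> = (\<Sum>i\<in>UNIV. weight (coord_no (i :: 'p) + 1) * \<bar>D (t - 1 + 1 - coord_no i) \<omega>\<bar>)"
    by (subst sum_coord_no[symmetric]) (simp add: algebra_simps)
  finally show ?thesis by (simp add: lags_nth)
qed

lemma abs_le_V_lags: "\<bar>D t \<omega>\<bar> \<le> V (lagv D t \<omega>)"
  unfolding V_shift using weight_nonneg by (simp add: sum_nonneg)

text \<open>In each coordinate, \<open>\<chi>v $ i\<close> plus the weight after ageing is the old
  weight minus \<open>gap\<close>. As weights are at most 1, this leaves at most the fraction
  \<open>lam = 1 - gap\<close> of the old weight.\<close>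

lemma shifted_weights_le:
  "(\<Sum>i\<in>UNIV. \<chi>v $ i * \<bar>y $ i\<bar>) + (\<Sum>i\<in>UNIV. weight (coord_no i + 1) * \<bar>y $ i\<bar>) \<le> lam * V y"
proof -
  have "\<chi>v $ i * \<bar>y $ i\<bar> + weight (coord_no i + 1) * \<bar>y $ i\<bar> \<le> lam * (weight (coord_no i) * \<bar>y $ i\<bar>)" for i
  proof -
    have "\<chi>v $ i + weight (coord_no i + 1) = weight (coord_no i) - gap" by (simp add: weight_Suc)
    also have "\<dots> \<le> lam * weight (coord_no i)"
      using weight_le_1[OF coord_no_ge_1, of i] gap_pos
      by (simp add: lam_def left_diff_distrib mult_le_cancel_left1)
    finally have "(\<chi>v $ i + weight (coord_no i + 1)) * \<bar>y $ i\<bar> \<le> lam * weight (coord_no i) * \<bar>y $ i\<bar>"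
      by (intro mult_right_mono) auto
    then show ?thesis by (simp add: algebra_simps)
  qed
  then show ?thesis
    unfolding V_def sum_distrib_left sum.distrib[symmetric] by (intro sum_mono)
qed

text \<open>For frozen lags \<open>y\<close>, the function of \<open>e\<close> is \<open>V\<close>
  of the next lag vector if \<open>H e\<close> is the new value. Minkowski adds the constant
  contribution of the older lags, and \<open>shifted_weights_le\<close> absorbs the sum.\<close>

lemma conditional_step:
  assumes "Lq_le \<mu> q H ((\<Sum>i\<in>UNIV. \<chi>v $ i * \<bar>y $ i\<bar>) + s)"
  shows "Lq_le \<mu> q (\<lambda>e. \<bar>H e\<bar> + (\<Sum>i\<in>UNIV. weight (coord_no i + 1) * \<bar>y $ i\<bar>)) (lam * V y + s)"
proof -
  let ?r = "\<Sum>i\<in>UNIV. weight (coord_no i + 1) * \<bar>y $ i\<bar>"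
  note [measurable] = Lq_le_measurable[OF assms]
  have r: "0 \<le> ?r" using weight_nonneg by (simp add: sum_nonneg)
  have "Lq_le \<mu> q (\<lambda>e. \<bar>H e\<bar>) ((\<Sum>i\<in>UNIV. \<chi>v $ i * \<bar>y $ i\<bar>) + s)"
    using assms q_ge_1 by (intro Lq_le_mono[OF assms]) auto
  from Lq_le_add[OF this Lq_le_const[OF prob_space_law, of q ?r] q_ge_1]
  show ?thesis
    by (rule Lq_le_weaken) (use q_ge_1 r shifted_weights_le[of y] in auto)
qed

text \<open>The conditional contraction, integrated over the past. The event \<open>A\<close>
  permits propagation when only a truncated initial moment is known; the source \<open>s\<close>
  stands for an additive constant or for a change of parameter.\<close>

lemma step:
  assumes D: "D t \<in> borel_measurable P" "lagv D (t - 1) \<in> borel_measurable (F (t - 1))"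
    and H: "(\<lambda>(e, \<omega>). H e \<omega>) \<in> borel_measurable (borel \<Otimes>\<^sub>M F (t - 1))"
    and eq: "AE \<omega> in P. D t \<omega> = H (\<epsilon> t \<omega>) \<omega>"
    and bound: "\<And>\<omega>. \<omega> \<in> space P \<Longrightarrow>
      Lq_le \<mu> q (\<lambda>e. H e \<omega>) ((\<Sum>i\<in>UNIV. \<chi>v $ i * \<bar>lagv D (t - 1) \<omega> $ i\<bar>) + s \<omega>)"
    and A: "A \<in> sets (F (t - 1))"
    and s: "Lq_le P q (\<lambda>\<omega>. indicator A \<omega> * s \<omega>) \<delta>"
    and v: "Lq_le P q (\<lambda>\<omega>. indicator A \<omega> * V (lagv D (t - 1) \<omega>)) v"
  shows "Lq_le P q (\<lambda>\<omega>. indicator A \<omega> * V (lagv D t \<omega>)) (lam * v + \<delta>)"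
proof -
  let ?Y = "lagv D (t - 1)"
  define r where "r \<omega> = (\<Sum>i\<in>UNIV. weight (coord_no i + 1) * \<bar>?Y \<omega> $ i\<bar>)" for \<omega>
  note [measurable] = D H A past_measurable[OF D(2)]
  have AP [measurable]: "A \<in> sets P"
    using subalgebra_past[of \<epsilon> P "t - 1"] A by (auto simp: subalgebra_def)
  have r_meas [measurable]: "r \<in> borel_measurable (F (t - 1))" unfolding r_def by measurable
  note rP [measurable] = past_measurable[OF r_meas]
  have VY [measurable]: "(\<lambda>\<omega>. V (lagv D t \<omega>)) \<in> borel_measurable P"
    unfolding V_shift by measurable
  have sum: "Lq_le P q (\<lambda>\<omega>. lam * (indicator A \<omega> * V (?Y \<omega>)) + indicator A \<omega> * s \<omega>) (lam * v + \<delta>)"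
    using Lq_le_add[OF Lq_le_cmult[OF v, of lam] s q_ge_1] q_ge_1 lam_nonneg by simp
  show ?thesis
  proof (rule Lq_leI)
    let ?h = "\<lambda>(e, \<omega>). indicator A \<omega> * ennreal ((\<bar>H e \<omega>\<bar> + r \<omega>) powr q)"
    have "(\<integral>\<^sup>+\<omega>. ennreal (\<bar>indicator A \<omega> * V (lagv D t \<omega>)\<bar> powr q) \<partial>P)
        = (\<integral>\<^sup>+\<omega>. ?h (\<epsilon> t \<omega>, \<omega>) \<partial>P)"
      using eq q_ge_1 weight_nonneg
      by (intro nn_integral_cong_AE)
        (auto elim!: eventually_mono simp: V_shift r_def abs_of_nonneg sum_nonneg split: split_indicator)
    also have "\<dots> = (\<integral>\<^sup>+\<omega>. \<integral>\<^sup>+e. ?h (e, \<omega>) \<partial>\<mu> \<partial>P)"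
      by (rule nn_integral_innov_past[OF innov]) measurable
    \<comment> \<open>The inner integral is the q-th power of a conditional norm, so the conditional
      bound is applied separately for each past; Minkowski over the past, in \<open>sum\<close>,
      then combines its two terms.\<close>
    also have "\<dots> \<le> (\<integral>\<^sup>+\<omega>. ennreal (\<bar>lam * (indicator A \<omega> * V (?Y \<omega>)) + indicator A \<omega> * s \<omega>\<bar> powr q) \<partial>P)"
    proof (rule nn_integral_mono)
      fix \<omega> assume \<omega>: "\<omega> \<in> space P"
      note L = conditional_step[OF bound[OF \<omega>]]
      have "(\<integral>\<^sup>+e. ?h (e, \<omega>) \<partial>\<mu>) = indicator A \<omega> * (\<integral>\<^sup>+e. ennreal ((\<bar>H e \<omega>\<bar> + r \<omega>) powr q) \<partial>\<mu>)"
        using \<omega> by (simp add: nn_integral_cmult)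
      also have "(\<integral>\<^sup>+e. ennreal ((\<bar>H e \<omega>\<bar> + r \<omega>) powr q) \<partial>\<mu>) \<le> ennreal ((lam * V (?Y \<omega>) + s \<omega>) powr q)"
        using Lq_le_nn_integral[OF L] weight_nonneg
        by (simp add: r_def abs_of_nonneg sum_nonneg)
      also have "indicator A \<omega> * ennreal ((lam * V (?Y \<omega>) + s \<omega>) powr q)
          = ennreal (\<bar>lam * (indicator A \<omega> * V (?Y \<omega>)) + indicator A \<omega> * s \<omega>\<bar> powr q)"
        using Lq_le_nonneg[OF L] by (auto split: split_indicator)
      finally show "(\<integral>\<^sup>+e. ?h (e, \<omega>) \<partial>\<mu>)
          \<le> ennreal (\<bar>lam * (indicator A \<omega> * V (?Y \<omega>)) + indicator A \<omega> * s \<omega>\<bar> powr q)"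
        by (simp add: mult_left_mono)
    qed
    also have "\<dots> \<le> ennreal ((lam * v + \<delta>) powr q)" by (rule Lq_le_nn_integral[OF sum])
    finally show "(\<integral>\<^sup>+\<omega>. ennreal (\<bar>indicator A \<omega> * V (lagv D t \<omega>)\<bar> powr q) \<partial>P) \<le> ennreal ((lam * v + \<delta>) powr q)" .
  qed (use Lq_le_nonneg[OF sum] in auto)
qed

lemma step_full:
  assumes D: "D t \<in> borel_measurable P" "lagv D (t - 1) \<in> borel_measurable (F (t - 1))"
    and H: "(\<lambda>(e, \<omega>). H e \<omega>) \<in> borel_measurable (borel \<Otimes>\<^sub>M F (t - 1))"
    and eq: "AE \<omega> in P. D t \<omega> = H (\<epsilon> t \<omega>) \<omega>"
    and bound: "\<And>\<omega>. \<omega> \<in> space P \<Longrightarrow>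
      Lq_le \<mu> q (\<lambda>e. H e \<omega>) ((\<Sum>i\<in>UNIV. \<chi>v $ i * \<bar>lagv D (t - 1) \<omega> $ i\<bar>) + s \<omega>)"
    and s: "Lq_le P q s \<delta>"
    and v: "Lq_le P q (\<lambda>\<omega>. V (lagv D (t - 1) \<omega>)) v"
  shows "Lq_le P q (\<lambda>\<omega>. V (lagv D t \<omega>)) (lam * v + \<delta>)"
proof -
  have "space P \<in> sets (F (t - 1))"
    using sets.top[of "F (t - 1)"] by simp
  from step[OF D H eq bound this, unfolded Lq_le_indicator_space, OF _ s v] show ?thesis by simp
qed

end

section \<open>Stationary and time-varying solutions\<close>

lemma stationary_nn_integral:
  assumes "stationary P X" and X [measurable]: "\<And>t. X t \<in> borel_measurable P"
    and [measurable]: "\<Phi> \<in> borel_measurable (\<Pi>\<^sub>M t\<in>UNIV. borel)"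
  shows "(\<integral>\<^sup>+\<omega>. \<Phi> (\<lambda>t. X (t + h) \<omega>) \<partial>P) = (\<integral>\<^sup>+\<omega>. \<Phi> (\<lambda>t. X t \<omega>) \<partial>P)"
proof -
  have *: "(\<lambda>\<omega> t. X (t + k) \<omega>) \<in> measurable P (\<Pi>\<^sub>M t\<in>(UNIV :: int set). borel)" for k
    by (rule measurable_PiM_single') auto
  have "(\<integral>\<^sup>+\<omega>. \<Phi> (\<lambda>t. X (t + h) \<omega>) \<partial>P) = integral\<^sup>N (distr P (\<Pi>\<^sub>M t\<in>UNIV. borel) (\<lambda>\<omega> t. X (t + h) \<omega>)) \<Phi>"
    by (subst nn_integral_distr[OF *]) auto
  also have "distr P (\<Pi>\<^sub>M t\<in>UNIV. borel) (\<lambda>\<omega> t. X (t + h) \<omega>) = distr P (\<Pi>\<^sub>M t\<in>UNIV. borel) (\<lambda>\<omega> t. X t \<omega>)"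
    using assms(1) by (auto simp: stationary_def)
  also have "integral\<^sup>N \<dots> \<Phi> = (\<integral>\<^sup>+\<omega>. \<Phi> (\<lambda>t. X t \<omega>) \<partial>P)"
    using *[of 0] by (subst nn_integral_distr) auto
  finally show ?thesis .
qed

lemma lags_diff: "lags (\<lambda>t \<omega>. A t \<omega> - B t \<omega>) t \<omega> = lags A t \<omega> - lags B t \<omega>"
  by (simp add: vec_eq_iff lags_nth)

text \<open>The recursion restarted with zeros at time \<open>s\<close>, with parameter
  \<open>a t\<close> at time t. It is a function of the innovation path \<open>e\<close> and not of
  the sample point, so that its dependence on the values of \<open>e\<close> after \<open>s\<close>
  alone can be read off; this yields independent copies. Since lags are at least 1, the distance to
  \<open>s\<close> decreases in every call.\<close>

function restart :: "(real \<Rightarrow> real ^ 'p::{finite,linorder} \<Rightarrow> real \<Rightarrow> real) \<Rightarrow> (int \<Rightarrow> real) \<Rightarrow> int \<Rightarrow>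
    int \<Rightarrow> (int \<Rightarrow> real) \<Rightarrow> real" where
  "restart G a s t e = (if t \<le> s then 0 else G (e t) (\<chi> i. restart G a s (t - coord_no i) e) (a t))"
  by auto
termination
proof (relation "Wellfounded.measure (\<lambda>(G, a, s, t, e). nat (t - s))", simp)
  fix G :: "real \<Rightarrow> real ^ 'p::{finite,linorder} \<Rightarrow> real \<Rightarrow> real" and a :: "int \<Rightarrow> real" and s t :: int
    and e :: "int \<Rightarrow> real" and x :: 'p
  assume "\<not> t \<le> s"
  then show "((G, a, s, t - coord_no x, e), G, a, s, t, e) \<in> Wellfounded.measure (\<lambda>(G, a, s, t, e). nat (t - s))"
    using coord_no_ge_1[of x] by simp
qed

declare restart.simps [simp del]

lemma restart_initial: "t \<le> s \<Longrightarrow> restart G a s t e = 0"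
  by (simp add: restart.simps)

lemma restart_step: "s < t \<Longrightarrow> restart G a s t e = G (e t) (lags (restart G a s) (t - 1) e) (a t)"
  by (subst restart.simps) (simp add: lags_def)

context autoregression
begin

lemma q_nonneg: "0 \<le> q" and q_pos: "0 < q"
  using q_ge_1 by simp_all

text \<open>The parameter is attached to a single time, so that one notion serves stationary
  solutions (constant parameter), rows of the array (parameter \<open>t / n\<close>) and restarted
  copies.\<close>

definition solves :: "(int \<Rightarrow> 'w \<Rightarrow> real) \<Rightarrow> int \<Rightarrow> real \<Rightarrow> bool" where
  "solves X t u \<longleftrightarrow> u \<in> {0..1} \<and> (AE \<omega> in P. X t \<omega> = G (\<epsilon> t \<omega>) (lagv X (t - 1) \<omega>) u)"

definition adapted :: "int \<Rightarrow> (int \<Rightarrow> 'w \<Rightarrow> real) \<Rightarrow> bool" where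
  "adapted n X \<longleftrightarrow> (\<forall>t\<le>n. X t \<in> borel_measurable (F t))"

lemma adaptedD: "adapted n X \<Longrightarrow> t \<le> n \<Longrightarrow> X t \<in> borel_measurable (F t)"
  by (simp add: adapted_def)

lemma adapted_mono: "adapted n X \<Longrightarrow> m \<le> n \<Longrightarrow> adapted m X"
  by (simp add: adapted_def)

lemma adapted_measurable: "adapted n X \<Longrightarrow> t \<le> n \<Longrightarrow> X t \<in> borel_measurable P"
  using adaptedD past_measurable by blast

lemma adapted_lags: "adapted n X \<Longrightarrow> t \<le> n \<Longrightarrow> lagv X t \<in> borel_measurable (F t)"
  by (rule lags_measurable_past) (simp add: adapted_def)

lemma adapted_lags_measurable: "adapted n X \<Longrightarrow> t \<le> n \<Longrightarrow> lagv X t \<in> borel_measurable P"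
  using adapted_lags past_measurable by blast

lemma adapted_diff: "adapted n A \<Longrightarrow> adapted n B \<Longrightarrow> adapted n (\<lambda>t \<omega>. A t \<omega> - B t \<omega>)"
  by (auto simp: adapted_def intro: borel_measurable_diff)

lemma G_measurable2:
  assumes "u \<in> {0..1}" "f \<in> borel_measurable N" "g \<in> borel_measurable N"
  shows "(\<lambda>x. G (f x) (g x) u) \<in> borel_measurable N"
proof -
  have "(\<lambda>x. (f x, g x)) \<in> measurable N (borel \<Otimes>\<^sub>M borel)" using assms by measurable
  from measurable_compose[OF this G_measurable[OF assms(1)]] show ?thesis by simp
qed

lemma G_past_measurable:
  assumes "u \<in> {0..1}" "Y \<in> borel_measurable (F t)"
  shows "(\<lambda>(e, \<omega>). G e (Y \<omega>) u) \<in> borel_measurable (borel \<Otimes>\<^sub>M F t)"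
proof -
  have "(\<lambda>x. G (fst x) (Y (snd x)) u) \<in> borel_measurable (borel \<Otimes>\<^sub>M F t)"
    by (rule G_measurable2[OF assms(1)]) (use assms(2) in measurable)
  then show ?thesis by (simp add: case_prod_unfold)
qed

lemma growth_step:
  assumes X: "adapted t X" and eq: "solves X t u" and A: "A \<in> sets (F (t - 1))"
    and v: "Lq_le P q (\<lambda>\<omega>. indicator A \<omega> * V (lagv X (t - 1) \<omega>)) v"
  shows "Lq_le P q (\<lambda>\<omega>. indicator A \<omega> * V (lagv X t \<omega>)) (lam * v + C0)"
proof (rule step[where H = "\<lambda>e \<omega>. G e (lagv X (t - 1) \<omega>) u" and s = "\<lambda>_. C0"])
  have u: "u \<in> {0..1}" using eq by (simp add: solves_def)
  have AP: "A \<in> sets P"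
    using subalgebra_past[of \<epsilon> P "t - 1"] A by (auto simp: subalgebra_def)
  show "X t \<in> borel_measurable P" by (rule adapted_measurable[OF X]) simp
  show L: "lagv X (t - 1) \<in> borel_measurable (F (t - 1))" by (rule adapted_lags[OF X]) simp
  show "(\<lambda>(e, \<omega>). G e (lagv X (t - 1) \<omega>) u) \<in> borel_measurable (borel \<Otimes>\<^sub>M F (t - 1))"
    by (rule G_past_measurable[OF u L])
  show "AE \<omega> in P. X t \<omega> = G (\<epsilon> t \<omega>) (lagv X (t - 1) \<omega>) u"
    using eq by (simp add: solves_def)
  show "Lq_le \<mu> q (\<lambda>e. G e (lagv X (t - 1) \<omega>) u)
      ((\<Sum>i\<in>UNIV. \<chi>v $ i * \<bar>lagv X (t - 1) \<omega> $ i\<bar>) + C0)" for \<omega>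
    by (rule G_growth[OF u])
  show "Lq_le P q (\<lambda>\<omega>. indicator A \<omega> * C0) C0"
    by (rule Lq_le_mono[of P q "\<lambda>_. C0"])
      (use Lq_le_const[of P q C0] C0_nonneg q_ge_1 AP prob_space_axioms in \<open>auto split: split_indicator\<close>)
qed (use A v in auto)

text \<open>The fixed point of the growth recursion \<open>v \<mapsto> lam * v + C0\<close>, as
  \<open>1 - lam = gap\<close>.\<close>

definition mom :: real where "mom = C0 / gap"

lemma mom_nonneg: "0 \<le> mom"
  using C0_nonneg gap_pos by (simp add: mom_def)

lemma mom_fixed: "lam * mom + C0 = mom"
  using gap_pos by (simp add: mom_def lam_def field_simps)

text \<open>The event on the initial lags belongs to every later past, so \<open>growth_step\<close>
  can be repeated, starting from the bound \<open>R\<close>, which is forgotten at the rate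
  \<open>lam\<close>.\<close>

lemma truncated_growth:
  assumes X: "\<And>n. adapted n X" and eq: "\<And>t. solves X t u"
    and A: "A = {\<omega> \<in> space P. V (lagv X 0 \<omega>) \<le> R}" and R: "0 \<le> R"
  shows "Lq_le P q (\<lambda>\<omega>. indicator A \<omega> * V (lagv X (int k) \<omega>)) (lam ^ k * R + mom)"
proof (induction k)
  case 0
  have [measurable]: "lagv X 0 \<in> borel_measurable P" by (rule adapted_lags_measurable[OF X, of _ 0]) simp
  have "Lq_le P q (\<lambda>\<omega>. indicator A \<omega> * V (lagv X 0 \<omega>)) R"
    unfolding A by (rule Lq_le_mono[of P q "\<lambda>_. R"])
      (use Lq_le_const[of P q R] R q_ge_1 prob_space_axioms V_nonneg in \<open>auto split: split_indicator\<close>)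
  then show ?case using Lq_le_weaken[of P q _ R "R + mom"] mom_nonneg q_ge_1 by simp
next
  case (Suc k)
  have "A \<in> sets (F 0)"
  proof -
    have "lagv X 0 \<in> borel_measurable (F 0)" by (rule adapted_lags[OF X, of _ 0]) simp
    then have "{\<omega> \<in> space (F 0). V (lagv X 0 \<omega>) \<le> R} \<in> sets (F 0)" by measurable
    then show ?thesis by (simp add: A)
  qed
  then have "A \<in> sets (F (int (Suc k) - 1))"
    using subalgebra_past_mono[of 0 "int k" P \<epsilon>] by (auto simp: subalgebra_def)
  from growth_step[OF X eq this, of "lam ^ k * R + mom"] Suc.IH
  have "Lq_le P q (\<lambda>\<omega>. indicator A \<omega> * V (lagv X (int (Suc k)) \<omega>)) (lam * (lam ^ k * R + mom) + C0)"
    by simp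
  moreover have "lam * (lam ^ k * R + mom) + C0 = lam ^ Suc k * R + mom"
    using mom_fixed by (simp add: algebra_simps)
  ultimately show ?case by simp
qed

lemma stationary_solution_adapted: "stationary_solution P \<epsilon> G u X \<Longrightarrow> adapted n X"
  by (simp add: stationary_solution_def adapted_def)

lemma stationary_solution_solves: "stationary_solution P \<epsilon> G u X \<Longrightarrow> u \<in> {0..1} \<Longrightarrow> solves X t u"
  by (simp add: stationary_solution_def solves_def)

lemma stationary_solution_nn_integral:
  assumes sol: "stationary_solution P \<epsilon> G u X"
    and \<Phi>: "\<Phi> \<in> borel_measurable (\<Pi>\<^sub>M t\<in>UNIV. borel)"
  shows "(\<integral>\<^sup>+\<omega>. \<Phi> (\<lambda>t. X (t + h) \<omega>) \<partial>P) = (\<integral>\<^sup>+\<omega>. \<Phi> (\<lambda>t. X t \<omega>) \<partial>P)"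
  using assms adapted_measurable[OF stationary_solution_adapted[OF sol] order_refl]
  by (intro stationary_nn_integral) (auto simp: stationary_solution_def)

text \<open>The solution is not assumed to have moments. On the event that its initial lags are bounded, the
  contraction bounds its moments at large times by \<open>mom\<close>; stationarity carries the bound back.\<close>

lemma stationary_moment:
  assumes sol: "stationary_solution P \<epsilon> G u X" and u: "u \<in> {0..1}"
  shows "Lq_le P q (X t) mom"
proof (rule Lq_leI)
  have adap: "adapted n X" for n by (rule stationary_solution_adapted[OF sol])
  have eq: "solves X t u" for t by (rule stationary_solution_solves[OF sol u])
  have X [measurable]: "X s \<in> borel_measurable P" for s by (rule adapted_measurable[OF adap order_refl])
  have [measurable]: "lagv X s \<in> borel_measurable P" for s by (rule adapted_lags_measurable[OF adap order_refl])
  have shift: "(\<integral>\<^sup>+\<omega>. f (X s \<omega>) \<partial>P) = (\<integral>\<^sup>+\<omega>. f (X t \<omega>) \<partial>P)" if "f \<in> borel_measurable borel" for f :: "real \<Rightarrow> ennreal" and s t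
    using that stationary_solution_nn_integral[OF sol, of "\<lambda>x. f (x 0)" s]
      stationary_solution_nn_integral[OF sol, of "\<lambda>x. f (x 0)" t] by simp
  define A where "A R = {\<omega> \<in> space P. V (lagv X 0 \<omega>) \<le> real R}" for R :: nat
  have [measurable]: "A R \<in> sets P" for R unfolding A_def by measurable
  \<comment> \<open>Truncation at \<open>N\<close> limits the contribution of the complement of
    \<open>A R\<close> to \<open>N\<close> times its probability. The order of the limits matters:
    stationarity moves the truncated moment to time k, which tends to infinity for fixed
    \<open>R\<close>; then \<open>R\<close> grows; the truncation at \<open>N\<close> is removed
    last, by monotone convergence.\<close>
  have trunc: "(\<integral>\<^sup>+\<omega>. min (ennreal (\<bar>X t \<omega>\<bar> powr q)) (ennreal (real N)) \<partial>P) \<le> ennreal (mom powr q)" for N :: nat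
  proof -
    let ?m = "\<lambda>\<omega> s. min (ennreal (\<bar>X s \<omega>\<bar> powr q)) (ennreal (real N))"
    have *: "(\<integral>\<^sup>+\<omega>. ?m \<omega> t \<partial>P) \<le> ennreal ((lam ^ k * real R + mom) powr q + real N * prob (space P - A R))" for k R
    proof -
      have "(\<integral>\<^sup>+\<omega>. ?m \<omega> t \<partial>P) = (\<integral>\<^sup>+\<omega>. ?m \<omega> (int k) \<partial>P)"
        by (rule shift) measurable
      also have "\<dots> \<le> (\<integral>\<^sup>+\<omega>. ennreal (\<bar>indicator (A R) \<omega> * V (lagv X (int k) \<omega>)\<bar> powr q)
          + ennreal (real N) * indicator (space P - A R) \<omega> \<partial>P)"
      proof (rule nn_integral_mono)
        fix \<omega> assume "\<omega> \<in> space P"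
        have "\<bar>X (int k) \<omega>\<bar> powr q \<le> \<bar>V (lagv X (int k) \<omega>)\<bar> powr q"
          using abs_le_V_lags[of X "int k" \<omega>] q_ge_1 by (intro powr_mono2) auto
        then show "?m \<omega> (int k) \<le> ennreal (\<bar>indicator (A R) \<omega> * V (lagv X (int k) \<omega>)\<bar> powr q)
          + ennreal (real N) * indicator (space P - A R) \<omega>"
          using \<open>\<omega> \<in> space P\<close> by (auto split: split_indicator simp: min_le_iff_disj intro!: ennreal_leI)
      qed
      also have "\<dots> = (\<integral>\<^sup>+\<omega>. ennreal (\<bar>indicator (A R) \<omega> * V (lagv X (int k) \<omega>)\<bar> powr q) \<partial>P)
          + ennreal (real N) * emeasure P (space P - A R)"
        by (subst nn_integral_add) (auto simp: nn_integral_cmult)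
      also have "\<dots> \<le> ennreal ((lam ^ k * real R + mom) powr q) + ennreal (real N) * emeasure P (space P - A R)"
        by (intro add_mono order_refl Lq_le_nn_integral truncated_growth[OF adap eq A_def]) simp
      also have "\<dots> = ennreal ((lam ^ k * real R + mom) powr q + real N * prob (space P - A R))"
        by (simp add: emeasure_eq_measure ennreal_mult ennreal_plus)
      finally show ?thesis .
    qed
    have "(\<lambda>k. ennreal ((lam ^ k * real R + mom) powr q + real N * prob (space P - A R)))
        \<longlonglongrightarrow> ennreal ((0 * real R + mom) powr q + real N * prob (space P - A R))" for R
      using q_ge_1 lam_nonneg lam_less_1 mom_nonneg
      by (intro tendsto_ennrealI tendsto_intros tendsto_powr2 LIMSEQ_power_zero) (auto intro!: always_eventually)
    then have **: "(\<integral>\<^sup>+\<omega>. ?m \<omega> t \<partial>P) \<le> ennreal ((0 * real R + mom) powr q + real N * prob (space P - A R))" for R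
      by (rule LIMSEQ_le_const) (use * in auto)
    have "(\<lambda>R. prob (space P - A R)) \<longlonglongrightarrow> prob (\<Inter>R. space P - A R)"
      by (rule finite_Lim_measure_decseq) (auto simp: decseq_def A_def)
    also have "(\<Inter>R. space P - A R) = {}"
      using real_arch_simple by (fastforce simp: A_def)
    finally have lim: "(\<lambda>R. prob (space P - A R)) \<longlonglongrightarrow> 0" by simp
    have "(\<lambda>R. ennreal (mom powr q + real N * prob (space P - A R))) \<longlonglongrightarrow> ennreal (mom powr q + real N * 0)"
      by (intro tendsto_ennrealI tendsto_intros lim)
    then have "(\<integral>\<^sup>+\<omega>. ?m \<omega> t \<partial>P) \<le> ennreal (mom powr q + real N * 0)"
      by (rule LIMSEQ_le_const) (use ** in auto)
    then show ?thesis by simp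
  qed
  have "(SUP N::nat. min (ennreal (\<bar>X t \<omega>\<bar> powr q)) (ennreal (real N))) = ennreal (\<bar>X t \<omega>\<bar> powr q)" for \<omega>
  proof -
    obtain N :: nat where N: "\<bar>X t \<omega>\<bar> powr q \<le> real N" using real_arch_simple by blast
    then show ?thesis
      by (intro antisym SUP_least SUP_upper2[of N]) (auto intro: ennreal_leI simp: min_absorb1)
  qed
  then have "(\<integral>\<^sup>+\<omega>. ennreal (\<bar>X t \<omega>\<bar> powr q) \<partial>P)
      = (\<integral>\<^sup>+\<omega>. (SUP N::nat. min (ennreal (\<bar>X t \<omega>\<bar> powr q)) (ennreal (real N))) \<partial>P)" by simp
  also have "\<dots> = (SUP N::nat. \<integral>\<^sup>+\<omega>. min (ennreal (\<bar>X t \<omega>\<bar> powr q)) (ennreal (real N)) \<partial>P)"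
    by (rule nn_integral_monotone_convergence_SUP)
      (auto simp: incseq_def le_fun_def intro: min.coboundedI2 ennreal_leI)
  also have "\<dots> \<le> ennreal (mom powr q)" by (rule SUP_least) (rule trunc)
  finally show "(\<integral>\<^sup>+\<omega>. ennreal (\<bar>X t \<omega>\<bar> powr q) \<partial>P) \<le> ennreal (mom powr q)" .
  show "X t \<in> borel_measurable P" by simp
qed (rule mom_nonneg)

text \<open>The weights are at most 1, so \<open>V\<close> is at most the sum of p absolute values,
  each of norm at most \<open>mom\<close>.\<close>

definition vbar :: real where "vbar = CARD('p) * mom"

lemma vbar_nonneg: "0 \<le> vbar"
  using mom_nonneg by (simp add: vbar_def)

lemma V_moment:
  assumes "\<And>s. s \<le> t \<Longrightarrow> Lq_le P q (X s) mom"
  shows "Lq_le P q (\<lambda>\<omega>. V (lagv X t \<omega>)) vbar"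
proof -
  have le: "t + 1 - coord_no i \<le> t" for i :: 'p using coord_no_ge_1[of i] by simp
  have [measurable]: "X s \<in> borel_measurable P" if "s \<le> t" for s
    using assms[OF that] by (rule Lq_le_measurable)
  have [measurable]: "lagv X t \<in> borel_measurable P" by (rule lags_measurable) simp
  have "Lq_le P q (\<lambda>\<omega>. \<Sum>i\<in>(UNIV :: 'p set). \<bar>X (t + 1 - coord_no i) \<omega>\<bar>) (\<Sum>i\<in>(UNIV :: 'p set). mom)"
  proof (rule Lq_le_sum)
    fix i :: 'p
    have "Lq_le P q (X (t + 1 - coord_no i)) mom" by (rule assms[OF le])
    then show "Lq_le P q (\<lambda>\<omega>. \<bar>X (t + 1 - coord_no i) \<omega>\<bar>) mom"
      unfolding Lq_le_def by auto
  qed (use q_ge_1 in auto)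
  then have "Lq_le P q (\<lambda>\<omega>. \<Sum>i\<in>(UNIV :: 'p set). \<bar>X (t + 1 - coord_no i) \<omega>\<bar>) vbar"
    by (simp add: vbar_def)
  then show ?thesis
  proof (rule Lq_le_mono)
    fix \<omega>
    show "\<bar>V (lagv X t \<omega>)\<bar> \<le> \<bar>\<Sum>i\<in>(UNIV :: 'p set). \<bar>X (t + 1 - coord_no i) \<omega>\<bar>\<bar>"
      using V_le_l1_norm[of "lagv X t \<omega>"] V_nonneg by (simp add: l1_norm_def lags_nth)
  qed (use q_ge_1 in auto)
qed

lemma growth_step_full:
  assumes "adapted t X" "solves X t u" "Lq_le P q (\<lambda>\<omega>. V (lagv X (t - 1) \<omega>)) v"
  shows "Lq_le P q (\<lambda>\<omega>. V (lagv X t \<omega>)) (lam * v + C0)"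
proof -
  have "space P \<in> sets (F (t - 1))" using sets.top[of "F (t - 1)"] by simp
  from growth_step[OF assms(1,2) this, unfolded Lq_le_indicator_space, OF assms(3)] show ?thesis .
qed

lemma tv_solution_adapted: "tv_solution P \<epsilon> G X0 n X \<Longrightarrow> adapted (int n) X"
  by (simp add: tv_solution_def adapted_def)

lemma rescaled_time_in_unit: "t \<le> int n \<Longrightarrow> max (real_of_int t / real n) 0 \<in> {0..1}"
  by (cases "n = 0") (auto simp: field_simps)

lemma tv_solution_solves:
  "tv_solution P \<epsilon> G X0 n X \<Longrightarrow> t \<le> int n \<Longrightarrow> solves X t (max (real_of_int t / real n) 0)"
  using rescaled_time_in_unit[of t n] by (simp add: tv_solution_def solves_def)

text \<open>Up to time 0 the row agrees with the stationary solution. From there on the growth step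
  preserves \<open>vbar\<close>, which is at least the fixed point \<open>mom\<close> because p is
  at least 1.\<close>

lemma tv_moment:
  assumes tv: "tv_solution P \<epsilon> G X0 n X" and X0: "stationary_solution P \<epsilon> G 0 X0" and t: "t \<le> int n"
  shows "Lq_le P q (\<lambda>\<omega>. V (lagv X t \<omega>)) vbar"
proof -
  have init: "Lq_le P q (\<lambda>\<omega>. V (lagv X s \<omega>)) vbar" if "s \<le> 0" for s
  proof (rule V_moment)
    fix r assume "r \<le> s"
    show "Lq_le P q (X r) mom"
    proof (rule Lq_le_mono_AE[OF stationary_moment[OF X0, of r]])
      have "AE \<omega> in P. X r \<omega> = X0 r \<omega>"
        using tv that \<open>r \<le> s\<close> by (simp add: tv_solution_def)
      then show "AE \<omega> in P. \<bar>X r \<omega>\<bar> \<le> \<bar>X0 r \<omega>\<bar>" by (auto elim!: eventually_mono)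
      show "X r \<in> borel_measurable P"
        using that \<open>r \<le> s\<close> by (intro adapted_measurable[OF tv_solution_adapted[OF tv]]) simp
    qed (use q_ge_1 in auto)
  qed
  have "Lq_le P q (\<lambda>\<omega>. V (lagv X (int k) \<omega>)) vbar" if "k \<le> n" for k
    using that
  proof (induction k)
    case 0
    show ?case using init[of 0] by simp
  next
    case (Suc k)
    have "Lq_le P q (\<lambda>\<omega>. V (lagv X (int (Suc k)) \<omega>)) (lam * vbar + C0)"
      by (rule growth_step_full[OF adapted_mono[OF tv_solution_adapted[OF tv]] tv_solution_solves[OF tv]])
        (use Suc in auto)
    moreover have "lam * vbar + C0 \<le> vbar"
    proof -
      have "1 * ((1 - lam) * mom) \<le> real CARD('p) * ((1 - lam) * mom)"
        using mom_nonneg lam_less_1 by (intro mult_right_mono) (auto simp: Suc_leI)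
      moreover have "C0 = (1 - lam) * mom" using mom_fixed by (simp add: algebra_simps)
      ultimately show ?thesis by (simp add: vbar_def algebra_simps)
    qed
    ultimately show ?case using q_nonneg by (rule Lq_le_weaken)
  qed
  from this[of "nat t"] init[of t] t show ?thesis by (cases "t \<le> 0") auto
qed

text \<open>Insert the recursion with the lags of \<open>B\<close> and the parameter
  \<open>a\<close>: one difference is governed by the Lipschitz condition, the other by
  \<open>s\<close>. The change of parameter is thus evaluated along \<open>B\<close>, which is a
  stationary solution whenever the parameters differ.\<close>

lemma contraction_step:
  assumes A: "adapted t A" "solves A t a" and B: "adapted t B" "solves B t b"
    and s: "\<And>\<omega>. \<omega> \<in> space P \<Longrightarrow>
      Lq_le \<mu> q (\<lambda>e. G e (lagv B (t - 1) \<omega>) a - G e (lagv B (t - 1) \<omega>) b) (s \<omega>)"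
    and \<delta>: "Lq_le P q s \<delta>"
    and d: "Lq_le P q (\<lambda>\<omega>. V (lagv (\<lambda>t \<omega>. A t \<omega> - B t \<omega>) (t - 1) \<omega>)) d"
  shows "Lq_le P q (\<lambda>\<omega>. V (lagv (\<lambda>t \<omega>. A t \<omega> - B t \<omega>) t \<omega>)) (lam * d + \<delta>)"
proof (rule step_full[where H = "\<lambda>e \<omega>. G e (lagv A (t - 1) \<omega>) a - G e (lagv B (t - 1) \<omega>) b"])
  have ab: "a \<in> {0..1}" "b \<in> {0..1}" using A(2) B(2) by (auto simp: solves_def)
  let ?D = "\<lambda>t \<omega>. A t \<omega> - B t \<omega>"
  have D: "adapted t ?D" by (rule adapted_diff[OF A(1) B(1)])
  show "?D t \<in> borel_measurable P" by (rule adapted_measurable[OF D order_refl])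
  show "lagv ?D (t - 1) \<in> borel_measurable (F (t - 1))" by (rule adapted_lags[OF D]) simp
  have [measurable]: "(\<lambda>x. G (fst x) (lagv A (t - 1) (snd x)) a) \<in> borel_measurable (borel \<Otimes>\<^sub>M F (t - 1))"
      "(\<lambda>x. G (fst x) (lagv B (t - 1) (snd x)) b) \<in> borel_measurable (borel \<Otimes>\<^sub>M F (t - 1))"
    using G_past_measurable[OF ab(1) adapted_lags[OF A(1), of "t - 1"]]
      G_past_measurable[OF ab(2) adapted_lags[OF B(1), of "t - 1"]] by (simp_all add: case_prod_unfold)
  show "(\<lambda>(e, \<omega>). G e (lagv A (t - 1) \<omega>) a - G e (lagv B (t - 1) \<omega>) b) \<in> borel_measurable (borel \<Otimes>\<^sub>M F (t - 1))"
    unfolding case_prod_unfold by measurable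
  show "AE \<omega> in P. ?D t \<omega> = G (\<epsilon> t \<omega>) (lagv A (t - 1) \<omega>) a - G (\<epsilon> t \<omega>) (lagv B (t - 1) \<omega>) b"
    using A(2) B(2) unfolding solves_def by (auto elim!: eventually_elim2)
  fix \<omega> assume \<omega>: "\<omega> \<in> space P"
  show "Lq_le \<mu> q (\<lambda>e. G e (lagv A (t - 1) \<omega>) a - G e (lagv B (t - 1) \<omega>) b)
      ((\<Sum>i\<in>UNIV. \<chi>v $ i * \<bar>lagv ?D (t - 1) \<omega> $ i\<bar>) + s \<omega>)"
    using Lq_le_add[OF G_lipschitz[OF ab(1), of "lagv A (t - 1) \<omega>" "lagv B (t - 1) \<omega>"] s[OF \<omega>] q_ge_1]
    by (simp add: lags_diff)
qed (use \<delta> d in auto)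

text \<open>The sources accumulate to the geometric series \<open>\<delta> / gap\<close>, while the
  initial distance is multiplied by \<open>lam\<close> in each step.\<close>

lemma contraction_iterate:
  assumes A: "adapted t A" and B: "adapted t B"
    and sol: "\<And>\<tau>. t - int m < \<tau> \<Longrightarrow> \<tau> \<le> t \<Longrightarrow> solves A \<tau> (a \<tau>) \<and> solves B \<tau> (b \<tau>)"
    and s: "\<And>\<tau> \<omega>. t - int m < \<tau> \<Longrightarrow> \<tau> \<le> t \<Longrightarrow> \<omega> \<in> space P \<Longrightarrow>
      Lq_le \<mu> q (\<lambda>e. G e (lagv B (\<tau> - 1) \<omega>) (a \<tau>) - G e (lagv B (\<tau> - 1) \<omega>) (b \<tau>)) (s \<tau> \<omega>)"
    and \<delta>: "\<And>\<tau>. t - int m < \<tau> \<Longrightarrow> \<tau> \<le> t \<Longrightarrow> Lq_le P q (s \<tau>) \<delta>"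
    and d: "Lq_le P q (\<lambda>\<omega>. V (lagv (\<lambda>t \<omega>. A t \<omega> - B t \<omega>) (t - int m) \<omega>)) d" and "0 \<le> \<delta>"
  shows "Lq_le P q (\<lambda>\<omega>. V (lagv (\<lambda>t \<omega>. A t \<omega> - B t \<omega>) t \<omega>)) (lam ^ m * d + \<delta> / gap)"
proof -
  let ?D = "\<lambda>t \<omega>. A t \<omega> - B t \<omega>"
  have "Lq_le P q (\<lambda>\<omega>. V (lagv ?D (t - int m + int k) \<omega>)) (lam ^ k * d + \<delta> / gap)" if "k \<le> m" for k
    using that
  proof (induction k)
    case 0
    then show ?case using d Lq_le_weaken[OF d, of "d + \<delta> / gap"] \<open>0 \<le> \<delta>\<close> gap_pos q_ge_1 by simp
  next
    case (Suc k)
    let ?t = "t - int m + int (Suc k)"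
    have t: "t - int m < ?t" "?t \<le> t" using Suc.prems by auto
    have "Lq_le P q (\<lambda>\<omega>. V (lagv ?D ?t \<omega>)) (lam * (lam ^ k * d + \<delta> / gap) + \<delta>)"
      by (rule contraction_step[OF adapted_mono[OF A t(2)] sol[OF t, THEN conjunct1]
          adapted_mono[OF B t(2)] sol[OF t, THEN conjunct2] s[OF t] \<delta>[OF t]]) (use Suc in \<open>auto simp: algebra_simps\<close>)
    moreover have "lam * (lam ^ k * d + \<delta> / gap) + \<delta> = lam ^ Suc k * d + \<delta> / gap"
      using gap_pos by (simp add: lam_def field_simps)
    ultimately show ?case by simp
  qed
  from this[of m] show ?thesis by simp
qed

section \<open>Restarted copies\<close>

lemma restart_measurable:
  assumes "\<And>\<tau>. s < \<tau> \<Longrightarrow> \<tau> \<le> t \<Longrightarrow> (\<lambda>x. E x \<tau>) \<in> borel_measurable N"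
    and "\<And>\<tau>. s < \<tau> \<Longrightarrow> \<tau> \<le> t \<Longrightarrow> a \<tau> \<in> {0..1}"
  shows "(\<lambda>x. restart G a s t (E x)) \<in> borel_measurable N"
  using assms
proof (induction "nat (t - s)" arbitrary: t rule: less_induct)
  case less
  show ?case
  proof (cases "t \<le> s")
    case True
    then show ?thesis by (simp add: restart_initial)
  next
    case False
    have "(\<lambda>x. lags (restart G a s) (t - 1) (E x) :: real ^ 'p::{finite,linorder}) \<in> borel_measurable N"
    proof (rule borel_measurable_vec)
      fix i :: 'p
      have "(\<lambda>x. restart G a s (t - coord_no i) (E x)) \<in> borel_measurable N"
        using False coord_no_ge_1[of i] by (intro less.hyps less.prems) auto
      then show "(\<lambda>x. lags (restart G a s) (t - 1) (E x) $ i) \<in> borel_measurable N"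
        by (simp add: lags_nth)
    qed
    then show ?thesis
      using False less.prems by (auto simp: restart_step intro!: G_measurable2)
  qed
qed

text \<open>The copy follows the same parameters, so \<open>contraction_iterate\<close> has source
  zero. At the restart time all its lags are zero; the initial difference is therefore
  \<open>X\<close> itself, whose moment is known.\<close>

lemma restart_close:
  assumes X: "adapted n X" and sol: "\<And>t. t \<le> n \<Longrightarrow> solves X t (a t)" and t: "t \<le> n"
    and v: "Lq_le P q (\<lambda>\<omega>. V (lagv X (t - int m) \<omega>)) v"
  shows "adapted n (\<lambda>\<tau> \<omega>. restart G a (t - int m) \<tau> (\<lambda>i. \<epsilon> i \<omega>))" (is "adapted n ?R")
    and "Lq_le P q (\<lambda>\<omega>. V (lagv (\<lambda>\<tau> \<omega>. X \<tau> \<omega> - restart G a (t - int m) \<tau> (\<lambda>i. \<epsilon> i \<omega>)) t \<omega>)) (lam ^ m * v)"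
proof -
  have a: "a \<tau> \<in> {0..1}" if "\<tau> \<le> n" for \<tau> using sol[OF that] by (simp add: solves_def)
  show R: "adapted n ?R"
    unfolding adapted_def using a innov_measurable_past
    by (intro allI impI restart_measurable) auto
  have "Lq_le P q (\<lambda>\<omega>. V (lagv (\<lambda>t \<omega>. X t \<omega> - ?R t \<omega>) t \<omega>)) (lam ^ m * v + 0 / gap)"
  proof (rule contraction_iterate[where s = "\<lambda>_ _. 0"])
    fix \<tau> assume \<tau>: "t - int m < \<tau>" "\<tau> \<le> t"
    have "solves ?R \<tau> (a \<tau>)"
      using \<tau> t a[of \<tau>] by (simp add: solves_def restart_step lags_def)
    then show "solves X \<tau> (a \<tau>) \<and> solves ?R \<tau> (a \<tau>)"
      using \<tau> t sol[of \<tau>] by simp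
    show "Lq_le P q (\<lambda>_. 0) 0"
      using Lq_le_const[of P q 0] q_ge_1 prob_space_axioms by simp
    show "Lq_le \<mu> q (\<lambda>e. G e (lagv ?R (\<tau> - 1) \<omega>) (a \<tau>) - G e (lagv ?R (\<tau> - 1) \<omega>) (a \<tau>)) 0" for \<omega>
      using Lq_le_const[of \<mu> q 0] q_ge_1 prob_space_law by simp
  next
    have "lagv (\<lambda>t \<omega>. X t \<omega> - ?R t \<omega>) (t - int m) = lagv X (t - int m)"
    proof (intro ext, simp add: vec_eq_iff lags_nth, intro allI)
      fix \<omega> and i :: 'p
      show "restart G a (t - int m) (t - int m + 1 - coord_no i) (\<lambda>i. \<epsilon> i \<omega>) = 0"
        using coord_no_ge_1[of i] by (intro restart_initial) simp
    qed
    then show "Lq_le P q (\<lambda>\<omega>. V (lagv (\<lambda>t \<omega>. X t \<omega> - ?R t \<omega>) (t - int m) \<omega>)) v" using v by simp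
  qed (use X R t adapted_mono in auto)
  then show "Lq_le P q (\<lambda>\<omega>. V (lagv (\<lambda>\<tau> \<omega>. X \<tau> \<omega> - ?R \<tau> \<omega>) t \<omega>)) (lam ^ m * v)" by simp
qed

text \<open>\<open>holder_const\<close> is a supremum over uncountably many pairs of parameters, so
  its measurability in \<open>y\<close> is not at hand. For one pair, the conditional distance is
  real-valued and measurable and can serve as a source in the contraction.\<close>

definition param_dist :: "real \<Rightarrow> real \<Rightarrow> real ^ 'p::{finite,linorder} \<Rightarrow> real" where
  "param_dist a b y = enn2real (\<integral>\<^sup>+e. ennreal (\<bar>G e y a - G e y b\<bar> powr q) \<partial>\<mu>) powr (1 / q)"

lemma param_dist_nonneg: "0 \<le> param_dist a b y"
  by (simp add: param_dist_def)

lemma G_section_measurable: "u \<in> {0..1} \<Longrightarrow> (\<lambda>e. G e y u) \<in> borel_measurable borel"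
  by (rule G_measurable2) auto

text \<open>The growth bounds at \<open>a\<close> and \<open>b\<close> make the integral finite, so
  \<open>enn2real\<close> loses nothing.\<close>

lemma param_dist_integral:
  assumes ab: "a \<in> {0..1}" "b \<in> {0..1}"
  shows "(\<integral>\<^sup>+e. ennreal (\<bar>G e y a - G e y b\<bar> powr q) \<partial>\<mu>) = ennreal (param_dist a b y powr q)"
proof -
  let ?S = "(\<Sum>i\<in>UNIV. \<chi>v $ i * \<bar>y $ i\<bar>) + C0"
  have "Lq_le \<mu> q (\<lambda>e. G e y a + (-1) * G e y b) (?S + \<bar>-1\<bar> * ?S)"
    using q_ge_1 by (intro Lq_le_add Lq_le_cmult G_growth ab) auto
  then have "(\<integral>\<^sup>+e. ennreal (\<bar>G e y a - G e y b\<bar> powr q) \<partial>\<mu>) \<le> ennreal ((2 * ?S) powr q)"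
    using Lq_le_nn_integral[of \<mu> q "\<lambda>e. G e y a + (-1) * G e y b"] by simp
  then have "(\<integral>\<^sup>+e. ennreal (\<bar>G e y a - G e y b\<bar> powr q) \<partial>\<mu>) < \<top>"
    by (rule order.strict_trans1) simp
  then show ?thesis
    unfolding param_dist_def using q_ge_1 by (simp add: powr_powr)
qed

lemma Lq_le_param_dist:
  assumes "a \<in> {0..1}" "b \<in> {0..1}"
  shows "Lq_le \<mu> q (\<lambda>e. G e y a - G e y b) (param_dist a b y)"
  using param_dist_integral[OF assms, of y] G_section_measurable[OF assms(1)] G_section_measurable[OF assms(2)]
  by (intro Lq_leI param_dist_nonneg) auto

lemma param_dist_measurable:
  assumes "a \<in> {0..1}" "b \<in> {0..1}"
  shows "param_dist a b \<in> borel_measurable borel"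
proof -
  interpret mu: prob_space \<mu> by (rule prob_space_law)
  have "(\<lambda>x. G (snd x) (fst x) u) \<in> borel_measurable (borel \<Otimes>\<^sub>M \<mu>)" if "u \<in> {0..1}" for u
    by (rule G_measurable2[OF that]) measurable
  from this[OF assms(1)] this[OF assms(2)]
  have [measurable]: "(\<lambda>(y, e). ennreal (\<bar>G e y a - G e y b\<bar> powr q)) \<in> borel_measurable (borel \<Otimes>\<^sub>M \<mu>)"
    by (simp add: case_prod_unfold)
  show ?thesis unfolding param_dist_def[abs_def] by measurable
qed

text \<open>Pointwise in \<open>y\<close>, \<open>param_dist\<close> divided by
  \<open>\<bar>a - b\<bar> powr \<alpha>\<close> is at most \<open>holder_const\<close>, and the
  monotonicity of the integral asks for no measurability of the larger function. The condition is
  stated at time 0; stationarity is applied to the measurable smaller function and carries the bound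
  to time t.\<close>

lemma Hoelder_param_dist:
  assumes L4: "L4_cond P \<epsilon> G Xt q"
    and sol: "\<And>u. u \<in> {0..1} \<Longrightarrow> stationary_solution P \<epsilon> G u (Xt u)"
  obtains \<alpha> C4 where "0 < \<alpha>" "0 \<le> C4"
    "\<And>u a b t. u \<in> {0..1} \<Longrightarrow> a \<in> {0..1} \<Longrightarrow> b \<in> {0..1} \<Longrightarrow>
      Lq_le P q (\<lambda>\<omega>. param_dist a b (lagv (Xt u) t \<omega>)) (C4 * \<bar>a - b\<bar> powr \<alpha>)"
proof -
  from L4 obtain \<alpha> where \<alpha>: "0 < \<alpha>"
    and fin: "(SUP u\<in>{0..1}. Lnorm P q (\<lambda>\<omega>. holder_const P \<epsilon> G q \<alpha> (lags (Xt u) 0 \<omega>))) < \<top>"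
    unfolding L4_cond_def by blast
  define C4 where "C4 = enn2real (SUP u\<in>{0..1}. Lnorm P q (\<lambda>\<omega>. holder_const P \<epsilon> G q \<alpha> (lags (Xt u) 0 \<omega>)))"
  have le: "Lnorm P q (\<lambda>\<omega>. holder_const P \<epsilon> G q \<alpha> (lags (Xt u) 0 \<omega>)) \<le> ennreal C4" if "u \<in> {0..1}" for u
    using that fin unfolding C4_def by (auto intro: SUP_upper)
  show thesis
  proof (rule that[OF \<alpha>, of C4])
    show "0 \<le> C4" by (simp add: C4_def)
    fix u a b :: real and t :: int assume u: "u \<in> {0..1}" and ab: "a \<in> {0..1}" "b \<in> {0..1}"
    note [measurable] = param_dist_measurable[OF ab]
    have [measurable]: "lagv (Xt u) s \<in> borel_measurable P" for s
      by (rule adapted_lags_measurable[OF stationary_solution_adapted[OF sol[OF u]] order_refl])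
    show "Lq_le P q (\<lambda>\<omega>. param_dist a b (lagv (Xt u) t \<omega>)) (C4 * \<bar>a - b\<bar> powr \<alpha>)"
    proof (cases "a = b")
      case True
      then show ?thesis
        using Lq_le_const[of P q 0] q_ge_1 prob_space_axioms by (simp add: param_dist_def)
    next
      case False
      define \<rho> where "\<rho> = \<bar>a - b\<bar> powr \<alpha>"
      have \<rho>: "\<rho> > 0" using False by (simp add: \<rho>_def)
      have pt: "ennreal (\<bar>1 / \<rho> * param_dist a b y\<bar> powr q) \<le> epow (holder_const P \<epsilon> G q \<alpha> y) q" for y
      proof -
        have "Lnorm_real P q (\<lambda>\<omega>. G (\<epsilon> 0 \<omega>) y a - G (\<epsilon> 0 \<omega>) y b)
            = epow (\<integral>\<^sup>+\<omega>. ennreal (\<bar>G (\<epsilon> 0 \<omega>) y a - G (\<epsilon> 0 \<omega>) y b\<bar> powr q) \<partial>P) (1 / q)"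
          by (simp add: Lnorm_def epow_ennreal)
        also have "(\<integral>\<^sup>+\<omega>. ennreal (\<bar>G (\<epsilon> 0 \<omega>) y a - G (\<epsilon> 0 \<omega>) y b\<bar> powr q) \<partial>P)
            = (\<integral>\<^sup>+e. ennreal (\<bar>G e y a - G e y b\<bar> powr q) \<partial>\<mu>)"
          using G_section_measurable[OF ab(1)] G_section_measurable[OF ab(2)]
          by (subst nn_integral_distr) auto
        also have "epow \<dots> (1 / q) = ennreal (param_dist a b y)"
          unfolding param_dist_integral[OF ab] using q_ge_1 param_dist_nonneg
          by (simp add: epow_ennreal powr_powr)
        finally have "ennreal (param_dist a b y) / ennreal \<rho> \<le> holder_const P \<epsilon> G q \<alpha> y"
          unfolding holder_const_def \<rho>_def using ab False
          by (intro SUP_upper2[of "(a, b)"]) auto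
        then have "ennreal (1 / \<rho> * param_dist a b y) \<le> holder_const P \<epsilon> G q \<alpha> y"
          using \<rho> param_dist_nonneg by (simp add: divide_ennreal)
        from epow_mono[OF this, of q] show ?thesis
          using q_ge_1 \<rho> param_dist_nonneg[of a b y] by (simp add: epow_ennreal)
      qed
      have "Lq_le P q (\<lambda>\<omega>. 1 / \<rho> * param_dist a b (lagv (Xt u) t \<omega>)) C4"
      proof (rule Lq_leI)
        have lags_eq: "lagv (Xt u) t \<omega> = (\<chi> i. Xt u (1 - coord_no i + t) \<omega>)" for t \<omega>
          by (simp add: lags_def algebra_simps)
        have [measurable]: "(\<lambda>x. \<chi> i. x (1 - coord_no (i :: 'p))) \<in> borel_measurable (\<Pi>\<^sub>M t\<in>(UNIV :: int set). (borel :: real measure))"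
          by (rule borel_measurable_vec) simp
        have "(\<integral>\<^sup>+\<omega>. ennreal (\<bar>1 / \<rho> * param_dist a b (lagv (Xt u) t \<omega>)\<bar> powr q) \<partial>P)
            = (\<integral>\<^sup>+\<omega>. ennreal (\<bar>1 / \<rho> * param_dist a b (lagv (Xt u) 0 \<omega>)\<bar> powr q) \<partial>P)"
          unfolding lags_eq
          using stationary_solution_nn_integral[OF sol[OF u],
            of "\<lambda>x. ennreal (\<bar>1 / \<rho> * param_dist a b (\<chi> i. x (1 - coord_no i))\<bar> powr q)" t]
          by simp
        also have "\<dots> \<le> (\<integral>\<^sup>+\<omega>. epow (holder_const P \<epsilon> G q \<alpha> (lags (Xt u) 0 \<omega>)) q \<partial>P)"
          by (rule nn_integral_mono) (rule pt)
        also have "\<dots> \<le> ennreal (C4 powr q)"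
          using q_ge_1 by (intro Lnorm_le_imp_nn_integral_le le[OF u]) (auto simp: C4_def)
        finally show "(\<integral>\<^sup>+\<omega>. ennreal (\<bar>1 / \<rho> * param_dist a b (lagv (Xt u) t \<omega>)\<bar> powr q) \<partial>P) \<le> ennreal (C4 powr q)" .
      qed (auto simp: C4_def)
      from Lq_le_cmult[OF this, of \<rho>] show ?thesis
        using \<rho> q_ge_1 by (simp add: \<rho>_def mult.commute)
    qed
  qed
qed

text \<open>During the last m steps the parameter stays within \<open>\<rho>\<close> of u, which
  bounds each source. Before that the two solutions may be unrelated; the triangle inequality then
  gives the initial distance \<open>2 * vbar\<close>.\<close>

lemma solution_close:
  assumes A: "adapted t A" and sol: "\<And>\<tau>. t - int m < \<tau> \<Longrightarrow> \<tau> \<le> t \<Longrightarrow> solves A \<tau> (a \<tau>)"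
    and near: "\<And>\<tau>. t - int m < \<tau> \<Longrightarrow> \<tau> \<le> t \<Longrightarrow> \<bar>a \<tau> - u\<bar> \<le> \<rho>" "0 \<le> \<rho>"
    and u: "u \<in> {0..1}" and B: "stationary_solution P \<epsilon> G u B"
    and H: "0 < \<alpha>" "0 \<le> C4" "\<And>a t. a \<in> {0..1} \<Longrightarrow>
      Lq_le P q (\<lambda>\<omega>. param_dist a u (lagv B t \<omega>)) (C4 * \<bar>a - u\<bar> powr \<alpha>)"
    and vA: "Lq_le P q (\<lambda>\<omega>. V (lagv A (t - int m) \<omega>)) vbar"
  shows "Lq_le P q (\<lambda>\<omega>. V (lagv (\<lambda>t \<omega>. A t \<omega> - B t \<omega>) t \<omega>)) (lam ^ m * (2 * vbar) + C4 * \<rho> powr \<alpha> / gap)"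
proof (rule contraction_iterate[where s = "\<lambda>\<tau> \<omega>. param_dist (a \<tau>) u (lagv B (\<tau> - 1) \<omega>)" and a = a and b = "\<lambda>_. u"])
  have aB: "adapted n B" for n by (rule stationary_solution_adapted[OF B])
  show "adapted t B" "adapted t A" using aB A by auto
  show "0 \<le> C4 * \<rho> powr \<alpha>" using H by simp
  fix \<tau> assume \<tau>: "t - int m < \<tau>" "\<tau> \<le> t"
  show "solves A \<tau> (a \<tau>) \<and> solves B \<tau> u"
    using sol[OF \<tau>] stationary_solution_solves[OF B u] by simp
  have a: "a \<tau> \<in> {0..1}" using sol[OF \<tau>] by (simp add: solves_def)
  show "Lq_le \<mu> q (\<lambda>e. G e (lagv B (\<tau> - 1) \<omega>) (a \<tau>) - G e (lagv B (\<tau> - 1) \<omega>) u) (param_dist (a \<tau>) u (lagv B (\<tau> - 1) \<omega>))" for \<omega>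
    by (rule Lq_le_param_dist[OF a u])
  have "C4 * \<bar>a \<tau> - u\<bar> powr \<alpha> \<le> C4 * \<rho> powr \<alpha>"
    using near(1)[OF \<tau>] H by (intro mult_left_mono powr_mono2) auto
  then show "Lq_le P q (\<lambda>\<omega>. param_dist (a \<tau>) u (lagv B (\<tau> - 1) \<omega>)) (C4 * \<rho> powr \<alpha>)"
    using Lq_le_weaken[OF H(3)[OF a] _ q_nonneg] by blast
next
  have aB: "adapted n B" for n by (rule stationary_solution_adapted[OF B])
  have "Lq_le P q (\<lambda>\<omega>. V (lagv B (t - int m) \<omega>)) vbar"
    by (rule V_moment) (rule stationary_moment[OF B u])
  from Lq_le_add[OF vA this q_ge_1]
  have sum: "Lq_le P q (\<lambda>\<omega>. V (lagv A (t - int m) \<omega>) + V (lagv B (t - int m) \<omega>)) (2 * vbar)" by simp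
  have "adapted (t - int m) (\<lambda>t \<omega>. A t \<omega> - B t \<omega>)"
    by (intro adapted_diff aB adapted_mono[OF A]) simp
  then have [measurable]: "lagv (\<lambda>t \<omega>. A t \<omega> - B t \<omega>) (t - int m) \<in> borel_measurable P"
    by (rule adapted_lags_measurable) simp
  show "Lq_le P q (\<lambda>\<omega>. V (lagv (\<lambda>t \<omega>. A t \<omega> - B t \<omega>) (t - int m) \<omega>)) (2 * vbar)"
  proof (rule Lq_le_mono[OF sum])
    show "(\<lambda>\<omega>. V (lagv (\<lambda>t \<omega>. A t \<omega> - B t \<omega>) (t - int m) \<omega>)) \<in> borel_measurable P" by measurable
    show "\<bar>V (lagv (\<lambda>t \<omega>. A t \<omega> - B t \<omega>) (t - int m) \<omega>)\<bar>
        \<le> \<bar>V (lagv A (t - int m) \<omega>) + V (lagv B (t - int m) \<omega>)\<bar>" for \<omega>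
      using V_diff_le V_nonneg by (simp add: lags_diff add_nonneg_nonneg)
  qed (rule q_nonneg)
qed

end

section \<open>Heavy tails over windows\<close>

lemma powr_mvt:
  fixes a x r :: real
  assumes "a > 0" "x > 0" "r \<ge> 1"
  obtains z where "a < z" "z < a + x" "(a + x) powr r - a powr r = x * (r * z powr (r - 1))"
proof -
  have "\<exists>z. a < z \<and> z < a + x \<and> (a + x) powr r - a powr r = (a + x - a) * (r * z powr (r - 1))"
    using assms by (intro MVT2) (auto intro!: derivative_eq_intros)
  then show thesis using that by auto
qed

lemma powr_ge_tangent:
  fixes a x r :: real
  assumes "a > 0" "x \<ge> 0" "r \<ge> 1"
  shows "a powr r + r * a powr (r - 1) * x \<le> (a + x) powr r"
proof (cases "x = 0")
  case False
  with assms have "x > 0" by simp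
  from powr_mvt[OF assms(1) this assms(3)] obtain z
    where z: "a < z" "(a + x) powr r - a powr r = x * (r * z powr (r - 1))" by metis
  have "x * (r * a powr (r - 1)) \<le> x * (r * z powr (r - 1))"
    using assms z by (intro mult_left_mono powr_mono2) auto
  then show ?thesis using z(2) by (simp add: algebra_simps)
qed simp

text \<open>The linear term keeps its coefficient up to \<open>1 + \<tau>\<close>; all further loss
  goes into \<open>y powr r\<close>. For \<open>y \<le> \<sigma> * a\<close> the mean value point is
  at most \<open>(1 + \<sigma>) * a\<close>; for larger y the whole sum is at most
  \<open>(1 / \<sigma> + 1) * y\<close>.\<close>

lemma powr_add_le:
  fixes r \<tau> :: real
  assumes r: "r \<ge> 1" and \<tau>: "\<tau> > 0"
  obtains C where "C \<ge> 1"
    "\<And>a y. a > 0 \<Longrightarrow> y \<ge> 0 \<Longrightarrow> (a + y) powr r \<le> a powr r + r * (1 + \<tau>) * a powr (r - 1) * y + C * y powr r"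
proof -
  \<comment> \<open>Chosen so that \<open>(1 + \<sigma>) powr r = 1 + \<tau>\<close>; the smaller
    power \<open>r - 1\<close> is then covered too.\<close>
  define \<sigma> where "\<sigma> = (1 + \<tau>) powr (1 / r) - 1"
  have \<sigma>: "\<sigma> > 0" using \<tau> r by (simp add: \<sigma>_def)
  have \<sigma>_le: "(1 + \<sigma>) powr (r - 1) \<le> 1 + \<tau>"
  proof -
    have "(1 + \<sigma>) powr (r - 1) \<le> (1 + \<sigma>) powr r" using \<sigma> by (intro powr_mono) auto
    also have "\<dots> = 1 + \<tau>" using \<tau> r by (simp add: \<sigma>_def powr_powr)
    finally show ?thesis .
  qed
  define C where "C = (1 / \<sigma> + 1) powr r"
  show thesis
  proof (rule that)
    show "C \<ge> 1" unfolding C_def using \<sigma> r by (intro ge_one_powr_ge_zero) auto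
    fix a y :: real assume a: "a > 0" and y: "y \<ge> 0"
    show "(a + y) powr r \<le> a powr r + r * (1 + \<tau>) * a powr (r - 1) * y + C * y powr r"
    proof (cases "y \<le> \<sigma> * a")
      case True
      have "(a + y) powr r \<le> a powr r + r * (1 + \<tau>) * a powr (r - 1) * y"
      proof (cases "y = 0")
        case False
        with y have "y > 0" by simp
        from powr_mvt[OF a this r] obtain z
          where z: "a < z" "z < a + y" "(a + y) powr r - a powr r = y * (r * z powr (r - 1))" by metis
        have "z powr (r - 1) \<le> ((1 + \<sigma>) * a) powr (r - 1)"
          using z a r True by (intro powr_mono2) (auto simp: algebra_simps)
        also have "\<dots> = (1 + \<sigma>) powr (r - 1) * a powr (r - 1)"
          using \<sigma> a by (simp add: powr_mult)
        also have "\<dots> \<le> (1 + \<tau>) * a powr (r - 1)"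
          by (intro mult_right_mono \<sigma>_le) simp
        finally have "y * (r * z powr (r - 1)) \<le> y * (r * ((1 + \<tau>) * a powr (r - 1)))"
          using y r by (intro mult_left_mono) auto
        then show ?thesis using z(3) by (simp add: algebra_simps)
      qed simp
      moreover have "0 \<le> C * y powr r" by (simp add: C_def)
      ultimately show ?thesis by linarith
    next
      case False
      have "(a + y) powr r \<le> ((1 / \<sigma> + 1) * y) powr r"
        using False a y \<sigma> r by (intro powr_mono2) (auto simp: field_simps)
      also have "\<dots> = C * y powr r" using \<sigma> y by (simp add: C_def powr_mult)
      finally show ?thesis
        using r \<tau> a y by (simp add: add_increasing)
    qed
  qed
qed

text \<open>The expansion is integrated term by term, and its linear part is folded back into a
  single power by \<open>powr_ge_tangent\<close>. The first term of the bound has the shape of the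
  integrand with \<open>y\<close> replaced by an inflated mean, so the estimate can be iterated and
  the remainders merely add up.\<close>

lemma nn_integral_positive_part_powr:
  fixes y :: "'a \<Rightarrow> real" and C r \<tau> \<kappa> B w1 w2 :: real
  assumes N: "prob_space N" and [measurable]: "y \<in> borel_measurable N" and y: "\<And>x. 0 \<le> y x"
    and r: "r \<ge> 1" and \<tau>: "\<tau> > 0" and C: "C \<ge> 1"
      "\<And>a y. a > 0 \<Longrightarrow> y \<ge> 0 \<Longrightarrow> (a + y) powr r \<le> a powr r + r * (1 + \<tau>) * a powr (r - 1) * y + C * y powr r"
    and w: "(\<integral>\<^sup>+x. ennreal (y x) \<partial>N) \<le> ennreal w1" "(\<integral>\<^sup>+x. ennreal (y x powr r) \<partial>N) \<le> ennreal w2"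
      "0 \<le> w1" "0 \<le> w2" and \<kappa>: "0 \<le> \<kappa>"
  shows "(\<integral>\<^sup>+x. ennreal (max (B + \<kappa> * y x) 0 powr r) \<partial>N)
    \<le> ennreal (max (B + (1 + \<tau>) * \<kappa> * w1) 0 powr r + C * \<kappa> powr r * w2)"
proof -
  interpret prob_space N by fact
  \<comment> \<open>For \<open>B\<close> at most 0 the positive part is already dominated by
    \<open>\<kappa> * y\<close>, so the first two coefficients are 0.\<close>
  define b where "b = (if B > 0 then B powr r else 0)"
  define b1 where "b1 = (if B > 0 then r * (1 + \<tau>) * B powr (r - 1) * \<kappa> else 0)"
  define b2 where "b2 = C * \<kappa> powr r"
  have nn: "0 \<le> b" "0 \<le> b1" "0 \<le> b2" using r \<tau> C \<kappa> by (auto simp: b_def b1_def b2_def)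
  have pt: "max (B + \<kappa> * y x) 0 powr r \<le> b + b1 * y x + b2 * y x powr r" for x
  proof (cases "B > 0")
    case True
    then have "max (B + \<kappa> * y x) 0 = B + \<kappa> * y x" using y[of x] \<kappa> by simp
    then show ?thesis
      using C(2)[OF True, of "\<kappa> * y x"] y[of x] \<kappa> True by (simp add: b_def b1_def b2_def powr_mult algebra_simps)
  next
    case False
    then have "max (B + \<kappa> * y x) 0 powr r \<le> (\<kappa> * y x) powr r"
      using r y[of x] \<kappa> by (intro powr_mono2) auto
    also have "\<dots> = 1 * (\<kappa> powr r * y x powr r)" using y[of x] \<kappa> by (simp add: powr_mult)
    also have "\<dots> \<le> C * (\<kappa> powr r * y x powr r)" using C(1) by (intro mult_right_mono) auto
    finally show ?thesis using False by (simp add: b_def b1_def b2_def algebra_simps)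
  qed
  have "(\<integral>\<^sup>+x. ennreal (max (B + \<kappa> * y x) 0 powr r) \<partial>N)
      \<le> (\<integral>\<^sup>+x. ennreal b + ennreal b1 * ennreal (y x) + ennreal b2 * ennreal (y x powr r) \<partial>N)"
  proof (rule nn_integral_mono)
    fix x
    have "ennreal (max (B + \<kappa> * y x) 0 powr r) \<le> ennreal (b + b1 * y x + b2 * y x powr r)"
      by (rule ennreal_leI[OF pt])
    then show "ennreal (max (B + \<kappa> * y x) 0 powr r) \<le> ennreal b + ennreal b1 * ennreal (y x) + ennreal b2 * ennreal (y x powr r)"
      using nn y[of x] by (simp add: ennreal_mult ennreal_plus)
  qed
  also have "\<dots> = ennreal b + ennreal b1 * (\<integral>\<^sup>+x. ennreal (y x) \<partial>N) + ennreal b2 * (\<integral>\<^sup>+x. ennreal (y x powr r) \<partial>N)"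
    by (simp add: nn_integral_add nn_integral_cmult emeasure_space_1)
  also have "\<dots> \<le> ennreal b + ennreal b1 * ennreal w1 + ennreal b2 * ennreal w2"
    by (intro add_mono mult_left_mono order_refl w) auto
  also have "\<dots> = ennreal (b + b1 * w1 + b2 * w2)"
    using nn w by (simp add: ennreal_mult ennreal_plus)
  also have "\<dots> \<le> ennreal (max (B + (1 + \<tau>) * \<kappa> * w1) 0 powr r + C * \<kappa> powr r * w2)"
  proof (rule ennreal_leI)
    have "b + b1 * w1 \<le> max (B + (1 + \<tau>) * \<kappa> * w1) 0 powr r"
    proof (cases "B > 0")
      case True
      have nn: "0 \<le> (1 + \<tau>) * \<kappa> * w1" using \<tau> \<kappa> w by simp
      have "b + b1 * w1 = B powr r + r * B powr (r - 1) * ((1 + \<tau>) * \<kappa> * w1)"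
        using True by (simp add: b_def b1_def)
      also have "\<dots> \<le> (B + (1 + \<tau>) * \<kappa> * w1) powr r" by (rule powr_ge_tangent[OF True nn r])
      finally show ?thesis using True nn by (simp add: max_def)
    qed (simp add: b_def b1_def)
    then show "b + b1 * w1 + b2 * w2 \<le> max (B + (1 + \<tau>) * \<kappa> * w1) 0 powr r + C * \<kappa> powr r * w2"
      by (simp add: b2_def)
  qed
  finally show ?thesis .
qed

text \<open>What is left of \<open>v powr s\<close> when a constant is removed, see
  \<open>powr_le_excess\<close>. The minimum carries two bounds used with different moments: the
  second branch gives a mean of order c, the first a moment of order \<open>q / s\<close>. It also
  passes on a contraction of \<open>v\<close>, see \<open>excess_scale\<close>.\<close>

definition excess :: "real \<Rightarrow> real \<Rightarrow> real \<Rightarrow> real \<Rightarrow> real" where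
  "excess s q c v = min (v powr s) (c * v powr q)"

lemma excess_nonneg: "0 \<le> c \<Longrightarrow> 0 \<le> excess s q c v"
  by (simp add: excess_def)

lemma excess_measurable [measurable]: "excess s q c \<in> borel_measurable borel"
  unfolding excess_def[abs_def] by measurable

lemma excess_mono: "0 \<le> v \<Longrightarrow> v \<le> w \<Longrightarrow> 0 \<le> s \<Longrightarrow> 0 \<le> q \<Longrightarrow> 0 \<le> c \<Longrightarrow> excess s q c v \<le> excess s q c w"
  unfolding excess_def by (intro min.mono mult_left_mono powr_mono2) auto

lemma excess_scale:
  assumes "0 \<le> l" "l \<le> 1" "1 \<le> s" "1 \<le> q" "0 \<le> c" "0 \<le> x"
  shows "excess s q c (l * x) \<le> l * excess s q c x"
proof -
  have l: "l powr a \<le> l" if "1 \<le> a" for a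
    using powr_mono'[of 1 a l] that assms by (cases "l = 0") auto
  have "l powr s * x powr s \<le> l * x powr s" "l powr q * (c * x powr q) \<le> l * (c * x powr q)"
    using assms by (auto intro!: mult_right_mono l)
  then show ?thesis
    using assms unfolding excess_def by (simp add: powr_mult min_mult_distrib_left algebra_simps min_def)
qed

context autoregression
begin

lemma excess_V_measurable:
  "Y \<in> borel_measurable N \<Longrightarrow> (\<lambda>\<omega>. excess s r c (V (Y \<omega>))) \<in> borel_measurable N"
  by measurable

text \<open>The midpoint between \<open>lam\<close> and 1. The additional factor absorbs the
  constant \<open>C0\<close> once the lags are large, and unlike \<open>lam\<close> it cannot be
  0.\<close>

definition lam1 :: real where "lam1 = (1 + lam) / 2"

lemma lam1_bounds: "lam < lam1" "lam1 < 1" "0 < lam1"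
  using lam_less_1 lam_nonneg by (simp_all add: lam1_def)

text \<open>The lines \<open>lam * x + C0\<close> and \<open>lam1 * x\<close> meet at
  \<open>x = C0 / (lam1 - lam)\<close>; the base of the power is their common value.\<close>

definition drift :: real where "drift = (lam1 * (C0 / (lam1 - lam))) powr q"

text \<open>Above the threshold, \<open>C0\<close> is absorbed into the factor \<open>lam1\<close>.
  Below it, \<open>lam * x + C0\<close> is bounded by a constant, and the branch with the factor c
  makes the contribution proportional to c.\<close>

lemma excess_drift:
  assumes s: "1 \<le> s" and c: "0 \<le> c" and x: "0 \<le> x"
  shows "excess s q c (lam * x + C0) \<le> lam1 * excess s q c x + c * drift"
proof (cases "C0 / (lam1 - lam) \<le> x")
  case True
  then have "C0 \<le> (lam1 - lam) * x"
    using lam1_bounds(1) by (simp add: divide_le_eq mult.commute)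
  then have "excess s q c (lam * x + C0) \<le> excess s q c (lam1 * x)"
    using lam_nonneg C0_nonneg x s c q_nonneg by (intro excess_mono) (auto simp: algebra_simps)
  also have "\<dots> \<le> lam1 * excess s q c x"
    using lam1_bounds s c x q_ge_1 by (intro excess_scale) auto
  also have "\<dots> \<le> lam1 * excess s q c x + c * drift" using c by (simp add: drift_def)
  finally show ?thesis .
next
  case False
  have "lam * x + C0 \<le> lam * (C0 / (lam1 - lam)) + C0"
    using False lam_nonneg by (intro add_right_mono mult_left_mono) auto
  also have "\<dots> = lam1 * (C0 / (lam1 - lam))" using lam1_bounds(1) by (simp add: field_simps)
  finally have le: "lam * x + C0 \<le> lam1 * (C0 / (lam1 - lam))" .
  have "excess s q c (lam * x + C0) \<le> c * (lam * x + C0) powr q" by (simp add: excess_def)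
  also have "\<dots> \<le> c * drift"
    unfolding drift_def using le c lam_nonneg x C0_nonneg q_nonneg by (intro mult_left_mono powr_mono2) auto
  finally show ?thesis
    using lam1_bounds(3) excess_nonneg[OF c, of s q x] by (simp add: add_increasing)
qed

text \<open>Adding \<open>\<kappa>\<close> times the last summand turns the window sum into a process that dominates its own conditional
  expectation, and subtracting c1 per step compensates the remaining drift. Hence the moment of order \<open>q / s\<close>
  of the positive part grows only linearly in the window length.\<close>

lemma excess_window_moment:
  assumes s: "1 \<le> s" "s < q" and c: "0 \<le> c" "c \<le> 1"
    and X: "adapted n X" and sol: "\<And>t. t \<le> n \<Longrightarrow> solves X t (a t)"
    and v: "\<And>t. t \<le> n \<Longrightarrow> Lq_le P q (\<lambda>\<omega>. V (lagv X t \<omega>)) vbar"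
    and \<tau>: "\<tau> > 0" and C: "C \<ge> 1"
      "\<And>a y. a > 0 \<Longrightarrow> y \<ge> 0 \<Longrightarrow> (a + y) powr (q / s)
        \<le> a powr (q / s) + q / s * (1 + \<tau>) * a powr (q / s - 1) * y + C * y powr (q / s)"
    and \<kappa>: "0 \<le> \<kappa>" "(1 + \<tau>) * (1 + \<kappa>) * lam1 \<le> \<kappa>"
    and kj: "k + int j \<le> n"
  shows "(\<integral>\<^sup>+\<omega>. ennreal (max ((\<Sum>t\<in>{k<..k + int j}. excess s q c (V (lagv X t \<omega>)))
        + \<kappa> * excess s q c (V (lagv X (k + int j) \<omega>)) - (1 + \<tau>) * (1 + \<kappa>) * (c * drift) * real j) 0 powr (q / s)) \<partial>P)
    \<le> ennreal (\<kappa> powr (q / s) * vbar powr q + real j * (C * (1 + \<kappa>) powr (q / s) * (lam * vbar + C0) powr q))"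
  using kj
proof (induction j)
  case 0
  let ?\<xi> = "\<lambda>\<omega>. excess s q c (V (lagv X k \<omega>))"
  have "(\<integral>\<^sup>+\<omega>. ennreal (max (\<kappa> * ?\<xi> \<omega>) 0 powr (q / s)) \<partial>P)
      \<le> (\<integral>\<^sup>+\<omega>. ennreal (\<kappa> powr (q / s)) * ennreal (\<bar>V (lagv X k \<omega>)\<bar> powr q) \<partial>P)"
  proof (rule nn_integral_mono)
    fix \<omega>
    have "?\<xi> \<omega> \<le> V (lagv X k \<omega>) powr s" by (simp add: excess_def)
    then have "max (\<kappa> * ?\<xi> \<omega>) 0 powr (q / s) \<le> (\<kappa> * V (lagv X k \<omega>) powr s) powr (q / s)"
      using s \<kappa> q_nonneg excess_nonneg[OF c(1)] by (intro powr_mono2) (auto intro!: mult_left_mono)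
    also have "\<dots> = \<kappa> powr (q / s) * \<bar>V (lagv X k \<omega>)\<bar> powr q"
      using s \<kappa> V_nonneg by (simp add: powr_mult powr_powr)
    finally show "ennreal (max (\<kappa> * ?\<xi> \<omega>) 0 powr (q / s)) \<le> ennreal (\<kappa> powr (q / s)) * ennreal (\<bar>V (lagv X k \<omega>)\<bar> powr q)"
      by (simp add: ennreal_leI flip: ennreal_mult)
  qed
  also have "\<dots> = ennreal (\<kappa> powr (q / s)) * (\<integral>\<^sup>+\<omega>. ennreal (\<bar>V (lagv X k \<omega>)\<bar> powr q) \<partial>P)"
    using Lq_le_measurable[OF v[of k]] 0 by (intro nn_integral_cmult) auto
  also have "\<dots> \<le> ennreal (\<kappa> powr (q / s)) * ennreal (vbar powr q)"
    using 0 by (intro mult_left_mono Lq_le_nn_integral v) auto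
  finally show ?case by (simp add: ennreal_mult)
next
  case (Suc j)
  let ?r = "q / s" and ?t = "k + int j + 1"
  let ?y = "\<lambda>\<omega>. lagv X (k + int j) \<omega>"
  let ?\<xi> = "\<lambda>t \<omega>. excess s q c (V (lagv X t \<omega>))"
  let ?c1 = "(1 + \<tau>) * (1 + \<kappa>) * (c * drift)"
  let ?C2 = "C * (1 + \<kappa>) powr (q / s)"
  have t: "?t \<le> n" "k + int j \<le> n" using Suc.prems by auto
  have r: "1 \<le> ?r" using s by simp
  have u: "a ?t \<in> {0..1}" and AE: "AE \<omega> in P. X ?t \<omega> = G (\<epsilon> ?t \<omega>) (?y \<omega>) (a ?t)"
    using sol[OF t(1)] by (auto simp: solves_def)
  have L [measurable]: "lagv X \<tau> \<in> borel_measurable (F (?t - 1))" if "\<tau> \<le> k + int j" for \<tau>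
    using past_measurable_mono[OF adapted_lags[OF X, of \<tau>], of "?t - 1"] that t by simp
  note [measurable] = L[OF order_refl]
  define Vn where "Vn e y = \<bar>G e y (a ?t)\<bar> + (\<Sum>i\<in>UNIV. weight (coord_no i + 1) * \<bar>y $ i\<bar>)" for e y
  have Vn_nonneg: "0 \<le> Vn e y" for e y using weight_nonneg by (simp add: Vn_def sum_nonneg)
  \<comment> \<open>\<open>B\<close> collects what is known before the new innovation, the
    compensator of the new step being subtracted already. The new excess enters as a summand and
    once more with weight \<open>\<kappa>\<close> as the last one, hence the factor
    \<open>1 + \<kappa>\<close> below.\<close>
  define B where "B \<omega> = (\<Sum>t\<in>{k<..k + int j}. ?\<xi> t \<omega>) - ?c1 * real (Suc j)" for \<omega>
  have B_meas [measurable]: "B \<in> borel_measurable (F (?t - 1))"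
    unfolding B_def by (intro borel_measurable_diff borel_measurable_sum borel_measurable_const) (use L in measurable)
  have split: "(\<Sum>t\<in>{k<..k + int (Suc j)}. ?\<xi> t \<omega>) = (\<Sum>t\<in>{k<..k + int j}. ?\<xi> t \<omega>) + ?\<xi> ?t \<omega>" for \<omega>
  proof -
    have "{k<..k + int (Suc j)} = insert ?t {k<..k + int j}" by auto
    then show ?thesis by simp
  qed
  have Gm: "(\<lambda>(e, \<omega>). G e (?y \<omega>) (a ?t)) \<in> borel_measurable (borel \<Otimes>\<^sub>M F (?t - 1))"
    by (rule G_past_measurable[OF u]) (use L[OF order_refl] in simp)
  then have [measurable]: "(\<lambda>x. G (fst x) (?y (snd x)) (a ?t)) \<in> borel_measurable (borel \<Otimes>\<^sub>M F (?t - 1))"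
    by (simp add: case_prod_unfold)
  have Vn_meas [measurable]: "(\<lambda>x. Vn (fst x) (?y (snd x))) \<in> borel_measurable (borel \<Otimes>\<^sub>M F (?t - 1))"
    unfolding Vn_def by measurable
  let ?h = "\<lambda>(e, \<omega>). ennreal (max (B \<omega> + (1 + \<kappa>) * excess s q c (Vn e (?y \<omega>))) 0 powr ?r)"
  have "(\<integral>\<^sup>+\<omega>. ennreal (max ((\<Sum>t\<in>{k<..k + int (Suc j)}. ?\<xi> t \<omega>) + \<kappa> * ?\<xi> (k + int (Suc j)) \<omega> - ?c1 * real (Suc j)) 0 powr ?r) \<partial>P)
      = (\<integral>\<^sup>+\<omega>. ?h (\<epsilon> ?t \<omega>, \<omega>) \<partial>P)"
  proof (rule nn_integral_cong_AE, use AE in eventually_elim)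
    fix \<omega> assume eq: "X ?t \<omega> = G (\<epsilon> ?t \<omega>) (?y \<omega>) (a ?t)"
    have "V (lagv X ?t \<omega>) = Vn (\<epsilon> ?t \<omega>) (?y \<omega>)"
      unfolding V_shift Vn_def using eq by simp
    moreover have "k + int (Suc j) = ?t" by simp
    ultimately show "ennreal (max ((\<Sum>t\<in>{k<..k + int (Suc j)}. ?\<xi> t \<omega>) + \<kappa> * ?\<xi> (k + int (Suc j)) \<omega> - ?c1 * real (Suc j)) 0 powr ?r)
        = ?h (\<epsilon> ?t \<omega>, \<omega>)"
      unfolding split by (simp add: B_def algebra_simps)
  qed
  also have "\<dots> = (\<integral>\<^sup>+\<omega>. \<integral>\<^sup>+e. ?h (e, \<omega>) \<partial>\<mu> \<partial>P)"
    by (rule nn_integral_innov_past[OF innov]) (unfold case_prod_unfold, measurable)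
  also have "\<dots> \<le> (\<integral>\<^sup>+\<omega>. ennreal (max ((\<Sum>t\<in>{k<..k + int j}. ?\<xi> t \<omega>) + \<kappa> * ?\<xi> (k + int j) \<omega> - ?c1 * real j) 0 powr ?r)
      + ennreal ?C2 * ennreal (\<bar>lam * V (?y \<omega>) + C0\<bar> powr q) \<partial>P)"
  proof (rule nn_integral_mono)
    fix \<omega> assume \<omega>: "\<omega> \<in> space P"
    define w where "w = lam * V (?y \<omega>) + C0"
    have w: "0 \<le> w" using lam_nonneg V_nonneg C0_nonneg by (simp add: w_def)
    have Lw: "Lq_le \<mu> q (\<lambda>e. Vn e (?y \<omega>)) w"
      unfolding Vn_def w_def by (rule conditional_step[OF G_growth[OF u]])
    have Ls: "Lq_le \<mu> s (\<lambda>e. Vn e (?y \<omega>)) w"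
      using s by (intro Lq_le_exponent[OF prob_space_law Lw]) auto
    note [measurable] = Lq_le_measurable[OF Lw]
    let ?w1 = "lam1 * ?\<xi> (k + int j) \<omega> + c * drift"
    \<comment> \<open>Each branch of the minimum bounds the conditional mean through its own moment.
      The same \<open>w\<close> serves both, as norms increase with the exponent; the result is the
      excess at \<open>w\<close>, to which the drift bound applies.\<close>
    have w1: "(\<integral>\<^sup>+e. ennreal (excess s q c (Vn e (?y \<omega>))) \<partial>\<mu>) \<le> ennreal ?w1"
    proof -
      have "(\<integral>\<^sup>+e. ennreal (excess s q c (Vn e (?y \<omega>))) \<partial>\<mu>) \<le> (\<integral>\<^sup>+e. ennreal (\<bar>Vn e (?y \<omega>)\<bar> powr s) \<partial>\<mu>)"
        using Vn_nonneg by (intro nn_integral_mono ennreal_leI) (simp add: excess_def)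
      also have "\<dots> \<le> ennreal (w powr s)" by (rule Lq_le_nn_integral[OF Ls])
      finally have 1: "(\<integral>\<^sup>+e. ennreal (excess s q c (Vn e (?y \<omega>))) \<partial>\<mu>) \<le> ennreal (w powr s)" .
      have "(\<integral>\<^sup>+e. ennreal (excess s q c (Vn e (?y \<omega>))) \<partial>\<mu>) \<le> (\<integral>\<^sup>+e. ennreal c * ennreal (\<bar>Vn e (?y \<omega>)\<bar> powr q) \<partial>\<mu>)"
        using Vn_nonneg c by (intro nn_integral_mono) (simp add: excess_def ennreal_leI flip: ennreal_mult)
      also have "\<dots> = ennreal c * (\<integral>\<^sup>+e. ennreal (\<bar>Vn e (?y \<omega>)\<bar> powr q) \<partial>\<mu>)"
        by (rule nn_integral_cmult) measurable
      also have "\<dots> \<le> ennreal c * ennreal (w powr q)"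
        by (intro mult_left_mono Lq_le_nn_integral[OF Lw]) simp
      finally have 2: "(\<integral>\<^sup>+e. ennreal (excess s q c (Vn e (?y \<omega>))) \<partial>\<mu>) \<le> ennreal (c * w powr q)"
        using c by (simp add: ennreal_mult)
      from 1 2 have "(\<integral>\<^sup>+e. ennreal (excess s q c (Vn e (?y \<omega>))) \<partial>\<mu>) \<le> ennreal (excess s q c w)"
        by (simp add: excess_def min_def)
      also have "\<dots> \<le> ennreal ?w1"
        unfolding w_def by (intro ennreal_leI excess_drift s c V_nonneg)
      finally show ?thesis .
    qed
    have w2: "(\<integral>\<^sup>+e. ennreal (excess s q c (Vn e (?y \<omega>)) powr ?r) \<partial>\<mu>) \<le> ennreal (w powr q)"
    proof -
      have "excess s q c (Vn e (?y \<omega>)) powr ?r \<le> \<bar>Vn e (?y \<omega>)\<bar> powr q" for e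
      proof -
        have "excess s q c (Vn e (?y \<omega>)) powr ?r \<le> (Vn e (?y \<omega>) powr s) powr ?r"
          using excess_nonneg[OF c(1)] r by (intro powr_mono2) (auto simp: excess_def)
        then show ?thesis using s Vn_nonneg by (simp add: powr_powr)
      qed
      then have "(\<integral>\<^sup>+e. ennreal (excess s q c (Vn e (?y \<omega>)) powr ?r) \<partial>\<mu>) \<le> (\<integral>\<^sup>+e. ennreal (\<bar>Vn e (?y \<omega>)\<bar> powr q) \<partial>\<mu>)"
        by (intro nn_integral_mono ennreal_leI)
      also note Lq_le_nn_integral[OF Lw]
      finally show ?thesis .
    qed
    have w1_nonneg: "0 \<le> ?w1"
      using lam1_bounds excess_nonneg[OF c(1)] c by (simp add: drift_def)
    have "(\<integral>\<^sup>+e. ?h (e, \<omega>) \<partial>\<mu>)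
        \<le> ennreal (max (B \<omega> + (1 + \<tau>) * (1 + \<kappa>) * ?w1) 0 powr ?r + ?C2 * w powr q)"
      unfolding prod.case
      by (rule nn_integral_positive_part_powr[OF prob_space_law _ _ r \<tau> C w1 w2 w1_nonneg])
        (use excess_nonneg[OF c(1)] \<kappa> in auto)
    also have "\<dots> \<le> ennreal (max ((\<Sum>t\<in>{k<..k + int j}. ?\<xi> t \<omega>) + \<kappa> * ?\<xi> (k + int j) \<omega> - ?c1 * real j) 0 powr ?r + ?C2 * w powr q)"
    \<comment> \<open>The condition on \<open>\<kappa>\<close> restores the weight of the previous
      excess, and the compensator of one step cancels the drift; this closes the induction.\<close>
    proof (intro ennreal_leI add_right_mono powr_mono2 max.mono order_refl)
      have "(1 + \<tau>) * (1 + \<kappa>) * lam1 * ?\<xi> (k + int j) \<omega> \<le> \<kappa> * ?\<xi> (k + int j) \<omega>"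
        by (intro mult_right_mono \<kappa> excess_nonneg c)
      then show "B \<omega> + (1 + \<tau>) * (1 + \<kappa>) * ?w1 \<le> (\<Sum>t\<in>{k<..k + int j}. ?\<xi> t \<omega>) + \<kappa> * ?\<xi> (k + int j) \<omega> - ?c1 * real j"
        by (simp add: B_def algebra_simps)
    qed (use r in auto)
    finally show "(\<integral>\<^sup>+e. ?h (e, \<omega>) \<partial>\<mu>)
        \<le> ennreal (max ((\<Sum>t\<in>{k<..k + int j}. ?\<xi> t \<omega>) + \<kappa> * ?\<xi> (k + int j) \<omega> - ?c1 * real j) 0 powr ?r)
          + ennreal ?C2 * ennreal (\<bar>lam * V (?y \<omega>) + C0\<bar> powr q)"
      using w C(1) by (simp add: w_def ennreal_mult ennreal_plus)
  qed
  also have "\<dots> = (\<integral>\<^sup>+\<omega>. ennreal (max ((\<Sum>t\<in>{k<..k + int j}. ?\<xi> t \<omega>) + \<kappa> * ?\<xi> (k + int j) \<omega> - ?c1 * real j) 0 powr ?r) \<partial>P)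
      + ennreal ?C2 * (\<integral>\<^sup>+\<omega>. ennreal (\<bar>lam * V (?y \<omega>) + C0\<bar> powr q) \<partial>P)"
  proof -
    have [measurable]: "?y \<in> borel_measurable P" by (rule past_measurable[OF L[OF order_refl]])
    have [measurable]: "(\<lambda>\<omega>. \<Sum>t\<in>{k<..k + int j}. ?\<xi> t \<omega>) \<in> borel_measurable P"
      by (intro borel_measurable_sum excess_V_measurable past_measurable[OF L]) simp
    show ?thesis by (subst nn_integral_add) (auto simp: nn_integral_cmult)
  qed
  also have "\<dots> \<le> ennreal (\<kappa> powr ?r * vbar powr q + real j * (?C2 * (lam * vbar + C0) powr q))
      + ennreal ?C2 * ennreal ((lam * vbar + C0) powr q)"
  proof (intro add_mono mult_left_mono)
    show "(\<integral>\<^sup>+\<omega>. ennreal (max ((\<Sum>t\<in>{k<..k + int j}. ?\<xi> t \<omega>) + \<kappa> * ?\<xi> (k + int j) \<omega> - ?c1 * real j) 0 powr ?r) \<partial>P)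
        \<le> ennreal (\<kappa> powr ?r * vbar powr q + real j * (?C2 * (lam * vbar + C0) powr q))"
      using Suc.IH t by simp
    have "Lq_le P q (\<lambda>\<omega>. lam * V (?y \<omega>) + C0) (\<bar>lam\<bar> * vbar + \<bar>C0\<bar>)"
      by (intro Lq_le_add Lq_le_cmult v t Lq_le_const prob_space_axioms q_ge_1 q_pos)
    then show "(\<integral>\<^sup>+\<omega>. ennreal (\<bar>lam * V (?y \<omega>) + C0\<bar> powr q) \<partial>P) \<le> ennreal ((lam * vbar + C0) powr q)"
      using Lq_le_nn_integral lam_nonneg C0_nonneg by fastforce
  qed simp
  also have "\<dots> = ennreal (\<kappa> powr ?r * vbar powr q + real (Suc j) * (?C2 * (lam * vbar + C0) powr q))"
    using C(1) by (simp add: algebra_simps flip: ennreal_mult ennreal_plus)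
  finally show ?case .
qed

text \<open>Markov's inequality of order \<open>q / s\<close> for the compensated sum. The constants
  depend neither on c nor on the window, and the bound is linear in the window length.\<close>

lemma excess_window:
  assumes s: "1 \<le> s" "s < q"
  obtains K1 K2 where "0 \<le> K1" "0 \<le> K2"
    "\<And>c n X a k j x. 0 \<le> c \<Longrightarrow> c \<le> 1 \<Longrightarrow> adapted n X \<Longrightarrow> (\<And>t. t \<le> n \<Longrightarrow> solves X t (a t)) \<Longrightarrow>
      (\<And>t. t \<le> n \<Longrightarrow> Lq_le P q (\<lambda>\<omega>. V (lagv X t \<omega>)) vbar) \<Longrightarrow> k + int j \<le> n \<Longrightarrow> 0 < x \<Longrightarrow>
      prob {\<omega> \<in> space P. (\<Sum>t\<in>{k<..k + int j}. excess s q c (V (lagv X t \<omega>))) > c * K1 * real j + x}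
        \<le> K2 * (real j + 1) / x powr (q / s)"
proof -
  \<comment> \<open>This keeps \<open>(1 + \<tau>) * lam1\<close> below 1: its distance to 1 is
    \<open>(1 - lam1) * (2 - lam1) / 2\<close>.\<close>
  define \<tau> where "\<tau> = (1 - lam1) / 2"
  have \<tau>: "\<tau> > 0" using lam1_bounds by (simp add: \<tau>_def)
  have r: "1 \<le> q / s" using s by simp
  from powr_add_le[OF r \<tau>] obtain C where C: "C \<ge> 1"
      "\<And>a y. a > 0 \<Longrightarrow> y \<ge> 0 \<Longrightarrow> (a + y) powr (q / s)
        \<le> a powr (q / s) + q / s * (1 + \<tau>) * a powr (q / s - 1) * y + C * y powr (q / s)" by blast
  define lam2 where "lam2 = (1 + \<tau>) * lam1"
  have lam2: "0 < lam2" "lam2 < 1"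
  proof -
    have "0 < (1 - lam1) * (2 - lam1)" using lam1_bounds by simp
    then show "lam2 < 1" by (simp add: lam2_def \<tau>_def field_simps)
    show "0 < lam2" using \<tau> lam1_bounds by (simp add: lam2_def)
  qed
  \<comment> \<open>The solution of \<open>(1 + \<kappa>) * lam2 = \<kappa>\<close>, so the
    condition of the moment recursion holds with equality.\<close>
  define \<kappa> where "\<kappa> = lam2 / (1 - lam2)"
  have \<kappa>: "0 \<le> \<kappa>" "(1 + \<tau>) * (1 + \<kappa>) * lam1 \<le> \<kappa>"
  proof -
    show "0 \<le> \<kappa>" using lam2 by (simp add: \<kappa>_def)
    have "(1 + \<kappa>) * lam2 = \<kappa>" using lam2 by (simp add: \<kappa>_def field_simps)
    then show "(1 + \<tau>) * (1 + \<kappa>) * lam1 \<le> \<kappa>" by (simp add: lam2_def algebra_simps)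
  qed
  define D1 where "D1 = \<kappa> powr (q / s) * vbar powr q"
  define D2 where "D2 = C * (1 + \<kappa>) powr (q / s) * (lam * vbar + C0) powr q"
  have D: "0 \<le> D1" "0 \<le> D2" using C(1) by (auto simp: D1_def D2_def)
  show thesis
  proof (rule that[of "(1 + \<tau>) * (1 + \<kappa>) * drift" "D1 + D2"])
    show "0 \<le> (1 + \<tau>) * (1 + \<kappa>) * drift" using \<tau> \<kappa> by (simp add: drift_def)
    show "0 \<le> D1 + D2" using D by simp
    fix c x :: real and n k :: int and X a and j :: nat
    assume c: "0 \<le> c" "c \<le> 1" and X: "adapted n X" and sol: "\<And>t. t \<le> n \<Longrightarrow> solves X t (a t)"
      and v: "\<And>t. t \<le> n \<Longrightarrow> Lq_le P q (\<lambda>\<omega>. V (lagv X t \<omega>)) vbar" and kj: "k + int j \<le> n" and x: "0 < x"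
    let ?S = "\<lambda>\<omega>. \<Sum>t\<in>{k<..k + int j}. excess s q c (V (lagv X t \<omega>))"
    let ?c1 = "(1 + \<tau>) * (1 + \<kappa>) * (c * drift)"
    let ?U = "\<lambda>\<omega>. max (?S \<omega> + \<kappa> * excess s q c (V (lagv X (k + int j) \<omega>)) - ?c1 * real j) 0"
    have L: "lagv X t \<in> borel_measurable P" if "t \<le> n" for t by (rule adapted_lags_measurable[OF X that])
    have Sm [measurable]: "?S \<in> borel_measurable P"
      by (rule borel_measurable_sum) (use L kj in auto)
    have [measurable]: "lagv X (k + int j) \<in> borel_measurable P" by (rule L[OF kj])
    have "emeasure P {\<omega> \<in> space P. ?S \<omega> > c * ((1 + \<tau>) * (1 + \<kappa>) * drift) * real j + x}
        \<le> emeasure P {\<omega> \<in> space P. 1 \<le> ennreal (1 / x powr (q / s)) * ennreal (?U \<omega> powr (q / s))}"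
    proof (rule emeasure_mono)
      show "{\<omega> \<in> space P. ?S \<omega> > c * ((1 + \<tau>) * (1 + \<kappa>) * drift) * real j + x}
        \<subseteq> {\<omega> \<in> space P. 1 \<le> ennreal (1 / x powr (q / s)) * ennreal (?U \<omega> powr (q / s))}"
      proof (safe)
        fix \<omega> assume "?S \<omega> > c * ((1 + \<tau>) * (1 + \<kappa>) * drift) * real j + x"
        moreover have "0 \<le> \<kappa> * excess s q c (V (lagv X (k + int j) \<omega>))"
          using \<kappa> excess_nonneg[OF c(1)] by simp
        ultimately have "x \<le> ?U \<omega>" by (simp add: algebra_simps)
        then have "x powr (q / s) \<le> ?U \<omega> powr (q / s)" using x r by (intro powr_mono2) auto
        then have "1 \<le> 1 / x powr (q / s) * ?U \<omega> powr (q / s)" using x by (simp add: field_simps)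
        then have "ennreal 1 \<le> ennreal (1 / x powr (q / s) * ?U \<omega> powr (q / s))" by (rule ennreal_leI)
        also have "\<dots> = ennreal (1 / x powr (q / s)) * ennreal (?U \<omega> powr (q / s))"
          by (rule ennreal_mult) simp_all
        finally show "1 \<le> ennreal (1 / x powr (q / s)) * ennreal (?U \<omega> powr (q / s))" by simp
      qed
    qed measurable
    also have "\<dots> \<le> ennreal (1 / x powr (q / s)) * (\<integral>\<^sup>+\<omega>. ennreal (?U \<omega> powr (q / s)) \<partial>P)"
      by (rule order_trans[OF nn_integral_Markov_inequality]) (auto intro!: mult_left_mono nn_integral_mono split: split_indicator)
    also have "\<dots> \<le> ennreal (1 / x powr (q / s)) * ennreal (D1 + real j * D2)"
      unfolding D1_def D2_def
      by (intro mult_left_mono excess_window_moment[OF s c X sol v \<tau> C \<kappa> kj]) auto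
    also have "\<dots> \<le> ennreal ((D1 + D2) * (real j + 1) / x powr (q / s))"
    proof -
      have "D1 + real j * D2 \<le> (D1 + D2) * (real j + 1)"
        using D by (simp add: algebra_simps)
      then have "1 / x powr (q / s) * (D1 + real j * D2) \<le> (D1 + D2) * (real j + 1) / x powr (q / s)"
        using x by (simp add: divide_right_mono)
      then have "ennreal (1 / x powr (q / s) * (D1 + real j * D2)) \<le> ennreal ((D1 + D2) * (real j + 1) / x powr (q / s))"
        by (rule ennreal_leI)
      moreover have "ennreal (1 / x powr (q / s)) * ennreal (D1 + real j * D2) = ennreal (1 / x powr (q / s) * (D1 + real j * D2))"
        using D by (subst ennreal_mult) auto
      ultimately show ?thesis by simp
    qed
    finally show "prob {\<omega> \<in> space P. ?S \<omega> > c * ((1 + \<tau>) * (1 + \<kappa>) * drift) * real j + x}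
        \<le> (D1 + D2) * (real j + 1) / x powr (q / s)"
      using D by (simp add: emeasure_eq_measure ennreal_le_iff)
  qed
qed

end

section \<open>The objective along the process\<close>

lemma l1_norm_nonneg: "0 \<le> l1_norm v"
  by (simp add: l1_norm_def sum_nonneg)

lemma l1_norm_pair_nonneg: "0 \<le> l1_norm_pair z"
  by (simp add: l1_norm_pair_def l1_norm_nonneg)

lemma l1_norm_add_le: "l1_norm (x + y) \<le> l1_norm x + l1_norm y"
  unfolding l1_norm_def sum.distrib[symmetric] by (intro sum_mono) (simp add: abs_triangle_ineq)

lemma l1_norm_pair_add_le: "l1_norm_pair (x + y) \<le> l1_norm_pair x + l1_norm_pair y"
  using l1_norm_add_le[of "snd x" "snd y"] by (simp add: l1_norm_pair_def)

lemma l1_norm_pair_continuous: "continuous_on UNIV l1_norm_pair"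
  unfolding l1_norm_pair_def[abs_def] l1_norm_def by (intro continuous_intros)

lemma l1_norm_pair_measurable [measurable]:
  "l1_norm_pair \<in> borel_measurable (borel \<Otimes>\<^sub>M (borel :: (real ^ 'p) measure))"
  unfolding borel_prod by (rule borel_measurable_continuous_onI[OF l1_norm_pair_continuous])

definition trunc :: "real \<Rightarrow> real \<Rightarrow> real" where
  "trunc R x = max (- R) (min R x)"

lemma trunc_measurable [measurable]: "trunc R \<in> borel_measurable borel"
  unfolding trunc_def[abs_def] by measurable

lemma abs_trunc_le: "0 \<le> R \<Longrightarrow> \<bar>trunc R x\<bar> \<le> R"
  by (simp add: trunc_def)

lemma trunc_lipschitz: "\<bar>trunc R x - trunc R y\<bar> \<le> \<bar>x - y\<bar>"
  by (auto simp: trunc_def max_def min_def)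

lemma (in prob_space) moment_bound:
  assumes "h \<in> borel_measurable M" "(\<integral>\<^sup>+x. ennreal \<bar>h x\<bar> \<partial>M) \<le> ennreal c" "0 \<le> c"
  shows "integrable M h" "(\<integral>x. \<bar>h x\<bar> \<partial>M) \<le> c" "\<bar>\<integral>x. h x \<partial>M\<bar> \<le> c"
proof -
  have "(\<integral>\<^sup>+x. ennreal (norm (h x)) \<partial>M) < \<infinity>"
    using order.strict_trans1[OF assms(2)] by simp
  then show i: "integrable M h" using assms(1) by (intro integrableI_bounded) auto
  have "ennreal (\<integral>x. \<bar>h x\<bar> \<partial>M) = (\<integral>\<^sup>+x. ennreal \<bar>h x\<bar> \<partial>M)"
    using i by (intro nn_integral_eq_integral[symmetric]) auto
  then have "ennreal (\<integral>x. \<bar>h x\<bar> \<partial>M) \<le> ennreal c" using assms(2) by simp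
  then show "(\<integral>x. \<bar>h x\<bar> \<partial>M) \<le> c" using assms(3) by (simp add: ennreal_le_iff)
  then show "\<bar>\<integral>x. h x \<partial>M\<bar> \<le> c" using integral_abs_bound[of M h] by linarith
qed

lemma (in prob_space) prob_gt_le:
  assumes [measurable]: "h \<in> borel_measurable M" and "(\<integral>\<^sup>+x. ennreal \<bar>h x\<bar> \<partial>M) \<le> ennreal c" "0 \<le> c" "0 < y"
  shows "prob {x \<in> space M. y < h x} \<le> c / y"
proof -
  have "emeasure M {x \<in> space M. y < h x} \<le> emeasure M {x \<in> space M. 1 \<le> ennreal (1 / y) * ennreal \<bar>h x\<bar>}"
  proof (rule emeasure_mono)
    show "{x \<in> space M. y < h x} \<subseteq> {x \<in> space M. 1 \<le> ennreal (1 / y) * ennreal \<bar>h x\<bar>}"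
    proof safe
      fix x assume "y < h x"
      then have "1 \<le> 1 / y * \<bar>h x\<bar>" using assms(4) by (simp add: field_simps)
      then have "ennreal 1 \<le> ennreal (1 / y * \<bar>h x\<bar>)" by (rule ennreal_leI)
      also have "\<dots> = ennreal (1 / y) * ennreal \<bar>h x\<bar>" using assms(4) by (intro ennreal_mult) auto
      finally show "1 \<le> ennreal (1 / y) * ennreal \<bar>h x\<bar>" by simp
    qed
  qed measurable
  also have "\<dots> \<le> ennreal (1 / y) * (\<integral>\<^sup>+x. ennreal \<bar>h x\<bar> \<partial>M)"
    by (rule order_trans[OF nn_integral_Markov_inequality]) (auto intro!: mult_left_mono nn_integral_mono split: split_indicator)
  also have "\<dots> \<le> ennreal (1 / y) * ennreal c" by (intro mult_left_mono assms) simp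
  also have "\<dots> = ennreal (c / y)" using assms by (simp flip: ennreal_mult)
  finally show ?thesis using assms by (simp add: emeasure_eq_measure ennreal_le_iff)
qed

lemma restart_cong:
  assumes "\<And>\<tau>. s < \<tau> \<Longrightarrow> \<tau> \<le> t \<Longrightarrow> e \<tau> = e' \<tau>"
  shows "restart G a s t e = restart G a s t e'"
  using assms
proof (induction "nat (t - s)" arbitrary: t rule: less_induct)
  case less
  show ?case
  proof (cases "t \<le> s")
    case False
    have "restart G a s (t - coord_no i) e = restart G a s (t - coord_no i) e'" for i :: 'a
      using False coord_no_ge_1[of i] less.prems by (intro less.hyps) auto
    then have "lags (restart G a s) (t - 1) e = (lags (restart G a s) (t - 1) e' :: real ^ 'a::{finite,linorder})"
      by (simp add: lags_def)
    then show ?thesis using False less.prems[of t] by (simp add: restart_step)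
  qed (simp add: restart_initial)
qed

locale objective = autoregression P \<epsilon> G "M + 1" \<chi>v C0
  for P :: "'w measure" and \<epsilon> and G :: "real \<Rightarrow> real ^ 'p::{finite,linorder} \<Rightarrow> real \<Rightarrow> real"
    and M :: real and \<chi>v C0 +
  fixes \<Theta> :: "(real ^ 'd) set" and Cz C\<theta> :: real
    and ell :: "real \<Rightarrow> real ^ 'p::{finite,linorder} \<Rightarrow> real ^ 'd \<Rightarrow> real"
  assumes M_nonneg: "0 \<le> M" and Cz_nonneg: "0 \<le> Cz" and C\<theta>_nonneg: "0 \<le> C\<theta>"
    and ell_class: "(\<lambda>(x, y). ell x y) \<in> lip_class \<Theta> M Cz C\<theta>"
begin

lemma ell_lipschitz:
  "\<theta> \<in> \<Theta> \<Longrightarrow> \<bar>ell x y \<theta> - ell x' y' \<theta>\<bar> \<le> Cz * l1_norm_pair ((x, y) - (x', y')) *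
     (1 + rpow (l1_norm_pair (x, y)) M + rpow (l1_norm_pair (x', y')) M)"
  using ell_class unfolding lip_class_def by fastforce

lemma ell_lipschitz_param:
  "\<theta> \<in> \<Theta> \<Longrightarrow> \<theta>' \<in> \<Theta> \<Longrightarrow>
    \<bar>ell x y \<theta> - ell x y \<theta>'\<bar> \<le> 3 * C\<theta> * (1 + rpow (l1_norm_pair (x, y)) (M + 1)) * l1_norm (\<theta> - \<theta>')"
  using ell_class unfolding lip_class_def by fastforce

text \<open>Measurability of the objective in the data is obtained from continuity: near a given
  point the growth factor in the Lipschitz condition is bounded.\<close>

lemma ell_continuous:
  assumes "\<theta> \<in> \<Theta>"
  shows "continuous_on UNIV (\<lambda>z. ell (fst z) (snd z) \<theta>)"
proof -
  have "((\<lambda>z. ell (fst z) (snd z) \<theta>) \<longlongrightarrow> ell (fst z0) (snd z0) \<theta>) (at z0)" for z0 :: "real \<times> (real ^ 'p::{finite,linorder})"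
  proof -
    have lim: "((\<lambda>z. l1_norm_pair (z - z0)) \<longlongrightarrow> 0) (at z0)"
    proof -
      have "continuous_on UNIV (\<lambda>z. l1_norm_pair (z - z0))"
        by (rule continuous_on_compose2[OF l1_norm_pair_continuous]) (auto intro!: continuous_intros)
      then have "isCont (\<lambda>z. l1_norm_pair (z - z0)) z0"
        using continuous_on_eq_continuous_at[OF open_UNIV] by blast
      then show ?thesis by (simp add: isCont_def l1_norm_pair_def l1_norm_def)
    qed
    define K where "K = Cz * (1 + rpow (l1_norm_pair z0 + 1) M + rpow (l1_norm_pair z0) M)"
    have "eventually (\<lambda>z. l1_norm_pair (z - z0) < 1) (at z0)"
      using lim by (rule order_tendstoD) simp
    then have "eventually (\<lambda>z. norm (ell (fst z) (snd z) \<theta> - ell (fst z0) (snd z0) \<theta>) \<le> K * l1_norm_pair (z - z0)) (at z0)"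
    proof eventually_elim
      case (elim z)
      have "l1_norm_pair z \<le> l1_norm_pair z0 + 1"
        using l1_norm_pair_add_le[of z0 "z - z0"] elim by simp
      then have r: "rpow (l1_norm_pair z) M \<le> rpow (l1_norm_pair z0 + 1) M"
        by (intro rpow_mono l1_norm_pair_nonneg M_nonneg)
      have "\<bar>ell (fst z) (snd z) \<theta> - ell (fst z0) (snd z0) \<theta>\<bar>
          \<le> Cz * l1_norm_pair (z - z0) * (1 + rpow (l1_norm_pair z) M + rpow (l1_norm_pair z0) M)"
        using ell_lipschitz[OF assms, of "fst z" "snd z" "fst z0" "snd z0"] by simp
      also have "\<dots> \<le> Cz * l1_norm_pair (z - z0) * (1 + rpow (l1_norm_pair z0 + 1) M + rpow (l1_norm_pair z0) M)"
        using r Cz_nonneg l1_norm_pair_nonneg[of "z - z0"] by (intro mult_left_mono mult_nonneg_nonneg) auto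
      finally show ?case by (simp add: K_def algebra_simps)
    qed
    moreover have "((\<lambda>z. K * l1_norm_pair (z - z0)) \<longlongrightarrow> 0) (at z0)"
      using tendsto_mult[OF tendsto_const lim, of K] by simp
    ultimately have "((\<lambda>z. ell (fst z) (snd z) \<theta> - ell (fst z0) (snd z0) \<theta>) \<longlongrightarrow> 0) (at z0)"
      by (rule Lim_null_comparison)
    then show ?thesis by (rule LIM_zero_cancel)
  qed
  then have "isCont (\<lambda>z. ell (fst z) (snd z) \<theta>) z0" for z0 by (simp add: isCont_def)
  then show ?thesis using continuous_on_eq_continuous_at[OF open_UNIV] by blast
qed

lemma ell_measurable:
  assumes "\<theta> \<in> \<Theta>" "f \<in> borel_measurable N" "g \<in> borel_measurable N"
  shows "(\<lambda>x. ell (f x) (g x) \<theta>) \<in> borel_measurable N"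
proof -
  have "(\<lambda>x. (f x, g x)) \<in> borel_measurable N"
    using assms by (intro borel_measurable_Pair)
  from measurable_compose[OF this borel_measurable_continuous_onI[OF ell_continuous[OF assms(1)]]]
  show ?thesis by simp
qed

definition obs :: "(int \<Rightarrow> 'w \<Rightarrow> real) \<Rightarrow> int \<Rightarrow> real ^ 'd \<Rightarrow> 'w \<Rightarrow> real" where
  "obs X t \<theta> \<omega> = ell (X t \<omega>) (lagv X (t - 1) \<omega>) \<theta>"

definition znorm :: "(int \<Rightarrow> 'w \<Rightarrow> real) \<Rightarrow> int \<Rightarrow> 'w \<Rightarrow> real" where
  "znorm X t \<omega> = l1_norm_pair (X t \<omega>, lagv X (t - 1) \<omega>)"

lemma znorm_nonneg: "0 \<le> znorm X t \<omega>"
  by (simp add: znorm_def l1_norm_pair_nonneg)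

lemma znorm_le_V: "znorm X t \<omega> \<le> V (lagv X t \<omega>) + 1 / gap * V (lagv X (t - 1) \<omega>)"
  using abs_le_V_lags[of X t \<omega>] l1_norm_le_V[of "lagv X (t - 1) \<omega>"]
  by (simp add: znorm_def l1_norm_pair_def)

lemma obs_measurable:
  assumes "adapted n X" "t \<le> n" "\<theta> \<in> \<Theta>"
  shows "obs X t \<theta> \<in> borel_measurable P"
  unfolding obs_def[abs_def]
  by (intro ell_measurable assms adapted_measurable[OF assms(1)] adapted_lags_measurable[OF assms(1)]) (use assms in auto)

lemma znorm_measurable:
  assumes "adapted n X" "t \<le> n"
  shows "znorm X t \<in> borel_measurable P"
proof -
  have "(\<lambda>\<omega>. (X t \<omega>, lagv X (t - 1) \<omega>)) \<in> measurable P (borel \<Otimes>\<^sub>M borel)"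
    using assms by (intro measurable_Pair adapted_measurable[OF assms(1)] adapted_lags_measurable[OF assms(1)]) auto
  from measurable_compose[OF this l1_norm_pair_measurable] show ?thesis by (simp add: znorm_def[abs_def])
qed

lemma znorm_moment:
  assumes "adapted n X" "t \<le> n"
    and "Lq_le P q (\<lambda>\<omega>. V (lagv X t \<omega>)) w" "Lq_le P q (\<lambda>\<omega>. V (lagv X (t - 1) \<omega>)) w" and q: "1 \<le> q"
  shows "Lq_le P q (znorm X t) (w * (1 + 1 / gap))"
proof -
  have "Lq_le P q (\<lambda>\<omega>. V (lagv X t \<omega>) + 1 / gap * V (lagv X (t - 1) \<omega>)) (w + \<bar>1 / gap\<bar> * w)"
    using q by (intro Lq_le_add Lq_le_cmult assms) auto
  moreover have "w + \<bar>1 / gap\<bar> * w = w * (1 + 1 / gap)" using gap_pos by (simp add: algebra_simps)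
  ultimately have *: "Lq_le P q (\<lambda>\<omega>. V (lagv X t \<omega>) + 1 / gap * V (lagv X (t - 1) \<omega>)) (w * (1 + 1 / gap))" by simp
  have "\<bar>znorm X t \<omega>\<bar> \<le> \<bar>V (lagv X t \<omega>) + 1 / gap * V (lagv X (t - 1) \<omega>)\<bar>" for \<omega>
    using znorm_le_V[of X t \<omega>] znorm_nonneg[of X t \<omega>] by linarith
  then show ?thesis
    using q by (intro Lq_le_mono[OF * znorm_measurable[OF assms(1,2)]]) auto
qed

text \<open>\<open>2 * vbar + 1\<close> is a common moment bound for rows, stationary solutions and
  restarted copies, strictly positive as \<open>Lq_le_Holder\<close> requires. The factor
  \<open>1 + 1 / gap\<close> converts \<open>V\<close> at two successive times into the norm of the
  pair.\<close>

definition Lc :: real where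
  "Lc = Cz * (1 + 1 / gap) * (1 + 2 * rpow ((2 * vbar + 1) * (1 + 1 / gap)) M)"

lemma Lc_nonneg: "0 \<le> Lc"
  unfolding Lc_def using Cz_nonneg gap_pos by simp

text \<open>The Lipschitz bound is a sum of products of the distance with powers of norms, and
  Hoelder integrates each product with moments of order \<open>M + 1\<close>. All comparisons of
  objectives are thereby reduced to distances of the underlying processes.\<close>

lemma obs_compare:
  assumes \<theta>: "\<theta> \<in> \<Theta>" and A: "adapted n A" and B: "adapted n B" and t: "t \<le> n" and d: "0 < d"
    and D: "\<And>s. s \<in> {t - 1, t} \<Longrightarrow> Lq_le P (M + 1) (\<lambda>\<omega>. V (lagv (\<lambda>t \<omega>. A t \<omega> - B t \<omega>) s \<omega>)) d"
    and w: "\<And>s. s \<in> {t - 1, t} \<Longrightarrow> Lq_le P (M + 1) (\<lambda>\<omega>. V (lagv A s \<omega>)) (2 * vbar + 1)"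
      "\<And>s. s \<in> {t - 1, t} \<Longrightarrow> Lq_le P (M + 1) (\<lambda>\<omega>. V (lagv B s \<omega>)) (2 * vbar + 1)"
  shows "(\<integral>\<^sup>+\<omega>. ennreal \<bar>obs A t \<theta> \<omega> - obs B t \<theta> \<omega>\<bar> \<partial>P) \<le> ennreal (Lc * d)"
proof -
  let ?D = "\<lambda>t \<omega>. A t \<omega> - B t \<omega>"
  let ?d = "d * (1 + 1 / gap)" and ?w = "(2 * vbar + 1) * (1 + 1 / gap)"
  have pos: "0 < ?d" "0 < ?w" using d gap_pos vbar_nonneg by (simp_all add: add_pos_pos add_nonneg_pos)
  have LD: "Lq_le P (M + 1) (znorm ?D t) ?d"
    by (rule znorm_moment[OF adapted_diff[OF A B] t]) (use D q_ge_1 in auto)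
  have LA: "Lq_le P (M + 1) (znorm A t) ?w" by (rule znorm_moment[OF A t]) (use w q_ge_1 in auto)
  have LB: "Lq_le P (M + 1) (znorm B t) ?w" by (rule znorm_moment[OF B t]) (use w q_ge_1 in auto)
  note [measurable] = Lq_le_measurable[OF LD] Lq_le_measurable[OF LA] Lq_le_measurable[OF LB]
  have L1: "Lq_le P (M + 1) (\<lambda>_. 1) 1"
    using Lq_le_const[of P "M + 1" 1] q_pos prob_space_axioms by simp
  let ?a = "\<lambda>\<omega>. ennreal (\<bar>znorm ?D t \<omega>\<bar> * rpow \<bar>1\<bar> M)"
  let ?b = "\<lambda>\<omega>. ennreal (\<bar>znorm ?D t \<omega>\<bar> * rpow \<bar>znorm A t \<omega>\<bar> M)"
  let ?c = "\<lambda>\<omega>. ennreal (\<bar>znorm ?D t \<omega>\<bar> * rpow \<bar>znorm B t \<omega>\<bar> M)"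
  have "(\<integral>\<^sup>+\<omega>. ennreal \<bar>obs A t \<theta> \<omega> - obs B t \<theta> \<omega>\<bar> \<partial>P) \<le> (\<integral>\<^sup>+\<omega>. ennreal Cz * (?a \<omega> + ?b \<omega> + ?c \<omega>) \<partial>P)"
  proof (rule nn_integral_mono)
    fix \<omega>
    have "\<bar>obs A t \<theta> \<omega> - obs B t \<theta> \<omega>\<bar>
        \<le> Cz * znorm ?D t \<omega> * (1 + rpow (znorm A t \<omega>) M + rpow (znorm B t \<omega>) M)"
      using ell_lipschitz[OF \<theta>, of "A t \<omega>" "lagv A (t - 1) \<omega>" "B t \<omega>" "lagv B (t - 1) \<omega>"]
      by (simp add: obs_def znorm_def lags_diff)
    also have "\<dots> = Cz * (\<bar>znorm ?D t \<omega>\<bar> * rpow \<bar>1\<bar> M + \<bar>znorm ?D t \<omega>\<bar> * rpow \<bar>znorm A t \<omega>\<bar> M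
        + \<bar>znorm ?D t \<omega>\<bar> * rpow \<bar>znorm B t \<omega>\<bar> M)"
      using znorm_nonneg by (simp add: rpow_def algebra_simps)
    finally show "ennreal \<bar>obs A t \<theta> \<omega> - obs B t \<theta> \<omega>\<bar> \<le> ennreal Cz * (?a \<omega> + ?b \<omega> + ?c \<omega>)"
      using Cz_nonneg by (simp add: ennreal_leI flip: ennreal_mult ennreal_plus)
  qed
  also have "\<dots> = ennreal Cz * ((\<integral>\<^sup>+\<omega>. ?a \<omega> \<partial>P) + (\<integral>\<^sup>+\<omega>. ?b \<omega> \<partial>P) + (\<integral>\<^sup>+\<omega>. ?c \<omega> \<partial>P))"
    by (simp add: nn_integral_cmult nn_integral_add)
  also have "\<dots> \<le> ennreal Cz * (ennreal (?d * rpow 1 M) + ennreal (?d * rpow ?w M) + ennreal (?d * rpow ?w M))"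
    by (intro mult_left_mono add_mono Lq_le_Holder LD LA LB L1 M_nonneg pos) auto
  also have "\<dots> = ennreal (Cz * (?d * rpow 1 M + ?d * rpow ?w M + ?d * rpow ?w M))"
  proof -
    have "0 \<le> ?d * rpow 1 M" "0 \<le> ?d * rpow ?w M" using pos by simp_all
    then show ?thesis using Cz_nonneg by (simp only: ennreal_mult ennreal_plus add_nonneg_nonneg)
  qed
  also have "Cz * (?d * rpow 1 M + ?d * rpow ?w M + ?d * rpow ?w M) = Lc * d"
    by (simp add: Lc_def rpow_def algebra_simps)
  finally show ?thesis .
qed

definition g0 :: "real ^ 'd \<Rightarrow> real" where
  "g0 \<theta> = \<bar>ell 0 0 \<theta>\<bar> + Lc * (vbar + 1)"

text \<open>Comparison with the zero process, along which the objective is the constant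
  \<open>ell 0 0 \<theta>\<close>. The distance bound is raised to \<open>vbar + 1\<close> because
  it has to be positive.\<close>

lemma obs_moment:
  assumes \<theta>: "\<theta> \<in> \<Theta>" and A: "adapted n A" and t: "t \<le> n"
    and w: "\<And>s. s \<in> {t - 1, t} \<Longrightarrow> Lq_le P (M + 1) (\<lambda>\<omega>. V (lagv A s \<omega>)) vbar"
  shows "(\<integral>\<^sup>+\<omega>. ennreal \<bar>obs A t \<theta> \<omega>\<bar> \<partial>P) \<le> ennreal (g0 \<theta>)"
proof -
  let ?Z = "\<lambda>_ _. 0 :: real"
  have Z: "adapted n ?Z" by (simp add: adapted_def)
  have Z0: "lagv ?Z s \<omega> = 0" for s \<omega> by (simp add: lags_def vec_eq_iff)
  have V0: "V 0 = 0" by (simp add: V_def)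
  have w': "Lq_le P (M + 1) (\<lambda>\<omega>. V (lagv A s \<omega>)) c" if "s \<in> {t - 1, t}" "vbar \<le> c" for s c
    by (rule Lq_le_weaken[OF w[OF that(1)] that(2) q_nonneg])
  have L0: "Lq_le P (M + 1) (\<lambda>_. 0) c" if "0 \<le> c" for c
    using Lq_le_weaken[OF Lq_le_const[of P "M + 1" 0], of c] that q_pos prob_space_axioms by simp
  have "(\<integral>\<^sup>+\<omega>. ennreal \<bar>obs A t \<theta> \<omega> - obs ?Z t \<theta> \<omega>\<bar> \<partial>P) \<le> ennreal (Lc * (vbar + 1))"
    by (rule obs_compare[OF \<theta> A Z t]) (use vbar_nonneg w' L0 in \<open>auto simp: Z0 V0\<close>)
  moreover have "obs ?Z t \<theta> \<omega> = ell 0 0 \<theta>" for \<omega> by (simp add: obs_def Z0)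
  ultimately have *: "(\<integral>\<^sup>+\<omega>. ennreal \<bar>obs A t \<theta> \<omega> - ell 0 0 \<theta>\<bar> \<partial>P) \<le> ennreal (Lc * (vbar + 1))" by simp
  have [measurable]: "obs A t \<theta> \<in> borel_measurable P" by (rule obs_measurable[OF A t \<theta>])
  have "(\<integral>\<^sup>+\<omega>. ennreal \<bar>obs A t \<theta> \<omega>\<bar> \<partial>P) \<le> (\<integral>\<^sup>+\<omega>. ennreal \<bar>ell 0 0 \<theta>\<bar> + ennreal \<bar>obs A t \<theta> \<omega> - ell 0 0 \<theta>\<bar> \<partial>P)"
    by (intro nn_integral_mono) (simp add: ennreal_leI flip: ennreal_plus)
  also have "\<dots> = ennreal \<bar>ell 0 0 \<theta>\<bar> + (\<integral>\<^sup>+\<omega>. ennreal \<bar>obs A t \<theta> \<omega> - ell 0 0 \<theta>\<bar> \<partial>P)"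
    by (simp add: nn_integral_add emeasure_space_1)
  also have "\<dots> \<le> ennreal \<bar>ell 0 0 \<theta>\<bar> + ennreal (Lc * (vbar + 1))" by (intro add_left_mono *)
  also have "\<dots> = ennreal (g0 \<theta>)"
    unfolding g0_def using Lc_nonneg vbar_nonneg by (simp flip: ennreal_plus)
  finally show ?thesis .
qed

text \<open>An m-dependent copy of \<open>obs\<close>: it involves the innovations at times \<open>t - m, \<dots>, t\<close> only.\<close>

definition obs_restart :: "(int \<Rightarrow> real) \<Rightarrow> nat \<Rightarrow> int \<Rightarrow> real ^ 'd \<Rightarrow> (int \<Rightarrow> real) \<Rightarrow> real" where
  "obs_restart a m t \<theta> e = ell (restart G a (t - 1 - int m) t e) (lags (restart G a (t - 1 - int m)) (t - 1) e) \<theta>"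

lemma obs_restart_measurable:
  assumes "\<theta> \<in> \<Theta>" "\<And>\<tau>. t - int m \<le> \<tau> \<Longrightarrow> \<tau> \<le> t \<Longrightarrow> (\<lambda>x. E x \<tau>) \<in> borel_measurable N"
    and "\<And>\<tau>. t - int m \<le> \<tau> \<Longrightarrow> \<tau> \<le> t \<Longrightarrow> a \<tau> \<in> {0..1}"
  shows "(\<lambda>x. obs_restart a m t \<theta> (E x)) \<in> borel_measurable N"
proof -
  have r: "(\<lambda>x. restart G a (t - 1 - int m) \<sigma> (E x)) \<in> borel_measurable N" if "\<sigma> \<le> t" for \<sigma>
    using that by (intro restart_measurable assms) auto
  show ?thesis
    unfolding obs_restart_def
  proof (intro ell_measurable[OF assms(1)] r borel_measurable_vec)
    fix i :: 'p
    show "(\<lambda>x. lags (restart G a (t - 1 - int m)) (t - 1) (E x) $ i) \<in> borel_measurable N"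
      unfolding lags_nth using coord_no_ge_1[of i] by (intro r) simp
  qed simp
qed

lemma obs_restart_cong:
  assumes "\<And>\<tau>. t - int m \<le> \<tau> \<Longrightarrow> \<tau> \<le> t \<Longrightarrow> e \<tau> = e' \<tau>"
  shows "obs_restart a m t \<theta> e = obs_restart a m t \<theta> e'"
proof -
  have r: "restart G a (t - 1 - int m) \<sigma> e = restart G a (t - 1 - int m) \<sigma> e'" if "\<sigma> \<le> t" for \<sigma>
    using that by (intro restart_cong assms) auto
  have "t - 1 + 1 - coord_no i \<le> t" for i :: 'p using coord_no_ge_1[of i] by simp
  then have "lags (restart G a (t - 1 - int m)) (t - 1) e = (lags (restart G a (t - 1 - int m)) (t - 1) e' :: real ^ 'p::{finite,linorder})"
    unfolding lags_def using r by (simp add: vec_eq_iff)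
  then show ?thesis using r by (simp add: obs_restart_def)
qed

text \<open>\<open>lam1\<close> and \<open>vbar + 1\<close>, instead of \<open>lam\<close> and
  \<open>vbar\<close>, keep the distance positive as \<open>obs_compare\<close> demands, and the
  decay can later be expressed through \<open>ln lam1\<close>.\<close>

definition coupling_error :: "nat \<Rightarrow> real" where
  "coupling_error m = Lc * (lam1 ^ m * (vbar + 1))"

lemma coupling_error_nonneg: "0 \<le> coupling_error m"
  unfolding coupling_error_def using Lc_nonneg lam1_bounds vbar_nonneg by simp

text \<open>The restart lies \<open>m + 1\<close> steps before t and m steps before t - 1, so both
  lag vectors have come within \<open>lam ^ m * vbar\<close>. The copy inherits its moment bound
  from the row and this difference.\<close>

lemma obs_restart_close:
  assumes \<theta>: "\<theta> \<in> \<Theta>" and X: "adapted n X" and sol: "\<And>t. t \<le> n \<Longrightarrow> solves X t (a t)" and t: "t \<le> n"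
    and v: "\<And>t. t \<le> n \<Longrightarrow> Lq_le P (M + 1) (\<lambda>\<omega>. V (lagv X t \<omega>)) vbar"
  shows "(\<integral>\<^sup>+\<omega>. ennreal \<bar>obs X t \<theta> \<omega> - obs_restart a m t \<theta> (\<lambda>i. \<epsilon> i \<omega>)\<bar> \<partial>P) \<le> ennreal (coupling_error m)"
proof -
  let ?s = "t - 1 - int m"
  let ?R = "\<lambda>\<tau> \<omega>. restart G a ?s \<tau> (\<lambda>i. \<epsilon> i \<omega>)"
  let ?D = "\<lambda>\<tau> \<omega>. X \<tau> \<omega> - ?R \<tau> \<omega>"
  have le: "lam ^ Suc m * vbar \<le> lam1 ^ m * (vbar + 1)" "lam ^ m * vbar \<le> lam1 ^ m * (vbar + 1)"
  proof -
    have "lam ^ m \<le> lam1 ^ m" using lam_nonneg lam1_bounds by (intro power_mono) auto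
    then show *: "lam ^ m * vbar \<le> lam1 ^ m * (vbar + 1)"
      using vbar_nonneg lam1_bounds by (intro mult_mono) auto
    have "lam ^ Suc m * vbar \<le> lam ^ m * vbar"
      using vbar_nonneg lam_nonneg lam_less_1 by (intro mult_right_mono power_decreasing) auto
    then show "lam ^ Suc m * vbar \<le> lam1 ^ m * (vbar + 1)" using * by linarith
  qed
  have "Lq_le P (M + 1) (\<lambda>\<omega>. V (lagv ?D t \<omega>)) (lam ^ Suc m * vbar)"
    using restart_close(2)[OF X sol t v, of "Suc m"] t by (simp add: algebra_simps)
  then have D1: "Lq_le P (M + 1) (\<lambda>\<omega>. V (lagv ?D t \<omega>)) (lam1 ^ m * (vbar + 1))"
    using le(1) q_nonneg by (rule Lq_le_weaken)
  have "Lq_le P (M + 1) (\<lambda>\<omega>. V (lagv ?D (t - 1) \<omega>)) (lam ^ m * vbar)"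
    using restart_close(2)[OF X sol _ v, of "t - 1" m] t by simp
  then have D2: "Lq_le P (M + 1) (\<lambda>\<omega>. V (lagv ?D (t - 1) \<omega>)) (lam1 ^ m * (vbar + 1))"
    using le(2) q_nonneg by (rule Lq_le_weaken)
  have R: "adapted n ?R"
    using restart_close(1)[OF X sol t v, of "Suc m"] t by (simp add: algebra_simps)
  have pw: "lam1 ^ m \<le> 1" using lam1_bounds by (intro power_le_one) auto
  have VR: "Lq_le P (M + 1) (\<lambda>\<omega>. V (lagv ?R s \<omega>)) (2 * vbar + 1)" if s: "s \<in> {t - 1, t}" for s
  proof -
    have "Lq_le P (M + 1) (\<lambda>\<omega>. V (lagv X s \<omega>) + V (lagv ?D s \<omega>)) (vbar + lam1 ^ m * (vbar + 1))"
      using s D1 D2 v t by (intro Lq_le_add q_ge_1) auto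
    moreover have "vbar + lam1 ^ m * (vbar + 1) \<le> 2 * vbar + 1"
      using mult_right_mono[OF pw, of "vbar + 1"] vbar_nonneg by simp
    ultimately have *: "Lq_le P (M + 1) (\<lambda>\<omega>. V (lagv X s \<omega>) + V (lagv ?D s \<omega>)) (2 * vbar + 1)"
      using q_nonneg by (rule Lq_le_weaken)
    show ?thesis
    proof (rule Lq_le_mono[OF *])
      have [measurable]: "lagv ?R s \<in> borel_measurable P"
        using s t by (intro adapted_lags_measurable[OF R]) auto
      show "(\<lambda>\<omega>. V (lagv ?R s \<omega>)) \<in> borel_measurable P" by measurable
      fix \<omega>
      from V_diff_le[of "lagv X s \<omega>" "lagv ?D s \<omega>"]
      show "\<bar>V (lagv ?R s \<omega>)\<bar> \<le> \<bar>V (lagv X s \<omega>) + V (lagv ?D s \<omega>)\<bar>"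
        using V_nonneg by (simp add: lags_diff add_nonneg_nonneg)
    qed (rule q_nonneg)
  qed
  have VX: "Lq_le P (M + 1) (\<lambda>\<omega>. V (lagv X s \<omega>)) (2 * vbar + 1)" if "s \<in> {t - 1, t}" for s
    using that t vbar_nonneg by (intro Lq_le_weaken[OF v _ q_nonneg]) auto
  have "(\<integral>\<^sup>+\<omega>. ennreal \<bar>obs X t \<theta> \<omega> - obs ?R t \<theta> \<omega>\<bar> \<partial>P) \<le> ennreal (Lc * (lam1 ^ m * (vbar + 1)))"
    by (rule obs_compare[OF \<theta> X R t _ _ VX VR]) (use D1 D2 lam1_bounds vbar_nonneg in auto)
  moreover have "obs ?R t \<theta> \<omega> = obs_restart a m t \<theta> (\<lambda>i. \<epsilon> i \<omega>)" for \<omega>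
    by (simp add: obs_def obs_restart_def lags_def)
  ultimately show ?thesis by (simp add: coupling_error_def)
qed

text \<open>Indices more than m apart use disjoint blocks of innovations, so the truncated copies
  are independent. The bound is in terms of \<open>J\<close> and not of \<open>card I\<close>, to be
  the same for all residue classes.\<close>

lemma restart_Hoeffding:
  assumes \<theta>: "\<theta> \<in> \<Theta>" and a: "\<And>t. t \<le> n \<Longrightarrow> a t \<in> {0..1}" and I: "finite I" "I \<subseteq> {..n}" "card I \<le> J"
    and sep: "\<And>s t. s \<in> I \<Longrightarrow> t \<in> I \<Longrightarrow> s < t \<Longrightarrow> s < t - int m" and R: "0 < R" and y: "0 < y"
  defines "f \<equiv> \<lambda>t \<omega>. trunc R (obs_restart a m t \<theta> (\<lambda>i. \<epsilon> i \<omega>))"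
  shows "prob {\<omega> \<in> space P. y \<le> \<bar>(\<Sum>t\<in>I. f t \<omega>) - (\<Sum>t\<in>I. expectation (f t))\<bar>} \<le> 2 * exp (- (y\<^sup>2 / (2 * real J * R\<^sup>2)))"
proof (cases "I = {}")
  case True
  then show ?thesis using y by simp
next
  case False
  let ?K = "\<lambda>t. {t - int m..t}"
  let ?Y = "\<lambda>t e. trunc R (obs_restart a m t \<theta> e)"
  have "indep_vars (\<lambda>t. PiM (?K t) (\<lambda>_. borel)) (\<lambda>t \<omega>. restrict (\<lambda>i. \<epsilon> i \<omega>) (?K t)) I"
  proof (rule indep_vars_restrict)
    show "indep_vars (\<lambda>_. borel) \<epsilon> UNIV" using innov by (simp add: iid_def)
    show "disjoint_family_on ?K I"
      unfolding disjoint_family_on_def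
    proof (intro ballI impI)
      fix s t assume "s \<in> I" "t \<in> I" "s \<noteq> t"
      then show "?K s \<inter> ?K t = {}" using sep[of s t] sep[of t s] by (cases "s < t") auto
    qed
  qed simp
  then have "indep_vars (\<lambda>_. borel) (\<lambda>t \<omega>. ?Y t (restrict (\<lambda>i. \<epsilon> i \<omega>) (?K t))) I"
  proof (rule indep_vars_compose2)
    fix t assume "t \<in> I"
    then have "(\<lambda>e. obs_restart a m t \<theta> e) \<in> borel_measurable (PiM (?K t) (\<lambda>_. borel))"
      using I by (intro obs_restart_measurable[OF \<theta>] measurable_component_singleton a) auto
    then show "?Y t \<in> borel_measurable (PiM (?K t) (\<lambda>_. borel))" by measurable
  qed
  moreover have "?Y t (restrict (\<lambda>i. \<epsilon> i \<omega>) (?K t)) = f t \<omega>" for t \<omega>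
    unfolding f_def by (intro arg_cong[where f = "trunc R"] obs_restart_cong) simp
  ultimately have indep: "indep_vars (\<lambda>_. borel) f I" by simp
  interpret H: Hoeffding_ineq P I f "\<lambda>_. - R" "\<lambda>_. R" "\<Sum>t\<in>I. expectation (f t)"
  proof unfold_locales
    show "AE \<omega> in P. f t \<omega> \<in> {- R..R}" for t
      using abs_trunc_le[of R] R by (auto simp: f_def abs_le_iff minus_le_iff)
  qed (use I indep in auto)
  have card: "0 < card I" using False I by (simp add: card_gt_0_iff)
  have sq: "(\<Sum>i\<in>I. (R - - R)\<^sup>2) = 4 * real (card I) * R\<^sup>2" by (simp add: power2_eq_square)
  have "prob {\<omega> \<in> space P. y \<le> \<bar>(\<Sum>t\<in>I. f t \<omega>) - (\<Sum>t\<in>I. expectation (f t))\<bar>} \<le> 2 * exp (- 2 * y\<^sup>2 / (4 * real (card I) * R\<^sup>2))"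
    using H.Hoeffding_ineq_abs_ge[of y] y R card unfolding sq by simp
  also have "\<dots> \<le> 2 * exp (- (y\<^sup>2 / (2 * real J * R\<^sup>2)))"
  proof -
    have "y\<^sup>2 / (2 * real J * R\<^sup>2) \<le> y\<^sup>2 / (2 * real (card I) * R\<^sup>2)"
      using I card R by (intro divide_left_mono mult_right_mono mult_left_mono mult_pos_pos) auto
    also have "\<dots> = 2 * y\<^sup>2 / (4 * real (card I) * R\<^sup>2)" by simp
    finally show ?thesis by simp
  qed
  finally show ?thesis .
qed

text \<open>Three errors of size y add up: the passage to the m-dependent copies, the corresponding
  change of the means, and the fluctuation of the copies. The last one is split over the residue
  classes modulo \<open>m + 1\<close>, each being allowed \<open>y / (m + 1)\<close>.\<close>

lemma bounded_concentration:
  assumes \<theta>: "\<theta> \<in> \<Theta>" and X: "adapted n X" and sol: "\<And>t. t \<le> n \<Longrightarrow> solves X t (a t)"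
    and v: "\<And>t. t \<le> n \<Longrightarrow> Lq_le P (M + 1) (\<lambda>\<omega>. V (lagv X t \<omega>)) vbar"
    and kj: "k + int j \<le> n" "j \<le> J" and R: "0 < R" and y: "0 < y" "real J * coupling_error m \<le> y"
  shows "prob {\<omega> \<in> space P. 3 * y < \<bar>\<Sum>t\<in>{k<..k + int j}. trunc R (obs X t \<theta> \<omega>) - expectation (\<lambda>\<omega>. trunc R (obs X t \<theta> \<omega>))\<bar>}
    \<le> real J * coupling_error m / y + 2 * (real m + 1) * exp (- ((y / (real m + 1))\<^sup>2 / (2 * real J * R\<^sup>2)))"
proof -
  let ?W = "{k<..k + int j}"
  let ?f = "\<lambda>t \<omega>. trunc R (obs X t \<theta> \<omega>)"
  let ?g = "\<lambda>t \<omega>. trunc R (obs_restart a m t \<theta> (\<lambda>i. \<epsilon> i \<omega>))"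
  let ?C = "\<lambda>c. {t \<in> ?W. t mod (int m + 1) = c}"
  let ?y = "y / (real m + 1)"
  have a: "a t \<in> {0..1}" if "t \<le> n" for t using sol[OF that] by (simp add: solves_def)
  have mod_le: "x mod (int m + 1) \<le> int m" for x :: int
    using pos_mod_bound[of "int m + 1" x] by linarith
  have tn: "t \<le> n" if "t \<in> ?W" for t using that kj by simp
  have fm [measurable]: "?f t \<in> borel_measurable P" if "t \<in> ?W" for t
    using obs_measurable[OF X tn[OF that] \<theta>] by measurable
  have gm [measurable]: "?g t \<in> borel_measurable P" if "t \<in> ?W" for t
  proof -
    have "(\<lambda>\<omega>. obs_restart a m t \<theta> (\<lambda>i. \<epsilon> i \<omega>)) \<in> borel_measurable P"
      using tn[OF that] by (intro obs_restart_measurable[OF \<theta>] a) auto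
    then show ?thesis by measurable
  qed
  have bounded_int: "integrable P h" if "h \<in> borel_measurable P" "\<And>\<omega>. \<bar>h \<omega>\<bar> \<le> R" for h :: "'w \<Rightarrow> real"
    using that by (intro integrable_const_bound[of _ R]) auto
  have int: "integrable P (?f t)" "integrable P (?g t)" if "t \<in> ?W" for t
    using that abs_trunc_le R by (auto intro!: bounded_int simp del: greaterThanAtMost_iff)
  have close: "(\<integral>\<^sup>+\<omega>. ennreal \<bar>?f t \<omega> - ?g t \<omega>\<bar> \<partial>P) \<le> ennreal (coupling_error m)" if t: "t \<in> ?W" for t
  proof -
    have "(\<integral>\<^sup>+\<omega>. ennreal \<bar>?f t \<omega> - ?g t \<omega>\<bar> \<partial>P)
        \<le> (\<integral>\<^sup>+\<omega>. ennreal \<bar>obs X t \<theta> \<omega> - obs_restart a m t \<theta> (\<lambda>i. \<epsilon> i \<omega>)\<bar> \<partial>P)"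
      by (intro nn_integral_mono ennreal_leI trunc_lipschitz)
    also have "\<dots> \<le> ennreal (coupling_error m)" by (rule obs_restart_close[OF \<theta> X sol tn[OF t] v])
    finally show ?thesis .
  qed
  have Eclose: "\<bar>expectation (?f t) - expectation (?g t)\<bar> \<le> coupling_error m" if t: "t \<in> ?W" for t
  proof -
    have "(\<lambda>\<omega>. ?f t \<omega> - ?g t \<omega>) \<in> borel_measurable P" using fm[OF t] gm[OF t] by measurable
    from moment_bound(3)[OF this close[OF t] coupling_error_nonneg] int[OF t] show ?thesis by simp
  qed
  define B0 where "B0 = {\<omega> \<in> space P. y < (\<Sum>t\<in>?W. \<bar>?f t \<omega> - ?g t \<omega>\<bar>)}"
  define B where "B c = {\<omega> \<in> space P. ?y \<le> \<bar>(\<Sum>t\<in>?C c. ?g t \<omega>) - (\<Sum>t\<in>?C c. expectation (?g t))\<bar>}" for c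
  have [measurable]: "(\<lambda>\<omega>. \<Sum>t\<in>?W. \<bar>?f t \<omega> - ?g t \<omega>\<bar>) \<in> borel_measurable P"
    by (intro borel_measurable_sum borel_measurable_abs borel_measurable_diff fm gm)
  have B0m: "B0 \<in> sets P" unfolding B0_def by measurable
  have Bm: "B c \<in> sets P" for c
  proof -
    have [measurable]: "(\<lambda>\<omega>. \<Sum>t\<in>?C c. ?g t \<omega>) \<in> borel_measurable P"
      by (intro borel_measurable_sum gm) simp
    show ?thesis unfolding B_def by measurable
  qed
  have B0p: "prob B0 \<le> real J * coupling_error m / y"
  proof -
    have "(\<integral>\<^sup>+\<omega>. ennreal \<bar>\<Sum>t\<in>?W. \<bar>?f t \<omega> - ?g t \<omega>\<bar>\<bar> \<partial>P) = (\<integral>\<^sup>+\<omega>. (\<Sum>t\<in>?W. ennreal \<bar>?f t \<omega> - ?g t \<omega>\<bar>) \<partial>P)"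
      by (simp add: sum_nonneg sum_ennreal)
    also have "\<dots> = (\<Sum>t\<in>?W. \<integral>\<^sup>+\<omega>. ennreal \<bar>?f t \<omega> - ?g t \<omega>\<bar> \<partial>P)"
    proof (rule nn_integral_sum)
      fix t assume t: "t \<in> ?W"
      show "(\<lambda>\<omega>. ennreal \<bar>?f t \<omega> - ?g t \<omega>\<bar>) \<in> borel_measurable P" using fm[OF t] gm[OF t] by measurable
    qed
    also have "\<dots> \<le> (\<Sum>t\<in>?W. ennreal (coupling_error m))" by (intro sum_mono close)
    also have "\<dots> = ennreal (real j * coupling_error m)"
      using coupling_error_nonneg by (simp add: ennreal_mult ennreal_of_nat_eq_real_of_nat)
    also have "\<dots> \<le> ennreal (real J * coupling_error m)"
      using kj coupling_error_nonneg by (intro ennreal_leI mult_right_mono) auto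
    finally show ?thesis
      unfolding B0_def using coupling_error_nonneg y by (intro prob_gt_le) auto
  qed
  have Bp: "prob (B c) \<le> 2 * exp (- (?y\<^sup>2 / (2 * real J * R\<^sup>2)))" for c
    unfolding B_def
  proof (rule restart_Hoeffding[OF \<theta> a])
    show "finite (?C c)" by (rule finite_subset[of _ ?W]) auto
    show "?C c \<subseteq> {..n}" using tn by auto
    have "card (?C c) \<le> card ?W" by (intro card_mono) auto
    then show "card (?C c) \<le> J" using kj by simp
    fix s t assume "s \<in> ?C c" "t \<in> ?C c" "s < t"
    \<comment> \<open>Distinct members of a residue class differ by a nonzero multiple of
      \<open>m + 1\<close>, hence by more than m.\<close>
    then have "(t - s) mod (int m + 1) = 0" "0 < t - s" by (auto simp: mod_eq_dvd_iff dvd_imp_mod_0)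
    then have "int m + 1 \<le> t - s" by (intro zdvd_imp_le) (auto simp: mod_eq_0_iff_dvd)
    then show "s < t - int m" by simp
  qed (use R y in auto)
  have "{\<omega> \<in> space P. 3 * y < \<bar>\<Sum>t\<in>?W. ?f t \<omega> - expectation (?f t)\<bar>} \<subseteq> B0 \<union> (\<Union>c\<in>{0..int m}. B c)"
  proof (rule subsetI, rule ccontr)
    fix \<omega> assume "\<omega> \<in> {\<omega> \<in> space P. 3 * y < \<bar>\<Sum>t\<in>?W. ?f t \<omega> - expectation (?f t)\<bar>}"
    then have \<omega>: "\<omega> \<in> space P" and big: "3 * y < \<bar>\<Sum>t\<in>?W. ?f t \<omega> - expectation (?f t)\<bar>" by auto
    assume "\<omega> \<notin> B0 \<union> (\<Union>c\<in>{0..int m}. B c)"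
    then have n0: "(\<Sum>t\<in>?W. \<bar>?f t \<omega> - ?g t \<omega>\<bar>) \<le> y"
      and n1: "\<And>c. c \<in> {0..int m} \<Longrightarrow> \<bar>(\<Sum>t\<in>?C c. ?g t \<omega>) - (\<Sum>t\<in>?C c. expectation (?g t))\<bar> < ?y"
      using \<omega> by (auto simp: B0_def B_def not_less not_le)
    have "(\<Sum>t\<in>?W. ?f t \<omega> - expectation (?f t)) = (\<Sum>t\<in>?W. ?f t \<omega> - ?g t \<omega>)
        - (\<Sum>t\<in>?W. expectation (?f t) - expectation (?g t)) + (\<Sum>t\<in>?W. ?g t \<omega> - expectation (?g t))"
      by (simp add: sum_subtractf)
    moreover have "\<bar>\<Sum>t\<in>?W. ?f t \<omega> - ?g t \<omega>\<bar> \<le> y"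
      using sum_abs[of "\<lambda>t. ?f t \<omega> - ?g t \<omega>" ?W] n0 by linarith
    moreover have "\<bar>\<Sum>t\<in>?W. expectation (?f t) - expectation (?g t)\<bar> \<le> y"
    proof -
      have "\<bar>\<Sum>t\<in>?W. expectation (?f t) - expectation (?g t)\<bar> \<le> (\<Sum>t\<in>?W. coupling_error m)"
        by (rule order_trans[OF sum_abs]) (intro sum_mono Eclose)
      also have "\<dots> = real j * coupling_error m" by simp
      also have "\<dots> \<le> real J * coupling_error m"
        using kj coupling_error_nonneg by (intro mult_right_mono) auto
      finally show ?thesis using y by linarith
    qed
    moreover have "\<bar>\<Sum>t\<in>?W. ?g t \<omega> - expectation (?g t)\<bar> \<le> y"
    proof -
      have eq: "(\<Sum>t\<in>?W. ?g t \<omega> - expectation (?g t)) = (\<Sum>c\<in>{0..int m}. \<Sum>t\<in>?C c. ?g t \<omega> - expectation (?g t))"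
      proof (rule sum.group[symmetric])
        show "(\<lambda>t. t mod (int m + 1)) ` ?W \<subseteq> {0..int m}" by (auto simp: mod_le)
      qed simp_all
      have "\<bar>\<Sum>t\<in>?W. ?g t \<omega> - expectation (?g t)\<bar> \<le> (\<Sum>c\<in>{0..int m}. \<bar>\<Sum>t\<in>?C c. ?g t \<omega> - expectation (?g t)\<bar>)" unfolding eq by (rule sum_abs)
      also have "\<dots> \<le> (\<Sum>c\<in>{0..int m}. ?y)"
        using n1 by (intro sum_mono) (simp add: sum_subtractf less_imp_le)
      also have "\<dots> = y" by simp
      finally show ?thesis .
    qed
    ultimately show False using big by linarith
  qed
  then have "prob {\<omega> \<in> space P. 3 * y < \<bar>\<Sum>t\<in>?W. ?f t \<omega> - expectation (?f t)\<bar>} \<le> prob (B0 \<union> (\<Union>c\<in>{0..int m}. B c))"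
    using B0m Bm by (intro finite_measure_mono) auto
  also have "\<dots> \<le> prob B0 + prob (\<Union>c\<in>{0..int m}. B c)"
    using B0m Bm by (intro measure_Un_le) auto
  also have "prob (\<Union>c\<in>{0..int m}. B c) \<le> (\<Sum>c\<in>{0..int m}. prob (B c))"
    using Bm by (intro measure_UNION_le) auto
  also have "\<dots> \<le> (\<Sum>c\<in>{0..int m}. 2 * exp (- (?y\<^sup>2 / (2 * real J * R\<^sup>2))))"
    by (intro sum_mono Bp)
  also have "\<dots> = 2 * (real m + 1) * exp (- (?y\<^sup>2 / (2 * real J * R\<^sup>2)))" by simp
  finally show ?thesis using B0p by linarith
qed

end

section \<open>Kernel sums\<close>

lemma sum_window: "(\<Sum>t\<in>{k<..k + int N}. f t) = (\<Sum>i<N. f (k + 1 + int i))"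
proof (induction N)
  case (Suc N)
  have "{k<..k + int (Suc N)} = insert (k + 1 + int N) {k<..k + int N}" by auto
  then show ?case using Suc by (simp add: add.commute)
qed simp

lemma kernel_boundsE:
  assumes "kernel K"
  obtains BK where "0 \<le> BK" "\<And>x. \<bar>K x\<bar> \<le> BK"
    "\<And>(x :: nat \<Rightarrow> real) N. mono x \<Longrightarrow> (\<Sum>i<N. \<bar>K (x (Suc i)) - K (x i)\<bar>) \<le> BK"
proof -
  from assms obtain B1 where B1: "\<And>x. \<bar>K x\<bar> \<le> B1"
    unfolding kernel_def bounded_iff by auto
  from assms obtain B2 where B2: "\<And>(x :: nat \<Rightarrow> real) N. mono x \<Longrightarrow> (\<Sum>i<N. \<bar>K (x (Suc i)) - K (x i)\<bar>) \<le> B2"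
    unfolding kernel_def bounded_variation_def by blast
  have "0 \<le> B1" using B1[of 0] by linarith
  then show thesis
    using B1 B2 by (intro that[of "max B1 B2"]) (auto simp: le_max_iff_disj)
qed

lemma summation_by_parts:
  fixes \<kappa> \<alpha> :: "nat \<Rightarrow> real"
  shows "(\<Sum>i<Suc n. \<kappa> i * \<alpha> i) = \<kappa> n * (\<Sum>i<Suc n. \<alpha> i) - (\<Sum>i<n. (\<kappa> (Suc i) - \<kappa> i) * (\<Sum>l<Suc i. \<alpha> l))"
proof (induction n)
  case (Suc n)
  have "(\<Sum>i<Suc (Suc n). \<kappa> i * \<alpha> i) = (\<Sum>i<Suc n. \<kappa> i * \<alpha> i) + \<kappa> (Suc n) * \<alpha> (Suc n)" by simp
  also have "\<dots> = \<kappa> n * (\<Sum>i<Suc n. \<alpha> i) - (\<Sum>i<n. (\<kappa> (Suc i) - \<kappa> i) * (\<Sum>l<Suc i. \<alpha> l)) + \<kappa> (Suc n) * \<alpha> (Suc n)"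
    unfolding Suc.IH ..
  also have "\<dots> = \<kappa> (Suc n) * (\<Sum>i<Suc (Suc n). \<alpha> i) - (\<Sum>i<Suc n. (\<kappa> (Suc i) - \<kappa> i) * (\<Sum>l<Suc i. \<alpha> l))"
    by (simp add: algebra_simps)
  finally show ?case .
qed simp

text \<open>The boundary term of the summation by parts costs the supremum of \<open>K\<close> and
  the increments cost its variation, both at most \<open>BK\<close>. Only partial sums of
  \<open>\<alpha>\<close> enter, so cancellation inside the window is retained.\<close>

lemma abs_kernel_sum_le:
  fixes x \<alpha> :: "nat \<Rightarrow> real"
  assumes BK: "0 \<le> BK" "\<And>x. \<bar>K x\<bar> \<le> BK"
      "\<And>(x :: nat \<Rightarrow> real) N. mono x \<Longrightarrow> (\<Sum>i<N. \<bar>K (x (Suc i)) - K (x i)\<bar>) \<le> BK"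
    and x: "mono x" and S: "\<And>j. j \<le> N \<Longrightarrow> \<bar>\<Sum>i<j. \<alpha> i\<bar> \<le> S"
  shows "\<bar>\<Sum>i<N. K (x i) * \<alpha> i\<bar> \<le> 2 * BK * S"
proof (cases N)
  case 0
  then show ?thesis using BK(1) S[of 0] by simp
next
  case (Suc n)
  have S0: "0 \<le> S" using S[of 0] by simp
  have "\<bar>\<Sum>i<n. (K (x (Suc i)) - K (x i)) * (\<Sum>l<Suc i. \<alpha> l)\<bar> \<le> (\<Sum>i<n. \<bar>K (x (Suc i)) - K (x i)\<bar> * S)"
    using S Suc by (intro order_trans[OF sum_abs] sum_mono) (auto simp: abs_mult intro!: mult_left_mono simp del: sum.lessThan_Suc)
  also have "\<dots> = (\<Sum>i<n. \<bar>K (x (Suc i)) - K (x i)\<bar>) * S" by (simp add: sum_distrib_right)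
  also have "\<dots> \<le> BK * S" by (intro mult_right_mono BK x S0)
  finally have 1: "\<bar>\<Sum>i<n. (K (x (Suc i)) - K (x i)) * (\<Sum>l<Suc i. \<alpha> l)\<bar> \<le> BK * S" .
  have 2: "\<bar>K (x n) * (\<Sum>i<Suc n. \<alpha> i)\<bar> \<le> BK * S"
    unfolding abs_mult using BK S[of "Suc n"] Suc S0 by (intro mult_mono) (auto simp del: sum.lessThan_Suc)
  show ?thesis
    unfolding Suc summation_by_parts using 1 2 by linarith
qed

text \<open>Averaging the Riemann sums over all shifts \<open>s \<in> [0, h)\<close> of the grid gives the integral exactly,
  and a shift changes the sum by at most the total variation.\<close>

lemma kernel_Riemann_sum:
  assumes K: "kernel K" and BK: "\<And>(x :: nat \<Rightarrow> real) N. mono x \<Longrightarrow> (\<Sum>i<N. \<bar>K (x (Suc i)) - K (x i)\<bar>) \<le> BK"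
    and h: "0 < h" and y: "y < -1/2" "1/2 \<le> y + real N * h"
  shows "\<bar>h * (\<Sum>i<N. K (y + real (Suc i) * h)) - 1\<bar> \<le> h * BK"
proof -
  have int1: "(LINT x|lborel. K x) = 1" using K by (simp add: kernel_def)
  \<comment> \<open>the integral of a non-integrable function is 0\<close>
  then have Kint: "integrable lborel K" using not_integrable_integral_eq by fastforce
  have [measurable]: "K \<in> borel_measurable borel" using Kint by auto
  let ?x = "\<lambda>i. y + real (Suc i) * h"
  let ?I = "\<lambda>i. {y + real i * h<..?x i}"
  have cover: "(\<Sum>i<n. indicator (?I i) x) = (indicator {y<..y + real n * h} x :: real)" for x n
  proof (induction n)
    case (Suc n)
    have nn: "0 \<le> h * real n" using h by simp
    have "indicator {y<..y + real (Suc n) * h} x = (indicator {y<..y + real n * h} x + indicator (?I n) x :: real)"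
      by (auto simp: indicator_def algebra_simps) (use nn h in linarith)+
    then show ?case using Suc by simp
  qed simp
  have "K x = (\<Sum>i<N. indicator (?I i) x * K x)" for x
  proof (cases "x \<in> {y<..y + real N * h}")
    case True
    then show ?thesis unfolding sum_distrib_right[symmetric] cover by simp
  next
    case False
    then have "x \<notin> {-1/2..1/2}" using y by auto
    then have "K x = 0" using K unfolding kernel_def by blast
    then show ?thesis by simp
  qed
  then have "(LINT x|lborel. K x) = (LINT x|lborel. (\<Sum>i<N. indicator (?I i) x * K x))"
    by (rule Bochner_Integration.integral_cong[OF refl])
  then have "1 = (LINT x|lborel. (\<Sum>i<N. indicator (?I i) x * K x))" unfolding int1 .
  also have "\<dots> = (\<Sum>i<N. LINT x|lborel. indicator (?I i) x * K x)"
    using integrable_mult_indicator[OF _ Kint] by (intro Bochner_Integration.integral_sum) auto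
  \<comment> \<open>The substitution \<open>x = ?x i - s\<close> moves each cell onto the common
    range \<open>{0..<h}\<close> of shifts; the reflection turns cells closed on the right into a
    range closed on the left.\<close>
  also have "\<dots> = (\<Sum>i<N. LINT s|lborel. indicator {0..<h} s * K (?x i - s))"
  proof (intro sum.cong refl)
    fix i
    have "(LINT x|lborel. indicator (?I i) x * K x) = (LINT s|lborel. indicator (?I i) (?x i + - 1 * s) * K (?x i + - 1 * s))"
      by (subst lborel_integral_real_affine[where c = "- 1" and t = "?x i"]) auto
    also have "\<dots> = (LINT s|lborel. indicator {0..<h} s * K (?x i - s))"
      by (intro Bochner_Integration.integral_cong) (auto simp: indicator_def algebra_simps)
    finally show "(LINT x|lborel. indicator (?I i) x * K x) = (LINT s|lborel. indicator {0..<h} s * K (?x i - s))" .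
  qed
  finally have one: "1 = (\<Sum>i<N. LINT s|lborel. indicator {0..<h} s * K (?x i - s))" .
  have int_shift: "integrable lborel (\<lambda>s. indicator {0..<h} s * K (c - s))" for c
  proof -
    have "integrable lborel (\<lambda>s. K (c + - 1 * s))"
      by (rule lborel_integrable_real_affine[OF Kint]) simp
    then show ?thesis
      using integrable_mult_indicator[of "{0..<h}" lborel "\<lambda>s. K (c - s)"] by simp
  qed
  have int_const: "integrable lborel (\<lambda>s. indicator {0..<h} s * c)" for c :: real
    using h by (intro integrable_mult_left) (simp add: integrable_indicator_iff)
  have const: "(LINT s|lborel. indicator {0..<h} s * c) = h * c" for c :: real
    using h by simp
  have "h * (\<Sum>i<N. K (?x i)) - 1 = (\<Sum>i<N. (LINT s|lborel. indicator {0..<h} s * K (?x i)) - (LINT s|lborel. indicator {0..<h} s * K (?x i - s)))"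
    unfolding const sum_subtractf one[symmetric] by (simp add: sum_distrib_left)
  also have "\<dots> = (\<Sum>i<N. LINT s|lborel. indicator {0..<h} s * K (?x i) - indicator {0..<h} s * K (?x i - s))"
    by (intro sum.cong refl Bochner_Integration.integral_diff[symmetric] int_const int_shift)
  also have "\<dots> = (LINT s|lborel. (\<Sum>i<N. indicator {0..<h} s * K (?x i) - indicator {0..<h} s * K (?x i - s)))"
    by (intro Bochner_Integration.integral_sum[symmetric] Bochner_Integration.integrable_diff int_const int_shift)
  finally have eq: "h * (\<Sum>i<N. K (?x i)) - 1
    = (LINT s|lborel. (\<Sum>i<N. indicator {0..<h} s * K (?x i) - indicator {0..<h} s * K (?x i - s)))" .
  have "\<bar>\<dots>\<bar> \<le> (LINT s|lborel. indicator {0..<h} s * BK)"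
  proof (rule integral_abs_bound[THEN order_trans], rule integral_mono)
    show "integrable lborel (\<lambda>s. \<bar>\<Sum>i<N. indicator {0..<h} s * K (?x i) - indicator {0..<h} s * K (?x i - s)\<bar>)"
      by (intro integrable_abs Bochner_Integration.integrable_sum Bochner_Integration.integrable_diff int_const int_shift)
    show "integrable lborel (\<lambda>s. indicator {0..<h} s * BK)" by (rule int_const)
    fix s :: real
    show "\<bar>\<Sum>i<N. indicator {0..<h} s * K (?x i) - indicator {0..<h} s * K (?x i - s)\<bar> \<le> indicator {0..<h} s * BK"
    proof (cases "s \<in> {0..<h}")
      case True
      \<comment> \<open>\<open>z\<close> interleaves the nodes with their shifts:
        \<open>?x 0 - s\<close>, \<open>?x 0\<close>, \<open>?x 1 - s\<close>, and so on, increasing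
        because \<open>s < h\<close>. The differences between a node and its own shift are every
        other increment of this one sequence, hence bounded together by the variation.\<close>
      define z where "z j = y + real (Suc (j div 2)) * h - (if even j then s else 0)" for j :: nat
      have "mono z"
        unfolding mono_iff_le_Suc
      proof
        fix j
        show "z j \<le> z (Suc j)"
          using True h by (cases "even j") (auto simp: z_def algebra_simps elim!: evenE oddE)
      qed
      then have "(\<Sum>j<2 * N. \<bar>K (z (Suc j)) - K (z j)\<bar>) \<le> BK" by (rule BK)
      moreover have "(\<Sum>i<n. \<bar>K (?x i) - K (?x i - s)\<bar>) \<le> (\<Sum>j<2 * n. \<bar>K (z (Suc j)) - K (z j)\<bar>)" for n
      proof (induction n)
        case (Suc n)
        have "z (2 * n) = ?x n - s" "z (Suc (2 * n)) = ?x n" by (auto simp: z_def)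
        then show ?case using Suc by simp
      qed simp
      ultimately have "(\<Sum>i<N. \<bar>K (?x i) - K (?x i - s)\<bar>) \<le> BK" by (meson order_trans)
      then have "\<bar>\<Sum>i<N. K (?x i) - K (?x i - s)\<bar> \<le> BK" by (rule order_trans[OF sum_abs])
      then show ?thesis using True by simp
    qed simp
  qed
  then show ?thesis unfolding eq const .
qed

definition window :: "nat \<Rightarrow> nat \<Rightarrow> real \<Rightarrow> real \<Rightarrow> int set" where
  "window p n b u = {t \<in> {int p + 1..int n}. \<bar>real_of_int t / real n - u\<bar> \<le> b / 2}"

text \<open>The window is a block of consecutive times, \<open>k\<close> being one less than the
  first since the interval is open on the left. A real interval of length \<open>n * b\<close>
  contains at most \<open>n * b + 1\<close> integers. An empty window is represented by
  \<open>k = 0\<close> and \<open>j = 0\<close>.\<close>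

lemma window_interval:
  assumes n: "1 \<le> n" and b: "0 < b"
  obtains k j where "window p n b u = {k<..k + int j}" "0 \<le> k" "k + int j \<le> int n" "real j \<le> real n * b + 1"
proof -
  define r where "r = min (int n) \<lfloor>real n * (u + b / 2)\<rfloor>"
  define k where "k = max (int p) (\<lceil>real n * (u - b / 2)\<rceil> - 1)"
  have W: "window p n b u = {k<..r}"
  proof (intro set_eqI iffI)
    fix t assume "t \<in> window p n b u"
    then have t: "int p + 1 \<le> t" "t \<le> int n" "\<bar>real_of_int t / real n - u\<bar> \<le> b / 2" by (auto simp: window_def)
    then have "u - b / 2 \<le> real_of_int t / real n" "real_of_int t / real n \<le> u + b / 2" by linarith+
    then have "real n * (u - b / 2) \<le> real_of_int t" "real_of_int t \<le> real n * (u + b / 2)"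
      using n by (auto simp: field_simps)
    then have "\<lceil>real n * (u - b / 2)\<rceil> \<le> t" "t \<le> \<lfloor>real n * (u + b / 2)\<rfloor>"
      by (auto simp: ceiling_le_iff le_floor_iff)
    then show "t \<in> {k<..r}" using t by (auto simp: k_def r_def)
  next
    fix t assume "t \<in> {k<..r}"
    then have t: "int p + 1 \<le> t" "t \<le> int n" "\<lceil>real n * (u - b / 2)\<rceil> \<le> t" "t \<le> \<lfloor>real n * (u + b / 2)\<rfloor>"
      by (auto simp: k_def r_def)
    then have "real n * (u - b / 2) \<le> real_of_int t" "real_of_int t \<le> real n * (u + b / 2)"
      by (auto simp: ceiling_le_iff le_floor_iff)
    then have "u - b / 2 \<le> real_of_int t / real n" "real_of_int t / real n \<le> u + b / 2"
      using n by (auto simp: field_simps)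
    then have "\<bar>real_of_int t / real n - u\<bar> \<le> b / 2" by linarith
    then show "t \<in> window p n b u" using t by (auto simp: window_def)
  qed
  show thesis
  proof (cases "k < r")
    case True
    have "real_of_int (r - k) \<le> real n * (u + b / 2) - (real n * (u - b / 2) - 1)"
      unfolding r_def k_def of_int_diff by (intro diff_mono) linarith+
    then have "real_of_int (r - k) \<le> real n * b + 1" by (simp add: algebra_simps)
    then show thesis
      using True W by (intro that[of k "nat (r - k)"]) (auto simp: k_def r_def)
  next
    case False
    then show thesis using W b by (intro that[of 0 0]) auto
  qed
qed

lemma kernel_zero_outside_window:
  assumes "kernel K" "0 < b" "t \<in> {int p + 1..int n}" "t \<notin> window p n b u"
  shows "K ((real_of_int t / real n - u) / b) = 0"
proof -
  have "b / 2 < \<bar>real_of_int t / real n - u\<bar>" using assms by (auto simp: window_def)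
  then have "1 / 2 < \<bar>real_of_int t / real n - u\<bar> / b" using assms(2) by (simp add: field_simps)
  then have "1 / 2 < \<bar>(real_of_int t / real n - u) / b\<bar>" using assms(2) by simp
  then have "(real_of_int t / real n - u) / b \<notin> {-1/2..1/2}" unfolding atLeastAtMost_iff by linarith
  then show ?thesis using assms(1) unfolding kernel_def by blast
qed

lemma L_emp_window:
  fixes ell :: "real \<Rightarrow> real ^ 'p::{finite,linorder} \<Rightarrow> real ^ 'd \<Rightarrow> real"
  assumes "kernel K" "0 < b"
  shows "L_emp K ell X n b u \<omega> \<theta> = 1 / (real n * b) *
    (\<Sum>t\<in>window CARD('p) n b u. K ((real_of_int t / real n - u) / b) * ell (X n t \<omega>) (lags (X n) (t - 1) \<omega>) \<theta>)"
proof -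
  have "(\<Sum>t\<in>window CARD('p) n b u. K ((real_of_int t / real n - u) / b) * ell (X n t \<omega>) (lags (X n) (t - 1) \<omega>) \<theta>)
      = (\<Sum>t\<in>{int CARD('p) + 1..int n}. K ((real_of_int t / real n - u) / b) * ell (X n t \<omega>) (lags (X n) (t - 1) \<omega>) \<theta>)"
  proof (intro sum.mono_neutral_left ballI)
    fix t assume "t \<in> {int CARD('p) + 1..int n} - window CARD('p) n b u"
    then have "K ((real_of_int t / real n - u) / b) = 0"
      by (intro kernel_zero_outside_window[OF assms, of _ "CARD('p)"]) auto
    then show "K ((real_of_int t / real n - u) / b) * ell (X n t \<omega>) (lags (X n) (t - 1) \<omega>) \<theta> = 0" by simp
  qed (auto simp: window_def)
  then show ?thesis
    by (simp add: L_emp_def K_scaled_def sum_distrib_left mult.assoc)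
qed

text \<open>For u at distance at least \<open>b / 2\<close> from both ends, the scaled support fits
  into the times 0 to n, and the Riemann sum over them has an error of \<open>BK\<close> times the
  mesh. The \<open>p + 1\<close> initial times missing from the window cost \<open>p + 1\<close>
  further terms of this size.\<close>

lemma kernel_window_sum:
  assumes K: "kernel K"
    and BK: "0 \<le> BK" "\<And>x. \<bar>K x\<bar> \<le> BK"
      "\<And>(x :: nat \<Rightarrow> real) N. mono x \<Longrightarrow> (\<Sum>i<N. \<bar>K (x (Suc i)) - K (x i)\<bar>) \<le> BK"
    and n: "1 \<le> n" "p \<le> n" and b: "0 < b" and u: "u \<in> {b / 2..1 - b / 2}"
  shows "\<bar>1 / (real n * b) * (\<Sum>t\<in>window p n b u. K ((real_of_int t / real n - u) / b)) - 1\<bar> \<le> (real p + 2) * BK / (real n * b)"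
proof -
  define h where "h = 1 / (real n * b)"
  have h: "0 < h" using n b by (simp add: h_def)
  let ?K = "\<lambda>t. K ((real_of_int t / real n - u) / b)"
  \<comment> \<open>Starting one mesh width before time 0 makes index i stand for time i, and keeps
    the left end strictly outside the support even when \<open>u = b / 2\<close>.\<close>
  have "\<bar>h * (\<Sum>i<Suc n. K (- h - u / b + real (Suc i) * h)) - 1\<bar> \<le> h * BK"
  proof (rule kernel_Riemann_sum[OF K BK(3) h])
    have "1 / 2 \<le> u / b" using u b by (simp add: field_simps)
    then show "- h - u / b < - 1 / 2" using h by linarith
    have "real n * h = 1 / b" using n by (simp add: h_def)
    then have "- h - u / b + real (Suc n) * h = (1 - u) / b" by (simp add: algebra_simps diff_divide_distrib)
    then show "1 / 2 \<le> - h - u / b + real (Suc n) * h" using u b by (simp add: field_simps)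
  qed
  moreover have "- h - u / b + real (Suc i) * h = (real_of_int (- 1 + 1 + int i) / real n - u) / b" for i
    using n b by (simp add: h_def field_simps)
  ultimately have "\<bar>h * (\<Sum>i<Suc n. ?K (- 1 + 1 + int i)) - 1\<bar> \<le> h * BK" by simp
  then have full: "\<bar>h * (\<Sum>t\<in>{- 1<..- 1 + int (Suc n)}. ?K t) - 1\<bar> \<le> h * BK" by (subst sum_window)
  have "(\<Sum>t\<in>window p n b u. ?K t) = (\<Sum>t\<in>{int p + 1..int n}. ?K t)"
  proof (intro sum.mono_neutral_left ballI)
    fix t assume "t \<in> {int p + 1..int n} - window p n b u"
    then show "?K t = 0" by (intro kernel_zero_outside_window[OF K b, of _ p]) auto
  qed (auto simp: window_def)
  moreover have "(\<Sum>t\<in>{- 1<..- 1 + int (Suc n)}. ?K t) = (\<Sum>t\<in>{0..int p}. ?K t) + (\<Sum>t\<in>{int p + 1..int n}. ?K t)"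
  proof -
    have "{- 1<..- 1 + int (Suc n)} = {0..int p} \<union> {int p + 1..int n}" using n by auto
    then show ?thesis by (simp add: sum.union_disjoint)
  qed
  moreover have "\<bar>\<Sum>t\<in>{0..int p}. ?K t\<bar> \<le> (real p + 1) * BK"
  proof -
    have "\<bar>\<Sum>t\<in>{0..int p}. ?K t\<bar> \<le> (\<Sum>t\<in>{0..int p}. BK)"
      by (rule order_trans[OF sum_abs]) (intro sum_mono BK)
    then show ?thesis by (simp add: algebra_simps)
  qed
  then have "h * \<bar>\<Sum>t\<in>{0..int p}. ?K t\<bar> \<le> h * ((real p + 1) * BK)"
    using h by (intro mult_left_mono) auto
  then have "\<bar>h * (\<Sum>t\<in>{0..int p}. ?K t)\<bar> \<le> h * ((real p + 1) * BK)"
    using h by (simp add: abs_mult)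
  ultimately have "\<bar>h * (\<Sum>t\<in>window p n b u. ?K t) - 1\<bar> \<le> h * BK + h * ((real p + 1) * BK)"
    using full by (simp add: distrib_left)
  also have "\<dots> = (real p + 2) * BK * h" by (simp add: algebra_simps)
  finally show ?thesis by (simp add: h_def)
qed

text \<open>The error is split into the centred part \<open>f - e\<close>, the truncation
  \<open>g - f\<close>, the bias \<open>e - L\<close> and the defect of the kernel mass. The centred
  part has cancellation to preserve and goes through summation by parts; truncation and bias are
  estimated in absolute value.\<close>

lemma kernel_average_error:
  fixes g f e :: "int \<Rightarrow> real"
  assumes K: "kernel K"
    and BK: "0 \<le> BK" "\<And>x. \<bar>K x\<bar> \<le> BK"
      "\<And>(x :: nat \<Rightarrow> real) N. mono x \<Longrightarrow> (\<Sum>i<N. \<bar>K (x (Suc i)) - K (x i)\<bar>) \<le> BK"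
    and n: "1 \<le> n" "p \<le> n" and b: "0 < b" and u: "u \<in> {b / 2..1 - b / 2}"
    and W: "window p n b u = {k<..k + int j}"
    and S: "\<And>i. i \<le> j \<Longrightarrow> \<bar>\<Sum>t\<in>{k<..k + int i}. f t - e t\<bar> \<le> S"
    and D: "(\<Sum>t\<in>window p n b u. \<bar>g t - f t\<bar>) \<le> D" and E: "(\<Sum>t\<in>window p n b u. \<bar>e t - L\<bar>) \<le> E"
  shows "\<bar>1 / (real n * b) * (\<Sum>t\<in>window p n b u. K ((real_of_int t / real n - u) / b) * g t) - L\<bar>
    \<le> BK / (real n * b) * (2 * S + D + E + \<bar>L\<bar> * (real p + 2))"
proof -
  define h where "h = 1 / (real n * b)"
  have h: "0 < h" using n b by (simp add: h_def)
  let ?K = "\<lambda>t. K ((real_of_int t / real n - u) / b)" and ?W = "window p n b u"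
  have "h * (\<Sum>t\<in>?W. ?K t * g t) - L = h * (\<Sum>t\<in>?W. ?K t * (f t - e t)) + h * (\<Sum>t\<in>?W. ?K t * (g t - f t))
      + h * (\<Sum>t\<in>?W. ?K t * (e t - L)) + L * (h * (\<Sum>t\<in>?W. ?K t) - 1)"
    by (simp add: right_diff_distrib sum_subtractf sum_distrib_left[symmetric] sum_distrib_right[symmetric] algebra_simps)
  moreover have "\<bar>h * (\<Sum>t\<in>?W. ?K t * (f t - e t))\<bar> \<le> h * (BK * (2 * S))"
  proof -
    have "\<bar>\<Sum>i<j. K ((real_of_int (k + 1 + int i) / real n - u) / b) * (f (k + 1 + int i) - e (k + 1 + int i))\<bar> \<le> 2 * BK * S"
    proof (rule abs_kernel_sum_le[OF BK])
      show "mono (\<lambda>i. (real_of_int (k + 1 + int i) / real n - u) / b)"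
        using b by (intro monoI divide_right_mono diff_right_mono) auto
      show "\<bar>\<Sum>i<i'. f (k + 1 + int i) - e (k + 1 + int i)\<bar> \<le> S" if "i' \<le> j" for i'
        using S[OF that] by (simp add: sum_window)
    qed
    then have "\<bar>\<Sum>t\<in>?W. ?K t * (f t - e t)\<bar> \<le> BK * (2 * S)" unfolding W sum_window by simp
    then show ?thesis using h by (simp add: abs_mult)
  qed
  moreover have *: "\<bar>h * (\<Sum>t\<in>?W. ?K t * a t)\<bar> \<le> h * (BK * A)" if "(\<Sum>t\<in>?W. \<bar>a t\<bar>) \<le> A" for a :: "int \<Rightarrow> real" and A
  proof -
    have "\<bar>\<Sum>t\<in>?W. ?K t * a t\<bar> \<le> (\<Sum>t\<in>?W. BK * \<bar>a t\<bar>)"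
      by (rule order_trans[OF sum_abs]) (auto simp: abs_mult intro!: sum_mono mult_right_mono BK)
    also have "\<dots> \<le> BK * A" unfolding sum_distrib_left[symmetric] by (intro mult_left_mono that BK)
    finally show ?thesis using h by (simp add: abs_mult)
  qed
  note *[OF D] *[OF E]
  moreover have "\<bar>L * (h * (\<Sum>t\<in>?W. ?K t) - 1)\<bar> \<le> h * (BK * (\<bar>L\<bar> * (real p + 2)))"
  proof -
    have "\<bar>h * (\<Sum>t\<in>?W. ?K t) - 1\<bar> \<le> h * BK * (real p + 2)"
      using kernel_window_sum[OF K BK n b u] by (simp add: h_def mult.commute)
    from mult_left_mono[OF this abs_ge_zero[of L]]
    have "\<bar>L * (h * (\<Sum>t\<in>?W. ?K t) - 1)\<bar> \<le> \<bar>L\<bar> * (h * BK * (real p + 2))" by (simp only: abs_mult)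
    then show ?thesis by (simp only: mult_ac)
  qed
  ultimately have "\<bar>h * (\<Sum>t\<in>?W. ?K t * g t) - L\<bar>
      \<le> h * (BK * (2 * S)) + h * (BK * D) + h * (BK * E) + h * (BK * (\<bar>L\<bar> * (real p + 2)))"
    by linarith
  also have "\<dots> = BK * h * (2 * S + D + E + \<bar>L\<bar> * (real p + 2))" by (simp add: algebra_simps)
  finally show ?thesis by (simp add: h_def)
qed


section \<open>Well-separated minimizers\<close>

text \<open>The pairs at distance at least \<open>\<delta>\<close> form a compact set, on which the
  height above the minimum is continuous and, by uniqueness, positive; so it attains a positive
  minimum. If the set is empty, any \<open>\<kappa>\<close> serves.\<close>

lemma well_separated_minimizer:
  fixes L :: "real \<Rightarrow> 'a::euclidean_space \<Rightarrow> real" and U :: "real set"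
  assumes U: "compact U" and \<Theta>: "compact \<Theta>" and \<theta>0: "continuous_on U \<theta>0" "\<theta>0 ` U \<subseteq> \<Theta>"
    and L: "continuous_on (U \<times> \<Theta>) (\<lambda>x. L (fst x) (snd x))"
    and min: "\<And>u \<theta>. u \<in> U \<Longrightarrow> is_arg_min (L u) (\<lambda>\<theta>. \<theta> \<in> \<Theta>) \<theta> \<longleftrightarrow> \<theta> = \<theta>0 u"
    and \<delta>: "0 < \<delta>"
  obtains \<kappa> where "0 < \<kappa>" "\<And>u \<theta>. u \<in> U \<Longrightarrow> \<theta> \<in> \<Theta> \<Longrightarrow> \<delta> \<le> norm (\<theta> - \<theta>0 u) \<Longrightarrow> L u (\<theta>0 u) + \<kappa> \<le> L u \<theta>"
proof -
  define S where "S = (U \<times> \<Theta>) \<inter> (\<lambda>x. norm (snd x - \<theta>0 (fst x))) -` {\<delta>..}"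
  have \<theta>0': "continuous_on (U \<times> \<Theta>) (\<lambda>x. \<theta>0 (fst x))"
    by (rule continuous_on_compose2[OF \<theta>0(1)]) (auto intro!: continuous_intros)
  have "closed S"
    unfolding S_def by (intro continuous_closed_preimage continuous_intros \<theta>0' compact_imp_closed compact_Times U \<Theta> closed_atLeast)
  then have S: "compact S"
    using compact_Int_closed[OF compact_Times[OF U \<Theta>] \<open>closed S\<close>] by (simp add: S_def Int_assoc[symmetric])
  have cont: "continuous_on S (\<lambda>x. L (fst x) (snd x) - L (fst x) (\<theta>0 (fst x)))"
  proof (rule continuous_on_subset[of "U \<times> \<Theta>"])
    have "continuous_on (U \<times> \<Theta>) (\<lambda>x. (fst x, \<theta>0 (fst x)))" by (intro continuous_intros \<theta>0')
    from continuous_on_compose2[OF L this] \<theta>0(2)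
    have "continuous_on (U \<times> \<Theta>) (\<lambda>x. L (fst x) (\<theta>0 (fst x)))" by (auto simp: image_subset_iff)
    then show "continuous_on (U \<times> \<Theta>) (\<lambda>x. L (fst x) (snd x) - L (fst x) (\<theta>0 (fst x)))"
      by (intro continuous_intros L)
  qed (auto simp: S_def)
  have pos: "0 < L (fst x) (snd x) - L (fst x) (\<theta>0 (fst x))" if "x \<in> S" for x
  proof -
    obtain u \<theta> where x: "x = (u, \<theta>)" by (cases x)
    have u: "u \<in> U" "\<theta> \<in> \<Theta>" "\<delta> \<le> norm (\<theta> - \<theta>0 u)" using that by (auto simp: S_def x)
    then have "\<theta> \<noteq> \<theta>0 u" using \<delta> by auto
    then have "\<not> is_arg_min (L u) (\<lambda>\<theta>. \<theta> \<in> \<Theta>) \<theta>" using min[OF u(1)] by simp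
    then obtain \<theta>' where \<theta>': "\<theta>' \<in> \<Theta>" "L u \<theta>' < L u \<theta>" using u by (auto simp: is_arg_min_def)
    have "is_arg_min (L u) (\<lambda>\<theta>. \<theta> \<in> \<Theta>) (\<theta>0 u)" using min[OF u(1)] by simp
    then have "L u (\<theta>0 u) \<le> L u \<theta>'" using \<theta>' by (auto simp: is_arg_min_def not_less)
    then show ?thesis using \<theta>' by (simp add: x)
  qed
  show thesis
  proof (cases "S = {}")
    case True
    then show thesis by (intro that[of 1]) (auto simp: S_def)
  next
    case False
    from continuous_attains_inf[OF S False cont] obtain x where x: "x \<in> S"
      "\<And>y. y \<in> S \<Longrightarrow> L (fst x) (snd x) - L (fst x) (\<theta>0 (fst x)) \<le> L (fst y) (snd y) - L (fst y) (\<theta>0 (fst y))" by blast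
    show thesis
    proof (rule that[OF pos[OF x(1)]])
      fix u \<theta> assume "u \<in> U" "\<theta> \<in> \<Theta>" "\<delta> \<le> norm (\<theta> - \<theta>0 u)"
      then have "(u, \<theta>) \<in> S" by (simp add: S_def)
      from x(2)[OF this] show "L u (\<theta>0 u) + (L (fst x) (snd x) - L (fst x) (\<theta>0 (fst x))) \<le> L u \<theta>" by simp
    qed
  qed
qed

text \<open>With m of order \<open>x powr (1/4)\<close>, the first summand is the coupling error and
  the second the Hoeffding term, whose exponent is of order \<open>x powr (1/2)\<close>. Both beat a
  polynomial number of window sums.\<close>

lemma superpolynomial_decay:
  fixes A s \<gamma> c :: real
  assumes "0 < \<gamma>" "0 < c"
  shows "((\<lambda>x. (x + 2) powr s * (A * exp (- \<gamma> * (x powr (1/4) - 1))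
    + 2 * (x powr (1/4) + 1) * exp (- (c * x / (x powr (1/4) + 1)\<^sup>2)))) \<longlongrightarrow> 0) at_top"
  using assms by real_asymp

section \<open>Uniform convergence of the empirical objective\<close>

context prob_space
begin

text \<open>Covering by an event makes union bounds available for sets that need not be measurable,
  such as those involving a supremum over u or an arbitrary minimizer. It also bounds the outer
  measure.\<close>

definition small :: "real \<Rightarrow> 'a set \<Rightarrow> bool" where
  "small c A \<longleftrightarrow> (\<exists>B\<in>events. A \<subseteq> B \<and> prob B \<le> c)"

lemma smallI: "B \<in> events \<Longrightarrow> A \<subseteq> B \<Longrightarrow> prob B \<le> c \<Longrightarrow> small c A"
  by (auto simp: small_def)

lemma small_mono: "small c B \<Longrightarrow> A \<subseteq> B \<Longrightarrow> c \<le> d \<Longrightarrow> small d A"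
  unfolding small_def by (meson order_trans)

lemma small_Un:
  assumes "small c A" "small d B"
  shows "small (c + d) (A \<union> B)"
proof -
  from assms obtain A' B' where "A' \<in> events" "A \<subseteq> A'" "prob A' \<le> c" "B' \<in> events" "B \<subseteq> B'" "prob B' \<le> d"
    by (auto simp: small_def)
  then show ?thesis
    using measure_Un_le[of A' M B'] by (intro smallI[of "A' \<union> B'"]) auto
qed

lemma small_UN:
  assumes "finite I" "\<And>i. i \<in> I \<Longrightarrow> small c (A i)"
  shows "small (real (card I) * c) (\<Union>i\<in>I. A i)"
  using assms
proof (induction I)
  case empty
  then show ?case by (intro smallI[of "{}"]) auto
next
  case (insert i I)
  then have "small (c + real (card I) * c) (A i \<union> (\<Union>i\<in>I. A i))" by (intro small_Un) auto
  then show ?case using insert by (simp add: algebra_simps)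
qed

lemma outer_measure_tendsto_0:
  assumes "\<And>\<eta>. 0 < \<eta> \<Longrightarrow> \<forall>\<^sub>F n in sequentially. small \<eta> (A n)"
  shows "(\<lambda>n. outer_measure_of M (A n)) \<longlonglongrightarrow> 0"
proof (rule order_tendstoI)
  fix c :: ennreal assume "0 < c"
  then obtain \<eta> where \<eta>: "0 < \<eta>" "ennreal \<eta> < c"
    by (metis ennreal_zero_less_top dense ennreal_less_zero_iff less_top_ennreal order.strict_trans top.not_eq_extremum)
  show "\<forall>\<^sub>F n in sequentially. outer_measure_of M (A n) < c"
    using assms[OF \<eta>(1)]
  proof eventually_elim
    case (elim n)
    then obtain B where B: "B \<in> events" "A n \<subseteq> B" "prob B \<le> \<eta>" by (auto simp: small_def)
    have "outer_measure_of M (A n) \<le> emeasure M B"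
      using outer_measure_of_mono[OF B(2), of M] B(1) by simp
    also have "\<dots> \<le> ennreal \<eta>" using B(3) by (simp add: emeasure_eq_measure ennreal_leI)
    finally show ?case using \<eta>(2) by simp
  qed
qed simp

end

lemma l1_norm_le_norm: "l1_norm (v :: real ^ 'd) \<le> CARD('d) * norm v"
proof -
  have "l1_norm v \<le> (\<Sum>i\<in>(UNIV :: 'd set). norm v)"
    unfolding l1_norm_def by (intro sum_mono component_le_norm_cart)
  then show ?thesis by simp
qed

locale estimation = objective P \<epsilon> G M \<chi>v C0 \<Theta> Cz C\<theta> ell
  for P :: "'w measure" and \<epsilon> and G :: "real \<Rightarrow> real ^ 'p::{finite,linorder} \<Rightarrow> real \<Rightarrow> real"
    and M and \<chi>v C0 and \<Theta> :: "(real ^ 'd) set" and Cz C\<theta> ell +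
  fixes Xt :: "real \<Rightarrow> int \<Rightarrow> 'w \<Rightarrow> real" and X :: "nat \<Rightarrow> int \<Rightarrow> 'w \<Rightarrow> real"
    and K :: "real \<Rightarrow> real" and \<theta>0 :: "real \<Rightarrow> real ^ 'd"
  assumes Xt_sol: "u \<in> {0..1} \<Longrightarrow> stationary_solution P \<epsilon> G u (Xt u)"
    and X_sol: "n \<ge> 1 \<Longrightarrow> tv_solution P \<epsilon> G (Xt 0) n (X n)"
    and L4: "L4_cond P \<epsilon> G Xt (M + 1)"
    and K_kernel: "kernel K"
    and \<Theta>_compact: "compact \<Theta>"
    and \<theta>0_range: "\<theta>0 ` {0..1} \<subseteq> \<Theta>"
    and \<theta>0_unique_min: "u \<in> {0..1} \<Longrightarrow> is_arg_min (L_lim P ell Xt u) (\<lambda>\<theta>. \<theta> \<in> \<Theta>) \<theta> \<longleftrightarrow> \<theta> = \<theta>0 u"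
begin

section \<open>Rows against stationary solutions, and continuity of the limit objective\<close>

abbreviation L :: "real \<Rightarrow> real ^ 'd \<Rightarrow> real" where "L \<equiv> L_lim P ell Xt"

lemma row_adapted: "1 \<le> n \<Longrightarrow> adapted (int n) (X n)"
  by (rule tv_solution_adapted[OF X_sol])

lemma row_solves: "1 \<le> n \<Longrightarrow> t \<le> int n \<Longrightarrow> solves (X n) t (max (real_of_int t / real n) 0)"
  by (rule tv_solution_solves[OF X_sol])

lemma row_moment: "1 \<le> n \<Longrightarrow> t \<le> int n \<Longrightarrow> Lq_le P (M + 1) (\<lambda>\<omega>. V (lagv (X n) t \<omega>)) vbar"
  by (rule tv_moment[OF X_sol Xt_sol]) auto

lemma stat_adapted: "u \<in> {0..1} \<Longrightarrow> adapted n (Xt u)"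
  by (rule stationary_solution_adapted[OF Xt_sol])

lemma stat_moment: "u \<in> {0..1} \<Longrightarrow> Lq_le P (M + 1) (\<lambda>\<omega>. V (lagv (Xt u) t \<omega>)) vbar"
  by (rule V_moment, rule stationary_moment[OF Xt_sol]) auto

lemma window_le: "t \<in> window CARD('p) n b u \<Longrightarrow> t \<le> int n"
  by (simp add: window_def)

lemma window_n: "t \<in> window CARD('p) n b u \<Longrightarrow> 1 \<le> n"
  by (auto simp: window_def)

lemma vbar_le: "vbar \<le> 2 * vbar + 1"
  using vbar_nonneg by simp

lemma obs_compare_stationary:
  assumes \<theta>: "\<theta> \<in> \<Theta>" and A: "adapted n A" and t: "t \<le> n" and u: "u \<in> {0..1}" and d: "0 < d"
    and v: "\<And>s. s \<le> n \<Longrightarrow> Lq_le P (M + 1) (\<lambda>\<omega>. V (lagv A s \<omega>)) vbar"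
    and D: "\<And>s. s \<in> {t - 1, t} \<Longrightarrow> Lq_le P (M + 1) (\<lambda>\<omega>. V (lagv (\<lambda>t \<omega>. A t \<omega> - Xt u t \<omega>) s \<omega>)) d"
  shows "(\<integral>\<^sup>+\<omega>. ennreal \<bar>obs A t \<theta> \<omega> - obs (Xt u) t \<theta> \<omega>\<bar> \<partial>P) \<le> ennreal (Lc * d)"
  by (rule obs_compare[OF \<theta> A stat_adapted[OF u] t d D])
    (use t in \<open>auto intro!: Lq_le_weaken[OF v vbar_le q_nonneg] Lq_le_weaken[OF stat_moment[OF u] vbar_le q_nonneg]\<close>)

lemma mixing_time:
  assumes "0 < d"
  obtains m where "lam ^ m * (2 * vbar) < d"
proof -
  have "(\<lambda>m. lam ^ m * (2 * vbar)) \<longlonglongrightarrow> 0 * (2 * vbar)"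
    using lam_nonneg lam_less_1 by (intro tendsto_intros LIMSEQ_power_zero) simp
  then have "\<forall>\<^sub>F m in sequentially. lam ^ m * (2 * vbar) < d" using assms by (intro order_tendstoD) auto
  then show thesis using that by (auto simp: eventually_sequentially)
qed

text \<open>First m is chosen so large that the initial difference is forgotten; then n must make
  both the bandwidth and the change of rescaled time during m steps negligible. The bound is uniform
  in u, t and \<open>\<theta>\<close> because all constants are.\<close>

lemma close_window:
  assumes \<eta>: "0 < \<eta>" and b: "b \<longlonglongrightarrow> 0" "\<And>n. 0 < b n"
  shows "\<forall>\<^sub>F n in sequentially. \<forall>u\<in>{0..1}. \<forall>t\<in>window CARD('p) n (b n) u. \<forall>\<theta>\<in>\<Theta>.
    (\<integral>\<^sup>+\<omega>. ennreal \<bar>obs (X n) t \<theta> \<omega> - obs (Xt u) t \<theta> \<omega>\<bar> \<partial>P) \<le> ennreal \<eta>"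
proof -
  from Hoelder_param_dist[OF L4 Xt_sol] obtain \<alpha> C4 where \<alpha>: "0 < \<alpha>" "0 \<le> C4"
    and H: "\<And>u a b t. u \<in> {0..1} \<Longrightarrow> a \<in> {0..1} \<Longrightarrow> b \<in> {0..1} \<Longrightarrow>
      Lq_le P (M + 1) (\<lambda>\<omega>. param_dist a b (lagv (Xt u) t \<omega>)) (C4 * \<bar>a - b\<bar> powr \<alpha>)" by blast
  define d where "d = \<eta> / (Lc + 1)"
  have d: "0 < d" "Lc * d \<le> \<eta>" using \<eta> Lc_nonneg by (auto simp: d_def field_simps)
  obtain m where m: "lam ^ m * (2 * vbar) < d / 2" using mixing_time[of "d / 2"] d by auto
  have "(\<lambda>n. b n / 2 + (real m + 1) / real n) \<longlonglongrightarrow> 0 / 2 + 0"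
    by (intro tendsto_intros b lim_const_over_n) simp
  then have "(\<lambda>n. C4 * (b n / 2 + (real m + 1) / real n) powr \<alpha> / gap) \<longlonglongrightarrow> C4 * 0 / gap"
    using b(2) \<alpha> gap_pos
    by (intro tendsto_intros tendsto_zero_powrI[OF _ tendsto_const]) (auto intro!: always_eventually add_nonneg_nonneg simp: less_imp_le)
  then have "\<forall>\<^sub>F n in sequentially. C4 * (b n / 2 + (real m + 1) / real n) powr \<alpha> / gap < d / 2"
    using d by (intro order_tendstoD) auto
  then show ?thesis
  proof eventually_elim
    case (elim n)
    show ?case
    proof (intro ballI)
      fix u t \<theta> assume u: "u \<in> {0..1 :: real}" and t: "t \<in> window CARD('p) n (b n) u" and \<theta>: "\<theta> \<in> \<Theta>"
      have n: "1 \<le> n" and tn: "t \<le> int n" and near: "\<bar>real_of_int t / real n - u\<bar> \<le> b n / 2"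
        using window_n[OF t] window_le[OF t] t by (auto simp: window_def)
      \<comment> \<open>Half the window plus the time travelled back; the additional 1 belongs to
        the lag vector at time t - 1.\<close>
      let ?\<rho> = "b n / 2 + (real m + 1) / real n"
      have \<rho>: "0 \<le> ?\<rho>" using b(2)[of n] by simp
      have D: "Lq_le P (M + 1) (\<lambda>\<omega>. V (lagv (\<lambda>t \<omega>. X n t \<omega> - Xt u t \<omega>) s \<omega>)) d" if s: "s \<in> {t - 1, t}" for s
      proof -
        have sn: "s \<le> int n" using s tn by auto
        have "Lq_le P (M + 1) (\<lambda>\<omega>. V (lagv (\<lambda>t \<omega>. X n t \<omega> - Xt u t \<omega>) s \<omega>)) (lam ^ m * (2 * vbar) + C4 * ?\<rho> powr \<alpha> / gap)"
        proof (rule solution_close[where a = "\<lambda>\<tau>. max (real_of_int \<tau> / real n) 0", OF adapted_mono[OF row_adapted[OF n] sn]])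
          fix \<tau> assume \<tau>: "s - int m < \<tau>" "\<tau> \<le> s"
          show "solves (X n) \<tau> (max (real_of_int \<tau> / real n) 0)" using \<tau> sn by (intro row_solves n) simp
          have "real_of_int t - real m - 1 \<le> real_of_int \<tau>" "real_of_int \<tau> \<le> real_of_int t" using \<tau> s by auto
          then have "(real_of_int t - real m - 1) / real n \<le> real_of_int \<tau> / real n" "real_of_int \<tau> / real n \<le> real_of_int t / real n"
            by (intro divide_right_mono; simp)+
          then have "\<bar>real_of_int \<tau> / real n - real_of_int t / real n\<bar> \<le> (real m + 1) / real n"
            by (simp add: diff_divide_distrib add_divide_distrib)
          then have "\<bar>real_of_int \<tau> / real n - u\<bar> \<le> ?\<rho>" using near by linarith
          \<comment> \<open>Clipping at 0 cannot increase the distance to a nonnegative u.\<close>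
          then show "\<bar>max (real_of_int \<tau> / real n) 0 - u\<bar> \<le> ?\<rho>" using u by (auto simp: max_def)
        qed (use u \<alpha> \<rho> H[OF u] sn in \<open>auto intro!: Xt_sol row_moment n\<close>)
        moreover have "lam ^ m * (2 * vbar) + C4 * ?\<rho> powr \<alpha> / gap \<le> d" using m elim by linarith
        ultimately show ?thesis using q_nonneg by (rule Lq_le_weaken)
      qed
      have "(\<integral>\<^sup>+\<omega>. ennreal \<bar>obs (X n) t \<theta> \<omega> - obs (Xt u) t \<theta> \<omega>\<bar> \<partial>P) \<le> ennreal (Lc * d)"
        by (rule obs_compare_stationary[OF \<theta> row_adapted[OF n] tn u d(1) row_moment[OF n] D])
      then show "(\<integral>\<^sup>+\<omega>. ennreal \<bar>obs (X n) t \<theta> \<omega> - obs (Xt u) t \<theta> \<omega>\<bar> \<partial>P) \<le> ennreal \<eta>"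
        using d(2) by (meson ennreal_leI order_trans)
    qed
  qed
qed

text \<open>The laws of the shifted paths agree, and the objective at time t is a fixed functional
  of the path shifted by t. \<open>f\<close> will be the identity or a truncation error.\<close>

lemma stationary_expectation:
  assumes u: "u \<in> {0..1}" and \<theta>: "\<theta> \<in> \<Theta>" and f: "f \<in> borel_measurable borel"
  shows "expectation (\<lambda>\<omega>. f (obs (Xt u) t \<theta> \<omega>)) = expectation (\<lambda>\<omega>. f (obs (Xt u) 0 \<theta> \<omega>) :: real)"
proof -
  let ?M = "\<Pi>\<^sub>M t\<in>(UNIV :: int set). (borel :: real measure)"
  define \<Phi> where "\<Phi> x = f (ell (x 0) (\<chi> i. x (- coord_no i)) \<theta>)" for x :: "int \<Rightarrow> real"
  have [measurable]: "Xt u s \<in> borel_measurable P" for s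
    by (rule adapted_measurable[OF stat_adapted[OF u] order_refl])
  have \<Phi>: "\<Phi> \<in> borel_measurable ?M"
  proof -
    have "(\<lambda>x. ell (x 0) (\<chi> i. x (- coord_no (i :: 'p))) \<theta>) \<in> borel_measurable ?M"
      by (intro ell_measurable[OF \<theta>] borel_measurable_vec) simp_all
    from measurable_compose[OF this f] show ?thesis by (simp add: \<Phi>_def[abs_def])
  qed
  have path: "(\<lambda>\<omega> s. Xt u (s + h) \<omega>) \<in> measurable P ?M" for h
    by (rule measurable_PiM_single') auto
  have eq: "\<Phi> (\<lambda>s. Xt u (s + h) \<omega>) = f (obs (Xt u) h \<theta> \<omega>)" for h \<omega>
    by (simp add: \<Phi>_def obs_def lags_def algebra_simps)
  have law: "distr P ?M (\<lambda>\<omega> s. Xt u (s + t) \<omega>) = distr P ?M (\<lambda>\<omega> s. Xt u (s + 0) \<omega>)"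
    using Xt_sol[OF u] unfolding stationary_solution_def stationary_def by simp
  have "expectation (\<lambda>\<omega>. f (obs (Xt u) t \<theta> \<omega>)) = integral\<^sup>L (distr P ?M (\<lambda>\<omega> s. Xt u (s + t) \<omega>)) \<Phi>"
    unfolding integral_distr[OF path \<Phi>] eq ..
  also have "\<dots> = expectation (\<lambda>\<omega>. f (obs (Xt u) 0 \<theta> \<omega>))"
    unfolding law integral_distr[OF path \<Phi>] eq ..
  finally show ?thesis .
qed

lemma expectation_obs_stationary:
  assumes "u \<in> {0..1}" "\<theta> \<in> \<Theta>"
  shows "expectation (obs (Xt u) t \<theta>) = L u \<theta>"
  using stationary_expectation[OF assms, of "\<lambda>x. x" t] by (simp add: L_lim_def obs_def[abs_def])

lemma stat_obs_integrable: "u \<in> {0..1} \<Longrightarrow> \<theta> \<in> \<Theta> \<Longrightarrow> integrable P (obs (Xt u) t \<theta>)"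
  by (rule moment_bound(1)[OF obs_measurable[OF stat_adapted order_refl] obs_moment[OF _ stat_adapted order_refl stat_moment]])
    (use Lc_nonneg vbar_nonneg in \<open>auto simp: g0_def\<close>)

lemma row_obs_integrable: "1 \<le> n \<Longrightarrow> t \<le> int n \<Longrightarrow> \<theta> \<in> \<Theta> \<Longrightarrow> integrable P (obs (X n) t \<theta>)"
  by (rule moment_bound(1)[OF obs_measurable[OF row_adapted] obs_moment[OF _ row_adapted _ row_moment]])
    (use Lc_nonneg vbar_nonneg in \<open>auto simp: g0_def\<close>)

definition CZ :: real where "CZ = 1 + (vbar * (1 + 1 / gap)) powr (M + 1)"

lemma CZ_pos: "0 < CZ"
  by (simp add: CZ_def add_pos_nonneg)

lemma zpow_moment:
  assumes A: "adapted n A" "t \<le> n" and v: "\<And>s. s \<le> n \<Longrightarrow> Lq_le P (M + 1) (\<lambda>\<omega>. V (lagv A s \<omega>)) vbar"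
  shows "(\<integral>\<^sup>+\<omega>. ennreal (1 + rpow (znorm A t \<omega>) (M + 1)) \<partial>P) \<le> ennreal CZ"
proof -
  have Z: "Lq_le P (M + 1) (znorm A t) (vbar * (1 + 1 / gap))"
    by (rule znorm_moment[OF A v v q_ge_1]) (use A in auto)
  have [measurable]: "znorm A t \<in> borel_measurable P" by (rule Lq_le_measurable[OF Z])
  have "(\<integral>\<^sup>+\<omega>. ennreal (1 + rpow (znorm A t \<omega>) (M + 1)) \<partial>P) = (\<integral>\<^sup>+\<omega>. 1 + ennreal (\<bar>znorm A t \<omega>\<bar> powr (M + 1)) \<partial>P)"
    using M_nonneg znorm_nonneg by (intro nn_integral_cong) (simp add: rpow_def)
  also have "\<dots> = 1 + (\<integral>\<^sup>+\<omega>. ennreal (\<bar>znorm A t \<omega>\<bar> powr (M + 1)) \<partial>P)"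
    by (simp add: nn_integral_add emeasure_space_1)
  also have "\<dots> \<le> 1 + ennreal ((vbar * (1 + 1 / gap)) powr (M + 1))"
    by (intro add_left_mono Lq_le_nn_integral Z)
  finally show ?thesis by (simp add: CZ_def)
qed

lemma obs_param_lipschitz:
  assumes "\<theta> \<in> \<Theta>" "\<theta>' \<in> \<Theta>"
  shows "\<bar>obs A t \<theta> \<omega> - obs A t \<theta>' \<omega>\<bar> \<le> 3 * C\<theta> * l1_norm (\<theta> - \<theta>') * (1 + rpow (znorm A t \<omega>) (M + 1))"
  using ell_lipschitz_param[OF assms, of "A t \<omega>" "lagv A (t - 1) \<omega>"] by (simp add: obs_def znorm_def algebra_simps)

lemma L_lipschitz:
  assumes u: "u \<in> {0..1}" and \<theta>: "\<theta> \<in> \<Theta>" "\<theta>' \<in> \<Theta>"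
  shows "\<bar>L u \<theta> - L u \<theta>'\<bar> \<le> 3 * C\<theta> * CZ * l1_norm (\<theta> - \<theta>')"
proof -
  let ?c = "3 * C\<theta> * l1_norm (\<theta> - \<theta>')"
  have c: "0 \<le> ?c" using C\<theta>_nonneg l1_norm_nonneg[of "\<theta> - \<theta>'"] by simp
  have [measurable]: "obs (Xt u) 0 \<theta> \<in> borel_measurable P" "obs (Xt u) 0 \<theta>' \<in> borel_measurable P"
      "znorm (Xt u) 0 \<in> borel_measurable P"
    by (auto intro: obs_measurable[OF stat_adapted[OF u] order_refl] \<theta> znorm_measurable[OF stat_adapted[OF u] order_refl])
  have "(\<integral>\<^sup>+\<omega>. ennreal \<bar>obs (Xt u) 0 \<theta> \<omega> - obs (Xt u) 0 \<theta>' \<omega>\<bar> \<partial>P)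
      \<le> (\<integral>\<^sup>+\<omega>. ennreal ?c * ennreal (1 + rpow (znorm (Xt u) 0 \<omega>) (M + 1)) \<partial>P)"
  proof (rule nn_integral_mono)
    fix \<omega>
    have "ennreal \<bar>obs (Xt u) 0 \<theta> \<omega> - obs (Xt u) 0 \<theta>' \<omega>\<bar> \<le> ennreal (?c * (1 + rpow (znorm (Xt u) 0 \<omega>) (M + 1)))"
      by (intro ennreal_leI obs_param_lipschitz[OF \<theta>])
    then show "ennreal \<bar>obs (Xt u) 0 \<theta> \<omega> - obs (Xt u) 0 \<theta>' \<omega>\<bar> \<le> ennreal ?c * ennreal (1 + rpow (znorm (Xt u) 0 \<omega>) (M + 1))"
      using c by (subst ennreal_mult[symmetric]) auto
  qed
  also have "\<dots> = ennreal ?c * (\<integral>\<^sup>+\<omega>. ennreal (1 + rpow (znorm (Xt u) 0 \<omega>) (M + 1)) \<partial>P)"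
    by (rule nn_integral_cmult) measurable
  also have "\<dots> \<le> ennreal ?c * ennreal CZ"
    by (intro mult_left_mono zpow_moment[OF stat_adapted[OF u] order_refl stat_moment[OF u]]) simp
  also have "\<dots> = ennreal (?c * CZ)" using c CZ_pos by (simp add: ennreal_mult)
  finally have "\<bar>expectation (\<lambda>\<omega>. obs (Xt u) 0 \<theta> \<omega> - obs (Xt u) 0 \<theta>' \<omega>)\<bar> \<le> ?c * CZ"
    using c CZ_pos by (intro moment_bound(3)) auto
  then show ?thesis
    using expectation_obs_stationary[OF u, of _ 0] stat_obs_integrable[OF u, of _ 0] \<theta> by (simp add: algebra_simps)
qed

text \<open>The comparison used for the rows, now between two stationary solutions: their parameter
  distance is constant in time, so after fixing m it is enough to make that distance small.\<close>

lemma L_equicontinuous: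
  assumes \<eta>: "0 < \<eta>"
  obtains \<delta> where "0 < \<delta>" "\<And>u u' \<theta>. u \<in> {0..1} \<Longrightarrow> u' \<in> {0..1} \<Longrightarrow> \<bar>u - u'\<bar> < \<delta> \<Longrightarrow> \<theta> \<in> \<Theta> \<Longrightarrow> \<bar>L u' \<theta> - L u \<theta>\<bar> \<le> \<eta>"
proof -
  from Hoelder_param_dist[OF L4 Xt_sol] obtain \<alpha> C4 where \<alpha>: "0 < \<alpha>" "0 \<le> C4"
    and H: "\<And>u a b t. u \<in> {0..1} \<Longrightarrow> a \<in> {0..1} \<Longrightarrow> b \<in> {0..1} \<Longrightarrow>
      Lq_le P (M + 1) (\<lambda>\<omega>. param_dist a b (lagv (Xt u) t \<omega>)) (C4 * \<bar>a - b\<bar> powr \<alpha>)" by blast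
  define d where "d = \<eta> / (Lc + 1)"
  have d: "0 < d" "Lc * d \<le> \<eta>" using \<eta> Lc_nonneg by (auto simp: d_def field_simps)
  obtain m where m: "lam ^ m * (2 * vbar) < d / 2" using mixing_time[of "d / 2"] d by auto
  have "((\<lambda>\<delta>. C4 * \<delta> powr \<alpha> / gap) \<longlongrightarrow> C4 * 0 / gap) (at_right 0)"
    using \<alpha> gap_pos by (intro tendsto_intros tendsto_zero_powrI[OF _ tendsto_const]) (auto simp: eventually_at_right_less intro: eventually_mono[OF eventually_at_right_less])
  then have "\<forall>\<^sub>F \<delta> in at_right 0. C4 * \<delta> powr \<alpha> / gap < d / 2" using d by (intro order_tendstoD) auto
  then have "\<forall>\<^sub>F \<delta> in at_right 0. C4 * \<delta> powr \<alpha> / gap < d / 2 \<and> 0 < \<delta>"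
    using eventually_at_right_less[of 0] by eventually_elim auto
  then obtain \<delta> where \<delta>: "C4 * \<delta> powr \<alpha> / gap < d / 2" "0 < \<delta>"
    using eventually_happens[of _ "at_right (0 :: real)"] by fastforce
  show thesis
  proof (rule that[OF \<delta>(2)])
    fix u u' \<theta> assume u: "u \<in> {0..1 :: real}" "u' \<in> {0..1}" "\<bar>u - u'\<bar> < \<delta>" and \<theta>: "\<theta> \<in> \<Theta>"
    have D: "Lq_le P (M + 1) (\<lambda>\<omega>. V (lagv (\<lambda>t \<omega>. Xt u' t \<omega> - Xt u t \<omega>) s \<omega>)) d" for s
    proof -
      have "Lq_le P (M + 1) (\<lambda>\<omega>. V (lagv (\<lambda>t \<omega>. Xt u' t \<omega> - Xt u t \<omega>) s \<omega>)) (lam ^ m * (2 * vbar) + C4 * \<delta> powr \<alpha> / gap)"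
        by (rule solution_close[where a = "\<lambda>_. u'"])
          (use u \<alpha> \<delta> H[OF u(1)] in \<open>auto intro!: stat_adapted Xt_sol stationary_solution_solves stat_moment simp: abs_minus_commute\<close>)
      moreover have "lam ^ m * (2 * vbar) + C4 * \<delta> powr \<alpha> / gap \<le> d" using m \<delta>(1) by linarith
      ultimately show ?thesis using q_nonneg by (rule Lq_le_weaken)
    qed
    have "(\<integral>\<^sup>+\<omega>. ennreal \<bar>obs (Xt u') 0 \<theta> \<omega> - obs (Xt u) 0 \<theta> \<omega>\<bar> \<partial>P) \<le> ennreal (Lc * d)"
      by (rule obs_compare_stationary[OF \<theta> stat_adapted[OF u(2)] order_refl u(1) d(1) stat_moment[OF u(2)] D])
    moreover have [measurable]: "obs (Xt u') 0 \<theta> \<in> borel_measurable P" "obs (Xt u) 0 \<theta> \<in> borel_measurable P"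
      using obs_measurable[OF stat_adapted[OF u(1)] order_refl \<theta>] obs_measurable[OF stat_adapted[OF u(2)] order_refl \<theta>] by auto
    ultimately have "\<bar>expectation (\<lambda>\<omega>. obs (Xt u') 0 \<theta> \<omega> - obs (Xt u) 0 \<theta> \<omega>)\<bar> \<le> Lc * d"
      using Lc_nonneg d by (intro moment_bound(3)) auto
    then show "\<bar>L u' \<theta> - L u \<theta>\<bar> \<le> \<eta>"
      using expectation_obs_stationary[OF u(1) \<theta>, of 0] expectation_obs_stationary[OF u(2) \<theta>, of 0]
        stat_obs_integrable[OF u(1) \<theta>, of 0] stat_obs_integrable[OF u(2) \<theta>, of 0] d(2) by simp
  qed
qed

text \<open>Equicontinuity in u, uniform in \<open>\<theta>\<close>, combined with the Lipschitz
  bound in \<open>\<theta>\<close>.\<close>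

lemma L_continuous: "continuous_on ({0..1} \<times> \<Theta>) (\<lambda>x. L (fst x) (snd x))"
  unfolding continuous_on_iff
proof (intro ballI allI impI)
  fix x :: "real \<times> (real ^ 'd)" and e :: real assume x: "x \<in> {0..1} \<times> \<Theta>" and e: "0 < e"
  obtain \<delta> where \<delta>: "0 < \<delta>" "\<And>u u' \<theta>. u \<in> {0..1} \<Longrightarrow> u' \<in> {0..1} \<Longrightarrow> \<bar>u - u'\<bar> < \<delta> \<Longrightarrow> \<theta> \<in> \<Theta> \<Longrightarrow> \<bar>L u' \<theta> - L u \<theta>\<bar> \<le> e / 3"
    using L_equicontinuous[of "e / 3"] e by auto
  define c where "c = 3 * C\<theta> * CZ * CARD('d) + 1"
  have c: "0 < c" using C\<theta>_nonneg CZ_pos by (simp add: c_def add_nonneg_pos)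
  show "\<exists>d>0. \<forall>x'\<in>{0..1} \<times> \<Theta>. dist x' x < d \<longrightarrow> dist (L (fst x') (snd x')) (L (fst x) (snd x)) < e"
  proof (intro exI[of _ "min \<delta> (e / (3 * c))"] conjI ballI impI)
    show "0 < min \<delta> (e / (3 * c))" using \<delta> e c by simp
    fix x' assume x': "x' \<in> {0..1} \<times> \<Theta>" and d: "dist x' x < min \<delta> (e / (3 * c))"
    obtain u \<theta> u' \<theta>' where eq: "x = (u, \<theta>)" "x' = (u', \<theta>')" by (cases x; cases x')
    have in1: "u \<in> {0..1}" "u' \<in> {0..1}" "\<theta> \<in> \<Theta>" "\<theta>' \<in> \<Theta>" using x x' by (auto simp: eq)
    have "dist u' u \<le> dist x' x" "dist \<theta>' \<theta> \<le> dist x' x"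
      using dist_fst_le[of x' x] dist_snd_le[of x' x] by (auto simp: eq)
    then have near: "\<bar>u - u'\<bar> < \<delta>" "norm (\<theta>' - \<theta>) < e / (3 * c)"
      using d by (auto simp: dist_real_def dist_norm)
    have "\<bar>L u' \<theta>' - L u \<theta>'\<bar> \<le> e / 3" by (rule \<delta>(2)[OF in1(1,2) near(1) in1(4)])
    moreover have "\<bar>L u \<theta>' - L u \<theta>\<bar> \<le> e / 3"
    proof -
      have "\<bar>L u \<theta>' - L u \<theta>\<bar> \<le> 3 * C\<theta> * CZ * l1_norm (\<theta>' - \<theta>)" by (rule L_lipschitz[OF in1(1,4,3)])
      also have "\<dots> \<le> 3 * C\<theta> * CZ * (CARD('d) * norm (\<theta>' - \<theta>))"
        using C\<theta>_nonneg CZ_pos by (intro mult_left_mono l1_norm_le_norm) auto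
      also have "\<dots> \<le> c * norm (\<theta>' - \<theta>)" by (simp add: c_def algebra_simps)
      also have "\<dots> \<le> c * (e / (3 * c))" using near(2) c by (intro mult_left_mono) auto
      finally show ?thesis using c by simp
    qed
    ultimately show "dist (L (fst x') (snd x')) (L (fst x) (snd x)) < e"
      using e unfolding eq dist_real_def fst_conv snd_conv by linarith
  qed
qed

end

text \<open>\<open>us n\<close> collects the rescaled times at which the estimator is studied and \<open>kset n\<close> the left ends
  of the corresponding kernel windows.\<close>

locale bandwidth = estimation P \<epsilon> G M \<chi>v C0 \<Theta> Cz C\<theta> ell Xt X K \<theta>0
  for P :: "'w measure" and \<epsilon> and G :: "real \<Rightarrow> real ^ 'p::{finite,linorder} \<Rightarrow> real \<Rightarrow> real"
    and M and \<chi>v C0 and \<Theta> :: "(real ^ 'd) set" and Cz C\<theta> ell Xt X K \<theta>0 +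
  fixes b :: "nat \<Rightarrow> real" and U :: "real set" and us :: "nat \<Rightarrow> real set" and kset :: "nat \<Rightarrow> int set" and s :: real
  assumes b_pos: "0 < b n" and b_lim: "b \<longlonglongrightarrow> 0"
    and N_lim: "filterlim (\<lambda>n. real n * b n) at_top sequentially"
    and U: "compact U" "U \<subseteq> {0..1}" "continuous_on U \<theta>0"
    and us_subset: "us n \<subseteq> U"
    and us_inner: "\<forall>\<^sub>F n in sequentially. us n \<subseteq> {b n / 2..1 - b n / 2}"
    and kset_finite: "finite (kset n)"
    and s_nonneg: "0 \<le> s"
    and kset_card: "\<forall>\<^sub>F n in sequentially. real (card (kset n)) \<le> (real n * b n + 2) powr s"
    and kset_window: "\<forall>\<^sub>F n in sequentially. \<forall>u\<in>us n. \<exists>k\<in>kset n. \<exists>j. window CARD('p) n (b n) u = {k<..k + int j}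
      \<and> k + int j \<le> int n \<and> real j \<le> real n * b n + 1"
    and excess_bound: "\<theta> \<in> \<Theta> \<Longrightarrow> 0 < \<eta> \<Longrightarrow> \<exists>R>0.
      (\<forall>\<^sub>F n in sequentially. small \<eta> {\<omega> \<in> space P. \<exists>u\<in>us n. \<eta> * (real n * b n)
        < (\<Sum>t\<in>window CARD('p) n (b n) u. \<bar>obs (X n) t \<theta> \<omega> - trunc R (obs (X n) t \<theta> \<omega>)\<bar>)}) \<and>
      (\<forall>\<^sub>F n in sequentially. \<forall>u\<in>us n. \<forall>t\<in>window CARD('p) n (b n) u.
        (\<integral>\<^sup>+\<omega>. ennreal \<bar>obs (X n) t \<theta> \<omega> - trunc R (obs (X n) t \<theta> \<omega>)\<bar> \<partial>P) \<le> ennreal \<eta>)"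
    and envelope_bound: "0 < \<eta> \<Longrightarrow> \<exists>C. \<forall>\<^sub>F n in sequentially. small \<eta> {\<omega> \<in> space P. \<exists>u\<in>us n. C * (real n * b n)
        < (\<Sum>t\<in>window CARD('p) n (b n) u. 1 + rpow (znorm (X n) t \<omega>) (M + 1))}"
begin

lemma N_large: "\<forall>\<^sub>F n in sequentially. c \<le> real n * b n"
  using N_lim by (simp add: filterlim_at_top)

text \<open>With \<open>N = n b\<close> there are at most \<open>(N + 2) powr s\<close> left ends
  and at most \<open>N + 2\<close> lengths, hence polynomially many sums, each with a
  superpolynomially small deviation probability. All partial lengths are included because summation
  by parts needs them.\<close>

lemma bounded_part:
  assumes \<theta>: "\<theta> \<in> \<Theta>" and R: "0 < R" and \<eta>: "0 < \<eta>"
  shows "\<forall>\<^sub>F n in sequentially. small \<eta> {\<omega> \<in> space P. \<exists>k\<in>kset n. \<exists>i. real i \<le> real n * b n + 1 \<and> k + int i \<le> int n \<and>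
    \<eta> * (real n * b n) < \<bar>\<Sum>t\<in>{k<..k + int i}. trunc R (obs (X n) t \<theta> \<omega>) - expectation (\<lambda>\<omega>. trunc R (obs (X n) t \<theta> \<omega>))\<bar>}"
proof -
  define \<gamma> where "\<gamma> = - ln lam1"
  \<comment> \<open>For \<open>y = \<eta> * N / 3\<close> and \<open>J \<le> 2 * N\<close>, the
    quotient \<open>y^2 / (2 * J * R^2)\<close> is at least \<open>c * N\<close>, and
    \<open>J / y \<le> 6 / \<eta>\<close> leads to \<open>A\<close>.\<close>
  define c where "c = \<eta>\<^sup>2 / (36 * R\<^sup>2)"
  define A where "A = 6 / \<eta> * (Lc * (vbar + 1))"
  have \<gamma>: "0 < \<gamma>" using lam1_bounds by (simp add: \<gamma>_def)
  have c: "0 < c" using \<eta> R by (simp add: c_def)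
  have A: "0 \<le> A" using \<eta> Lc_nonneg vbar_nonneg by (simp add: A_def)
  define \<psi> where "\<psi> x = A * exp (- \<gamma> * (x powr (1/4) - 1)) + 2 * (x powr (1/4) + 1) * exp (- (c * x / (x powr (1/4) + 1)\<^sup>2))" for x
  have "((\<lambda>n. (real n * b n + 2) powr (s + 1) * \<psi> (real n * b n)) \<longlongrightarrow> 0) sequentially"
    using filterlim_compose[OF superpolynomial_decay[OF \<gamma> c, of "s + 1" A] N_lim] by (simp add: \<psi>_def)
  \<comment> \<open>The bound 1 secures the side condition
    \<open>real J * coupling_error m \<le> y\<close> of the concentration inequality; the bound
    \<open>\<eta>\<close> is for the final probability.\<close>
  then have "\<forall>\<^sub>F n in sequentially. (real n * b n + 2) powr (s + 1) * \<psi> (real n * b n) < min \<eta> 1"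
    using \<eta> by (intro order_tendstoD) auto
  with kset_card N_large[of 1] eventually_ge_at_top[of 1] show ?thesis
  proof eventually_elim
    case (elim n)
    define N where "N = real n * b n"
    define J where "J = nat \<lfloor>N + 1\<rfloor>"
    define m where "m = nat \<lfloor>N powr (1/4)\<rfloor>"
    define y where "y = \<eta> * N / 3"
    have N: "1 \<le> N" using elim by (simp add: N_def)
    have n: "1 \<le> n" by fact
    have J: "real J \<le> N + 1" "1 \<le> J" using N by (auto simp: J_def le_nat_iff le_floor_iff)
    have m: "real m \<le> N powr (1/4)" "N powr (1/4) - 1 \<le> real m" by (auto simp: m_def)
    have y: "0 < y" using \<eta> N by (simp add: y_def)
    have pow1: "1 \<le> (N + 2) powr (s + 1)" using N s_nonneg by (intro ge_one_powr_ge_zero) auto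
    have first: "real J * coupling_error m / y \<le> A * exp (- \<gamma> * (N powr (1/4) - 1))"
    proof -
      have "lam1 ^ m = exp (- \<gamma> * real m)"
        using exp_of_nat2_mult[of "ln lam1" m] lam1_bounds by (simp add: \<gamma>_def)
      also have "\<dots> \<le> exp (- \<gamma> * (N powr (1/4) - 1))" using m(2) \<gamma> by simp
      finally have lam: "lam1 ^ m \<le> exp (- \<gamma> * (N powr (1/4) - 1))" .
      have "real J / y \<le> 6 / \<eta>" using J N \<eta> by (simp add: y_def field_simps)
      then have "real J / y * coupling_error m \<le> 6 / \<eta> * coupling_error m"
        by (intro mult_right_mono coupling_error_nonneg)
      also have "\<dots> = A * lam1 ^ m" by (simp add: coupling_error_def A_def)
      also have "\<dots> \<le> A * exp (- \<gamma> * (N powr (1/4) - 1))" by (intro mult_left_mono lam A)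
      finally show ?thesis by simp
    qed
    have second: "2 * (real m + 1) * exp (- ((y / (real m + 1))\<^sup>2 / (2 * real J * R\<^sup>2)))
        \<le> 2 * (N powr (1/4) + 1) * exp (- (c * N / (N powr (1/4) + 1)\<^sup>2))"
    proof (intro mult_mono)
      have "c * N / D\<^sup>2 = (y / D)\<^sup>2 / (2 * (2 * N) * R\<^sup>2)" for D
        using N by (simp add: c_def y_def power_divide power_mult_distrib power2_eq_square[of N])
      then have "c * N / (N powr (1/4) + 1)\<^sup>2 = (y / (N powr (1/4) + 1))\<^sup>2 / (2 * (2 * N) * R\<^sup>2)" .
      also have "\<dots> \<le> (y / (real m + 1))\<^sup>2 / (2 * real J * R\<^sup>2)"
        using m J N R y
        by (intro frac_le power_mono divide_left_mono mult_right_mono mult_left_mono mult_pos_pos) (auto simp: add_nonneg_pos)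
      finally show "exp (- ((y / (real m + 1))\<^sup>2 / (2 * real J * R\<^sup>2))) \<le> exp (- (c * N / (N powr (1/4) + 1)\<^sup>2))"
        by simp
    qed (use m in auto)
    have \<psi>_le: "real J * coupling_error m / y + 2 * (real m + 1) * exp (- ((y / (real m + 1))\<^sup>2 / (2 * real J * R\<^sup>2))) \<le> \<psi> N"
      using first second by (simp add: \<psi>_def)
    have \<psi>_nonneg: "0 \<le> \<psi> N" using A by (simp add: \<psi>_def)
    have total: "(N + 2) powr (s + 1) * \<psi> N < min \<eta> 1" using elim by (simp add: N_def)
    have "1 * \<psi> N \<le> (N + 2) powr (s + 1) * \<psi> N" by (intro mult_right_mono pow1 \<psi>_nonneg)
    then have "\<psi> N < 1" using total by simp
    moreover have "real J * coupling_error m / y \<le> \<psi> N" using first by (simp add: \<psi>_def add_increasing2)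
    ultimately have "real J * coupling_error m / y < 1" by linarith
    then have couple: "real J * coupling_error m \<le> y" using y by (simp add: field_simps)
    let ?E = "\<lambda>k i. {\<omega> \<in> space P. 3 * y < \<bar>\<Sum>t\<in>{k<..k + int i}. trunc R (obs (X n) t \<theta> \<omega>) - expectation (\<lambda>\<omega>. trunc R (obs (X n) t \<theta> \<omega>))\<bar>}"
    define I where "I = {ki \<in> kset n \<times> {..J}. fst ki + int (snd ki) \<le> int n}"
    have I: "finite I" "card I \<le> card (kset n) * (J + 1)"
    proof -
      have fin: "finite (kset n \<times> {..J})" using kset_finite by simp
      then show "finite I" by (rule finite_subset[rotated]) (auto simp: I_def)
      have "card I \<le> card (kset n \<times> {..J})" using fin by (intro card_mono) (auto simp: I_def)
      then show "card I \<le> card (kset n) * (J + 1)" by (simp add: card_cartesian_product)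
    qed
    have one: "small (\<psi> N) (case ki of (k, i) \<Rightarrow> ?E k i)" if "ki \<in> I" for ki
    proof -
      obtain k i where ki: "ki = (k, i)" by (cases ki)
      have ki': "k + int i \<le> int n" "i \<le> J" using that by (auto simp: I_def ki)
      have "?E k i \<in> events"
      proof -
        have "(\<lambda>\<omega>. trunc R (obs (X n) t \<theta> \<omega>)) \<in> borel_measurable P" if "t \<in> {k<..k + int i}" for t
          by (rule measurable_compose[OF obs_measurable[OF row_adapted[OF n] _ \<theta>]]) (use that ki' in auto)
        then have [measurable]: "(\<lambda>\<omega>. \<Sum>t\<in>{k<..k + int i}. trunc R (obs (X n) t \<theta> \<omega>) - expectation (\<lambda>\<omega>. trunc R (obs (X n) t \<theta> \<omega>))) \<in> borel_measurable P"
          by (intro borel_measurable_sum borel_measurable_diff borel_measurable_const)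
        show ?thesis by measurable
      qed
      moreover have "prob (?E k i) \<le> \<psi> N"
        by (rule order_trans[OF bounded_concentration[OF \<theta> row_adapted[OF n] row_solves[OF n] row_moment[OF n] ki' R y couple] \<psi>_le])
      ultimately show ?thesis unfolding ki by (auto intro: smallI)
    qed
    have "small (real (card I) * \<psi> N) (\<Union>ki\<in>I. case ki of (k, i) \<Rightarrow> ?E k i)"
      by (rule small_UN[OF I(1) one])
    then show ?case
    proof (rule small_mono)
      show "{\<omega> \<in> space P. \<exists>k\<in>kset n. \<exists>i. real i \<le> real n * b n + 1 \<and> k + int i \<le> int n \<and>
          \<eta> * (real n * b n) < \<bar>\<Sum>t\<in>{k<..k + int i}. trunc R (obs (X n) t \<theta> \<omega>) - expectation (\<lambda>\<omega>. trunc R (obs (X n) t \<theta> \<omega>))\<bar>}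
        \<subseteq> (\<Union>ki\<in>I. case ki of (k, i) \<Rightarrow> ?E k i)"
      proof safe
        fix \<omega> k i assume "\<omega> \<in> space P" "k \<in> kset n" "real i \<le> real n * b n + 1" "k + int i \<le> int n"
          "\<eta> * (real n * b n) < \<bar>\<Sum>t\<in>{k<..k + int i}. trunc R (obs (X n) t \<theta> \<omega>) - expectation (\<lambda>\<omega>. trunc R (obs (X n) t \<theta> \<omega>))\<bar>"
        moreover from this(3) have "i \<le> J" unfolding J_def N_def by (rule le_nat_floor)
        ultimately show "\<omega> \<in> (\<Union>ki\<in>I. case ki of (k, i) \<Rightarrow> ?E k i)"
          by (intro UN_I[of "(k, i)"]) (auto simp: I_def y_def N_def)
      qed
      have "real (card I) * \<psi> N \<le> ((N + 2) powr s * (N + 2)) * \<psi> N"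
      proof (intro mult_right_mono \<psi>_nonneg)
        have "real (card I) \<le> real (card (kset n)) * (real J + 1)"
          using I(2) by (metis of_nat_1 of_nat_add of_nat_le_iff of_nat_mult)
        also have "\<dots> \<le> (N + 2) powr s * (N + 2)"
          using elim(1) J N by (intro mult_mono) (auto simp: N_def)
        finally show "real (card I) \<le> (N + 2) powr s * (N + 2)" .
      qed
      also have "(N + 2) powr s * (N + 2) = (N + 2) powr (s + 1)" using N by (simp add: powr_add)
      finally show "real (card I) * \<psi> N \<le> \<eta>" using total by linarith
    qed
  qed
qed

lemma L_bound:
  assumes "u \<in> {0..1}" "\<theta> \<in> \<Theta>"
  shows "\<bar>L u \<theta>\<bar> \<le> g0 \<theta>"
  unfolding expectation_obs_stationary[OF assms, of 0, symmetric]
  by (rule moment_bound(3)[OF obs_measurable[OF stat_adapted order_refl] obs_moment[OF _ stat_adapted order_refl stat_moment]])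
    (use assms Lc_nonneg vbar_nonneg in \<open>auto simp: g0_def\<close>)

text \<open>\<open>excess_bound\<close> enters twice: the truncation error has to be small in sum
  over each window off a small set, and small in mean at each time, since the truncated sums are
  centred at truncated means.\<close>

lemma pointwise_convergence:
  assumes \<theta>: "\<theta> \<in> \<Theta>" and \<eta>: "0 < \<eta>"
  shows "\<forall>\<^sub>F n in sequentially. small \<eta> {\<omega> \<in> space P. \<exists>u\<in>us n. \<eta> < \<bar>L_emp K ell X n (b n) u \<omega> \<theta> - L u \<theta>\<bar>}"
proof -
  from kernel_boundsE[OF K_kernel] obtain BK where BK: "0 \<le> BK" "\<And>x. \<bar>K x\<bar> \<le> BK"
    "\<And>(x :: nat \<Rightarrow> real) N. mono x \<Longrightarrow> (\<Sum>i<N. \<bar>K (x (Suc i)) - K (x i)\<bar>) \<le> BK" by blast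
  let ?p = "CARD('p)"
  \<comment> \<open>The eight shares: two for the fluctuation, one for the truncation, four for the
    bias (at most \<open>2 * N\<close> terms of size \<open>2 * \<eta>'\<close>), one for the kernel
    mass. The minimum with \<open>\<eta> / 2\<close> lets two exceptional sets fit into
    \<open>\<eta>\<close>.\<close>
  define \<eta>' where "\<eta>' = min (\<eta> / (8 * (BK + 1))) (\<eta> / 2)"
  have \<eta>': "0 < \<eta>'" "\<eta>' \<le> \<eta> / 2" "BK * (8 * \<eta>') \<le> \<eta>"
  proof -
    show "0 < \<eta>'" using \<eta> BK(1) by (simp add: \<eta>'_def)
    show "\<eta>' \<le> \<eta> / 2" unfolding \<eta>'_def by (rule min.cobounded2)
    have "BK * (8 * \<eta>') \<le> (BK + 1) * (8 * (\<eta> / (8 * (BK + 1))))"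
      using \<eta> BK \<open>0 < \<eta>'\<close> by (intro mult_mono) (auto simp: \<eta>'_def)
    also have "\<dots> = \<eta>" using BK by (simp add: field_simps)
    finally show "BK * (8 * \<eta>') \<le> \<eta>" .
  qed
  from excess_bound[OF \<theta> \<eta>'(1)] obtain R where R: "0 < R"
    and ex1: "\<forall>\<^sub>F n in sequentially. small \<eta>' {\<omega> \<in> space P. \<exists>u\<in>us n. \<eta>' * (real n * b n)
        < (\<Sum>t\<in>window ?p n (b n) u. \<bar>obs (X n) t \<theta> \<omega> - trunc R (obs (X n) t \<theta> \<omega>)\<bar>)}"
    and ex2: "\<forall>\<^sub>F n in sequentially. \<forall>u\<in>us n. \<forall>t\<in>window ?p n (b n) u.
        (\<integral>\<^sup>+\<omega>. ennreal \<bar>obs (X n) t \<theta> \<omega> - trunc R (obs (X n) t \<theta> \<omega>)\<bar> \<partial>P) \<le> ennreal \<eta>'" by blast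
  show ?thesis
    using ex1 ex2 bounded_part[OF \<theta> R \<eta>'(1)] close_window[OF \<eta>'(1) b_lim b_pos] us_inner kset_window
      N_large[of "max 1 (g0 \<theta> * (real ?p + 2) / \<eta>')"] eventually_ge_at_top[of "Suc ?p"]
  proof eventually_elim
    case (elim n)
    define N where "N = real n * b n"
    have n: "1 \<le> n" "?p \<le> n" using elim(8) by auto
    have N: "1 \<le> N" "g0 \<theta> * (real ?p + 2) \<le> \<eta>' * N" using elim(7) \<eta>'(1) by (auto simp: N_def field_simps)
    from small_Un[OF elim(1,3)] show ?case
    proof (rule small_mono)
      show "\<eta>' + \<eta>' \<le> \<eta>" using \<eta>'(2) by simp
      show "{\<omega> \<in> space P. \<exists>u\<in>us n. \<eta> < \<bar>L_emp K ell X n (b n) u \<omega> \<theta> - L u \<theta>\<bar>} \<subseteq>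
        {\<omega> \<in> space P. \<exists>u\<in>us n. \<eta>' * (real n * b n)
          < (\<Sum>t\<in>window ?p n (b n) u. \<bar>obs (X n) t \<theta> \<omega> - trunc R (obs (X n) t \<theta> \<omega>)\<bar>)} \<union>
        {\<omega> \<in> space P. \<exists>k\<in>kset n. \<exists>i. real i \<le> real n * b n + 1 \<and> k + int i \<le> int n \<and>
          \<eta>' * (real n * b n) < \<bar>\<Sum>t\<in>{k<..k + int i}. trunc R (obs (X n) t \<theta> \<omega>) - expectation (\<lambda>\<omega>. trunc R (obs (X n) t \<theta> \<omega>))\<bar>}"
      proof (rule subsetI, rule ccontr)
        fix \<omega> assume "\<omega> \<in> {\<omega> \<in> space P. \<exists>u\<in>us n. \<eta> < \<bar>L_emp K ell X n (b n) u \<omega> \<theta> - L u \<theta>\<bar>}"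
        then obtain u where \<omega>: "\<omega> \<in> space P" and u: "u \<in> us n" and big: "\<eta> < \<bar>L_emp K ell X n (b n) u \<omega> \<theta> - L u \<theta>\<bar>" by auto
        have u01: "u \<in> {0..1}" using u us_subset U(2) by blast
        let ?g = "\<lambda>t. obs (X n) t \<theta> \<omega>" and ?f = "\<lambda>t. trunc R (obs (X n) t \<theta> \<omega>)"
        let ?e = "\<lambda>t. expectation (\<lambda>\<omega>. trunc R (obs (X n) t \<theta> \<omega>))"
        obtain k j where kj: "k \<in> kset n" "window ?p n (b n) u = {k<..k + int j}" "k + int j \<le> int n" "real j \<le> N + 1"
          using elim(6) u unfolding N_def by blast
        assume "\<omega> \<notin> {\<omega> \<in> space P. \<exists>u\<in>us n. \<eta>' * (real n * b n)
          < (\<Sum>t\<in>window ?p n (b n) u. \<bar>obs (X n) t \<theta> \<omega> - trunc R (obs (X n) t \<theta> \<omega>)\<bar>)} \<union>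
        {\<omega> \<in> space P. \<exists>k\<in>kset n. \<exists>i. real i \<le> real n * b n + 1 \<and> k + int i \<le> int n \<and>
          \<eta>' * (real n * b n) < \<bar>\<Sum>t\<in>{k<..k + int i}. trunc R (obs (X n) t \<theta> \<omega>) - expectation (\<lambda>\<omega>. trunc R (obs (X n) t \<theta> \<omega>))\<bar>}"
        then have D: "(\<Sum>t\<in>window ?p n (b n) u. \<bar>?g t - ?f t\<bar>) \<le> \<eta>' * N"
          and S: "\<And>i. real i \<le> N + 1 \<Longrightarrow> k + int i \<le> int n \<Longrightarrow> \<bar>\<Sum>t\<in>{k<..k + int i}. ?f t - ?e t\<bar> \<le> \<eta>' * N"
          using \<omega> u kj(1) by (auto simp: N_def not_less)
        have E: "\<bar>?e t - L u \<theta>\<bar> \<le> 2 * \<eta>'" if t: "t \<in> window ?p n (b n) u" for t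
        proof -
          have tn: "t \<le> int n" by (rule window_le[OF t])
          have [measurable]: "obs (X n) t \<theta> \<in> borel_measurable P" "obs (Xt u) t \<theta> \<in> borel_measurable P"
            using obs_measurable[OF row_adapted[OF n(1)] tn \<theta>] obs_measurable[OF stat_adapted[OF u01] order_refl \<theta>] by auto
          have int: "integrable P (obs (X n) t \<theta>)" "integrable P (obs (Xt u) t \<theta>)"
            by (rule row_obs_integrable[OF n(1) tn \<theta>], rule stat_obs_integrable[OF u01 \<theta>])
          have intf: "integrable P (\<lambda>\<omega>. trunc R (obs (X n) t \<theta> \<omega>))"
            using abs_trunc_le[of R] R by (intro integrable_const_bound[of _ R]) auto
          have "\<bar>expectation (\<lambda>\<omega>. obs (X n) t \<theta> \<omega> - trunc R (obs (X n) t \<theta> \<omega>))\<bar> \<le> \<eta>'"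
            using elim(2) u t \<eta>'(1) by (intro moment_bound(3)) auto
          moreover have "\<bar>expectation (\<lambda>\<omega>. obs (X n) t \<theta> \<omega> - obs (Xt u) t \<theta> \<omega>)\<bar> \<le> \<eta>'"
            using elim(4) u01 t \<theta> \<eta>'(1) by (intro moment_bound(3)) auto
          ultimately show ?thesis
            using int intf expectation_obs_stationary[OF u01 \<theta>, of t] by simp
        qed
        have "(\<Sum>t\<in>window ?p n (b n) u. \<bar>?e t - L u \<theta>\<bar>) \<le> (\<Sum>t\<in>window ?p n (b n) u. 2 * \<eta>')"
          by (intro sum_mono E)
        also have "\<dots> = real j * (2 * \<eta>')" unfolding kj(2) by simp
        also have "\<dots> \<le> (2 * N) * (2 * \<eta>')" using kj(4) N(1) \<eta>'(1) by (intro mult_right_mono) auto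
        finally have E': "(\<Sum>t\<in>window ?p n (b n) u. \<bar>?e t - L u \<theta>\<bar>) \<le> 4 * \<eta>' * N" by (simp add: mult_ac)
        have "\<bar>1 / (real n * b n) * (\<Sum>t\<in>window ?p n (b n) u. K ((real_of_int t / real n - u) / b n) * ?g t) - L u \<theta>\<bar>
            \<le> BK / (real n * b n) * (2 * (\<eta>' * N) + \<eta>' * N + 4 * \<eta>' * N + \<bar>L u \<theta>\<bar> * (real ?p + 2))"
        proof (rule kernel_average_error[OF K_kernel BK n b_pos _ kj(2) _ D E'])
          show "u \<in> {b n / 2..1 - b n / 2}" using elim(5) u by blast
          show "\<bar>\<Sum>t\<in>{k<..k + int i}. ?f t - ?e t\<bar> \<le> \<eta>' * N" if "i \<le> j" for i
            using that kj by (intro S) auto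
        qed
        moreover have "L_emp K ell X n (b n) u \<omega> \<theta>
            = 1 / (real n * b n) * (\<Sum>t\<in>window ?p n (b n) u. K ((real_of_int t / real n - u) / b n) * ?g t)"
          unfolding L_emp_window[OF K_kernel b_pos] obs_def ..
        ultimately have "\<bar>L_emp K ell X n (b n) u \<omega> \<theta> - L u \<theta>\<bar> \<le> BK / N * (7 * \<eta>' * N + \<bar>L u \<theta>\<bar> * (real ?p + 2))"
          by (simp add: N_def algebra_simps)
        also have "\<dots> \<le> BK / N * (8 * \<eta>' * N)"
        proof (intro mult_left_mono)
          have "\<bar>L u \<theta>\<bar> * (real ?p + 2) \<le> g0 \<theta> * (real ?p + 2)"
            using L_bound[OF u01 \<theta>] by (intro mult_right_mono) auto
          then show "7 * \<eta>' * N + \<bar>L u \<theta>\<bar> * (real ?p + 2) \<le> 8 * \<eta>' * N" using N(2) by linarith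
        qed (use BK N in auto)
        also have "\<dots> = BK * (8 * \<eta>')" using N by simp
        finally show False using big \<eta>'(3) by linarith
      qed
    qed
  qed
qed

text \<open>A finite net in \<open>\<Theta>\<close> leaves finitely many parameters. Away from the
  net the empirical objective moves by a random Lipschitz constant, a kernel average of
  \<open>1 + rpow (znorm (X n) t \<omega>) (M + 1)\<close>, which \<open>envelope_bound\<close>
  keeps bounded off a small set.\<close>

lemma uniform_convergence:
  assumes \<eta>: "0 < \<eta>"
  shows "\<forall>\<^sub>F n in sequentially. small \<eta> {\<omega> \<in> space P. \<exists>u\<in>us n. \<exists>\<theta>\<in>\<Theta>. \<eta> < \<bar>L_emp K ell X n (b n) u \<omega> \<theta> - L u \<theta>\<bar>}"
proof -
  from kernel_boundsE[OF K_kernel] obtain BK where BK: "0 \<le> BK" "\<And>x. \<bar>K x\<bar> \<le> BK"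
    "\<And>(x :: nat \<Rightarrow> real) N. mono x \<Longrightarrow> (\<Sum>i<N. \<bar>K (x (Suc i)) - K (x i)\<bar>) \<le> BK" by blast
  let ?p = "CARD('p)"
  from envelope_bound[of "\<eta> / 2"] \<eta> obtain C where
    C: "\<forall>\<^sub>F n in sequentially. small (\<eta> / 2) {\<omega> \<in> space P. \<exists>u\<in>us n. C * (real n * b n)
        < (\<Sum>t\<in>window ?p n (b n) u. 1 + rpow (znorm (X n) t \<omega>) (M + 1))}" by auto
  \<comment> \<open>\<open>c\<close> exceeds the Lipschitz constants of the empirical and the limit
    objective together. The radius \<open>\<rho>\<close> limits their joint change to
    \<open>\<eta> / 2\<close>; the net points contribute at most the other half.\<close>
  define c where "c = BK * (3 * C\<theta>) * \<bar>C\<bar> + 3 * C\<theta> * CZ + 1"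
  have c: "0 < c" using BK C\<theta>_nonneg CZ_pos by (simp add: c_def add_nonneg_pos)
  define \<rho> where "\<rho> = \<eta> / (2 * c * CARD('d))"
  have \<rho>: "0 < \<rho>" using \<eta> c by (simp add: \<rho>_def)
  have "\<exists>T. finite T \<and> T \<subseteq> \<Theta> \<and> \<Theta> \<subseteq> (\<Union>x\<in>T. ball x \<rho>)"
    using seq_compact_imp_totally_bounded[OF compact_imp_seq_compact[OF \<Theta>_compact]] \<rho> by simp
  then obtain T where T: "finite T" "T \<subseteq> \<Theta>" "\<Theta> \<subseteq> (\<Union>x\<in>T. ball x \<rho>)" by (elim exE conjE) (rule that)
  define \<eta>' where "\<eta>' = \<eta> / (2 * (real (card T) + 1))"
  have \<eta>': "0 < \<eta>'" "real (card T) * \<eta>' \<le> \<eta> / 2" "\<eta>' \<le> \<eta> / 2" using \<eta> by (auto simp: \<eta>'_def field_simps)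
  have "\<forall>\<^sub>F n in sequentially. \<forall>\<theta>\<in>T. small \<eta>' {\<omega> \<in> space P. \<exists>u\<in>us n. \<eta>' < \<bar>L_emp K ell X n (b n) u \<omega> \<theta> - L u \<theta>\<bar>}"
    using T pointwise_convergence[OF _ \<eta>'(1)] by (intro eventually_ball_finite) auto
  with C N_large[of 1] eventually_ge_at_top[of 1] show ?thesis
  proof eventually_elim
    case (elim n)
    define N where "N = real n * b n"
    have N: "1 \<le> N" using elim by (simp add: N_def)
    have "small (\<eta> / 2 + real (card T) * \<eta>')
      ({\<omega> \<in> space P. \<exists>u\<in>us n. C * (real n * b n) < (\<Sum>t\<in>window ?p n (b n) u. 1 + rpow (znorm (X n) t \<omega>) (M + 1))}
        \<union> (\<Union>\<theta>\<in>T. {\<omega> \<in> space P. \<exists>u\<in>us n. \<eta>' < \<bar>L_emp K ell X n (b n) u \<omega> \<theta> - L u \<theta>\<bar>}))"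
      using elim T(1) by (intro small_Un small_UN) auto
    then show ?case
    proof (rule small_mono)
      show "\<eta> / 2 + real (card T) * \<eta>' \<le> \<eta>" using \<eta>'(2) by simp
      show "{\<omega> \<in> space P. \<exists>u\<in>us n. \<exists>\<theta>\<in>\<Theta>. \<eta> < \<bar>L_emp K ell X n (b n) u \<omega> \<theta> - L u \<theta>\<bar>} \<subseteq>
        {\<omega> \<in> space P. \<exists>u\<in>us n. C * (real n * b n) < (\<Sum>t\<in>window ?p n (b n) u. 1 + rpow (znorm (X n) t \<omega>) (M + 1))}
        \<union> (\<Union>\<theta>\<in>T. {\<omega> \<in> space P. \<exists>u\<in>us n. \<eta>' < \<bar>L_emp K ell X n (b n) u \<omega> \<theta> - L u \<theta>\<bar>})"
      proof (rule subsetI, rule ccontr)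
        fix \<omega> assume "\<omega> \<in> {\<omega> \<in> space P. \<exists>u\<in>us n. \<exists>\<theta>\<in>\<Theta>. \<eta> < \<bar>L_emp K ell X n (b n) u \<omega> \<theta> - L u \<theta>\<bar>}"
        then obtain u \<theta> where \<omega>: "\<omega> \<in> space P" and u: "u \<in> us n" and \<theta>: "\<theta> \<in> \<Theta>"
          and big: "\<eta> < \<bar>L_emp K ell X n (b n) u \<omega> \<theta> - L u \<theta>\<bar>" by auto
        have u01: "u \<in> {0..1}" using u us_subset U(2) by blast
        obtain \<theta>' where \<theta>': "\<theta>' \<in> T" "dist \<theta>' \<theta> < \<rho>" using T(3) \<theta> by auto
        have \<theta>'\<Theta>: "\<theta>' \<in> \<Theta>" using \<theta>' T by blast
        assume "\<omega> \<notin> {\<omega> \<in> space P. \<exists>u\<in>us n. C * (real n * b n) < (\<Sum>t\<in>window ?p n (b n) u. 1 + rpow (znorm (X n) t \<omega>) (M + 1))}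
          \<union> (\<Union>\<theta>\<in>T. {\<omega> \<in> space P. \<exists>u\<in>us n. \<eta>' < \<bar>L_emp K ell X n (b n) u \<omega> \<theta> - L u \<theta>\<bar>})"
        then have env: "(\<Sum>t\<in>window ?p n (b n) u. 1 + rpow (znorm (X n) t \<omega>) (M + 1)) \<le> C * N"
          and net: "\<bar>L_emp K ell X n (b n) u \<omega> \<theta>' - L u \<theta>'\<bar> \<le> \<eta>'"
          using \<omega> u \<theta>' by (auto simp: N_def not_less)
        let ?l = "l1_norm (\<theta> - \<theta>')"
        have l: "0 \<le> ?l" "c * ?l \<le> \<eta> / 2"
        proof -
          have "?l \<le> CARD('d) * \<rho>"
          proof (rule order_trans[OF l1_norm_le_norm mult_left_mono])
            show "norm (\<theta> - \<theta>') \<le> \<rho>" using \<theta>'(2) by (simp add: dist_norm norm_minus_commute)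
          qed simp
          then have "c * ?l \<le> c * (CARD('d) * \<rho>)" using c by (intro mult_left_mono) auto
          then show "c * ?l \<le> \<eta> / 2" using c by (simp add: \<rho>_def)
        qed (rule l1_norm_nonneg)
        have "\<bar>L_emp K ell X n (b n) u \<omega> \<theta> - L_emp K ell X n (b n) u \<omega> \<theta>'\<bar>
            = \<bar>1 / N * (\<Sum>t\<in>window ?p n (b n) u. K ((real_of_int t / real n - u) / b n) * (obs (X n) t \<theta> \<omega> - obs (X n) t \<theta>' \<omega>))\<bar>"
          unfolding L_emp_window[OF K_kernel b_pos] N_def obs_def
          by (simp add: right_diff_distrib sum_subtractf)
        also have "\<dots> \<le> 1 / N * (\<Sum>t\<in>window ?p n (b n) u. BK * (3 * C\<theta> * ?l * (1 + rpow (znorm (X n) t \<omega>) (M + 1))))"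
        proof -
          have "\<bar>\<Sum>t\<in>window ?p n (b n) u. K ((real_of_int t / real n - u) / b n) * (obs (X n) t \<theta> \<omega> - obs (X n) t \<theta>' \<omega>)\<bar>
              \<le> (\<Sum>t\<in>window ?p n (b n) u. BK * (3 * C\<theta> * ?l * (1 + rpow (znorm (X n) t \<omega>) (M + 1))))"
            by (rule order_trans[OF sum_abs])
              (auto simp: abs_mult intro!: sum_mono mult_mono BK obs_param_lipschitz \<theta> \<theta>'\<Theta>)
          then show ?thesis using N by (simp add: abs_mult divide_right_mono)
        qed
        also have "\<dots> = 1 / N * (BK * (3 * C\<theta>) * ?l) * (\<Sum>t\<in>window ?p n (b n) u. 1 + rpow (znorm (X n) t \<omega>) (M + 1))"
          by (simp only: sum_distrib_left mult_ac)
        also have "\<dots> \<le> 1 / N * (BK * (3 * C\<theta>) * ?l) * (\<bar>C\<bar> * N)"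
        proof (rule mult_left_mono)
          have "C * N \<le> \<bar>C\<bar> * N" using N by (intro mult_right_mono) auto
          then show "(\<Sum>t\<in>window ?p n (b n) u. 1 + rpow (znorm (X n) t \<omega>) (M + 1)) \<le> \<bar>C\<bar> * N" using env by linarith
        qed (use N BK C\<theta>_nonneg l in auto)
        also have "\<dots> = BK * (3 * C\<theta>) * \<bar>C\<bar> * ?l" using N by simp
        finally have 1: "\<bar>L_emp K ell X n (b n) u \<omega> \<theta> - L_emp K ell X n (b n) u \<omega> \<theta>'\<bar> \<le> BK * (3 * C\<theta>) * \<bar>C\<bar> * ?l" .
        have 2: "\<bar>L u \<theta> - L u \<theta>'\<bar> \<le> 3 * C\<theta> * CZ * ?l" by (rule L_lipschitz[OF u01 \<theta> \<theta>'\<Theta>])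
        have "BK * (3 * C\<theta>) * \<bar>C\<bar> * ?l + 3 * C\<theta> * CZ * ?l \<le> c * ?l"
          using l(1) by (simp add: c_def algebra_simps)
        then show False using 1 2 net big l(2) \<eta>'(3) by linarith
      qed
    qed
  qed
qed

text \<open>Off the small set, empirical and limit objective differ by at most
  \<open>\<kappa> / 3\<close> at both the estimate and the true parameter. Minimality then puts the
  limit objective at the estimate at most \<open>2 * \<kappa> / 3\<close> above its minimum, less
  than the separation \<open>\<kappa>\<close>.\<close>

lemma consistency:
  fixes \<theta>hat :: "nat \<Rightarrow> real \<Rightarrow> 'w \<Rightarrow> real ^ 'd"
  assumes min: "\<And>n u \<omega>. n \<ge> 1 \<Longrightarrow> u \<in> {0..1} \<Longrightarrow> \<omega> \<in> space P \<Longrightarrow>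
      is_arg_min (L_emp K ell X n (b n) u \<omega>) (\<lambda>\<theta>. \<theta> \<in> \<Theta>) (\<theta>hat n u \<omega>)"
    and \<delta>: "0 < \<delta>"
  shows "(\<lambda>n. outer_measure_of P {\<omega> \<in> space P. \<exists>u\<in>us n. \<delta> \<le> norm (\<theta>hat n u \<omega> - \<theta>0 u)}) \<longlonglongrightarrow> 0"
proof (rule outer_measure_tendsto_0)
  fix \<eta> :: real assume \<eta>: "0 < \<eta>"
  have cont: "continuous_on (U \<times> \<Theta>) (\<lambda>x. L (fst x) (snd x))"
    by (rule continuous_on_subset[OF L_continuous]) (use U in auto)
  have range: "\<theta>0 ` U \<subseteq> \<Theta>" using \<theta>0_range U(2) by auto
  have unique: "u \<in> U \<Longrightarrow> is_arg_min (L u) (\<lambda>\<theta>. \<theta> \<in> \<Theta>) \<theta> \<longleftrightarrow> \<theta> = \<theta>0 u" for u \<theta>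
    using U(2) by (intro \<theta>0_unique_min) auto
  from well_separated_minimizer[OF U(1) \<Theta>_compact U(3) range cont unique \<delta>] obtain \<kappa> where \<kappa>: "0 < \<kappa>"
    "\<And>u \<theta>. u \<in> U \<Longrightarrow> \<theta> \<in> \<Theta> \<Longrightarrow> \<delta> \<le> norm (\<theta> - \<theta>0 u) \<Longrightarrow> L u (\<theta>0 u) + \<kappa> \<le> L u \<theta>" by blast
  define \<eta>' where "\<eta>' = min \<eta> (\<kappa> / 3)"
  have \<eta>': "0 < \<eta>'" using \<eta> \<kappa> by (simp add: \<eta>'_def)
  show "\<forall>\<^sub>F n in sequentially. small \<eta> {\<omega> \<in> space P. \<exists>u\<in>us n. \<delta> \<le> norm (\<theta>hat n u \<omega> - \<theta>0 u)}"
    using uniform_convergence[OF \<eta>'] eventually_ge_at_top[of 1]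
  proof eventually_elim
    case (elim n)
    from elim(1) show ?case
    proof (rule small_mono)
      show "\<eta>' \<le> \<eta>" by (simp add: \<eta>'_def)
      show "{\<omega> \<in> space P. \<exists>u\<in>us n. \<delta> \<le> norm (\<theta>hat n u \<omega> - \<theta>0 u)}
        \<subseteq> {\<omega> \<in> space P. \<exists>u\<in>us n. \<exists>\<theta>\<in>\<Theta>. \<eta>' < \<bar>L_emp K ell X n (b n) u \<omega> \<theta> - L u \<theta>\<bar>}"
      proof (rule subsetI, rule ccontr)
        fix \<omega> assume "\<omega> \<in> {\<omega> \<in> space P. \<exists>u\<in>us n. \<delta> \<le> norm (\<theta>hat n u \<omega> - \<theta>0 u)}"
        then obtain u where \<omega>: "\<omega> \<in> space P" and u: "u \<in> us n" "\<delta> \<le> norm (\<theta>hat n u \<omega> - \<theta>0 u)" by auto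
        have uU: "u \<in> U" "u \<in> {0..1}" using u us_subset U(2) by blast+
        let ?L = "L_emp K ell X n (b n) u \<omega>"
        assume "\<omega> \<notin> {\<omega> \<in> space P. \<exists>u\<in>us n. \<exists>\<theta>\<in>\<Theta>. \<eta>' < \<bar>L_emp K ell X n (b n) u \<omega> \<theta> - L u \<theta>\<bar>}"
        then have close: "\<bar>?L \<theta> - L u \<theta>\<bar> \<le> \<kappa> / 3" if "\<theta> \<in> \<Theta>" for \<theta>
        proof -
          have "\<bar>?L \<theta> - L u \<theta>\<bar> \<le> \<eta>'"
            using \<open>\<omega> \<notin> _\<close> that \<omega> u(1) by (auto simp: not_less)
          then show ?thesis by (simp add: \<eta>'_def)
        qed
        have am: "is_arg_min ?L (\<lambda>\<theta>. \<theta> \<in> \<Theta>) (\<theta>hat n u \<omega>)" by (rule min[OF elim(2) uU(2) \<omega>])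
        have hat: "\<theta>hat n u \<omega> \<in> \<Theta>" using am by (simp add: is_arg_min_def)
        have t0: "\<theta>0 u \<in> \<Theta>" using range uU by blast
        have "?L (\<theta>hat n u \<omega>) \<le> ?L (\<theta>0 u)" using am t0 by (auto simp: is_arg_min_def not_less)
        then show False using close[OF hat] close[OF t0] \<kappa>(2)[OF uU(1) hat u(2)] \<kappa>(1) by linarith
      qed
    qed
  qed
qed

end

section \<open>Excesses in all windows simultaneously\<close>

lemma trunc_excess: "0 \<le> R \<Longrightarrow> \<bar>x - trunc R x\<bar> = max (\<bar>x\<bar> - R) 0"
  by (auto simp: trunc_def max_def min_def)

text \<open>Unless the excess equals \<open>v powr s\<close>, one has
  \<open>c * v powr q < v powr s\<close>, which bounds \<open>v\<close> by a power of
  \<open>1 / c\<close>. A smaller c thus means a higher cut-off level.\<close>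

lemma powr_le_excess:
  assumes c: "0 < c" and s: "0 < s" "s < q" and v: "0 \<le> v"
  shows "v powr s \<le> (1 / c) powr (s / (q - s)) + excess s q c v"
proof (cases "v powr s \<le> c * v powr q")
  case True
  then show ?thesis by (simp add: excess_def)
next
  case False
  then have v: "0 < v" using v s by (cases "v = 0") auto
  have "v powr (q - s) < 1 / c"
  proof -
    have "c * (v powr (q - s) * v powr s) < v powr s"
      using False by (simp add: powr_add[symmetric])
    then show ?thesis using v c by (simp add: field_simps)
  qed
  then have "(v powr (q - s)) powr (s / (q - s)) \<le> (1 / c) powr (s / (q - s))"
    using s c by (intro powr_mono2) auto
  then have "v powr s \<le> (1 / c) powr (s / (q - s))" using s by (simp add: powr_powr)
  then show ?thesis using excess_nonneg[of c s q v] c by simp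
qed

context autoregression
begin

lemma excess_moment:
  assumes "0 \<le> c" and v: "Lq_le P q (\<lambda>\<omega>. V (lagv X t \<omega>)) vbar"
  shows "(\<integral>\<^sup>+\<omega>. ennreal (excess s q c (V (lagv X t \<omega>))) \<partial>P) \<le> ennreal (c * vbar powr q)"
proof -
  note [measurable] = Lq_le_measurable[OF v]
  have "(\<integral>\<^sup>+\<omega>. ennreal (excess s q c (V (lagv X t \<omega>))) \<partial>P) \<le> (\<integral>\<^sup>+\<omega>. ennreal c * ennreal (\<bar>V (lagv X t \<omega>)\<bar> powr q) \<partial>P)"
    using assms(1) V_nonneg by (intro nn_integral_mono) (simp add: excess_def ennreal_leI flip: ennreal_mult)
  also have "\<dots> = ennreal c * (\<integral>\<^sup>+\<omega>. ennreal (\<bar>V (lagv X t \<omega>)\<bar> powr q) \<partial>P)"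
    by (rule nn_integral_cmult) measurable
  also have "\<dots> \<le> ennreal c * ennreal (vbar powr q)" by (intro mult_left_mono Lq_le_nn_integral[OF v]) simp
  finally show ?thesis using assms(1) by (simp add: ennreal_mult)
qed

text \<open>Time is cut into blocks of length \<open>J\<close>, longer than any admissible window,
  so that a window meets at most two successive blocks. About \<open>n / N\<close> blocks, each
  failing with probability of order \<open>N * N powr - (q / s)\<close>, give
  \<open>n * N powr - (q / s)\<close> in total. A union over all window positions would cost another
  factor \<open>N\<close>.\<close>

lemma excess_uniform:
  fixes N :: "nat \<Rightarrow> real" and X :: "nat \<Rightarrow> int \<Rightarrow> 'w \<Rightarrow> real"
  assumes s: "1 \<le> s" "s < q"
    and X: "\<And>n. 1 \<le> n \<Longrightarrow> adapted (int n) (X n)"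
      "\<And>n t. 1 \<le> n \<Longrightarrow> t \<le> int n \<Longrightarrow> solves (X n) t (a n t)"
      "\<And>n t. 1 \<le> n \<Longrightarrow> t \<le> int n \<Longrightarrow> Lq_le P q (\<lambda>\<omega>. V (lagv (X n) t \<omega>)) vbar"
    and N: "filterlim N at_top sequentially" "\<forall>\<^sub>F n in sequentially. N n \<le> real n"
      "(\<lambda>n. real n * N n powr - (q / s)) \<longlonglongrightarrow> 0"
    and \<eta>: "0 < \<eta>"
  obtains c where "0 < c" "c \<le> 1" "c * vbar powr q \<le> \<eta>"
    "\<forall>\<^sub>F n in sequentially. small \<eta> {\<omega> \<in> space P. \<exists>k j. 0 \<le> k \<and> k + int j \<le> int n \<and> real j \<le> N n + 1 \<and>
      \<eta> * N n < (\<Sum>t\<in>{k..k + int j}. excess s q c (V (lagv (X n) t \<omega>)))}"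
proof -
  let ?r = "q / s"
  from excess_window[OF s] obtain K1 K2 where K: "0 \<le> K1" "0 \<le> K2"
    and win: "\<And>c n X a k j x. 0 \<le> c \<Longrightarrow> c \<le> 1 \<Longrightarrow> adapted n X \<Longrightarrow> (\<And>t. t \<le> n \<Longrightarrow> solves X t (a t)) \<Longrightarrow>
      (\<And>t. t \<le> n \<Longrightarrow> Lq_le P q (\<lambda>\<omega>. V (lagv X t \<omega>)) vbar) \<Longrightarrow> k + int j \<le> n \<Longrightarrow> 0 < x \<Longrightarrow>
      prob {\<omega> \<in> space P. (\<Sum>t\<in>{k<..k + int j}. excess s q c (V (lagv X t \<omega>))) > c * K1 * real j + x}
        \<le> K2 * (real j + 1) / x powr ?r" by blast
  \<comment> \<open>The summands of \<open>D\<close> yield the bounds on c. As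
    \<open>J \<le> 4 * N n\<close>, the compensator \<open>c * K1 * J\<close> of a block is at most
    \<open>\<eta> * N n / 4\<close>, which is also the value of \<open>x\<close>; two blocks then
    stay within \<open>\<eta> * N n\<close>.\<close>
  define D where "D = 16 * K1 + vbar powr q + \<eta> + 1"
  have D: "0 < D" using K \<eta> by (simp add: D_def add_nonneg_pos)
  define c where "c = \<eta> / D"
  have c: "0 < c" "c \<le> 1" "c * vbar powr q \<le> \<eta>" "c * K1 \<le> \<eta> / 16"
  proof -
    show "0 < c" using \<eta> D by (simp add: c_def)
    have le: "c * z \<le> \<eta>" if "z \<le> D" for z
      using that \<eta> D \<open>0 < c\<close> mult_left_mono[of z D c] by (simp add: c_def)
    have nn: "0 \<le> vbar powr q" by simp
    show "c * vbar powr q \<le> \<eta>" using K \<eta> by (intro le) (simp add: D_def)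
    have "c * (16 * K1) \<le> \<eta>" using K \<eta> nn by (intro le) (simp add: D_def)
    then show "c * K1 \<le> \<eta> / 16" by simp
    show "c \<le> 1" using D K \<eta> nn by (simp add: c_def) (simp add: D_def)
  qed
  define c' where "c' = 10 * K2 * (4 / \<eta>) powr ?r"
  have "(\<lambda>n. c' * (real n * N n powr - ?r)) \<longlonglongrightarrow> c' * 0" by (intro tendsto_intros N)
  then have lim: "\<forall>\<^sub>F n in sequentially. c' * (real n * N n powr - ?r) < \<eta>" using \<eta> by (intro order_tendstoD) auto
  have N1: "\<forall>\<^sub>F n in sequentially. 1 \<le> N n" using N(1) by (simp add: filterlim_at_top)
  have "\<forall>\<^sub>F n in sequentially. small \<eta> {\<omega> \<in> space P. \<exists>k j. 0 \<le> k \<and> k + int j \<le> int n \<and> real j \<le> N n + 1 \<and>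
      \<eta> * N n < (\<Sum>t\<in>{k..k + int j}. excess s q c (V (lagv (X n) t \<omega>)))}"
    using lim N1 N(2) eventually_ge_at_top[of 1]
  proof eventually_elim
    case (elim n)
    note n = \<open>1 \<le> n\<close> and Nn = \<open>1 \<le> N n\<close> \<open>N n \<le> real n\<close>
    define J where "J = nat \<lceil>N n + 2\<rceil>"
    have J: "N n + 2 \<le> real J" "real J \<le> 4 * N n" "0 < J"
      using Nn by (auto simp: J_def) linarith+
    define x where "x = \<eta> * N n / 4"
    have x: "0 < x" using \<eta> Nn by (simp add: x_def)
    let ?\<xi> = "\<lambda>t \<omega>. excess s q c (V (lagv (X n) t \<omega>))"
    have \<xi>: "0 \<le> ?\<xi> t \<omega>" for t \<omega> using excess_nonneg[of c] c by simp
    define blk where "blk i = {int i * int J..int (Suc i) * int J - 1} \<inter> {..int n}" for i :: nat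
    define B where "B i = {\<omega> \<in> space P. c * K1 * real J + x < (\<Sum>t\<in>blk i. ?\<xi> t \<omega>)}" for i
    have small_B: "small (K2 * (5 * N n) / x powr ?r) (B i)" if i: "i \<in> {..n div J}" for i
    proof -
      have iJ: "i * J \<le> n" using i J by (metis atMost_iff div_times_less_eq_dividend le_trans mult_le_mono1)
      define z where "z = i * J"
      \<comment> \<open>The last block is cut at time n. The first one has left end -1, which is
        admissible because the rows extend to negative times.\<close>
      define j where "j = min J (n + 1 - z)"
      have z: "z \<le> n" "int i * int J = int z" "int (Suc i) * int J = int z + int J"
        using iJ by (auto simp: z_def algebra_simps)
      have blk: "blk i = {int z - 1<..int z - 1 + int j}"
        unfolding blk_def z using z(1) by (auto simp: j_def)
      have jn: "int z - 1 + int j \<le> int n" using z(1) by (auto simp: j_def)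
      have jJ: "real j \<le> real J" by (simp add: j_def)
      have m: "lagv (X n) t \<in> borel_measurable P" if "t \<in> blk i" for t
        by (rule adapted_lags_measurable[OF X(1)[OF n]]) (use that in \<open>simp add: blk_def\<close>)
      have [measurable]: "(\<lambda>\<omega>. \<Sum>t\<in>blk i. ?\<xi> t \<omega>) \<in> borel_measurable P"
        by (intro borel_measurable_sum excess_V_measurable m)
      have "prob (B i) \<le> prob {\<omega> \<in> space P. c * K1 * real j + x < (\<Sum>t\<in>blk i. ?\<xi> t \<omega>)}"
      proof (rule finite_measure_mono)
        have "c * K1 * real j \<le> c * K1 * real J" using c K jJ by (intro mult_left_mono) auto
        then show "B i \<subseteq> {\<omega> \<in> space P. c * K1 * real j + x < (\<Sum>t\<in>blk i. ?\<xi> t \<omega>)}" by (auto simp: B_def)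
      qed measurable
      also have "\<dots> \<le> K2 * (real j + 1) / x powr ?r"
        unfolding blk using c by (intro win[OF _ _ X(1)[OF n] X(2)[OF n] X(3)[OF n] jn x]) auto
      also have "\<dots> \<le> K2 * (5 * N n) / x powr ?r"
        using K J jJ Nn by (intro divide_right_mono mult_left_mono) auto
      finally show ?thesis by (intro smallI[of "B i"]) (auto simp: B_def)
    qed
    have "small (real (card {..n div J}) * (K2 * (5 * N n) / x powr ?r)) (\<Union>i\<in>{..n div J}. B i)"
      by (rule small_UN) (use small_B in auto)
    then show ?case
    proof (rule small_mono)
      have "real (card {..n div J}) \<le> 2 * (real n / N n)"
      proof -
        have "real (n div J) \<le> real n / real J" by (rule of_nat_div_le_of_nat)
        also have "\<dots> \<le> real n / N n" using J Nn by (intro frac_le) auto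
        finally have "real (n div J) \<le> real n / N n" .
        moreover have "1 \<le> real n / N n" using Nn by (simp add: field_simps)
        ultimately show ?thesis by simp
      qed
      then have "real (card {..n div J}) * (K2 * (5 * N n) / x powr ?r) \<le> 2 * (real n / N n) * (K2 * (5 * N n) / x powr ?r)"
        using K Nn by (intro mult_right_mono) auto
      also have "\<dots> = 10 * K2 * real n * (1 / x powr ?r)" using Nn by simp
      also have "1 / x powr ?r = (4 / \<eta>) powr ?r * N n powr - ?r"
      proof -
        have "1 / x powr ?r = (1 / x) powr ?r" using x by (simp add: powr_divide)
        also have "1 / x = 4 / \<eta> * (1 / N n)" by (simp add: x_def)
        also have "(4 / \<eta> * (1 / N n)) powr ?r = (4 / \<eta>) powr ?r * (1 / N n) powr ?r" by (rule powr_mult)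
        also have "(1 / N n) powr ?r = N n powr - ?r" using Nn by (simp add: powr_divide powr_minus_divide)
        finally show ?thesis .
      qed
      finally show "real (card {..n div J}) * (K2 * (5 * N n) / x powr ?r) \<le> \<eta>"
        using elim(1) by (simp add: c'_def mult_ac)
      show "{\<omega> \<in> space P. \<exists>k j. 0 \<le> k \<and> k + int j \<le> int n \<and> real j \<le> N n + 1 \<and>
          \<eta> * N n < (\<Sum>t\<in>{k..k + int j}. ?\<xi> t \<omega>)} \<subseteq> (\<Union>i\<in>{..n div J}. B i)"
      proof (rule subsetI, rule ccontr)
        fix \<omega> assume "\<omega> \<in> {\<omega> \<in> space P. \<exists>k j. 0 \<le> k \<and> k + int j \<le> int n \<and> real j \<le> N n + 1 \<and>
          \<eta> * N n < (\<Sum>t\<in>{k..k + int j}. ?\<xi> t \<omega>)}"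
        then obtain k j where \<omega>: "\<omega> \<in> space P" and k: "0 \<le> k" "k + int j \<le> int n" and j: "real j \<le> N n + 1"
          and big: "\<eta> * N n < (\<Sum>t\<in>{k..k + int j}. ?\<xi> t \<omega>)" by auto
        assume "\<omega> \<notin> (\<Union>i\<in>{..n div J}. B i)"
        then have good: "(\<Sum>t\<in>blk i. ?\<xi> t \<omega>) \<le> c * K1 * real J + x" for i
        proof (cases "i \<le> n div J")
          case True
          then show ?thesis using \<open>\<omega> \<notin> _\<close> \<omega> by (auto simp: B_def not_less)
        next
          case False
          then have "n < i * J" using J(3) by (simp add: div_less_iff_less_mult not_le)
          then have "int n < int i * int J" by (metis of_nat_less_iff of_nat_mult)
          then have "blk i = {}" by (auto simp: blk_def)
          then show ?thesis using c K x by simp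
        qed
        define i where "i = nat k div J"
        have "i * J \<le> nat k" "nat k < Suc i * J"
          using dividend_less_div_times[OF J(3), of "nat k"] by (auto simp: i_def)
        then have "int (i * J) \<le> k" "k < int (Suc i * J)" using k(1) by linarith+
        then have i: "int i * int J \<le> k" "k < int (Suc i) * int J" by (simp_all only: of_nat_mult)
        have "j < J" using j J(1) by linarith
        then have "{k..k + int j} \<subseteq> blk i \<union> blk (Suc i)"
          using i k by (auto simp: blk_def algebra_simps)
        then have "(\<Sum>t\<in>{k..k + int j}. ?\<xi> t \<omega>) \<le> (\<Sum>t\<in>blk i \<union> blk (Suc i). ?\<xi> t \<omega>)"
          using \<xi> by (intro sum_mono2) (auto simp: blk_def)
        also have "\<dots> \<le> (\<Sum>t\<in>blk i. ?\<xi> t \<omega>) + (\<Sum>t\<in>blk (Suc i). ?\<xi> t \<omega>)"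
          using \<xi> by (subst sum_Un) (auto simp: blk_def intro: sum_nonneg)
        also have "\<dots> \<le> 2 * (c * K1 * real J + x)" using good[of i] good[of "Suc i"] by simp
        also have "\<dots> \<le> \<eta> * N n"
        proof -
          have "c * K1 * real J \<le> \<eta> / 16 * (4 * N n)" using c K J \<eta> by (intro mult_mono) auto
          then show ?thesis by (simp add: x_def)
        qed
        finally show False using big by simp
      qed
    qed
  qed
  then show thesis using c by (intro that) auto
qed

end

context estimation
begin

text \<open>Markov's inequality for the sum. As \<open>1 \<le> real n * b\<close>, a window has at
  most \<open>2 * (real n * b)\<close> members, whence the factor 2.\<close>

lemma window_sum_small:
  assumes h: "\<And>t. t \<in> window CARD('p) n b u \<Longrightarrow> h t \<in> borel_measurable P"
    "\<And>t \<omega>. 0 \<le> h t \<omega>" "\<And>t. t \<in> window CARD('p) n b u \<Longrightarrow> (\<integral>\<^sup>+\<omega>. ennreal (h t \<omega>) \<partial>P) \<le> ennreal c"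
    and n: "1 \<le> n" and b: "0 < b" and N: "1 \<le> real n * b" and c: "0 \<le> c" and y: "0 < y"
  shows "small (2 * c / y) {\<omega> \<in> space P. y * (real n * b) < (\<Sum>t\<in>window CARD('p) n b u. h t \<omega>)}"
proof -
  let ?W = "window CARD('p) n b u" and ?N = "real n * b"
  from window_interval[OF n b, where p = "CARD('p)" and u = u] obtain k j where kj: "?W = {k<..k + int j}" "real j \<le> ?N + 1" by metis
  have [measurable]: "(\<lambda>\<omega>. \<Sum>t\<in>?W. h t \<omega>) \<in> borel_measurable P" by (intro borel_measurable_sum h)
  have "(\<integral>\<^sup>+\<omega>. ennreal \<bar>\<Sum>t\<in>?W. h t \<omega>\<bar> \<partial>P) = (\<integral>\<^sup>+\<omega>. (\<Sum>t\<in>?W. ennreal (h t \<omega>)) \<partial>P)"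
    using h(2) by (simp add: sum_nonneg)
  also have "\<dots> = (\<Sum>t\<in>?W. \<integral>\<^sup>+\<omega>. ennreal (h t \<omega>) \<partial>P)"
    by (rule nn_integral_sum) (use h(1) in measurable)
  also have "\<dots> \<le> (\<Sum>t\<in>?W. ennreal c)" by (intro sum_mono h)
  also have "\<dots> = ennreal (real j * c)" using c unfolding kj(1) by (simp add: ennreal_mult ennreal_of_nat_eq_real_of_nat)
  also have "\<dots> \<le> ennreal (2 * ?N * c)" using kj(2) N c by (intro ennreal_leI mult_right_mono) auto
  finally have "prob {\<omega> \<in> space P. y * ?N < (\<Sum>t\<in>?W. h t \<omega>)} \<le> 2 * ?N * c / (y * ?N)"
    using c y N by (intro prob_gt_le) auto
  also have "\<dots> = 2 * c / y"
  proof -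
    have "2 * z * c / (y * z) = 2 * c / y" if "z \<noteq> 0" for z using that by simp
    moreover have "?N \<noteq> 0" using N by linarith
    ultimately show ?thesis .
  qed
  finally show ?thesis by (intro smallI) auto
qed

text \<open>The Lipschitz condition against the origin has degree \<open>M + 1\<close> in the norm;
  lower powers are absorbed by \<open>1 + rpow (znorm A t \<omega>) (M + 1)\<close>.\<close>

lemma obs_growth:
  assumes "\<theta> \<in> \<Theta>"
  shows "\<bar>obs A t \<theta> \<omega>\<bar> \<le> (\<bar>ell 0 0 \<theta>\<bar> + 3 * Cz + 1) * (1 + rpow (znorm A t \<omega>) (M + 1))"
proof -
  let ?z = "znorm A t \<omega>" and ?Z = "rpow (znorm A t \<omega>) (M + 1)"
  have z: "0 \<le> ?z" by (rule znorm_nonneg)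
  have Z: "?Z = ?z powr (M + 1)" using M_nonneg by (simp add: rpow_def)
  have z0: "l1_norm_pair (0, 0 :: real ^ 'p::{finite,linorder}) = 0" by (simp add: l1_norm_pair_def l1_norm_def)
  have "rpow 0 M \<le> 1" by (simp add: rpow_def)
  have zM: "?z * rpow ?z M = ?Z"
    using z M_nonneg unfolding Z by (cases "?z = 0") (auto simp: rpow_def powr_add)
  have zle: "?z \<le> 1 + ?Z"
  proof (cases "?z \<le> 1")
    case False
    then have "?z powr 1 \<le> ?z powr (M + 1)" using M_nonneg by (intro powr_mono) auto
    then show ?thesis unfolding Z using False by simp
  qed (use z in \<open>simp add: Z add_increasing2\<close>)
  have "\<bar>obs A t \<theta> \<omega> - ell 0 0 \<theta>\<bar> \<le> Cz * ?z * (1 + rpow ?z M + rpow 0 M)"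
    using ell_lipschitz[OF assms, of "A t \<omega>" "lagv A (t - 1) \<omega>" 0 0] by (simp add: obs_def znorm_def z0)
  also have "\<dots> \<le> Cz * ?z * (2 + rpow ?z M)"
    using \<open>rpow 0 M \<le> 1\<close> Cz_nonneg z by (intro mult_left_mono) auto
  also have "\<dots> = Cz * (2 * ?z + ?z * rpow ?z M)" by (simp add: algebra_simps)
  also have "\<dots> \<le> Cz * (3 * (1 + ?Z))" unfolding zM using zle Cz_nonneg by (intro mult_left_mono) auto
  finally have "\<bar>obs A t \<theta> \<omega>\<bar> \<le> \<bar>ell 0 0 \<theta>\<bar> * 1 + Cz * (3 * (1 + ?Z))" by linarith
  also have "\<dots> \<le> \<bar>ell 0 0 \<theta>\<bar> * (1 + ?Z) + Cz * (3 * (1 + ?Z)) + 1 * (1 + ?Z)"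
  proof -
    have "0 \<le> ?Z" by simp
    then have "\<bar>ell 0 0 \<theta>\<bar> * 1 \<le> \<bar>ell 0 0 \<theta>\<bar> * (1 + ?Z)" by (intro mult_left_mono) auto
    then show ?thesis using \<open>0 \<le> ?Z\<close> unfolding mult_1 by linarith
  qed
  finally show ?thesis by (simp add: algebra_simps)
qed

section \<open>The two bandwidth regimes\<close>

text \<open>For a single u one window per n is enough, its left end being picked by
  \<open>SOME\<close>, and Markov's inequality suffices. The mean truncation error tends to 0 by
  dominated convergence for the stationary solution at u and passes to the rows through
  \<open>close_window\<close>.\<close>

lemma pointwise_bandwidth:
  assumes u: "u \<in> {0<..<1}" and b: "\<And>n. 0 < b n" "b \<longlonglongrightarrow> 0" "filterlim (\<lambda>n. real n * b n) at_top sequentially"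
  shows "bandwidth P \<epsilon> G M \<chi>v C0 \<Theta> Cz C\<theta> ell Xt X K \<theta>0 b {u} (\<lambda>_. {u})
    (\<lambda>n. {SOME k. \<exists>j. window CARD('p) n (b n) u = {k<..k + int j} \<and> k + int j \<le> int n \<and> real j \<le> real n * b n + 1}) 0"
proof unfold_locales
  have u01: "u \<in> {0..1}" using u by auto
  have Nlarge: "\<forall>\<^sub>F n in sequentially. 1 \<le> real n * b n" using b(3) by (simp add: filterlim_at_top)
  show "\<forall>\<^sub>F n in sequentially. {u} \<subseteq> {b n / 2..1 - b n / 2}"
  proof -
    have "\<forall>\<^sub>F n in sequentially. b n < min u (1 - u)" using b(2) u by (intro order_tendstoD) auto
    then show ?thesis by eventually_elim (use u in auto)
  qed
  show "\<forall>\<^sub>F n in sequentially. real (card {SOME k. \<exists>j. window CARD('p) n (b n) u = {k<..k + int j} \<and> k + int j \<le> int n \<and> real j \<le> real n * b n + 1})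
      \<le> (real n * b n + 2) powr 0"
    using Nlarge by eventually_elim simp
  show "\<forall>\<^sub>F n in sequentially. \<forall>u'\<in>{u}. \<exists>k\<in>{SOME k. \<exists>j. window CARD('p) n (b n) u = {k<..k + int j} \<and> k + int j \<le> int n \<and> real j \<le> real n * b n + 1}.
      \<exists>j. window CARD('p) n (b n) u' = {k<..k + int j} \<and> k + int j \<le> int n \<and> real j \<le> real n * b n + 1"
    using eventually_ge_at_top[of 1]
  proof eventually_elim
    case (elim n)
    have "\<exists>k j. window CARD('p) n (b n) u = {k<..k + int j} \<and> k + int j \<le> int n \<and> real j \<le> real n * b n + 1"
      using window_interval[OF elim b(1), where p = "CARD('p)" and u = u] by metis
    from someI_ex[OF this] show ?case by simp
  qed
  fix \<eta> :: real assume \<eta>: "0 < \<eta>"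
  show "\<exists>C. \<forall>\<^sub>F n in sequentially. small \<eta> {\<omega> \<in> space P. \<exists>u\<in>{u}. C * (real n * b n)
        < (\<Sum>t\<in>window CARD('p) n (b n) u. 1 + rpow (znorm (X n) t \<omega>) (M + 1))}"
  proof (rule exI[of _ "2 * CZ / \<eta>"], use Nlarge eventually_ge_at_top[of 1] in eventually_elim)
    case (elim n)
    have "small (2 * CZ / (2 * CZ / \<eta>)) {\<omega> \<in> space P. 2 * CZ / \<eta> * (real n * b n)
        < (\<Sum>t\<in>window CARD('p) n (b n) u. 1 + rpow (znorm (X n) t \<omega>) (M + 1))}"
    proof (rule window_sum_small[OF _ _ _ elim(2) b(1) elim(1)])
      fix t assume t: "t \<in> window CARD('p) n (b n) u"
      have [measurable]: "znorm (X n) t \<in> borel_measurable P"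
        by (rule znorm_measurable[OF row_adapted[OF elim(2)] window_le[OF t]])
      show "(\<lambda>\<omega>. 1 + rpow (znorm (X n) t \<omega>) (M + 1)) \<in> borel_measurable P" by measurable
      show "(\<integral>\<^sup>+\<omega>. ennreal (1 + rpow (znorm (X n) t \<omega>) (M + 1)) \<partial>P) \<le> ennreal CZ"
        by (rule zpow_moment[OF row_adapted[OF elim(2)] window_le[OF t] row_moment[OF elim(2)]])
    qed (use CZ_pos \<eta> in auto)
    then show ?case using CZ_pos by simp
  qed
  fix \<theta> assume \<theta>: "\<theta> \<in> \<Theta>"
  \<comment> \<open>\<open>2 * \<eta>1\<close> will bound the mean truncation error, and
    \<open>window_sum_small\<close> turns it into the probability
    \<open>4 * \<eta>1 / \<eta>\<close>; both have to be at most \<open>\<eta>\<close>.\<close>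
  define \<eta>1 where "\<eta>1 = min (\<eta> / 2) (\<eta> * \<eta> / 4)"
  have \<eta>1: "0 < \<eta>1" "2 * \<eta>1 \<le> \<eta>" "4 * \<eta>1 \<le> \<eta> * \<eta>" using \<eta> by (auto simp: \<eta>1_def)
  let ?g = "obs (Xt u) 0 \<theta>"
  have int: "integrable P ?g" by (rule stat_obs_integrable[OF u01 \<theta>])
  then have [measurable]: "?g \<in> borel_measurable P" by auto
  have "(\<lambda>k. expectation (\<lambda>\<omega>. \<bar>?g \<omega> - trunc (real k) (?g \<omega>)\<bar>)) \<longlonglongrightarrow> expectation (\<lambda>_. 0)"
  proof (rule integral_dominated_convergence[where w = "\<lambda>\<omega>. \<bar>?g \<omega>\<bar>"])
    show "AE \<omega> in P. (\<lambda>k. \<bar>?g \<omega> - trunc (real k) (?g \<omega>)\<bar>) \<longlonglongrightarrow> 0"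
    proof (rule AE_I2)
      fix \<omega>
      obtain k0 :: nat where "\<bar>?g \<omega>\<bar> \<le> real k0" using real_arch_simple by blast
      have "\<forall>\<^sub>F k in sequentially. \<bar>?g \<omega> - trunc (real k) (?g \<omega>)\<bar> = 0"
        using eventually_ge_at_top[of k0]
        by eventually_elim (use \<open>\<bar>?g \<omega>\<bar> \<le> real k0\<close> in \<open>simp add: trunc_excess\<close>)
      then show "(\<lambda>k. \<bar>?g \<omega> - trunc (real k) (?g \<omega>)\<bar>) \<longlonglongrightarrow> 0" by (rule tendsto_eventually)
    qed
    show "AE \<omega> in P. norm \<bar>?g \<omega> - trunc (real k) (?g \<omega>)\<bar> \<le> \<bar>?g \<omega>\<bar>" for k
      by (rule AE_I2) (simp add: trunc_excess)
  qed (use int in auto)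
  then have "\<forall>\<^sub>F k in sequentially. expectation (\<lambda>\<omega>. \<bar>?g \<omega> - trunc (real k) (?g \<omega>)\<bar>) < \<eta>1"
    using \<eta>1 by (intro order_tendstoD) auto
  with eventually_ge_at_top[of 1] have "\<forall>\<^sub>F k in sequentially. 1 \<le> k \<and> expectation (\<lambda>\<omega>. \<bar>?g \<omega> - trunc (real k) (?g \<omega>)\<bar>) < \<eta>1"
    by eventually_elim simp
  then obtain k :: nat where k: "1 \<le> k" "expectation (\<lambda>\<omega>. \<bar>?g \<omega> - trunc (real k) (?g \<omega>)\<bar>) < \<eta>1"
    using eventually_happens by fastforce
  define R where "R = real k"
  have R: "0 < R" using k by (simp add: R_def)
  have stat: "(\<integral>\<^sup>+\<omega>. ennreal \<bar>obs (Xt u) t \<theta> \<omega> - trunc R (obs (Xt u) t \<theta> \<omega>)\<bar> \<partial>P) \<le> ennreal \<eta>1" for t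
  proof -
    have [measurable]: "obs (Xt u) t \<theta> \<in> borel_measurable P" by (rule obs_measurable[OF stat_adapted[OF u01] order_refl \<theta>])
    have "integrable P (\<lambda>\<omega>. \<bar>obs (Xt u) t \<theta> \<omega> - trunc R (obs (Xt u) t \<theta> \<omega>)\<bar>)"
      by (rule Bochner_Integration.integrable_bound[OF stat_obs_integrable[OF u01 \<theta>, of t]])
        (use R in \<open>auto simp: trunc_excess\<close>)
    then have "(\<integral>\<^sup>+\<omega>. ennreal \<bar>obs (Xt u) t \<theta> \<omega> - trunc R (obs (Xt u) t \<theta> \<omega>)\<bar> \<partial>P)
        = ennreal (expectation (\<lambda>\<omega>. \<bar>obs (Xt u) t \<theta> \<omega> - trunc R (obs (Xt u) t \<theta> \<omega>)\<bar>))"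
      by (intro nn_integral_eq_integral) auto
    also have "expectation (\<lambda>\<omega>. \<bar>obs (Xt u) t \<theta> \<omega> - trunc R (obs (Xt u) t \<theta> \<omega>)\<bar>) = expectation (\<lambda>\<omega>. \<bar>?g \<omega> - trunc R (?g \<omega>)\<bar>)"
      by (rule stationary_expectation[OF u01 \<theta>, of "\<lambda>x. \<bar>x - trunc R x\<bar>"]) measurable
    finally show ?thesis using k(2) by (simp add: R_def ennreal_leI)
  qed
  have both: "\<forall>\<^sub>F n in sequentially. \<forall>t\<in>window CARD('p) n (b n) u.
      (\<integral>\<^sup>+\<omega>. ennreal \<bar>obs (X n) t \<theta> \<omega> - trunc R (obs (X n) t \<theta> \<omega>)\<bar> \<partial>P) \<le> ennreal (2 * \<eta>1)"
    using close_window[OF \<eta>1(1) b(2,1)] eventually_ge_at_top[of 1]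
  proof eventually_elim
    case (elim n)
    show ?case
    proof
      fix t assume t: "t \<in> window CARD('p) n (b n) u"
      have [measurable]: "obs (Xt u) t \<theta> \<in> borel_measurable P" "obs (X n) t \<theta> \<in> borel_measurable P"
        using obs_measurable[OF stat_adapted[OF u01] order_refl \<theta>] obs_measurable[OF row_adapted[OF elim(2)] window_le[OF t] \<theta>] by auto
      have "(\<integral>\<^sup>+\<omega>. ennreal \<bar>obs (X n) t \<theta> \<omega> - trunc R (obs (X n) t \<theta> \<omega>)\<bar> \<partial>P)
          \<le> (\<integral>\<^sup>+\<omega>. ennreal \<bar>obs (Xt u) t \<theta> \<omega> - trunc R (obs (Xt u) t \<theta> \<omega>)\<bar> + ennreal \<bar>obs (X n) t \<theta> \<omega> - obs (Xt u) t \<theta> \<omega>\<bar> \<partial>P)"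
      proof (rule nn_integral_mono)
        fix \<omega>
        \<comment> \<open>By \<open>trunc_excess\<close>, the truncation error is a 1-Lipschitz
          function of its argument.\<close>
        have "\<bar>x - trunc R x\<bar> \<le> \<bar>y - trunc R y\<bar> + \<bar>x - y\<bar>" for x y
          using R by (auto simp: trunc_excess)
        then have "ennreal \<bar>obs (X n) t \<theta> \<omega> - trunc R (obs (X n) t \<theta> \<omega>)\<bar>
          \<le> ennreal (\<bar>obs (Xt u) t \<theta> \<omega> - trunc R (obs (Xt u) t \<theta> \<omega>)\<bar> + \<bar>obs (X n) t \<theta> \<omega> - obs (Xt u) t \<theta> \<omega>\<bar>)"
          by (intro ennreal_leI)
        then show "ennreal \<bar>obs (X n) t \<theta> \<omega> - trunc R (obs (X n) t \<theta> \<omega>)\<bar>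
          \<le> ennreal \<bar>obs (Xt u) t \<theta> \<omega> - trunc R (obs (Xt u) t \<theta> \<omega>)\<bar> + ennreal \<bar>obs (X n) t \<theta> \<omega> - obs (Xt u) t \<theta> \<omega>\<bar>"
          by simp
      qed
      also have "\<dots> = (\<integral>\<^sup>+\<omega>. ennreal \<bar>obs (Xt u) t \<theta> \<omega> - trunc R (obs (Xt u) t \<theta> \<omega>)\<bar> \<partial>P)
          + (\<integral>\<^sup>+\<omega>. ennreal \<bar>obs (X n) t \<theta> \<omega> - obs (Xt u) t \<theta> \<omega>\<bar> \<partial>P)"
        by (rule nn_integral_add) measurable
      also have "\<dots> \<le> ennreal \<eta>1 + ennreal \<eta>1" using elim(1) u01 t \<theta> by (intro add_mono stat) auto
      also have "\<dots> = ennreal (2 * \<eta>1)" using \<eta>1 by (simp flip: ennreal_plus)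
      finally show "(\<integral>\<^sup>+\<omega>. ennreal \<bar>obs (X n) t \<theta> \<omega> - trunc R (obs (X n) t \<theta> \<omega>)\<bar> \<partial>P) \<le> ennreal (2 * \<eta>1)" .
    qed
  qed
  show "\<exists>R>0. (\<forall>\<^sub>F n in sequentially. small \<eta> {\<omega> \<in> space P. \<exists>u\<in>{u}. \<eta> * (real n * b n)
        < (\<Sum>t\<in>window CARD('p) n (b n) u. \<bar>obs (X n) t \<theta> \<omega> - trunc R (obs (X n) t \<theta> \<omega>)\<bar>)}) \<and>
      (\<forall>\<^sub>F n in sequentially. \<forall>u\<in>{u}. \<forall>t\<in>window CARD('p) n (b n) u.
        (\<integral>\<^sup>+\<omega>. ennreal \<bar>obs (X n) t \<theta> \<omega> - trunc R (obs (X n) t \<theta> \<omega>)\<bar> \<partial>P) \<le> ennreal \<eta>)"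
  proof (intro exI[of _ R] conjI R)
    show "\<forall>\<^sub>F n in sequentially. \<forall>u\<in>{u}. \<forall>t\<in>window CARD('p) n (b n) u.
        (\<integral>\<^sup>+\<omega>. ennreal \<bar>obs (X n) t \<theta> \<omega> - trunc R (obs (X n) t \<theta> \<omega>)\<bar> \<partial>P) \<le> ennreal \<eta>"
      using both by eventually_elim (use \<eta>1(2) in \<open>auto intro: order_trans ennreal_leI\<close>)
    show "\<forall>\<^sub>F n in sequentially. small \<eta> {\<omega> \<in> space P. \<exists>u\<in>{u}. \<eta> * (real n * b n)
        < (\<Sum>t\<in>window CARD('p) n (b n) u. \<bar>obs (X n) t \<theta> \<omega> - trunc R (obs (X n) t \<theta> \<omega>)\<bar>)}"
      using both Nlarge eventually_ge_at_top[of 1]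
    proof eventually_elim
      case (elim n)
      have "small (2 * (2 * \<eta>1) / \<eta>) {\<omega> \<in> space P. \<eta> * (real n * b n)
        < (\<Sum>t\<in>window CARD('p) n (b n) u. \<bar>obs (X n) t \<theta> \<omega> - trunc R (obs (X n) t \<theta> \<omega>)\<bar>)}"
      proof (rule window_sum_small[OF _ _ _ elim(3) b(1) elim(2)])
        fix t assume t: "t \<in> window CARD('p) n (b n) u"
        have [measurable]: "obs (X n) t \<theta> \<in> borel_measurable P"
          by (rule obs_measurable[OF row_adapted[OF elim(3)] window_le[OF t] \<theta>])
        show "(\<lambda>\<omega>. \<bar>obs (X n) t \<theta> \<omega> - trunc R (obs (X n) t \<theta> \<omega>)\<bar>) \<in> borel_measurable P" by measurable
        show "(\<integral>\<^sup>+\<omega>. ennreal \<bar>obs (X n) t \<theta> \<omega> - trunc R (obs (X n) t \<theta> \<omega>)\<bar> \<partial>P) \<le> ennreal (2 * \<eta>1)"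
          using elim(1) t by blast
      qed (use \<eta>1 \<eta> in auto)
      moreover have "2 * (2 * \<eta>1) / \<eta> \<le> \<eta>" using \<eta>1 \<eta> by (simp add: field_simps)
      ultimately show ?case by (rule_tac small_mono) auto
    qed
  qed
qed (use b u in \<open>auto simp: mult.commute\<close>)


lemma uniform_bandwidth:
  assumes Q: "autoregression P \<epsilon> G q \<chi>' C0'" and q: "M + 1 < q"
    and b: "\<And>n. 0 < b n" "b \<longlonglongrightarrow> 0" and rate: "(\<lambda>n. real n powr ((M + 1) / q - 1)) \<in> o(b)"
    and cont: "continuous_on {0..1} \<theta>0"
  shows "bandwidth P \<epsilon> G M \<chi>v C0 \<Theta> Cz C\<theta> ell Xt X K \<theta>0 b {0..1} (\<lambda>n. {b n / 2..1 - b n / 2}) (\<lambda>n. {0..int n}) (q / (M + 1))"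
proof -
  interpret Q: autoregression P \<epsilon> G q \<chi>' C0' by (rule Q)
  let ?s = "M + 1"
  define r where "r = q / ?s"
  have s: "1 \<le> ?s" "?s < q" using M_nonneg q by auto
  have r: "1 < r" using s by (simp add: r_def)
  let ?N = "\<lambda>n. real n * b n"
  \<comment> \<open>As \<open>(M + 1) / q = 1 / r\<close>, multiplying the rate by n gives
    \<open>n powr (1 / r) = o(n b)\<close>. The divergence of \<open>n b\<close> and the ratio
    needed for the union over blocks both follow from this.\<close>
  have key: "\<forall>\<^sub>F n in sequentially. real n powr (1 / r) \<le> e * ?N n" if e: "0 < e" for e
    using landau_o.smallD[OF rate e] eventually_ge_at_top[of 1]
  proof eventually_elim
    case (elim n)
    have "real n powr (1 / r) = real n * real n powr (?s / q - 1)"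
      using elim(2) s by (simp add: r_def powr_mult_base)
    also have "\<dots> \<le> real n * (e * b n)" using elim(1) b(1)[of n] by (intro mult_left_mono) auto
    finally show ?case by (simp add: algebra_simps)
  qed
  have N_lim: "filterlim ?N at_top sequentially"
  proof (rule filterlim_at_top_mono)
    show "filterlim (\<lambda>n. real n powr (1 / r)) at_top sequentially" using r by real_asymp
    show "\<forall>\<^sub>F n in sequentially. real n powr (1 / r) \<le> ?N n" using key[of 1] by simp
  qed
  then have N1: "\<forall>\<^sub>F n in sequentially. 1 \<le> ?N n" by (simp add: filterlim_at_top)
  have Nn: "\<forall>\<^sub>F n in sequentially. ?N n \<le> real n"
  proof -
    have "\<forall>\<^sub>F n in sequentially. b n < 1" using b(2) by (intro order_tendstoD) auto
    then show ?thesis by eventually_elim (simp add: mult_left_le less_imp_le)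
  qed
  have n_le: "\<forall>\<^sub>F n in sequentially. real n \<le> e * ?N n powr r" if e: "0 < e" for e
  proof -
    have "0 < e powr (1 / r)" using e by simp
    from key[OF this] N1 eventually_ge_at_top[of 1] show ?thesis
    proof eventually_elim
      case (elim n)
      have "real n = (real n powr (1 / r)) powr r" using r by (simp add: powr_powr)
      also have "\<dots> \<le> (e powr (1 / r) * ?N n) powr r" using elim(1) r by (intro powr_mono2) auto
      also have "\<dots> = e * ?N n powr r" using e r by (simp add: powr_mult powr_powr)
      finally show ?case .
    qed
  qed
  have ratio: "(\<lambda>n. real n * ?N n powr - r) \<longlonglongrightarrow> 0"
  proof (rule tendstoI)
    fix e :: real assume e: "0 < e"
    from n_le[of "e / 2"] e N1 show "\<forall>\<^sub>F n in sequentially. dist (real n * ?N n powr - r) 0 < e"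
    proof (elim eventually_elim2)
      fix n assume le: "real n \<le> e / 2 * ?N n powr r" and N: "1 \<le> ?N n"
      have "real n * ?N n powr - r \<le> e / 2 * ?N n powr r * ?N n powr - r"
        by (intro mult_right_mono le) simp
      also have "\<dots> = e / 2"
      proof -
        have "x powr r * x powr - r = 1" if "1 \<le> x" for x :: real
          using that by (simp add: powr_add[symmetric])
        from this[OF N] show ?thesis by simp
      qed
      finally show "dist (real n * ?N n powr - r) 0 < e" using e by simp
    qed simp
  qed
  have rows: "\<And>n. 1 \<le> n \<Longrightarrow> Q.adapted (int n) (X n)"
    "\<And>n t. 1 \<le> n \<Longrightarrow> t \<le> int n \<Longrightarrow> Q.solves (X n) t (max (real_of_int t / real n) 0)"
    "\<And>n t. 1 \<le> n \<Longrightarrow> t \<le> int n \<Longrightarrow> Lq_le P q (\<lambda>\<omega>. Q.V (lagv (X n) t \<omega>)) Q.vbar"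
    using Q.tv_solution_adapted[OF X_sol] Q.tv_solution_solves[OF X_sol] Q.tv_moment[OF X_sol Xt_sol] by auto
  define B where "B = (1 + 1 / Q.gap) powr ?s"
  have B: "0 \<le> B" by (simp add: B_def)
  let ?v = "\<lambda>n t \<omega>. Q.V (lagv (X n) t \<omega>)"
  have z: "rpow (znorm (X n) t \<omega>) ?s \<le> B * (?v n t \<omega> powr ?s + ?v n (t - 1) \<omega> powr ?s)" for n t \<omega>
  proof -
    let ?m = "max (?v n t \<omega>) (?v n (t - 1) \<omega>)"
    have "znorm (X n) t \<omega> \<le> ?v n t \<omega> + ?v n (t - 1) \<omega> / Q.gap"
      using Q.abs_le_V_lags[of "X n" t \<omega>] Q.l1_norm_le_V[of "lagv (X n) (t - 1) \<omega>"]
      by (simp add: znorm_def l1_norm_pair_def)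
    also have "\<dots> \<le> ?m + ?m / Q.gap"
      using Q.gap_pos by (intro add_mono divide_right_mono) auto
    finally have "znorm (X n) t \<omega> \<le> (1 + 1 / Q.gap) * ?m" by (simp add: algebra_simps)
    then have "rpow (znorm (X n) t \<omega>) ?s \<le> ((1 + 1 / Q.gap) * ?m) powr ?s"
      using znorm_nonneg M_nonneg by (simp add: rpow_def powr_mono2)
    also have "\<dots> = B * ?m powr ?s" by (simp add: powr_mult B_def)
    also have "\<dots> \<le> B * (?v n t \<omega> powr ?s + ?v n (t - 1) \<omega> powr ?s)"
      using B by (intro mult_left_mono) (auto simp: max_def)
    finally show ?thesis .
  qed
  define \<rho> where "\<rho> c = (1 / c) powr (?s / (q - ?s))" for c :: real
  have \<rho>: "0 \<le> \<rho> c" for c by (simp add: \<rho>_def)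
  let ?\<xi> = "\<lambda>c n t \<omega>. excess ?s q c (?v n t \<omega>)"
  have zx: "1 + rpow (znorm (X n) t \<omega>) ?s \<le> (1 + 2 * B * \<rho> c) + B * (?\<xi> c n t \<omega> + ?\<xi> c n (t - 1) \<omega>)" if c: "0 < c" for c n t \<omega>
  proof -
    have "?v n t \<omega> powr ?s + ?v n (t - 1) \<omega> powr ?s \<le> (\<rho> c + ?\<xi> c n t \<omega>) + (\<rho> c + ?\<xi> c n (t - 1) \<omega>)"
      unfolding \<rho>_def using s c by (intro add_mono powr_le_excess Q.V_nonneg) auto
    from mult_left_mono[OF this B] z[of n t \<omega>] show ?thesis by (simp add: algebra_simps)
  qed
  \<comment> \<open>The norm of the pair at time t involves \<open>V\<close> at t and at t - 1.
    Hence the excesses are summed over intervals that include the left end, at the cost of a factor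
    2.\<close>
  have lagged: "(\<Sum>t\<in>{k<..k + int j}. f t + f (t - 1)) \<le> 2 * (\<Sum>t\<in>{k..k + int j}. f t)"
    if f: "\<And>t. 0 \<le> f t" for f :: "int \<Rightarrow> real" and k j
  proof -
    have "(\<Sum>t\<in>{k<..k + int j}. f (t - 1)) = (\<Sum>t\<in>{k..<k + int j}. f t)"
      by (rule sum.reindex_bij_witness[of _ "\<lambda>t. t + 1" "\<lambda>t. t - 1"]) auto
    also have "\<dots> \<le> (\<Sum>t\<in>{k..k + int j}. f t)" using f by (intro sum_mono2) auto
    finally have "(\<Sum>t\<in>{k<..k + int j}. f (t - 1)) \<le> (\<Sum>t\<in>{k..k + int j}. f t)" .
    moreover have "(\<Sum>t\<in>{k<..k + int j}. f t) \<le> (\<Sum>t\<in>{k..k + int j}. f t)" using f by (intro sum_mono2) auto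
    ultimately show ?thesis by (simp add: sum.distrib)
  qed
  have uniform: "\<exists>c. 0 < c \<and> c \<le> 1 \<and> c * Q.vbar powr q \<le> \<eta> \<and>
    (\<forall>\<^sub>F n in sequentially. small \<eta> {\<omega> \<in> space P. \<exists>k j. 0 \<le> k \<and> k + int j \<le> int n \<and> real j \<le> ?N n + 1 \<and>
      \<eta> * ?N n < (\<Sum>t\<in>{k..k + int j}. ?\<xi> c n t \<omega>)})" if \<eta>: "0 < \<eta>" for \<eta>
  proof (rule Q.excess_uniform[where X = X and N = ?N, OF s])
    show "\<And>n. 1 \<le> n \<Longrightarrow> Q.adapted (int n) (X n)"
      "\<And>n t. 1 \<le> n \<Longrightarrow> t \<le> int n \<Longrightarrow> Q.solves (X n) t (max (real_of_int t / real n) 0)"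
      "\<And>n t. 1 \<le> n \<Longrightarrow> t \<le> int n \<Longrightarrow> Lq_le P q (\<lambda>\<omega>. Q.V (lagv (X n) t \<omega>)) Q.vbar"
      by (fact rows)+
  qed (fact N_lim Nn ratio[unfolded r_def] \<eta> | rule exI, intro conjI, assumption+)+
  show ?thesis
  proof unfold_locales
    show "\<forall>\<^sub>F n in sequentially. real (card {0..int n}) \<le> (?N n + 2) powr (q / ?s)"
      using n_le[of 1] N1
    proof (elim eventually_elim2)
      fix n assume le: "real n \<le> 1 * ?N n powr r" and N: "1 \<le> ?N n"
      \<comment> \<open>The tangent inequality with increment 2 supplies the additional 1 in the
        cardinality \<open>n + 1\<close>.\<close>
      have "1 \<le> r * ?N n powr (r - 1)"
        using mult_mono[of 1 r 1 "?N n powr (r - 1)"] r N ge_one_powr_ge_zero[of "?N n" "r - 1"] by simp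
      then have "?N n powr r + 1 \<le> ?N n powr r + r * ?N n powr (r - 1) * 2" by simp
      also have "\<dots> \<le> (?N n + 2) powr r" using N r by (intro powr_ge_tangent) auto
      finally show "real (card {0..int n}) \<le> (?N n + 2) powr (q / ?s)" using le by (simp add: r_def)
    qed simp
    show "\<forall>\<^sub>F n in sequentially. \<forall>u\<in>{b n / 2..1 - b n / 2}. \<exists>k\<in>{0..int n}. \<exists>j. window CARD('p) n (b n) u = {k<..k + int j}
      \<and> k + int j \<le> int n \<and> real j \<le> ?N n + 1"
      using eventually_ge_at_top[of 1]
    proof eventually_elim
      case (elim n)
      show ?case
      proof
        fix u
        from window_interval[OF elim b(1), where p = "CARD('p)" and u = u] obtain k j
          where "window CARD('p) n (b n) u = {k<..k + int j}" "0 \<le> k" "k + int j \<le> int n" "real j \<le> ?N n + 1" by metis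
        then show "\<exists>k\<in>{0..int n}. \<exists>j. window CARD('p) n (b n) u = {k<..k + int j} \<and> k + int j \<le> int n \<and> real j \<le> ?N n + 1"
          by (intro bexI[of _ k] exI[of _ j]) auto
      qed
    qed
    fix \<eta> :: real assume \<eta>: "0 < \<eta>"
    show "\<exists>C. \<forall>\<^sub>F n in sequentially. small \<eta> {\<omega> \<in> space P. \<exists>u\<in>{b n / 2..1 - b n / 2}. C * ?N n
        < (\<Sum>t\<in>window CARD('p) n (b n) u. 1 + rpow (znorm (X n) t \<omega>) ?s)}"
    proof -
      from uniform[OF \<eta>] obtain c where c: "0 < c" "c \<le> 1"
        and ev: "\<forall>\<^sub>F n in sequentially. small \<eta> {\<omega> \<in> space P. \<exists>k j. 0 \<le> k \<and> k + int j \<le> int n \<and> real j \<le> ?N n + 1 \<and>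
          \<eta> * ?N n < (\<Sum>t\<in>{k..k + int j}. ?\<xi> c n t \<omega>)}" by (elim exE conjE) (rule that)
      show ?thesis
      proof (rule exI[of _ "2 * (1 + 2 * B * \<rho> c) + B * (2 * \<eta>)"], use ev N1 eventually_ge_at_top[of 1] in eventually_elim)
        case (elim n)
        from elim(1) show ?case
        proof (rule small_mono)
          show "{\<omega> \<in> space P. \<exists>u\<in>{b n / 2..1 - b n / 2}. (2 * (1 + 2 * B * \<rho> c) + B * (2 * \<eta>)) * ?N n
              < (\<Sum>t\<in>window CARD('p) n (b n) u. 1 + rpow (znorm (X n) t \<omega>) ?s)}
            \<subseteq> {\<omega> \<in> space P. \<exists>k j. 0 \<le> k \<and> k + int j \<le> int n \<and> real j \<le> ?N n + 1 \<and>
              \<eta> * ?N n < (\<Sum>t\<in>{k..k + int j}. ?\<xi> c n t \<omega>)}"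
          proof (rule subsetI, rule ccontr)
            fix \<omega> assume "\<omega> \<in> {\<omega> \<in> space P. \<exists>u\<in>{b n / 2..1 - b n / 2}. (2 * (1 + 2 * B * \<rho> c) + B * (2 * \<eta>)) * ?N n
              < (\<Sum>t\<in>window CARD('p) n (b n) u. 1 + rpow (znorm (X n) t \<omega>) ?s)}"
            then obtain u where \<omega>: "\<omega> \<in> space P" and big: "(2 * (1 + 2 * B * \<rho> c) + B * (2 * \<eta>)) * ?N n
              < (\<Sum>t\<in>window CARD('p) n (b n) u. 1 + rpow (znorm (X n) t \<omega>) ?s)" by auto
            from window_interval[OF elim(3) b(1), where p = "CARD('p)" and u = u] obtain k j
              where kj: "window CARD('p) n (b n) u = {k<..k + int j}" "0 \<le> k" "k + int j \<le> int n" "real j \<le> ?N n + 1" by metis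
            assume "\<omega> \<notin> {\<omega> \<in> space P. \<exists>k j. 0 \<le> k \<and> k + int j \<le> int n \<and> real j \<le> ?N n + 1 \<and>
              \<eta> * ?N n < (\<Sum>t\<in>{k..k + int j}. ?\<xi> c n t \<omega>)}"
            then have le: "(\<Sum>t\<in>{k..k + int j}. ?\<xi> c n t \<omega>) \<le> \<eta> * ?N n"
              using \<omega> kj by (auto simp: not_less)
            have "(\<Sum>t\<in>{k<..k + int j}. 1 + rpow (znorm (X n) t \<omega>) ?s)
                \<le> (\<Sum>t\<in>{k<..k + int j}. (1 + 2 * B * \<rho> c) + B * (?\<xi> c n t \<omega> + ?\<xi> c n (t - 1) \<omega>))"
              by (intro sum_mono zx c)
            also have "\<dots> = real j * (1 + 2 * B * \<rho> c) + B * (\<Sum>t\<in>{k<..k + int j}. ?\<xi> c n t \<omega> + ?\<xi> c n (t - 1) \<omega>)"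
              unfolding sum.distrib[of "\<lambda>_. 1 + 2 * B * \<rho> c"] sum_distrib_left by simp
            also have "\<dots> \<le> 2 * ?N n * (1 + 2 * B * \<rho> c) + B * (2 * (\<eta> * ?N n))"
            proof (intro add_mono mult_right_mono mult_left_mono B)
              show "real j \<le> 2 * ?N n" using kj elim(2) by simp
              show "(\<Sum>t\<in>{k<..k + int j}. ?\<xi> c n t \<omega> + ?\<xi> c n (t - 1) \<omega>) \<le> 2 * (\<eta> * ?N n)"
                using lagged[of "\<lambda>t. ?\<xi> c n t \<omega>" k j] excess_nonneg[of c] c le by fastforce
            qed (use B \<rho> in auto)
            finally show False using big unfolding kj(1) by (simp add: algebra_simps)
          qed
        qed simp
      qed
    qed
    fix \<theta> assume \<theta>: "\<theta> \<in> \<Theta>"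
    define A where "A = \<bar>ell 0 0 \<theta>\<bar> + 3 * Cz + 1"
    have A: "0 < A" using Cz_nonneg by (simp add: A_def)
    define \<eta>0 where "\<eta>0 = min \<eta> (\<eta> / (2 * (A * B) + 1))"
    have AB: "0 \<le> A * B" using A B by simp
    have \<eta>0: "0 < \<eta>0" "\<eta>0 \<le> \<eta>" "A * B * (2 * \<eta>0) \<le> \<eta>"
    proof -
      show "0 < \<eta>0" "\<eta>0 \<le> \<eta>" using \<eta> AB by (auto simp: \<eta>0_def)
      have "A * B * (2 * \<eta>0) \<le> A * B * (2 * (\<eta> / (2 * (A * B) + 1)))"
        using AB by (intro mult_left_mono) (auto simp: \<eta>0_def)
      also have "\<dots> \<le> \<eta>" using AB \<eta> by (simp add: field_simps)
      finally show "A * B * (2 * \<eta>0) \<le> \<eta>" .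
    qed
    from uniform[OF \<eta>0(1)] obtain c where c: "0 < c" "c \<le> 1" "c * Q.vbar powr q \<le> \<eta>0"
      and ev: "\<forall>\<^sub>F n in sequentially. small \<eta>0 {\<omega> \<in> space P. \<exists>k j. 0 \<le> k \<and> k + int j \<le> int n \<and> real j \<le> ?N n + 1 \<and>
          \<eta>0 * ?N n < (\<Sum>t\<in>{k..k + int j}. ?\<xi> c n t \<omega>)}" by (elim exE conjE) (rule that)
    have \<xi>0: "0 \<le> ?\<xi> c n t \<omega>" for n t \<omega> using excess_nonneg[of c] c by simp
    \<comment> \<open>At this level truncation removes the constant part of the growth bound, so
      that the truncation error is dominated by the two excesses alone.\<close>
    define R where "R = A * (1 + 2 * B * \<rho> c)"
    have R: "0 < R" unfolding R_def using A B \<rho>[of c] by (intro mult_pos_pos add_pos_nonneg) auto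
    have pt: "\<bar>obs (X n) t \<theta> \<omega> - trunc R (obs (X n) t \<theta> \<omega>)\<bar> \<le> A * B * (?\<xi> c n t \<omega> + ?\<xi> c n (t - 1) \<omega>)" for n t \<omega>
    proof -
      have "\<bar>obs (X n) t \<theta> \<omega>\<bar> \<le> A * (1 + rpow (znorm (X n) t \<omega>) ?s)"
        unfolding A_def by (rule obs_growth[OF \<theta>])
      also have "\<dots> \<le> A * ((1 + 2 * B * \<rho> c) + B * (?\<xi> c n t \<omega> + ?\<xi> c n (t - 1) \<omega>))"
        using A by (intro mult_left_mono zx c) auto
      also have "\<dots> = R + A * B * (?\<xi> c n t \<omega> + ?\<xi> c n (t - 1) \<omega>)" by (simp add: R_def algebra_simps)
      finally show ?thesis
        using R AB \<xi>0 by (simp add: trunc_excess)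
    qed
    show "\<exists>R>0. (\<forall>\<^sub>F n in sequentially. small \<eta> {\<omega> \<in> space P. \<exists>u\<in>{b n / 2..1 - b n / 2}. \<eta> * ?N n
          < (\<Sum>t\<in>window CARD('p) n (b n) u. \<bar>obs (X n) t \<theta> \<omega> - trunc R (obs (X n) t \<theta> \<omega>)\<bar>)}) \<and>
        (\<forall>\<^sub>F n in sequentially. \<forall>u\<in>{b n / 2..1 - b n / 2}. \<forall>t\<in>window CARD('p) n (b n) u.
          (\<integral>\<^sup>+\<omega>. ennreal \<bar>obs (X n) t \<theta> \<omega> - trunc R (obs (X n) t \<theta> \<omega>)\<bar> \<partial>P) \<le> ennreal \<eta>)"
    proof (intro exI[of _ R] conjI R)
      show "\<forall>\<^sub>F n in sequentially. small \<eta> {\<omega> \<in> space P. \<exists>u\<in>{b n / 2..1 - b n / 2}. \<eta> * ?N n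
          < (\<Sum>t\<in>window CARD('p) n (b n) u. \<bar>obs (X n) t \<theta> \<omega> - trunc R (obs (X n) t \<theta> \<omega>)\<bar>)}"
        using ev N1 eventually_ge_at_top[of 1]
      proof eventually_elim
        case (elim n)
        from elim(1) show ?case
        proof (rule small_mono)
          show "{\<omega> \<in> space P. \<exists>u\<in>{b n / 2..1 - b n / 2}. \<eta> * ?N n
              < (\<Sum>t\<in>window CARD('p) n (b n) u. \<bar>obs (X n) t \<theta> \<omega> - trunc R (obs (X n) t \<theta> \<omega>)\<bar>)}
            \<subseteq> {\<omega> \<in> space P. \<exists>k j. 0 \<le> k \<and> k + int j \<le> int n \<and> real j \<le> ?N n + 1 \<and>
              \<eta>0 * ?N n < (\<Sum>t\<in>{k..k + int j}. ?\<xi> c n t \<omega>)}"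
          proof (rule subsetI, rule ccontr)
            fix \<omega> assume "\<omega> \<in> {\<omega> \<in> space P. \<exists>u\<in>{b n / 2..1 - b n / 2}. \<eta> * ?N n
              < (\<Sum>t\<in>window CARD('p) n (b n) u. \<bar>obs (X n) t \<theta> \<omega> - trunc R (obs (X n) t \<theta> \<omega>)\<bar>)}"
            then obtain u where \<omega>: "\<omega> \<in> space P" and big: "\<eta> * ?N n
              < (\<Sum>t\<in>window CARD('p) n (b n) u. \<bar>obs (X n) t \<theta> \<omega> - trunc R (obs (X n) t \<theta> \<omega>)\<bar>)" by auto
            from window_interval[OF elim(3) b(1), where p = "CARD('p)" and u = u] obtain k j
              where kj: "window CARD('p) n (b n) u = {k<..k + int j}" "0 \<le> k" "k + int j \<le> int n" "real j \<le> ?N n + 1" by metis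
            assume "\<omega> \<notin> {\<omega> \<in> space P. \<exists>k j. 0 \<le> k \<and> k + int j \<le> int n \<and> real j \<le> ?N n + 1 \<and>
              \<eta>0 * ?N n < (\<Sum>t\<in>{k..k + int j}. ?\<xi> c n t \<omega>)}"
            then have le: "(\<Sum>t\<in>{k..k + int j}. ?\<xi> c n t \<omega>) \<le> \<eta>0 * ?N n"
              using \<omega> kj by (auto simp: not_less)
            have "(\<Sum>t\<in>{k<..k + int j}. \<bar>obs (X n) t \<theta> \<omega> - trunc R (obs (X n) t \<theta> \<omega>)\<bar>)
                \<le> (\<Sum>t\<in>{k<..k + int j}. A * B * (?\<xi> c n t \<omega> + ?\<xi> c n (t - 1) \<omega>))"
              by (intro sum_mono pt)
            also have "\<dots> = A * B * (\<Sum>t\<in>{k<..k + int j}. ?\<xi> c n t \<omega> + ?\<xi> c n (t - 1) \<omega>)"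
              by (simp add: sum_distrib_left)
            also have "\<dots> \<le> A * B * (2 * (\<eta>0 * ?N n))"
            proof (rule mult_left_mono[OF _ AB])
              show "(\<Sum>t\<in>{k<..k + int j}. ?\<xi> c n t \<omega> + ?\<xi> c n (t - 1) \<omega>) \<le> 2 * (\<eta>0 * ?N n)"
                using lagged[of "\<lambda>t. ?\<xi> c n t \<omega>" k j] \<xi>0 le by fastforce
            qed
            also have "\<dots> = A * B * (2 * \<eta>0) * ?N n" by simp
            also have "\<dots> \<le> \<eta> * ?N n" using \<eta>0(3) elim(2) by (intro mult_right_mono) auto
            finally show False using big unfolding kj(1) by simp
          qed
        qed (rule \<eta>0)
      qed
      show "\<forall>\<^sub>F n in sequentially. \<forall>u\<in>{b n / 2..1 - b n / 2}. \<forall>t\<in>window CARD('p) n (b n) u.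
          (\<integral>\<^sup>+\<omega>. ennreal \<bar>obs (X n) t \<theta> \<omega> - trunc R (obs (X n) t \<theta> \<omega>)\<bar> \<partial>P) \<le> ennreal \<eta>"
        using eventually_ge_at_top[of 1]
      proof eventually_elim
        case (elim n)
        show ?case
        proof (intro ballI)
          fix u t assume t: "t \<in> window CARD('p) n (b n) u"
          have tn: "t \<le> int n" "t - 1 \<le> int n" using window_le[OF t] by auto
          note L = rows(3)[OF elim tn(1)] rows(3)[OF elim tn(2)]
          note [measurable] = Lq_le_measurable[OF L(1)] Lq_le_measurable[OF L(2)]
          have "(\<integral>\<^sup>+\<omega>. ennreal \<bar>obs (X n) t \<theta> \<omega> - trunc R (obs (X n) t \<theta> \<omega>)\<bar> \<partial>P)
              \<le> (\<integral>\<^sup>+\<omega>. ennreal (A * B) * (ennreal (?\<xi> c n t \<omega>) + ennreal (?\<xi> c n (t - 1) \<omega>)) \<partial>P)"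
          proof (rule nn_integral_mono)
            fix \<omega>
            have "ennreal \<bar>obs (X n) t \<theta> \<omega> - trunc R (obs (X n) t \<theta> \<omega>)\<bar> \<le> ennreal (A * B * (?\<xi> c n t \<omega> + ?\<xi> c n (t - 1) \<omega>))"
              by (rule ennreal_leI[OF pt])
            then show "ennreal \<bar>obs (X n) t \<theta> \<omega> - trunc R (obs (X n) t \<theta> \<omega>)\<bar>
                \<le> ennreal (A * B) * (ennreal (?\<xi> c n t \<omega>) + ennreal (?\<xi> c n (t - 1) \<omega>))"
              using AB \<xi>0 by (simp only: ennreal_mult ennreal_plus add_nonneg_nonneg)
          qed
          also have "\<dots> = ennreal (A * B) * ((\<integral>\<^sup>+\<omega>. ennreal (?\<xi> c n t \<omega>) \<partial>P) + (\<integral>\<^sup>+\<omega>. ennreal (?\<xi> c n (t - 1) \<omega>) \<partial>P))"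
            by (simp add: nn_integral_cmult nn_integral_add)
          also have "\<dots> \<le> ennreal (A * B) * (ennreal (c * Q.vbar powr q) + ennreal (c * Q.vbar powr q))"
            using c by (intro mult_left_mono add_mono Q.excess_moment L) auto
          also have "\<dots> \<le> ennreal (A * B) * (ennreal \<eta>0 + ennreal \<eta>0)"
            using c by (intro mult_left_mono add_mono ennreal_leI) auto
          also have "\<dots> = ennreal (A * B * (2 * \<eta>0))" using AB \<eta>0(1) by (simp flip: ennreal_plus ennreal_mult)
          also have "\<dots> \<le> ennreal \<eta>" by (rule ennreal_leI[OF \<eta>0(3)])
          finally show "(\<integral>\<^sup>+\<omega>. ennreal \<bar>obs (X n) t \<theta> \<omega> - trunc R (obs (X n) t \<theta> \<omega>)\<bar> \<partial>P) \<le> ennreal \<eta>" .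
        qed
      qed
    qed
  next
    show "0 \<le> q / ?s" using s by simp
    show "{b n / 2..1 - b n / 2} \<subseteq> {0..1}" for n using b(1)[of n] by auto
  qed (use b N_lim cont in auto)
qed

end


section \<open>From the assumptions to the locales\<close>

lemma G_fun_measurable:
  fixes Gt :: "real \<Rightarrow> real ^ 'p \<Rightarrow> real ^ 'd \<Rightarrow> real"
  assumes "(\<lambda>(e, y, \<theta>). Gt e y \<theta>) \<in> borel_measurable (borel \<Otimes>\<^sub>M borel \<Otimes>\<^sub>M restrict_space borel \<Theta>)"
    and "\<theta>0 u \<in> \<Theta>"
  shows "(\<lambda>(e, y). G_fun Gt \<theta>0 e y u) \<in> borel_measurable (borel \<Otimes>\<^sub>M borel)"
proof -
  have "(\<lambda>x. (fst x, snd x, \<theta>0 u)) \<in> measurable (borel \<Otimes>\<^sub>M borel) (borel \<Otimes>\<^sub>M borel \<Otimes>\<^sub>M restrict_space borel \<Theta>)"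
    using assms(2) by (intro measurable_Pair measurable_const) (auto simp: space_restrict_space)
  from measurable_compose[OF this assms(1)] show ?thesis
    by (simp add: case_prod_unfold G_fun_def)
qed

text \<open>Minkowski combines the moment at the reference point \<open>y0\<close> with the
  Lipschitz bound between \<open>y\<close> and \<open>y0\<close>; the triangle inequality then moves
  the position of \<open>y0\<close> into \<open>C0\<close>. Norms over the sample space are
  transferred to the law of \<open>\<epsilon> 0\<close>.\<close>

lemma L1_autoregression:
  fixes G :: "real \<Rightarrow> real ^ 'p::{finite,linorder} \<Rightarrow> real \<Rightarrow> real"
  assumes P: "prob_space P" and iid: "iid P \<epsilon>" and q: "1 \<le> q"
    and G: "\<And>u. u \<in> {0..1} \<Longrightarrow> (\<lambda>(e, y). G e y u) \<in> borel_measurable (borel \<Otimes>\<^sub>M borel)"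
    and L1: "L1_cond P \<epsilon> G q"
  obtains \<chi>v C0 where "autoregression P \<epsilon> G q \<chi>v C0"
proof -
  interpret prob_space P by (rule P)
  from L1 obtain \<chi>v y0 where \<chi>: "\<And>i. 0 \<le> \<chi>v $ i" "(\<Sum>i\<in>UNIV. \<chi>v $ i) < 1"
    and fin: "(SUP u\<in>{0..1}. Lnorm_real P q (\<lambda>\<omega>. G (\<epsilon> 0 \<omega>) y0 u)) < \<top>"
    and lip: "\<And>u y y'. u \<in> {0..1} \<Longrightarrow> Lnorm_real P q (\<lambda>\<omega>. G (\<epsilon> 0 \<omega>) y u - G (\<epsilon> 0 \<omega>) y' u)
      \<le> ennreal (\<Sum>i\<in>UNIV. \<chi>v $ i * \<bar>y $ i - y' $ i\<bar>)"
    unfolding L1_cond_def by blast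
  define S where "S = enn2real (SUP u\<in>{0..1}. Lnorm_real P q (\<lambda>\<omega>. G (\<epsilon> 0 \<omega>) y0 u))"
  define C0 where "C0 = (\<Sum>i\<in>UNIV. \<chi>v $ i * \<bar>y0 $ i\<bar>) + S"
  have S: "0 \<le> S" by (simp add: S_def)
  have [measurable]: "\<epsilon> 0 \<in> borel_measurable P" by (rule iid_measurable[OF iid])
  have sec: "(\<lambda>e. G e y u) \<in> borel_measurable borel" if "u \<in> {0..1}" for y u
    using measurable_compose[OF measurable_Pair[OF measurable_ident measurable_const[of y borel borel]] G[OF that]]
    by (simp add: id_def)
  have transfer: "Lq_le (innov_law P \<epsilon>) q f A" if f: "f \<in> borel_measurable borel" and le: "Lnorm_real P q (\<lambda>\<omega>. f (\<epsilon> 0 \<omega>)) \<le> ennreal A" and A: "0 \<le> A" for f A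
  proof -
    have "Lq_le P q (\<lambda>\<omega>. f (\<epsilon> 0 \<omega>)) A"
      using f q by (intro Lnorm_real_le_iff[OF _ le A]) auto
    then show ?thesis using f unfolding Lq_le_def by (simp add: nn_integral_distr)
  qed
  have lip': "Lq_le (innov_law P \<epsilon>) q (\<lambda>e. G e y u - G e y' u) (\<Sum>i\<in>UNIV. \<chi>v $ i * \<bar>y $ i - y' $ i\<bar>)"
    if u: "u \<in> {0..1}" for u y y'
    using \<chi> sec[OF u] by (intro transfer lip[OF u] sum_nonneg) auto
  have base: "Lq_le (innov_law P \<epsilon>) q (\<lambda>e. G e y0 u) S" if u: "u \<in> {0..1}" for u
  proof (rule transfer[OF sec[OF u] _ S])
    have "Lnorm_real P q (\<lambda>\<omega>. G (\<epsilon> 0 \<omega>) y0 u) \<le> (SUP u\<in>{0..1}. Lnorm_real P q (\<lambda>\<omega>. G (\<epsilon> 0 \<omega>) y0 u))"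
      using u by (rule SUP_upper)
    also have "\<dots> = ennreal S" using fin by (simp add: S_def)
    finally show "Lnorm_real P q (\<lambda>\<omega>. G (\<epsilon> 0 \<omega>) y0 u) \<le> ennreal S" .
  qed
  have growth: "Lq_le (innov_law P \<epsilon>) q (\<lambda>e. G e y u) ((\<Sum>i\<in>UNIV. \<chi>v $ i * \<bar>y $ i\<bar>) + C0)" if u: "u \<in> {0..1}" for u y
  proof -
    have "Lq_le (innov_law P \<epsilon>) q (\<lambda>e. G e y u) ((\<Sum>i\<in>UNIV. \<chi>v $ i * \<bar>y $ i - y0 $ i\<bar>) + S)"
      using Lq_le_add[OF lip'[OF u, of y y0] base[OF u] q] by simp
    moreover have "(\<Sum>i\<in>UNIV. \<chi>v $ i * \<bar>y $ i - y0 $ i\<bar>) + S \<le> (\<Sum>i\<in>UNIV. \<chi>v $ i * \<bar>y $ i\<bar>) + C0"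
      unfolding C0_def add.assoc[symmetric] sum.distrib[symmetric] distrib_left[symmetric]
      using \<chi> by (intro add_right_mono sum_mono mult_left_mono) auto
    ultimately show ?thesis using q by (rule_tac Lq_le_weaken) auto
  qed
  have "autoregression P \<epsilon> G q \<chi>v C0"
    using iid q \<chi> G growth lip' S by unfold_locales (auto simp: C0_def intro!: add_nonneg_nonneg sum_nonneg)
  then show thesis by (rule that)
qed

theorem theorem5p2:
  fixes P :: "'w measure"
    and \<epsilon> :: "int \<Rightarrow> 'w \<Rightarrow> real"
    and \<Theta> :: "(real ^ 'd) set"
    and \<theta>0 :: "real \<Rightarrow> real ^ 'd"
    and Gt :: "real \<Rightarrow> real ^ 'p::{finite,linorder} \<Rightarrow> real ^ 'd \<Rightarrow> real"
    and Xt :: "real \<Rightarrow> int \<Rightarrow> 'w \<Rightarrow> real"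
    and X :: "nat \<Rightarrow> int \<Rightarrow> 'w \<Rightarrow> real"
    and ell :: "real \<Rightarrow> real ^ 'p::{finite,linorder} \<Rightarrow> real ^ 'd \<Rightarrow> real"
    and K :: "real \<Rightarrow> real"
    and \<theta>hat :: "nat \<Rightarrow> real \<Rightarrow> real \<Rightarrow> 'w \<Rightarrow> real ^ 'd"
    and M Cz C\<theta> :: real
  assumes prob: "prob_space P"
    and innov: "iid P \<epsilon>"
    and \<theta>0_range: "\<theta>0 ` {0..1} \<subseteq> \<Theta>"
    and Gt_meas: "(\<lambda>(e, y, \<theta>). Gt e y \<theta>)
        \<in> borel_measurable (borel \<Otimes>\<^sub>M borel \<Otimes>\<^sub>M restrict_space borel \<Theta>)"
    and Xt_sol: "\<And>u. u \<in> {0..1} \<Longrightarrow> stationary_solution P \<epsilon> (G_fun Gt \<theta>0) u (Xt u)"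
    and X_sol: "\<And>n. n \<ge> 1 \<Longrightarrow> tv_solution P \<epsilon> (G_fun Gt \<theta>0) (Xt 0) n (X n)"
    and minimizer: "\<And>n b u \<omega>. n \<ge> 1 \<Longrightarrow> b > 0 \<Longrightarrow> u \<in> {0..1} \<Longrightarrow> \<omega> \<in> space P \<Longrightarrow>
        is_arg_min (L_emp K ell X n b u \<omega>) (\<lambda>\<theta>. \<theta> \<in> \<Theta>) (\<theta>hat n b u \<omega>)"
    and K_kernel: "kernel K"
    and nonneg: "M \<ge> 0" "Cz \<ge> 0" "C\<theta> \<ge> 0"
    and ell_class: "(\<lambda>(x, y). ell x y) \<in> lip_class \<Theta> M Cz C\<theta>"
    and L1: "L1_cond P \<epsilon> (G_fun Gt \<theta>0) (M + 1)"
    and L4: "L4_cond P \<epsilon> (G_fun Gt \<theta>0) Xt (M + 1)"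
    and \<Theta>_compact: "compact \<Theta>"
    and \<theta>0_interior: "\<And>u. u \<in> {0..1} \<Longrightarrow> \<theta>0 u \<in> interior \<Theta>"
    and \<theta>0_unique_min: "\<And>u \<theta>. u \<in> {0..1} \<Longrightarrow>
        is_arg_min (L_lim P ell Xt u) (\<lambda>\<theta>. \<theta> \<in> \<Theta>) \<theta> \<longleftrightarrow> \<theta> = \<theta>0 u"
  shows "(\<forall>u\<in>{0<..<1}. \<forall>b :: nat \<Rightarrow> real.
           (\<forall>n. b n > 0) \<and> b \<longlonglongrightarrow> 0 \<and> filterlim (\<lambda>n. b n * real n) at_top sequentially
             \<longrightarrow> tendsto_in_prob P (\<lambda>n. \<theta>hat n (b n) u) (\<theta>0 u))
       \<and> (\<forall>(q :: real) (b :: nat \<Rightarrow> real).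
           q > M + 1 \<and> L1_cond P \<epsilon> (G_fun Gt \<theta>0) q \<and> L4_cond P \<epsilon> (G_fun Gt \<theta>0) Xt q \<and>
           (\<forall>n. b n > 0) \<and> b \<longlonglongrightarrow> 0 \<and>
           (\<lambda>n. real n powr ((M + 1) / q - 1)) \<in> o(b) \<and> continuous_on {0..1} \<theta>0
             \<longrightarrow> tendsto_in_prob P
                   (\<lambda>n \<omega>. SUP u\<in>{b n / 2..1 - b n / 2}. norm (\<theta>hat n (b n) u \<omega> - \<theta>0 u)) 0)"
proof -
  let ?G = "G_fun Gt \<theta>0"
  have G: "u \<in> {0..1} \<Longrightarrow> (\<lambda>(e, y). ?G e y u) \<in> borel_measurable (borel \<Otimes>\<^sub>M borel)" for u
    using \<theta>0_range by (intro G_fun_measurable[OF Gt_meas]) auto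
  have "1 \<le> M + 1" using nonneg by simp
  from L1_autoregression[OF prob innov this G L1] obtain \<chi>v C0 where "autoregression P \<epsilon> ?G (M + 1) \<chi>v C0" by blast
  then interpret A: autoregression P \<epsilon> ?G "M + 1" \<chi>v C0 .
  interpret estimation P \<epsilon> ?G M \<chi>v C0 \<Theta> Cz C\<theta> ell Xt X K \<theta>0
    by unfold_locales (use nonneg ell_class Xt_sol X_sol L4 K_kernel \<Theta>_compact \<theta>0_range \<theta>0_unique_min in auto)
  show ?thesis
  proof (intro conjI ballI allI impI)
    fix u :: real and b :: "nat \<Rightarrow> real"
    assume u: "u \<in> {0<..<1}"
      and b: "(\<forall>n. b n > 0) \<and> b \<longlonglongrightarrow> 0 \<and> filterlim (\<lambda>n. b n * real n) at_top sequentially"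
    interpret bandwidth P \<epsilon> ?G M \<chi>v C0 \<Theta> Cz C\<theta> ell Xt X K \<theta>0 b "{u}" "\<lambda>_. {u}"
      "\<lambda>n. {SOME k. \<exists>j. window CARD('p) n (b n) u = {k<..k + int j} \<and> k + int j \<le> int n \<and> real j \<le> real n * b n + 1}" 0
      using b by (intro pointwise_bandwidth u) (auto simp: mult.commute)
    show "tendsto_in_prob P (\<lambda>n. \<theta>hat n (b n) u) (\<theta>0 u)"
      unfolding tendsto_in_prob_def
    proof (intro allI impI)
      fix r :: real assume r: "0 < r"
      have lim: "(\<lambda>n. outer_measure_of P {\<omega> \<in> space P. \<exists>u\<in>{u}. r \<le> norm (\<theta>hat n (b n) u \<omega> - \<theta>0 u)}) \<longlonglongrightarrow> 0"
        by (rule consistency[OF _ r]) (use minimizer b in auto)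
      show "(\<lambda>n. outer_measure_of P {\<omega> \<in> space P. r < dist (\<theta>hat n (b n) u \<omega>) (\<theta>0 u)}) \<longlonglongrightarrow> 0"
        by (rule tendsto_sandwich[OF _ _ tendsto_const lim])
          (auto intro!: always_eventually outer_measure_of_mono simp: dist_norm)
    qed
  next
    fix q :: real and b :: "nat \<Rightarrow> real"
    assume as: "q > M + 1 \<and> L1_cond P \<epsilon> ?G q \<and> L4_cond P \<epsilon> ?G Xt q \<and> (\<forall>n. b n > 0) \<and> b \<longlonglongrightarrow> 0 \<and>
      (\<lambda>n. real n powr ((M + 1) / q - 1)) \<in> o(b) \<and> continuous_on {0..1} \<theta>0"
    then have b: "\<And>n. 0 < b n" "b \<longlonglongrightarrow> 0" by auto
    have "1 \<le> q" using as nonneg by linarith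
    moreover have "L1_cond P \<epsilon> ?G q" using as by simp
    ultimately obtain \<chi>' C0' where Q: "autoregression P \<epsilon> ?G q \<chi>' C0'"
      using L1_autoregression[where G = ?G, OF prob innov _ G] by blast
    interpret bandwidth P \<epsilon> ?G M \<chi>v C0 \<Theta> Cz C\<theta> ell Xt X K \<theta>0 b "{0..1}" "\<lambda>n. {b n / 2..1 - b n / 2}" "\<lambda>n. {0..int n}" "q / (M + 1)"
      using as by (intro uniform_bandwidth[OF Q]) auto
    show "tendsto_in_prob P (\<lambda>n \<omega>. SUP u\<in>{b n / 2..1 - b n / 2}. norm (\<theta>hat n (b n) u \<omega> - \<theta>0 u)) 0"
      unfolding tendsto_in_prob_def
    proof (intro allI impI)
      fix r :: real assume r: "0 < r"
      have lim: "(\<lambda>n. outer_measure_of P {\<omega> \<in> space P. \<exists>u\<in>{b n / 2..1 - b n / 2}. r \<le> norm (\<theta>hat n (b n) u \<omega> - \<theta>0 u)}) \<longlonglongrightarrow> 0"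
        by (rule consistency[OF _ r]) (use minimizer b in auto)
      \<comment> \<open>Once \<open>b n < 1\<close>, the interval of u contains 1/2, so the supremum
        is taken over a nonempty set.\<close>
      have b1: "\<forall>\<^sub>F n in sequentially. b n < 1" using b(2) by (intro order_tendstoD) auto
      show "(\<lambda>n. outer_measure_of P {\<omega> \<in> space P. r < dist (SUP u\<in>{b n / 2..1 - b n / 2}. norm (\<theta>hat n (b n) u \<omega> - \<theta>0 u)) 0}) \<longlonglongrightarrow> 0"
      proof (rule tendsto_sandwich[OF _ _ tendsto_const lim])
        show "\<forall>\<^sub>F n in sequentially. outer_measure_of P {\<omega> \<in> space P. r < dist (SUP u\<in>{b n / 2..1 - b n / 2}. norm (\<theta>hat n (b n) u \<omega> - \<theta>0 u)) 0}
          \<le> outer_measure_of P {\<omega> \<in> space P. \<exists>u\<in>{b n / 2..1 - b n / 2}. r \<le> norm (\<theta>hat n (b n) u \<omega> - \<theta>0 u)}"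
          using b1
        proof eventually_elim
          case (elim n)
          show ?case
          proof (intro outer_measure_of_mono subsetI, rule ccontr)
            fix \<omega> assume \<omega>: "\<omega> \<in> {\<omega> \<in> space P. r < dist (SUP u\<in>{b n / 2..1 - b n / 2}. norm (\<theta>hat n (b n) u \<omega> - \<theta>0 u)) 0}"
            assume "\<omega> \<notin> {\<omega> \<in> space P. \<exists>u\<in>{b n / 2..1 - b n / 2}. r \<le> norm (\<theta>hat n (b n) u \<omega> - \<theta>0 u)}"
            \<comment> \<open>Off the exceptional set all the norms are at most r. This bounds the
              real supremum and also provides the boundedness without which its value would be
              unspecified.\<close>
            then have le: "norm (\<theta>hat n (b n) u \<omega> - \<theta>0 u) \<le> r" if "u \<in> {b n / 2..1 - b n / 2}" for u
              using \<omega> that by force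
            have half: "1 / 2 \<in> {b n / 2..1 - b n / 2}" using elim by auto
            let ?S = "SUP u\<in>{b n / 2..1 - b n / 2}. norm (\<theta>hat n (b n) u \<omega> - \<theta>0 u)"
            have "?S \<le> r" using half le by (intro cSUP_least) auto
            moreover have "0 \<le> ?S"
              by (rule order_trans[OF norm_ge_zero cSUP_upper[OF half]]) (rule bdd_aboveI2[OF le])
            ultimately show False using \<omega> by (simp add: dist_real_def)
          qed
        qed
      qed simp
    qed
  qed
qed

end
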